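(* Let $\theta$ be any Keane direction on a translation surface $X$. Then for Lebesgue almost any $p\in X$ we have $$\overline{w}_{\mathrm{ret}}(\phi_\theta,p)=1.$$
   Context: A translation surface $X$ is a connected compact surface obtained from finitely many polygons in $\mathbb{R}^2$ by identifying, via translations, pairs of parallel sides of equal length and opposite orientation; it has a flat metric outside a finite set $\Sigma$ of conical singularities. $\phi_\theta$ is the unit speed flow on $X$ along the constant vector field $(\sin\theta,\cos\theta)$. A saddle connection is a geodesic segment connecting two points of $\Sigma$ with none in its interior; $\theta$ is Keane if no saddle connection has direction $\theta$. The return time is $R(\phi_\theta,p,r)=\inf\{t>r:\ \mathrm{Dist}(\phi_\theta^t(p),p)<r\}$, with $\mathrm{Dist}$ the flat distance, and $\overline{w}_{\mathrm{ret}}(\phi_\theta,p)=\limsup_{r\to0^+}\frac{\log R(\phi_\theta,p,r)}{-\log r}$.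
   Formalization: The set Σ is assumed non-empty (marked points of angle 2π are allowed): on a flat torus with Σ empty every direction is vacuously Keane, and in periodic directions the claimed exponent 1 fails (it is 0). *)

theory Defs
  imports "HOL-Analysis.Analysis"
begin

text \<open>The plane is \<^typ>\<open>complex\<close>. A polygon is the list of its vertices; indices are cyclic.\<close>

definition vertex :: "complex list \<Rightarrow> nat \<Rightarrow> complex" where
  "vertex P k = P ! (k mod length P)"

definition edge :: "complex list \<Rightarrow> nat \<Rightarrow> complex" where
  "edge P k = vertex P (Suc k) - vertex P k"

definition side :: "complex list \<Rightarrow> nat \<Rightarrow> complex set" where
  "side P k = closed_segment (vertex P k) (vertex P (Suc k))"

definition boundary :: "complex list \<Rightarrow> complex set" where
  "boundary P = (\<Union>k<length P. side P k)"

definition region :: "complex list \<Rightarrow> complex set" where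
  "region P = boundary P \<union> inside (boundary P)"

text \<open>Distinct sides meet at most in a common vertex. Convexity is not required, and interior
  angles equal to \<open>\<pi>\<close> are allowed.\<close>

definition simple_polygon :: "complex list \<Rightarrow> bool" where
  "simple_polygon P \<longleftrightarrow> 3 \<le> length P \<and> distinct P \<and>
     (\<forall>k<length P. \<forall>l<length P. k \<noteq> l \<longrightarrow>
        side P k \<inter> side P l \<subseteq> {vertex P k, vertex P (Suc k)} \<inter> {vertex P l, vertex P (Suc l)})"

text \<open>Counterclockwise order of the vertices: the interior lies to the left of every side.\<close>

definition positively_oriented :: "complex list \<Rightarrow> bool" where
  "positively_oriented P \<longleftrightarrow>
     (\<forall>k<length P. \<forall>x\<in>open_segment (vertex P k) (vertex P (Suc k)).
        \<forall>\<^sub>F h in at_right (0::real). x + of_real h * (\<i> * edge P k) \<in> inside (boundary P))"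

text \<open>For a counterclockwise polygon this is the interior angle at the \<open>k\<close>-th vertex, in
  \<open>(0, 2\<pi>)\<close>; the index \<open>k + length P - 1\<close> is that of the preceding vertex.\<close>

definition interior_angle :: "complex list \<Rightarrow> nat \<Rightarrow> real" where
  "interior_angle P k =
     Arg2pi ((vertex P (k + length P - 1) - vertex P k) / (vertex P (Suc k) - vertex P k))"

text \<open>Side \<open>k\<close> of polygon \<open>i\<close> is glued to the side \<open>glue (i, k)\<close>. A point of the surface is a class
  of pairs (polygon index, point of that polygon). The set \<open>sing\<close> is the set \<open>\<Sigma>\<close>.\<close>

record surface =
  polys :: "complex list list"
  glue :: "nat \<times> nat \<Rightarrow> nat \<times> nat"
  sing :: "(nat \<times> complex) set set"

definition sides :: "surface \<Rightarrow> (nat \<times> nat) set" where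
  "sides X = {(i, k). i < length (polys X) \<and> k < length (polys X ! i)}"

definition side_pairing :: "surface \<Rightarrow> bool" where
  "side_pairing X \<longleftrightarrow> (\<forall>i k. (i, k) \<in> sides X \<longrightarrow>
     (case glue X (i, k) of (j, l) \<Rightarrow>
        (j, l) \<in> sides X \<and> glue X (j, l) = (i, k) \<and>
        edge (polys X ! j) l = - edge (polys X ! i) k))"

definition disjoint_polys :: "surface \<Rightarrow> (nat \<times> complex) set" where
  "disjoint_polys X = {(i, x). i < length (polys X) \<and> x \<in> region (polys X ! i)}"

text \<open>Since paired sides have opposite orientation, the translation takes the initial vertex of one
  to the terminal vertex of the other.\<close>

definition glue_rel :: "surface \<Rightarrow> ((nat \<times> complex) \<times> (nat \<times> complex)) set" where
  "glue_rel X = {((i, x), (j, y)). \<exists>k l. (i, k) \<in> sides X \<and> glue X (i, k) = (j, l) \<and>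
     x \<in> side (polys X ! i) k \<and>
     y = x + (vertex (polys X ! j) (Suc l) - vertex (polys X ! i) k)}"

definition same_point :: "surface \<Rightarrow> ((nat \<times> complex) \<times> (nat \<times> complex)) set" where
  "same_point X = {(a, b). a \<in> disjoint_polys X \<and> (a, b) \<in> (glue_rel X)\<^sup>*}"

definition points :: "surface \<Rightarrow> (nat \<times> complex) set set" where
  "points X = disjoint_polys X // same_point X"

definition pt :: "surface \<Rightarrow> nat \<Rightarrow> complex \<Rightarrow> (nat \<times> complex) set" where
  "pt X i x = same_point X `` {(i, x)}"

text \<open>The quotient topology.\<close>

definition surface_topology :: "surface \<Rightarrow> (nat \<times> complex) set topology" where
  "surface_topology X = topology (\<lambda>U. U \<subseteq> points X \<and>
     (\<forall>i<length (polys X).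
        openin (top_of_set (region (polys X ! i))) {x \<in> region (polys X ! i). pt X i x \<in> U}))"

definition vertex_points :: "surface \<Rightarrow> (nat \<times> complex) set set" where
  "vertex_points X = (\<lambda>(i, k). pt X i (vertex (polys X ! i) k)) ` sides X"

definition cone_angle :: "surface \<Rightarrow> (nat \<times> complex) set \<Rightarrow> real" where
  "cone_angle X p =
     (\<Sum>(i, k) \<in> {(i, k) \<in> sides X. pt X i (vertex (polys X ! i) k) = p}. interior_angle (polys X ! i) k)"

text \<open>The set \<open>\<Sigma>\<close> contains all points with cone angle different from \<open>2\<pi>\<close>; it may also contain
  vertices with cone angle \<open>2\<pi>\<close> (marked points). It is nonempty: this only matters for flat tori, on
  which every direction would otherwise be Keane, including the periodic ones.\<close>

definition translation_surface :: "surface \<Rightarrow> bool" where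
  "translation_surface X \<longleftrightarrow>
     (\<forall>P\<in>set (polys X). simple_polygon P \<and> positively_oriented P) \<and>
     side_pairing X \<and>
     connected_space (surface_topology X) \<and>
     sing X \<noteq> {} \<and> sing X \<subseteq> vertex_points X \<and>
     {p \<in> vertex_points X. cone_angle X p \<noteq> 2 * pi} \<subseteq> sing X"

text \<open>Lebesgue measure on the surface: the sum of the areas of the parts in the polygons.\<close>

definition polygon_part :: "surface \<Rightarrow> nat \<Rightarrow> (nat \<times> complex) set set \<Rightarrow> complex set" where
  "polygon_part X i A = {x \<in> region (polys X ! i). pt X i x \<in> A}"

definition area_measure :: "surface \<Rightarrow> (nat \<times> complex) set measure" where
  "area_measure X = measure_of (points X)
     {A. A \<subseteq> points X \<and> (\<forall>i<length (polys X). polygon_part X i A \<in> sets lebesgue)}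
     (\<lambda>A. \<Sum>i<length (polys X). emeasure lebesgue (polygon_part X i A))"

text \<open>The flat distance: infimum of the lengths of the broken lines joining two points, each of
  whose segments lies in one polygon.\<close>

inductive broken_line :: "surface \<Rightarrow> (nat \<times> complex) set \<Rightarrow> real \<Rightarrow> (nat \<times> complex) set \<Rightarrow> bool"
  for X where
  start: "p \<in> points X \<Longrightarrow> broken_line X p 0 p"
| step: "broken_line X p l q \<Longrightarrow> q' \<in> points X \<Longrightarrow> (i, x) \<in> q \<Longrightarrow> (i, y) \<in> q' \<Longrightarrow>
    closed_segment x y \<subseteq> region (polys X ! i) \<Longrightarrow> broken_line X p (l + dist x y) q'"

definition flat_dist :: "surface \<Rightarrow> (nat \<times> complex) set \<Rightarrow> (nat \<times> complex) set \<Rightarrow> real" where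
  "flat_dist X p q = Inf {l. broken_line X p l q}"

definition direction :: "real \<Rightarrow> complex" where
  "direction \<theta> = Complex (sin \<theta>) (cos \<theta>)"

text \<open>Integral curves on \<open>[0, T]\<close> of the constant vector field \<open>v\<close>: immediately after and
  immediately before every time the curve moves in the coordinates of some polygon with velocity
  \<open>v\<close>. The curve changes polygon through the identification of the representatives of \<open>\<gamma> t\<close>.\<close>

definition integral_curve :: "surface \<Rightarrow> complex \<Rightarrow> real \<Rightarrow> (real \<Rightarrow> (nat \<times> complex) set) \<Rightarrow> bool" where
  "integral_curve X v T \<gamma> \<longleftrightarrow>
     (\<forall>t\<in>{0..T}. \<gamma> t \<in> points X) \<and>
     (\<forall>t\<in>{0..<T}. \<exists>(i, x)\<in>\<gamma> t. \<forall>\<^sub>F h in at_right 0. (i, x + of_real h * v) \<in> \<gamma> (t + h)) \<and>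
     (\<forall>t\<in>{0<..T}. \<exists>(i, x)\<in>\<gamma> t. \<forall>\<^sub>F h in at_right 0. (i, x - of_real h * v) \<in> \<gamma> (t - h))"

text \<open>Saddle connections are parametrised by arc length. Orienting them by \<open>direction \<theta>\<close> is no
  restriction, since reversal turns direction \<open>\<theta> + \<pi>\<close> into \<open>\<theta>\<close>.\<close>

definition saddle_connection :: "surface \<Rightarrow> real \<Rightarrow> real \<Rightarrow> (real \<Rightarrow> (nat \<times> complex) set) \<Rightarrow> bool" where
  "saddle_connection X \<theta> T \<gamma> \<longleftrightarrow> 0 < T \<and> integral_curve X (direction \<theta>) T \<gamma> \<and>
     \<gamma> 0 \<in> sing X \<and> \<gamma> T \<in> sing X \<and> (\<forall>t\<in>{0<..<T}. \<gamma> t \<notin> sing X)"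

definition keane :: "surface \<Rightarrow> real \<Rightarrow> bool" where
  "keane X \<theta> \<longleftrightarrow> \<not> (\<exists>T \<gamma>. saddle_connection X \<theta> T \<gamma>)"

text \<open>\<open>flow X \<theta> t p q\<close> says that \<open>\<phi>\<^sub>\<theta>\<^sup>t(p)\<close> is defined and equal to \<open>q\<close>; the flow is undefined from
  the moment an orbit reaches \<open>\<Sigma>\<close>. The relation is functional in \<open>q\<close>, because a point outside
  \<open>\<Sigma>\<close> has total angle \<open>2\<pi>\<close>.\<close>

definition flow :: "surface \<Rightarrow> real \<Rightarrow> real \<Rightarrow> (nat \<times> complex) set \<Rightarrow> (nat \<times> complex) set \<Rightarrow> bool" where
  "flow X \<theta> t p q \<longleftrightarrow> 0 \<le> t \<and> (\<exists>\<gamma>. integral_curve X (direction \<theta>) t \<gamma> \<and>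
     \<gamma> 0 = p \<and> \<gamma> t = q \<and> (\<forall>s\<in>{0..t}. \<gamma> s \<notin> sing X))"

text \<open>The infimum is taken in \<^typ>\<open>ereal\<close>, so it is \<open>\<infinity>\<close> if the orbit never returns.\<close>

definition return_time :: "surface \<Rightarrow> real \<Rightarrow> (nat \<times> complex) set \<Rightarrow> real \<Rightarrow> ereal" where
  "return_time X \<theta> p r = Inf (ereal ` {t. t > r \<and> (\<exists>q. flow X \<theta> t p q \<and> flat_dist X q p < r)})"

text \<open>Only used for \<open>x > 0\<close>.\<close>

definition log_ereal :: "ereal \<Rightarrow> ereal" where
  "log_ereal x = (if x = \<infinity> then \<infinity> else ereal (ln (real_of_ereal x)))"

definition upper_return_exponent :: "surface \<Rightarrow> real \<Rightarrow> (nat \<times> complex) set \<Rightarrow> ereal" where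
  "upper_return_exponent X \<theta> p =
     Limsup (at_right 0) (\<lambda>r. log_ereal (return_time X \<theta> p r) / ereal (- ln r))"


text \<open>The identification is an equivalence relation, and the functions given to
  \<^const>\<open>topology\<close> and \<^const>\<open>measure_of\<close> above are a topology and a measure.\<close>

lemma glue_rel_sym:
  assumes "side_pairing X" "(a, b) \<in> glue_rel X"
  shows "(b, a) \<in> glue_rel X" "b \<in> disjoint_polys X"
proof -
  obtain i k x j l y where eq: "a = (i, x)" "b = (j, y)" and s: "(i, k) \<in> sides X"
    and g: "glue X (i, k) = (j, l)" and x: "x \<in> side (polys X ! i) k"
    and y: "y = x + (vertex (polys X ! j) (Suc l) - vertex (polys X ! i) k)"
    using assms(2) by (auto simp: glue_rel_def)
  have t: "(j, l) \<in> sides X" "glue X (j, l) = (i, k)"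
    and e: "edge (polys X ! j) l = - edge (polys X ! i) k"
    using assms(1) s g by (force simp: side_pairing_def)+
  have e': "vertex (polys X ! j) l =
      vertex (polys X ! j) (Suc l) + (vertex (polys X ! i) (Suc k) - vertex (polys X ! i) k)"
    using e by (simp add: edge_def algebra_simps)
  define d where "d = vertex (polys X ! j) (Suc l) - vertex (polys X ! i) k"
  have "y \<in> closed_segment (d + vertex (polys X ! i) k) (d + vertex (polys X ! i) (Suc k))"
    using x unfolding closed_segment_translation y side_def d_def[symmetric] by (auto simp: add.commute)
  also have "\<dots> = side (polys X ! j) l"
    unfolding side_def e' d_def by (simp add: closed_segment_commute algebra_simps)
  finally have y': "y \<in> side (polys X ! j) l" .
  have "x = y + (vertex (polys X ! i) (Suc k) - vertex (polys X ! j) l)"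
    unfolding y e' by simp
  then show "(b, a) \<in> glue_rel X"
    unfolding eq glue_rel_def using t y' by blast
  show "b \<in> disjoint_polys X"
    using t(1) y' by (auto simp: eq disjoint_polys_def region_def boundary_def sides_def)
qed

lemma equiv_same_point:
  assumes "side_pairing X"
  shows "equiv (disjoint_polys X) (same_point X)"
proof (rule equivI)
  have "sym ((glue_rel X)\<^sup>*)"
    using glue_rel_sym(1)[OF assms] by (intro sym_rtrancl symI)
  moreover have mem: "b \<in> disjoint_polys X"
    if "(a, b) \<in> (glue_rel X)\<^sup>*" "a \<in> disjoint_polys X" for a b
    using that by induction (auto dest: glue_rel_sym(2)[OF assms])
  ultimately show "sym (same_point X)"
    by (auto simp: same_point_def intro!: symI dest: symD)
  show "same_point X \<subseteq> disjoint_polys X \<times> disjoint_polys X"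
    using mem by (auto simp: same_point_def)
qed (auto simp: same_point_def refl_on_def intro!: transI)

lemma openin_surface_topology:
  "openin (surface_topology X) U \<longleftrightarrow> U \<subseteq> points X \<and>
     (\<forall>i<length (polys X). openin (top_of_set (region (polys X ! i))) (polygon_part X i U))"
proof -
  have eq: "polygon_part X i (S \<inter> T) = polygon_part X i S \<inter> polygon_part X i T"
    "polygon_part X i (\<Union>K) = (\<Union>S\<in>K. polygon_part X i S)" for i S T K
    by (auto simp: polygon_part_def)
  have "istopology (\<lambda>U. U \<subseteq> points X \<and>
     (\<forall>i<length (polys X). openin (top_of_set (region (polys X ! i))) (polygon_part X i U)))"
    unfolding istopology_def eq by (auto intro!: openin_Union)
  from topology_inverse'[OF this] show ?thesis
    unfolding surface_topology_def polygon_part_def by simp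
qed

lemma pt_in_points: "i < length (polys X) \<Longrightarrow> x \<in> region (polys X ! i) \<Longrightarrow> pt X i x \<in> points X"
  by (auto simp: pt_def points_def disjoint_polys_def intro: quotientI)

lemma closed_boundary: "closed (boundary P)"
  by (auto simp: boundary_def side_def intro!: closed_UN)

lemma compact_region: "compact (region P)"
proof -
  have c: "compact (boundary P)"
    by (auto simp: boundary_def side_def intro!: compact_UN)
  have "region P = - outside (boundary P)"
    unfolding region_def using inside_Un_outside[of "boundary P"] inside_Int_outside[of "boundary P"]
      outside_no_overlap[of "boundary P"] by blast
  then have "closed (region P)"
    using open_outside[OF closed_boundary] by (simp add: closed_def)
  moreover have "bounded (region P)"
    using c bounded_inside[OF compact_imp_bounded[OF c]] by (simp add: region_def compact_imp_bounded)
  ultimately show ?thesis by (simp add: compact_eq_bounded_closed)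
qed

lemma area_measure:
  shows space_area_measure: "space (area_measure X) = points X"
    and sets_area_measure: "sets (area_measure X) =
      {A. A \<subseteq> points X \<and> (\<forall>i<length (polys X). polygon_part X i A \<in> sets lebesgue)}" (is "_ = ?S")
    and emeasure_area_measure: "A \<in> sets (area_measure X) \<Longrightarrow>
      emeasure (area_measure X) A = (\<Sum>i<length (polys X). emeasure lebesgue (polygon_part X i A))"
proof -
  have reg: "region P \<in> sets lebesgue" for P
    using compact_region lmeasurable_compact by blast
  have sa: "sigma_algebra (points X) ?S"
  proof (unfold sigma_algebra_iff2, intro conjI ballI allI impI)
    fix A assume A: "A \<in> ?S"
    have "polygon_part X i (points X - A) = region (polys X ! i) - polygon_part X i A" if "i < length (polys X)" for i
      using pt_in_points[OF that] by (auto simp: polygon_part_def)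
    then show "points X - A \<in> ?S" using A reg by auto
  next
    fix A :: "nat \<Rightarrow> _" assume A: "range A \<subseteq> ?S"
    have "polygon_part X i (\<Union>(range A)) = (\<Union>n. polygon_part X i (A n))" for i
      by (auto simp: polygon_part_def)
    moreover have "(\<Union>n. polygon_part X i (A n)) \<in> sets lebesgue" if "i < length (polys X)" for i
      using A that by (intro sets.countable_UN) auto
    ultimately show "\<Union>(range A) \<in> ?S" using A by auto
  qed (auto simp: polygon_part_def)
  have sub: "?S \<subseteq> Pow (points X)" by auto
  show "space (area_measure X) = points X"
    unfolding area_measure_def by (rule space_measure_of[OF sub])
  show sets: "sets (area_measure X) = ?S"
    unfolding area_measure_def
    by (rule trans[OF sets_measure_of[OF sub] sigma_algebra.sigma_sets_eq[OF sa]])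
  have ca: "countably_additive ?S (\<lambda>A. \<Sum>i<length (polys X). emeasure lebesgue (polygon_part X i A))"
  proof (rule countably_additiveI)
    fix A :: "nat \<Rightarrow> _" assume A: "range A \<subseteq> ?S" "disjoint_family A"
    have eq: "polygon_part X i (\<Union>(range A)) = (\<Union>n. polygon_part X i (A n))" for i
      by (auto simp: polygon_part_def)
    have dis: "disjoint_family (\<lambda>n. polygon_part X i (A n))" for i
      using A(2) by (auto simp: disjoint_family_on_def polygon_part_def)
    have "(\<Sum>n. \<Sum>i<length (polys X). emeasure lebesgue (polygon_part X i (A n)))
        = (\<Sum>i<length (polys X). \<Sum>n. emeasure lebesgue (polygon_part X i (A n)))"
      by (rule suminf_sum) simp
    also have "\<dots> = (\<Sum>i<length (polys X). emeasure lebesgue (\<Union>n. polygon_part X i (A n)))"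
      by (rule sum.cong[OF refl], rule suminf_emeasure) (use A dis in auto)
    finally show "(\<Sum>n. \<Sum>i<length (polys X). emeasure lebesgue (polygon_part X i (A n)))
        = (\<Sum>i<length (polys X). emeasure lebesgue (polygon_part X i (\<Union>(range A))))"
      by (simp add: eq)
  qed
  show "emeasure (area_measure X) A = (\<Sum>i<length (polys X). emeasure lebesgue (polygon_part X i A))"
    if "A \<in> sets (area_measure X)"
    using that unfolding sets unfolding area_measure_def
    by (intro emeasure_measure_of_sigma[OF sa _ ca]) (auto simp: positive_def polygon_part_def)
qed

end

theory Submission
  imports Defs
begin

text \<open>
  At almost every point the following holds for every \<open>\<epsilon> > 0\<close>: the return time is at most of the order
  of \<open>1 / r\<close> to the power \<open>1 + \<epsilon>\<close> for all small \<open>r\<close>, and it is at least of the order of \<open>1 / r\<close> to the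
  power \<open>1 / (1 + \<epsilon>)\<close> for arbitrarily small \<open>r\<close>.

  \<^emph>\<open>Upper bound.\<close> The flow preserves area and the total area is finite. Cover the surface by about
  \<open>4\<^sup>n\<close> squares of diameter less than \<open>1 / 2\<^sup>n\<close>. The points of a square \<open>Q\<close> that are outside \<open>Q\<close> at
  all the times \<open>\<tau>\<close>, \<open>2\<tau>\<close>, ..., \<open>m\<tau>\<close> have disjoint images under the flow at the times \<open>0\<close>, \<open>\<tau>\<close>,
  ..., \<open>m\<tau>\<close>, so that they have area at most \<open>area X / (m + 1)\<close> (\<open>no_return_area\<close>). Since a small
  square is crossed in a small time, the step \<open>\<tau>\<close> may be taken of order \<open>1 / 2\<^sup>n\<close>. With \<open>m\<close> of order
  \<open>2\<^sup>n\<close> to the power \<open>2 + \<epsilon>\<close> the exceptional areas are summable over \<open>n\<close>, and by the Borel--Cantelli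
  lemma almost every point returns within \<open>1 / 2\<^sup>n\<close> before a time of order \<open>2\<^sup>n\<close> to the power
  \<open>1 + \<epsilon>\<close> (\<open>AE_returns\<close>, \<open>exponent_upper\<close>).

  \<^emph>\<open>Lower bound.\<close> The points at distance less than \<open>\<rho>\<close> from the vertices have area of order \<open>\<rho>\<^sup>2\<close>.
  A second application of the Borel--Cantelli lemma shows that the orbit of almost every point \<open>p\<close> up
  to time \<open>2\<^sup>n\<close> is surrounded by a tube of flat discs whose radius \<open>b\<^sub>n\<close> is of order \<open>2\<^sup>n\<close> to the power
  \<open>- 1 - \<epsilon>\<close> (\<open>AE_tubed\<close>). Let \<open>s\<close> be the displacement at the first return of \<open>p\<close> to a short segment
  through \<open>p\<close> which is orthogonal to the flow. It is not zero, because in a Keane direction no orbit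
  is periodic (\<open>no_periodic_orbit\<close>). Assume that a still closer return takes place before time \<open>2\<^sup>n\<close>,
  while \<open>10 * \<bar>s\<bar> < b\<^sub>n\<close>. Then both returns take place inside the tube, and they glue a part of it to
  a closed surface without singular points. Since the surface is connected this part is everything,
  but \<open>\<Sigma>\<close> is not empty (\<open>no_two_close_returns\<close>). So the return time for the radius \<open>\<bar>s\<bar>\<close> is at least
  of the order of \<open>\<bar>s\<bar>\<close> to the power \<open>- 1 / (1 + \<epsilon>)\<close>. As the segment may be taken arbitrarily short,
  this happens for arbitrarily small radii (\<open>slow_return\<close>, \<open>exponent_lower\<close>).

  \<^emph>\<open>Charts.\<close> Both parts need the flow to be injective and locally a translation. Integral curves are
  given in the coordinates of the polygons, where they jump whenever they cross a side. They become
  straight lines in translation charts, which exist at all points outside \<open>\<Sigma>\<close>: in the interior of a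
  polygon, at a side where two half discs fit together, and at a vertex of cone angle \<open>2\<pi>\<close>, whose
  corners fit together to a disc (\<open>chart_exists\<close>). The shape of a simple polygon near a boundary
  point, on which the last two cases rest, comes from the Jordan curve theorem. The predicate
  \<open>reg \<rho> p\<close> says that there is a chart of radius \<open>\<rho>\<close> around \<open>p\<close>, and \<open>shift p w\<close> is the point
  \<open>p + w\<close> in such a chart.
\<close>

section \<open>Polygons near a point of their boundary\<close>

lemma vertex_mod: "vertex P (k mod length P) = vertex P k"
  by (simp add: vertex_def)

lemma vertex_add_length: "vertex P (k + length P) = vertex P k"
  by (simp add: vertex_def)

lemma vertex_eq_iff:
  assumes "distinct P" "P \<noteq> []"
  shows "vertex P k = vertex P l \<longleftrightarrow> k mod length P = l mod length P"
  using assms by (simp add: vertex_def nth_eq_iff_index_eq)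

lemma side_mod: "side P (k mod length P) = side P k"
  by (simp add: side_def vertex_def mod_Suc_eq)

lemma edge_nonzero:
  assumes "simple_polygon P"
  shows "edge P k \<noteq> 0"
proof
  assume "edge P k = 0"
  then have "Suc k mod length P = k mod length P"
    using assms by (subst vertex_eq_iff[symmetric]) (auto simp: edge_def simple_polygon_def)
  moreover have "3 \<le> length P" using assms by (simp add: simple_polygon_def)
  ultimately show False by (auto simp: mod_Suc split: if_splits)
qed

primrec polygon_path :: "complex list \<Rightarrow> nat \<Rightarrow> real \<Rightarrow> complex" where
  "polygon_path P 0 = linepath (vertex P 0) (vertex P 1)"
| "polygon_path P (Suc m) = polygon_path P m +++ linepath (vertex P (Suc m)) (vertex P (Suc (Suc m)))"

lemma sides_meet:
  assumes "simple_polygon P" "k < length P" "l < length P" "k \<noteq> l"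
  shows "side P k \<inter> side P l \<subseteq> {vertex P k, vertex P (Suc k)} \<inter> {vertex P l, vertex P (Suc l)}"
  using assms by (auto simp: simple_polygon_def)

lemma arc_polygon_path:
  assumes P: "simple_polygon P" and "Suc m < length P"
  shows "arc (polygon_path P m) \<and> path_image (polygon_path P m) = (\<Union>k\<le>m. side P k) \<and>
    pathstart (polygon_path P m) = vertex P 0 \<and> pathfinish (polygon_path P m) = vertex P (Suc m)"
  using assms(2)
proof (induction m)
  case 0
  have "vertex P 0 \<noteq> vertex P (Suc 0)" using edge_nonzero[OF P, of 0] by (auto simp: edge_def)
  then show ?case by (auto simp: side_def)
next
  case (Suc m)
  then have IH: "arc (polygon_path P m)" "path_image (polygon_path P m) = (\<Union>k\<le>m. side P k)"
    "pathstart (polygon_path P m) = vertex P 0" "pathfinish (polygon_path P m) = vertex P (Suc m)"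
    by auto
  have ne: "vertex P (Suc m) \<noteq> vertex P (Suc (Suc m))"
    using edge_nonzero[OF P, of "Suc m"] by (auto simp: edge_def)
  have "(\<Union>k\<le>m. side P k) \<inter> side P (Suc m) \<subseteq> {vertex P (Suc m)}"
  proof
    fix x assume "x \<in> (\<Union>k\<le>m. side P k) \<inter> side P (Suc m)"
    then obtain k where k: "k \<le> m" "x \<in> side P k" "x \<in> side P (Suc m)" by auto
    then have "x \<in> {vertex P k, vertex P (Suc k)} \<inter> {vertex P (Suc m), vertex P (Suc (Suc m))}"
      using sides_meet[OF P, of k "Suc m"] Suc.prems by force
    moreover have "vertex P (Suc (Suc m)) \<noteq> vertex P k" "vertex P (Suc (Suc m)) \<noteq> vertex P (Suc k)"
      using P Suc.prems k(1) by (subst vertex_eq_iff; auto simp: simple_polygon_def)+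
    ultimately show "x \<in> {vertex P (Suc m)}" by auto
  qed
  then have "arc (polygon_path P (Suc m))"
    using IH ne by (auto intro!: arc_join simp: side_def)
  moreover have "path_image (polygon_path P (Suc m)) = (\<Union>k\<le>Suc m. side P k)"
    using IH by (simp add: path_image_join side_def atMost_Suc Un_commute)
  ultimately show ?case using IH by simp
qed

text \<open>This opens the way to the Jordan curve theorem, which supplies the two complementary
  components of the boundary and the fact that every point of the boundary is a limit of each of
  them.\<close>

lemma boundary_simple_closed_path:
  assumes P: "simple_polygon P"
  obtains c where "simple_path c" "pathfinish c = pathstart c" "path_image c = boundary P"
proof -
  define m where "m = length P - 2"
  have len: "length P = Suc (Suc m)" and m0: "0 < m" using P by (auto simp: m_def simple_polygon_def)
  let ?g = "polygon_path P m" and ?h = "linepath (vertex P (Suc m)) (vertex P (Suc (Suc m)))"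
  have A: "arc ?g" "path_image ?g = (\<Union>k\<le>m. side P k)"
    "pathstart ?g = vertex P 0" "pathfinish ?g = vertex P (Suc m)"
    using arc_polygon_path[OF P, of m] len by auto
  have v0: "vertex P (Suc (Suc m)) = vertex P 0" using len by (simp add: vertex_def)
  have "arc ?h"
    using edge_nonzero[OF P, of "Suc m"] by (auto simp: edge_def)
  moreover have "(\<Union>k\<le>m. side P k) \<inter> side P (Suc m) \<subseteq> {vertex P 0, vertex P (Suc m)}"
  proof
    fix x assume "x \<in> (\<Union>k\<le>m. side P k) \<inter> side P (Suc m)"
    then obtain k where k: "k \<le> m" "x \<in> side P k" "x \<in> side P (Suc m)" by auto
    then show "x \<in> {vertex P 0, vertex P (Suc m)}"
      using sides_meet[OF P, of k "Suc m"] len v0 by force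
  qed
  ultimately have "simple_path (?g +++ ?h)"
    using A v0 by (intro simple_path_join_loop) (auto simp: side_def)
  moreover have "path_image (?g +++ ?h) = boundary P"
    using A by (simp add: path_image_join side_def boundary_def len lessThan_Suc_atMost atMost_Suc Un_commute)
  ultimately show ?thesis using that[of "?g +++ ?h"] A v0 by simp
qed

lemma polygon_Jordan:
  assumes P: "simple_polygon P"
  shows "open (inside (boundary P))" "open (outside (boundary P))"
    "frontier (inside (boundary P)) = boundary P" "frontier (outside (boundary P)) = boundary P"
proof -
  obtain c where "simple_path c" "pathfinish c = pathstart c" "path_image c = boundary P"
    using boundary_simple_closed_path[OF P] .
  from Jordan_inside_outside[OF this(1,2)] this(3)
  show "open (inside (boundary P))" "open (outside (boundary P))"
    "frontier (inside (boundary P)) = boundary P" "frontier (outside (boundary P)) = boundary P"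
    by auto
qed

lemma outside_region: "x \<in> outside (boundary P) \<longleftrightarrow> x \<notin> region P"
  unfolding region_def using inside_Un_outside[of "boundary P"] inside_Int_outside[of "boundary P"]
      outside_no_overlap[of "boundary P"] by blast

lemma inside_region: "x \<in> inside (boundary P) \<longleftrightarrow> x \<in> region P \<and> x \<notin> boundary P"
  unfolding region_def using inside_no_overlap[of "boundary P"] by blast

text \<open>In polar coordinates a sector is a rectangle.\<close>

lemma connected_sector:
  assumes "e \<noteq> 0"
  shows "connected {x + w |w. w \<noteq> 0 \<and> norm w < \<rho> \<and> a < Arg2pi (w / e) \<and> Arg2pi (w / e) < b}"
proof -
  let ?S = "{x + w |w. w \<noteq> 0 \<and> norm w < \<rho> \<and> a < Arg2pi (w / e) \<and> Arg2pi (w / e) < b}"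
  let ?f = "\<lambda>(r::real, \<phi>). x + of_real r * (e / of_real (norm e)) * exp (\<i> * of_real \<phi>)"
  let ?D = "{0<..<\<rho>} \<times> ({a<..<b} \<inter> {0..<2*pi})"
  have "connected (?f ` ?D)"
    by (intro connected_continuous_image continuous_intros)
      (use assms in \<open>auto simp: case_prod_beta intro!: continuous_intros convex_connected convex_Times convex_Int\<close>)
  moreover have "?f ` ?D = ?S"
  proof (intro set_eqI iffI)
    fix y assume "y \<in> ?f ` ?D"
    then obtain r \<phi> where r: "0 < r" "r < \<rho>" and p: "a < \<phi>" "\<phi> < b" "0 \<le> \<phi>" "\<phi> < 2 * pi"
      and y: "y = x + of_real r * (e / of_real (norm e)) * exp (\<i> * of_real \<phi>)" by auto
    define w where "w = of_real r * (e / of_real (norm e)) * exp (\<i> * of_real \<phi>)"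
    have "w / e = of_real (r / norm e) * exp (\<i> * of_real \<phi>)" using assms by (simp add: w_def)
    then have "Arg2pi (w / e) = \<phi>"
      using r p assms by (intro Arg2pi_unique[of "r / norm e"]) auto
    moreover have "norm w = r" using r assms by (simp add: norm_mult norm_divide w_def)
    moreover have "w \<noteq> 0" using r assms by (auto simp: w_def)
    moreover have "y = x + w" using y by (simp add: w_def)
    ultimately show "y \<in> ?S" using r p by blast
  next
    fix y assume "y \<in> ?S"
    then obtain w where w: "y = x + w" "w \<noteq> 0" "norm w < \<rho>" "a < Arg2pi (w / e)" "Arg2pi (w / e) < b"
      by auto
    have "w / e = of_real (norm (w / e)) * exp (\<i> * of_real (Arg2pi (w / e)))"
      using Arg2pi_eq by blast
    then have "w = of_real (norm w) * (e / of_real (norm e)) * exp (\<i> * of_real (Arg2pi (w / e)))"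
      using assms by (simp add: norm_divide field_simps)
    then show "y \<in> ?f ` ?D" using w Arg2pi_ge_0[of "w/e"] Arg2pi_lt_2pi[of "w/e"]
      by (intro image_eqI[of _ _ "(norm w, Arg2pi (w / e))"]) auto
  qed
  ultimately show ?thesis by simp
qed

text \<open>If two rays are all that a small disc around \<open>x\<close> contains of the boundary, then each of the
  two open sectors between them is connected and misses the boundary, so that it lies on one side
  of it. The sector of \<open>w\<^sub>0\<close> lies inside. The other one lies outside, because \<open>x\<close> is a limit of
  outside points.\<close>

lemma region_sector:
  assumes P: "simple_polygon P" and e: "e \<noteq> 0" and \<alpha>: "0 < \<alpha>" and \<rho>: "0 < \<rho>"
    and bd: "\<And>w. norm w < \<rho> \<Longrightarrow> x + w \<in> boundary P \<longleftrightarrow> Arg2pi (w / e) = 0 \<or> Arg2pi (w / e) = \<alpha>"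
    and ins: "norm w\<^sub>0 < \<rho>" "0 < Arg2pi (w\<^sub>0 / e)" "Arg2pi (w\<^sub>0 / e) < \<alpha>" "x + w\<^sub>0 \<in> inside (boundary P)"
    and w: "norm w < \<rho>"
  shows "x + w \<in> region P \<longleftrightarrow> Arg2pi (w / e) \<le> \<alpha>"
proof -
  define S where "S a b = {x + w |w. w \<noteq> 0 \<and> norm w < \<rho> \<and> a < Arg2pi (w / e) \<and> Arg2pi (w / e) < b}" for a b
  have conn: "connected (S a b)" for a b
    unfolding S_def by (rule connected_sector[OF e])
  note J = polygon_Jordan[OF P]
  have nz: "w \<noteq> 0" if "0 < Arg2pi (w / e)" for w using that by auto
  have x: "x \<in> boundary P" using bd[of 0] \<rho> by simp
  have d1: "S 0 \<alpha> \<inter> boundary P = {}" unfolding S_def using bd by fastforce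
  have d2: "S \<alpha> (2*pi) \<inter> boundary P = {}" unfolding S_def using bd \<alpha> by fastforce
  have "x + w\<^sub>0 \<in> S 0 \<alpha>" unfolding S_def using ins nz by blast
  then have s1: "S 0 \<alpha> \<subseteq> inside (boundary P)"
    using connected_Int_frontier[OF conn, of 0 \<alpha> "inside (boundary P)"] ins(4) d1 J(3) by auto
  have "x \<in> frontier (outside (boundary P))" using x J(4) by simp
  then obtain y where y: "y \<in> outside (boundary P)" "dist y x < \<rho>"
    using \<rho> unfolding frontier_straddle by (metis (lifting) mem_Collect_eq dist_commute)
  have yn: "norm (y - x) < \<rho>" using y(2) by (simp add: dist_norm)
  have yb: "y \<notin> region P" using y(1) outside_region by blast
  then have yb': "y \<notin> boundary P" "y \<notin> inside (boundary P)" by (auto simp: region_def)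
  have "y \<in> S \<alpha> (2*pi)"
  proof -
    have "y \<notin> S 0 \<alpha>" using s1 yb'(2) by blast
    then have "\<not> (0 < Arg2pi ((y - x) / e) \<and> Arg2pi ((y - x) / e) < \<alpha>)"
    proof (rule contrapos_nn)
      assume "0 < Arg2pi ((y - x) / e) \<and> Arg2pi ((y - x) / e) < \<alpha>"
      then have "x + (y - x) \<in> S 0 \<alpha>" using yn nz[of "y - x"] unfolding S_def by blast
      then show "y \<in> S 0 \<alpha>" by simp
    qed
    moreover have "Arg2pi ((y - x) / e) \<noteq> 0" "Arg2pi ((y - x) / e) \<noteq> \<alpha>"
      using bd[OF yn] yb'(1) by auto
    ultimately have "\<alpha> < Arg2pi ((y - x) / e)" using Arg2pi_ge_0[of "(y - x) / e"] by linarith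
    then show ?thesis unfolding S_def using yn nz[of "y - x"] \<alpha> Arg2pi_lt_2pi[of "(y - x) / e"]
      by (auto intro!: exI[of _ "y - x"])
  qed
  then have s2: "S \<alpha> (2*pi) \<subseteq> outside (boundary P)"
    using connected_Int_frontier[OF conn, of \<alpha> "2*pi" "outside (boundary P)"] y(1) d2 J(4) by auto
  consider "Arg2pi (w / e) = 0 \<or> Arg2pi (w / e) = \<alpha>" | "0 < Arg2pi (w / e)" "Arg2pi (w / e) < \<alpha>"
    | "\<alpha> < Arg2pi (w / e)" using Arg2pi_ge_0[of "w / e"] by linarith
  then show ?thesis
  proof cases
    case 1
    then show ?thesis using bd[OF w] \<alpha> by (auto simp: region_def)
  next
    case 2
    then have "x + w \<in> S 0 \<alpha>" unfolding S_def using nz w by blast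
    then show ?thesis using s1 2 by (auto simp: region_def)
  next
    case 3
    then have "x + w \<in> S \<alpha> (2*pi)" unfolding S_def using nz[of w] w \<alpha> Arg2pi_lt_2pi[of "w/e"] by fastforce
    then show ?thesis using s2 3 outside_region by auto
  qed
qed


lemma side_iff: "x \<in> side P k \<longleftrightarrow> (\<exists>s. 0 \<le> s \<and> s \<le> 1 \<and> x = vertex P k + of_real s * edge P k)"
  unfolding side_def edge_def in_segment
  by (auto simp: algebra_simps scaleR_conv_of_real)

lemma vertex_in_side: "vertex P k \<in> side P k" "vertex P (Suc k) \<in> side P k"
  by (auto simp: side_def)

lemma simple_polygon_length: "simple_polygon P \<Longrightarrow> 3 \<le> length P"
  by (simp add: simple_polygon_def)

text \<open>In a disc around a point of a side that misses all other sides, the boundary consists of two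
  opposite rays. The positive orientation supplies a point of the left half disc that lies inside.\<close>

lemma half_disc:
  assumes P: "simple_polygon P" and po: "positively_oriented P" and k: "k < length P"
    and x: "x \<in> side P k" and \<rho>: "0 < \<rho>"
    and away: "\<And>l. l < length P \<Longrightarrow> l \<noteq> k \<Longrightarrow> ball x \<rho> \<inter> side P l = {}"
    and w: "norm w < \<rho>"
  shows "x + w \<in> side P k \<longleftrightarrow> Im (w / edge P k) = 0"
    "x + w \<in> region P \<longleftrightarrow> 0 \<le> Im (w / edge P k)"
proof -
  define e where "e = edge P k"
  have e: "e \<noteq> 0" using edge_nonzero[OF P] by (simp add: e_def)
  have len: "3 \<le> length P" by (rule simple_polygon_length[OF P])
  obtain s where s: "0 \<le> s" "s \<le> 1" "x = vertex P k + of_real s * e"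
    using x by (auto simp: side_iff e_def)
  have other: "v \<notin> ball x \<rho>" if "v \<in> side P l" "l mod length P \<noteq> k" for v l
  proof -
    have "l mod length P < length P" by (rule mod_less_divisor) (use len in linarith)
    then show ?thesis using away[of "l mod length P"] that by (auto simp: side_mod)
  qed
  have "Suc k mod length P \<noteq> k" using k len by (auto simp: mod_Suc)
  then have d2: "\<rho> \<le> dist x (vertex P (Suc k))"
    using other[of "vertex P (Suc k)" "Suc k"] vertex_in_side by auto
  have "(k + length P - 1) mod length P \<noteq> k"
    using k len by (cases k) auto
  moreover have "Suc (k + length P - 1) = k + length P" using len by linarith
  then have "vertex P k = vertex P (Suc (k + length P - 1))"
    using vertex_add_length[of P k] by simp
  ultimately have d1: "\<rho> \<le> dist x (vertex P k)"
    using other[of "vertex P k" "k + length P - 1"] vertex_in_side(2) by auto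
  \<comment> \<open>the end points of the side also belong to its neighbours, so the disc does not reach them\<close>
  have n1: "\<rho> \<le> s * norm e" using d1 s by (simp add: dist_norm norm_mult)
  have "x - vertex P (Suc k) = of_real (s - 1) * e"
    using s by (simp add: e_def edge_def algebra_simps)
  then have n2: "\<rho> \<le> (1 - s) * norm e" using d2 s by (simp add: dist_norm norm_mult del: of_real_diff)
  have sd: "x + w \<in> side P k \<longleftrightarrow> Im (w / e) = 0" if w: "norm w < \<rho>" for w
  proof
    assume "x + w \<in> side P k"
    then obtain s' where "x + w = vertex P k + of_real s' * e"
      by (auto simp: side_iff e_def)
    then have "w = of_real (s' - s) * e" using s by (simp add: algebra_simps)
    then show "Im (w / e) = 0" using e by simp
  next
    assume "Im (w / e) = 0"
    then have we: "w = of_real (Re (w / e)) * e" using e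
      by (metis complex_is_Real_iff nonzero_eq_divide_eq of_real_Re)
    let ?t = "Re (w / e)"
    have "\<bar>?t\<bar> * norm e < \<rho>" using w we by (metis norm_mult norm_of_real)
    then have "\<bar>?t\<bar> * norm e < s * norm e" "\<bar>?t\<bar> * norm e < (1 - s) * norm e" using n1 n2 by linarith+
    then have "\<bar>?t\<bar> < s" "\<bar>?t\<bar> < 1 - s" using e by (simp_all add: mult_less_cancel_right)
    moreover have "x + w = vertex P k + of_real (s + ?t) * e"
      using we s(3) by (simp add: algebra_simps del: of_real_Re)
    ultimately show "x + w \<in> side P k" unfolding side_iff e_def[symmetric]
      by (intro exI[of _ "s + ?t"]) auto
  qed
  show "x + w \<in> side P k \<longleftrightarrow> Im (w / edge P k) = 0" using sd[OF w] by (simp add: e_def)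
  have bd: "x + w \<in> boundary P \<longleftrightarrow> Arg2pi (w / e) = 0 \<or> Arg2pi (w / e) = pi" if w: "norm w < \<rho>" for w
  proof -
    have "x + w \<in> ball x \<rho>" using w by (simp add: dist_norm)
    then have "x + w \<in> boundary P \<longleftrightarrow> x + w \<in> side P k"
      using away k unfolding boundary_def by blast
    also have "\<dots> \<longleftrightarrow> Im (w / e) = 0" by (rule sd[OF w])
    also have "\<dots> \<longleftrightarrow> Arg2pi (w / e) = 0 \<or> Arg2pi (w / e) = pi"
      unfolding Arg2pi_eq_0 Arg2pi_eq_pi complex_is_Real_iff by auto
    finally show ?thesis .
  qed
  have "x \<noteq> vertex P k" "x \<noteq> vertex P (Suc k)" using d1 d2 \<rho> by auto
  then have "x \<in> open_segment (vertex P k) (vertex P (Suc k))"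
    using x by (simp add: open_segment_def side_def)
  then have "\<forall>\<^sub>F h in at_right (0::real). x + of_real h * (\<i> * e) \<in> inside (boundary P)"
    using po k unfolding positively_oriented_def e_def by blast
  moreover have "\<forall>\<^sub>F h in at_right (0::real). h < \<rho> / norm e"
    using \<rho> e by (intro eventually_at_right_less order_tendstoD tendsto_ident_at) auto
  moreover have "\<forall>\<^sub>F h in at_right (0::real). 0 < h" by (simp add: eventually_at_right_less)
  ultimately have "\<forall>\<^sub>F h in at_right (0::real). x + of_real h * (\<i> * e) \<in> inside (boundary P) \<and> h < \<rho> / norm e \<and> 0 < h"
    by eventually_elim auto
  then obtain h where h: "x + of_real h * (\<i> * e) \<in> inside (boundary P)" "h < \<rho> / norm e" "0 < h"
    using eventually_happens'[OF trivial_limit_at_right_real] by blast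
  have we: "of_real h * (\<i> * e) / e = \<i> * of_real h" using e by simp
  have hA: "0 < Arg2pi (of_real h * (\<i> * e) / e)" "Arg2pi (of_real h * (\<i> * e) / e) < pi"
    using Arg2pi_lt_pi[of "\<i> * of_real h"] h(3) unfolding we by auto
  have "norm (of_real h * (\<i> * e)) < \<rho>" using h e by (simp add: norm_mult field_simps)
  from region_sector[OF P e pi_gt_zero \<rho> bd this hA h(1) w]
  show "x + w \<in> region P \<longleftrightarrow> 0 \<le> Im (w / edge P k)"
    by (simp add: Arg2pi_le_pi e_def)
qed

text \<open>Of two segments from \<open>a\<close> with the same direction, the longer one contains the end point of
  the shorter one.\<close>

lemma segments_not_parallel:
  fixes a b c :: complex
  assumes "closed_segment a b \<inter> closed_segment a c \<subseteq> {a}" "a \<noteq> b" "a \<noteq> c"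
  shows "\<not> (Im ((b - a) / (c - a)) = 0 \<and> 0 \<le> Re ((b - a) / (c - a)))"
proof
  assume *: "Im ((b - a) / (c - a)) = 0 \<and> 0 \<le> Re ((b - a) / (c - a))"
  define t where "t = Re ((b - a) / (c - a))"
  have "(b - a) / (c - a) = of_real t" using * by (simp add: t_def complex_eq_iff)
  then have t: "b - a = of_real t * (c - a)" "0 \<le> t" using * assms(3)
    by (simp_all add: t_def field_simps)
  show False
  proof (cases "t \<le> 1")
    case True
    have "b \<in> closed_segment a c" using t True
      by (auto simp: in_segment scaleR_conv_of_real algebra_simps intro!: exI[of _ t])
    then show False using assms by auto
  next
    case False
    then have "c - a = of_real (1/t) * (b - a)" using t by simp
    then have "c = (1 - 1/t) *\<^sub>R a + (1/t) *\<^sub>R b"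
      by (simp add: scaleR_conv_of_real algebra_simps diff_divide_distrib)
    then have "c \<in> closed_segment a b" using False
      unfolding in_segment by (intro exI[of _ "1/t"]) auto
    then show False using assms by auto
  qed
qed

lemma adjacent_sides:
  assumes P: "simple_polygon P" and kl: "k < length P" "l < length P" and v: "vertex P (Suc k) = vertex P l"
  shows "k \<noteq> l" "side P k \<inter> side P l \<subseteq> {vertex P l}"
    "\<not> (Im ((vertex P k - vertex P l) / edge P l) = 0 \<and> 0 \<le> Re ((vertex P k - vertex P l) / edge P l))"
proof -
  have len: "3 \<le> length P" by (rule simple_polygon_length[OF P])
  have d: "distinct P" "P \<noteq> []" using P len by (auto simp: simple_polygon_def)
  note veq = vertex_eq_iff[OF d]
  have l: "l = Suc k mod length P" using v kl by (simp add: veq)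
  show ne: "k \<noteq> l" unfolding l using kl len by (auto simp: mod_Suc)
  have "vertex P k \<noteq> vertex P (Suc l)"
    unfolding veq l using kl len by (auto simp: mod_Suc split: if_splits)
  moreover have "vertex P k \<noteq> vertex P l" using ne kl by (simp add: veq)
  ultimately show *: "side P k \<inter> side P l \<subseteq> {vertex P l}"
    using sides_meet[OF P kl ne] v by auto
  show "\<not> (Im ((vertex P k - vertex P l) / edge P l) = 0 \<and> 0 \<le> Re ((vertex P k - vertex P l) / edge P l))"
    unfolding edge_def
    using * edge_nonzero[OF P, of l] \<open>vertex P k \<noteq> vertex P l\<close>
    by (intro segments_not_parallel) (auto simp: side_def edge_def v closed_segment_commute)
qed

lemma Arg2pi_eq_Arg_nonneg: "0 \<le> Im z \<Longrightarrow> 0 < Re z \<Longrightarrow> Arg2pi z = Arg z"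
proof -
  assume z: "0 \<le> Im z" "0 < Re z"
  then have "z \<noteq> 0" by auto
  moreover from this have "of_real (norm z) * exp (\<i> * of_real (Arg z)) = z" by (rule Arg_eq[symmetric])
  moreover have "0 \<le> Arg z" using z Arg_less_0[of z] by linarith
  moreover have "Arg z < 2 * pi" using Arg_le_pi[of z] pi_gt_zero by linarith
  ultimately show "Arg2pi z = Arg z" by (intro Arg2pi_unique[of "norm z"]) auto
qed

lemma previous_side:
  assumes P: "simple_polygon P" and k: "k < length P"
  defines "l \<equiv> (k + length P - 1) mod length P"
  shows "l < length P" "vertex P (Suc l) = vertex P k" "vertex P l = vertex P (k + length P - 1)"
    "Suc l mod length P = k"
proof -
  have len: "3 \<le> length P" by (rule simple_polygon_length[OF P])
  show "l < length P" unfolding l_def by (rule mod_less_divisor) (use len in linarith)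
  show *: "Suc l mod length P = k"
  proof -
    have "Suc (k + length P - 1) = k + length P" using len by linarith
    then show ?thesis unfolding l_def mod_Suc_eq using k by simp
  qed
  then show "vertex P (Suc l) = vertex P k" using k by (simp add: vertex_def)
  show "vertex P l = vertex P (k + length P - 1)" by (simp add: l_def vertex_mod)
qed

text \<open>At a vertex the two rays are the outgoing and the incoming side, and the sector between them
  has the interior angle as its opening. A point of this sector that lies inside is found slightly
  to the left of the outgoing side, close to the vertex.\<close>

lemma vertex_sector:
  assumes P: "simple_polygon P" and po: "positively_oriented P" and k: "k < length P"
    and \<rho>: "0 < \<rho>" "\<rho> \<le> norm (edge P k)" "\<rho> \<le> norm (vertex P (k + length P - 1) - vertex P k)"
    and away: "\<And>l. l < length P \<Longrightarrow> l \<noteq> k \<Longrightarrow> Suc l mod length P \<noteq> k \<Longrightarrow>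
      ball (vertex P k) \<rho> \<inter> side P l = {}"
  shows "0 < interior_angle P k"
    "norm w < \<rho> \<Longrightarrow> vertex P k + w \<in> region P \<longleftrightarrow> Arg2pi (w / edge P k) \<le> interior_angle P k"
    "norm w < \<rho> \<Longrightarrow> Arg2pi (w / edge P k) = 0 \<Longrightarrow> vertex P k + w \<in> side P k"
proof -
  define e where "e = edge P k"
  define l where "l = (k + length P - 1) mod length P"
  define f where "f = vertex P l - vertex P k"
  have e: "e \<noteq> 0" using edge_nonzero[OF P] by (simp add: e_def)
  note l = previous_side[OF P k, folded l_def]
  have fl: "edge P l = - f" by (simp add: f_def edge_def l)
  then have f: "f \<noteq> 0" using edge_nonzero[OF P, of l] by auto
  have \<alpha>: "interior_angle P k = Arg2pi (f / e)"
    unfolding interior_angle_def f_def e_def edge_def l(3) by simp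
  have \<rho>': "\<rho> \<le> norm e" "\<rho> \<le> norm f" using \<rho> by (auto simp: e_def f_def l(3))
  have np: "\<not> (Im (f / e) = 0 \<and> 0 \<le> Re (f / e))"
    using adjacent_sides(3)[OF P l(1) k l(2)] by (simp add: f_def e_def)
  show \<alpha>0: "0 < interior_angle P k"
    using np Arg2pi_ge_0[of "f / e"] Arg2pi_eq_0[of "f / e"] unfolding \<alpha> complex_is_Real_iff by linarith
  have s1: "vertex P k + w \<in> side P k \<longleftrightarrow> Arg2pi (w / e) = 0" if w: "norm w < \<rho>" for w
  proof
    assume "vertex P k + w \<in> side P k"
    then obtain s where "0 \<le> s" "w = of_real s * e" by (auto simp: side_iff e_def)
    then show "Arg2pi (w / e) = 0" using e by (simp add: Arg2pi_eq_0)
  next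
    assume "Arg2pi (w / e) = 0"
    then have *: "w / e \<in> \<real>" "0 \<le> Re (w / e)" by (auto simp: Arg2pi_eq_0)
    then have we: "w = of_real (Re (w / e)) * e" using e
      by (metis nonzero_eq_divide_eq of_real_Re)
    have "Re (w / e) * norm e < 1 * norm e" using w we \<rho>' *(2)
      by (metis abs_of_nonneg norm_mult norm_of_real mult_1 less_le_trans)
    then have "Re (w / e) \<le> 1" using e by (simp add: mult_less_cancel_right)
    then show "vertex P k + w \<in> side P k" unfolding side_iff e_def[symmetric]
      using we *(2) by (intro exI[of _ "Re (w / e)"]) auto
  qed
  show "norm w < \<rho> \<Longrightarrow> Arg2pi (w / edge P k) = 0 \<Longrightarrow> vertex P k + w \<in> side P k"
    using s1[of w] by (simp add: e_def)
  have s2: "vertex P k + w \<in> side P l \<longleftrightarrow> Arg2pi (w / e) = Arg2pi (f / e) \<or> w = 0" if w: "norm w < \<rho>" for w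
  proof
    assume "vertex P k + w \<in> side P l"
    then obtain s where s: "0 \<le> s" "s \<le> 1" "vertex P k + w = vertex P l + of_real s * (- f)"
      unfolding side_iff fl by auto
    then have w': "w = of_real (1 - s) * f" by (simp add: f_def algebra_simps)
    show "Arg2pi (w / e) = Arg2pi (f / e) \<or> w = 0"
    proof (cases "s = 1")
      case False
      then have "Arg2pi (of_real (1 - s) * (f / e)) = Arg2pi (f / e)"
        using s by (intro Arg2pi_times_of_real) auto
      then show ?thesis using w' by simp
    qed (use w' in simp)
  next
    assume *: "Arg2pi (w / e) = Arg2pi (f / e) \<or> w = 0"
    show "vertex P k + w \<in> side P l"
    proof (cases "w = 0")
      case True
      then show ?thesis using vertex_in_side(2)[of P l] by (simp add: l)
    next
      case False
      then have "Arg2pi (w / e) = Arg2pi (f / e)" using * by simp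
      moreover define E where "E = exp (\<i> * of_real (Arg2pi (f / e)))"
      ultimately have "w / e = of_real (norm w / norm e) * E" "f / e = of_real (norm f / norm e) * E"
        using Arg2pi_eq[of "w / e"] Arg2pi_eq[of "f / e"] by (simp_all add: norm_divide)
      then have "w / e = of_real (norm w / norm f) * (f / e)"
        using f e by (simp only:) simp
      then have w': "w = of_real (norm w / norm f) * f" using e by (simp add: field_simps)
      have "vertex P k + w = vertex P l + of_real (1 - norm w / norm f) * (- f)"
      proof -
        have "vertex P l = vertex P k + f" by (simp add: f_def)
        then show ?thesis by (subst w') (simp add: algebra_simps)
      qed
      moreover have "norm w / norm f \<le> 1" using w \<rho>' f by simp
      ultimately show ?thesis unfolding side_iff fl by (intro exI[of _ "1 - norm w / norm f"]) auto
    qed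
  qed
  have bd: "vertex P k + w \<in> boundary P \<longleftrightarrow> Arg2pi (w / e) = 0 \<or> Arg2pi (w / e) = Arg2pi (f / e)"
    if w: "norm w < \<rho>" for w
  proof -
    have unique: "l' = l" if "l' < length P" "Suc l' mod length P = k" for l'
      using that l(1,4) by (auto simp: mod_Suc split: if_splits)
    have "vertex P k + w \<in> ball (vertex P k) \<rho>" using w by (simp add: dist_norm)
    then have "vertex P k + w \<in> boundary P \<longleftrightarrow> vertex P k + w \<in> side P k \<or> vertex P k + w \<in> side P l"
    proof (intro iffI)
      assume "vertex P k + w \<in> boundary P"
      then obtain l' where l': "l' < length P" "vertex P k + w \<in> side P l'" by (auto simp: boundary_def)
      then have "l' = k \<or> Suc l' mod length P = k"
        using away[of l'] \<open>vertex P k + w \<in> ball (vertex P k) \<rho>\<close> by blast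
      then show "vertex P k + w \<in> side P k \<or> vertex P k + w \<in> side P l"
        using unique l' by blast
    qed (use k l(1) in \<open>auto simp: boundary_def\<close>)
    also have "\<dots> \<longleftrightarrow> Arg2pi (w / e) = 0 \<or> Arg2pi (w / e) = Arg2pi (f / e)"
      using s1[OF w] s2[OF w] by auto
    finally show ?thesis .
  qed
  define \<delta> where "\<delta> = \<rho> / (2 * norm e)"
  have \<delta>: "0 < \<delta>" "\<delta> * norm e < \<rho>" "\<delta> < 1" using \<rho> \<rho>' e by (auto simp: \<delta>_def field_simps)
  let ?x = "vertex P k + of_real \<delta> * e"
  have "?x \<in> open_segment (vertex P k) (vertex P (Suc k))"
    unfolding in_segment(2) using \<delta> e
    by (auto simp: e_def edge_def scaleR_conv_of_real algebra_simps intro!: exI[of _ \<delta>])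
  then have "\<forall>\<^sub>F h in at_right (0::real). ?x + of_real h * (\<i> * e) \<in> inside (boundary P)"
    using po k unfolding positively_oriented_def e_def by blast
  moreover have "\<forall>\<^sub>F h in at_right (0::real). norm (of_real \<delta> * e + of_real h * (\<i> * e)) < \<rho>"
  proof (rule order_tendstoD)
    show "((\<lambda>h::real. norm (of_real \<delta> * e + of_real h * (\<i> * e))) \<longlongrightarrow>
        norm (of_real \<delta> * e + of_real 0 * (\<i> * e))) (at_right 0)"
      by (intro tendsto_intros)
  qed (use \<delta> in \<open>simp add: norm_mult\<close>)
  moreover have "\<forall>\<^sub>F h in at_right (0::real). Arg (of_real \<delta> + \<i> * of_real h) < Arg2pi (f / e)"
  proof (rule order_tendstoD)
    have "isCont Arg (of_real \<delta>)" using \<delta> by (intro continuous_at_Arg) (simp add: complex_nonpos_Reals_iff)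
    then show "((\<lambda>h::real. Arg (of_real \<delta> + \<i> * of_real h)) \<longlongrightarrow> Arg (of_real \<delta>)) (at_right 0)"
      by (rule isCont_tendsto_compose) (auto intro!: tendsto_eq_intros)
    show "Arg (of_real \<delta>) < Arg2pi (f / e)" using \<alpha>0 \<alpha> \<delta> by (simp add: Arg_of_real)
  qed
  moreover have "\<forall>\<^sub>F h in at_right (0::real). 0 < h" by (simp add: eventually_at_right_less)
  ultimately have "\<forall>\<^sub>F h in at_right (0::real). ?x + of_real h * (\<i> * e) \<in> inside (boundary P) \<and>
    norm (of_real \<delta> * e + of_real h * (\<i> * e)) < \<rho> \<and> Arg (of_real \<delta> + \<i> * of_real h) < Arg2pi (f / e) \<and> 0 < h"
    by eventually_elim auto
  then obtain h where h: "?x + of_real h * (\<i> * e) \<in> inside (boundary P)"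
    "norm (of_real \<delta> * e + of_real h * (\<i> * e)) < \<rho>" "Arg (of_real \<delta> + \<i> * of_real h) < Arg2pi (f / e)" "0 < h"
    using eventually_happens'[OF trivial_limit_at_right_real] by blast
  define w\<^sub>0 where "w\<^sub>0 = of_real \<delta> * e + of_real h * (\<i> * e)"
  have w0e: "w\<^sub>0 / e = of_real \<delta> + \<i> * of_real h" using e by (simp add: w\<^sub>0_def field_simps)
  have A0: "Arg2pi (w\<^sub>0 / e) = Arg (of_real \<delta> + \<i> * of_real h)"
    unfolding w0e using h \<delta> by (intro Arg2pi_eq_Arg_nonneg) auto
  have A1: "0 < Arg2pi (w\<^sub>0 / e)"
    using Arg2pi_lt_pi[of "w\<^sub>0 / e"] h(4) unfolding w0e by simp
  show "vertex P k + w \<in> region P \<longleftrightarrow> Arg2pi (w / edge P k) \<le> interior_angle P k" if "norm w < \<rho>"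
    unfolding \<alpha> e_def[symmetric]
    using region_sector[OF P e \<alpha>0[unfolded \<alpha>] \<rho>(1) bd _ A1 _ _ that] h A0
    by (auto simp: w\<^sub>0_def algebra_simps)
qed

text \<open>Two rays from the same origin which do not coincide diverge at a linear rate. The proof
  distinguishes rays on different lines from opposite rays.\<close>

lemma distance_from_segment:
  fixes e f :: complex
  assumes "\<not> (Im (e / f) = 0 \<and> 0 \<le> Re (e / f))"
  obtains \<delta> where "0 < \<delta>" "\<And>s u. 0 \<le> s \<Longrightarrow> 0 \<le> u \<Longrightarrow> \<delta> * s \<le> norm (of_real s * e - of_real u * f)"
proof -
  have f: "f \<noteq> 0" using assms by auto
  show ?thesis
  proof (cases "Im (e / f) = 0")
    case False
    have "norm f * \<bar>Im (e / f)\<bar> * s \<le> norm (of_real s * e - of_real u * f)" if "0 \<le> s" for s u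
    proof -
      have "\<bar>Im (e / f)\<bar> * s = \<bar>Im ((of_real s * e - of_real u * f) / f)\<bar>"
      proof -
        have "(of_real s * e - of_real u * f) / f = of_real s * (e / f) - of_real u"
          using f by (simp add: field_simps)
        then have "Im ((of_real s * e - of_real u * f) / f) = s * Im (e / f)"
          by (simp only: minus_complex.sel Im_complex_of_real times_complex.sel Re_complex_of_real)
        then show ?thesis using that by (simp add: abs_mult)
      qed
      also have "\<dots> \<le> norm ((of_real s * e - of_real u * f) / f)" by (rule abs_Im_le_cmod)
      finally show ?thesis using f by (simp add: norm_divide field_simps)
    qed
    then show ?thesis using that[of "norm f * \<bar>Im (e / f)\<bar>"] False f by auto
  next
    case True
    then have R: "Re (e / f) < 0" using assms by auto
    have "norm f * \<bar>Re (e / f)\<bar> * s \<le> norm (of_real s * e - of_real u * f)" if "0 \<le> s" "0 \<le> u" for s u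
    proof -
      have "(of_real s * e - of_real u * f) / f = of_real s * (e / f) - of_real u"
        using f by (simp add: field_simps)
      then have "Re ((of_real s * e - of_real u * f) / f) = s * Re (e / f) - u"
        by (simp only: minus_complex.sel Im_complex_of_real times_complex.sel Re_complex_of_real)
      moreover have "s * Re (e / f) \<le> 0" using that R by (simp add: mult_nonneg_nonpos)
      ultimately have "\<bar>Re (e / f)\<bar> * s \<le> \<bar>Re ((of_real s * e - of_real u * f) / f)\<bar>"
        using that R by (simp add: mult.commute)
      also have "\<dots> \<le> norm ((of_real s * e - of_real u * f) / f)" by (rule abs_Re_le_cmod)
      finally show ?thesis using f by (simp add: norm_divide field_simps)
    qed
    then show ?thesis using that[of "norm f * \<bar>Re (e / f)\<bar>"] R f by (auto simp: mult_pos_neg)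
  qed
qed

text \<open>Disjoint sides have a positive distance, and sides with a common vertex are parts of two
  different rays from this vertex.\<close>

lemma side_pair_separation:
  assumes P: "simple_polygon P" and kl: "k < length P" "l < length P" "k \<noteq> l"
  shows "\<exists>\<kappa>>0. \<forall>y\<in>side P k. \<forall>z\<in>side P l. \<kappa> * min (dist y (vertex P k)) (dist y (vertex P (Suc k))) \<le> dist y z"
proof (cases "side P k \<inter> side P l = {}")
  case True
  obtain d where d: "0 < d" "\<forall>y\<in>side P k. \<forall>z\<in>side P l. d \<le> dist y z"
    using separate_compact_closed[OF _ _ True] by (auto simp: side_def)
  have e: "edge P k \<noteq> 0" by (rule edge_nonzero[OF P])
  have "d / norm (edge P k) * min (dist y (vertex P k)) (dist y (vertex P (Suc k))) \<le> dist y z"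
    if y: "y \<in> side P k" and z: "z \<in> side P l" for y z
  proof -
    obtain s where "0 \<le> s" "s \<le> 1" "y = vertex P k + of_real s * edge P k" using y by (auto simp: side_iff)
    then have "dist y (vertex P k) \<le> norm (edge P k)"
      by (simp add: dist_norm norm_mult mult_left_le_one_le)
    then have "d * min (dist y (vertex P k)) (dist y (vertex P (Suc k))) \<le> d * norm (edge P k)"
      using d by (intro mult_left_mono) auto
    then have "d / norm (edge P k) * min (dist y (vertex P k)) (dist y (vertex P (Suc k))) \<le> d"
      using e by (simp add: field_simps)
    then show ?thesis using d y z by fastforce
  qed
  then show ?thesis using d e by (intro exI[of _ "d / norm (edge P k)"]) auto
next
  case False
  have len: "3 \<le> length P" by (rule simple_polygon_length[OF P])
  have d: "distinct P" "P \<noteq> []" using P len by (auto simp: simple_polygon_def)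
  note veq = vertex_eq_iff[OF d]
  have "vertex P k \<noteq> vertex P l" using kl by (simp add: veq)
  moreover have "vertex P (Suc k) \<noteq> vertex P (Suc l)" using kl
    by (auto simp: veq mod_Suc split: if_splits)
  moreover obtain x where "x \<in> side P k" "x \<in> side P l" using False by auto
  then have "x \<in> {vertex P k, vertex P (Suc k)} \<inter> {vertex P l, vertex P (Suc l)}"
    using sides_meet[OF P kl] by blast
  ultimately consider "vertex P (Suc k) = vertex P l" | "vertex P (Suc l) = vertex P k"
    by auto
  then show ?thesis
  proof cases
    case 1
    define a where "a = vertex P l"
    define e where "e = vertex P k - a"
    obtain \<delta> where \<delta>: "0 < \<delta>" "\<And>s u. 0 \<le> s \<Longrightarrow> 0 \<le> u \<Longrightarrow> \<delta> * s \<le> norm (of_real s * e - of_real u * edge P l)"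
      using distance_from_segment adjacent_sides(3)[OF P kl(1,2) 1] unfolding e_def a_def by blast
    have ek: "edge P k = - e" by (simp add: e_def a_def edge_def 1)
    have e0: "e \<noteq> 0" using edge_nonzero[OF P, of k] ek by auto
    have "\<delta> / norm e * min (dist y (vertex P k)) (dist y (vertex P (Suc k))) \<le> dist y z"
      if y: "y \<in> side P k" and z: "z \<in> side P l" for y z
    proof -
      obtain s where s: "0 \<le> s" "s \<le> 1" "y = vertex P k + of_real s * (- e)" using y by (auto simp: side_iff ek)
      obtain u where u: "0 \<le> u" "z = a + of_real u * edge P l" using z by (auto simp: side_iff a_def)
      have y': "y = a + of_real (1 - s) * e" using s by (simp add: e_def algebra_simps)
      have "\<delta> * (1 - s) \<le> dist y z" using \<delta>(2)[of "1 - s" u] s(1,2) u(1) unfolding u(2) y' dist_norm by simp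
      moreover have "min (dist y (vertex P k)) (dist y (vertex P (Suc k))) \<le> (1 - s) * norm e"
        using s(1,2) unfolding 1 y' a_def[symmetric] by (intro min.coboundedI2) (simp add: dist_norm norm_mult del: of_real_diff)
      then have "\<delta> / norm e * min (dist y (vertex P k)) (dist y (vertex P (Suc k))) \<le> \<delta> / norm e * ((1 - s) * norm e)"
        using \<delta> by (intro mult_left_mono) auto
      ultimately show ?thesis using e0 by simp
    qed
    then show ?thesis using \<delta> e0 by (intro exI[of _ "\<delta> / norm e"]) auto
  next
    case 2
    define a where "a = vertex P k"
    define e where "e = vertex P l - a"
    have el: "edge P l = - e" by (simp add: e_def a_def edge_def 2)
    have e0: "e \<noteq> 0" using edge_nonzero[OF P, of l] el by auto
    have k0: "edge P k \<noteq> 0" by (rule edge_nonzero[OF P])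
    have "\<not> (Im (e / edge P k) = 0 \<and> 0 \<le> Re (e / edge P k))"
      using adjacent_sides(3)[OF P kl(2,1) 2] unfolding e_def a_def .
    then have "\<not> (Im (edge P k / e) = 0 \<and> 0 \<le> Re (edge P k / e))"
      using e0 k0 by (auto simp: Im_divide Re_divide complex_neq_0 divide_le_0_iff zero_le_divide_iff mult.commute)
    then obtain \<delta> where \<delta>: "0 < \<delta>" "\<And>s u. 0 \<le> s \<Longrightarrow> 0 \<le> u \<Longrightarrow> \<delta> * s \<le> norm (of_real s * edge P k - of_real u * e)"
      using distance_from_segment by blast
    have "\<delta> / norm (edge P k) * min (dist y (vertex P k)) (dist y (vertex P (Suc k))) \<le> dist y z"
      if y: "y \<in> side P k" and z: "z \<in> side P l" for y z
    proof -
      obtain s where s: "0 \<le> s" "s \<le> 1" "y = a + of_real s * edge P k" using y by (auto simp: side_iff a_def)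
      obtain u where u: "u \<le> 1" "z = vertex P l + of_real u * (- e)" using z by (auto simp: side_iff el)
      have z': "z = a + of_real (1 - u) * e" using u by (simp add: e_def algebra_simps)
      have "\<delta> * s \<le> dist y z" using \<delta>(2)[of s "1 - u"] s u(1) unfolding z' s(3) dist_norm by simp
      moreover have "min (dist y (vertex P k)) (dist y (vertex P (Suc k))) \<le> s * norm (edge P k)"
        using s(1) unfolding s(3) a_def[symmetric] by (intro min.coboundedI1) (simp add: dist_norm norm_mult)
      then have "\<delta> / norm (edge P k) * min (dist y (vertex P k)) (dist y (vertex P (Suc k))) \<le> \<delta> / norm (edge P k) * (s * norm (edge P k))"
        using \<delta> by (intro mult_left_mono) auto
      ultimately show ?thesis using k0 by simp
    qed
    then show ?thesis using \<delta> k0 by (intro exI[of _ "\<delta> / norm (edge P k)"]) auto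
  qed
qed

text \<open>As \<open>\<kappa>\<close> depends on the polygon only, a disc around a point of a side meets no other side if
  its radius is a fixed fraction of the distance to the end points, at all scales.\<close>

lemma side_separation:
  assumes P: "simple_polygon P"
  shows "\<exists>\<kappa>>0. \<forall>k<length P. \<forall>l<length P. k \<noteq> l \<longrightarrow> (\<forall>y\<in>side P k. \<forall>z\<in>side P l.
    \<kappa> * min (dist y (vertex P k)) (dist y (vertex P (Suc k))) \<le> dist y z)"
proof -
  define I where "I = {(k, l). k < length P \<and> l < length P \<and> k \<noteq> l}"
  have "finite I" unfolding I_def by (rule finite_subset[of _ "{..<length P} \<times> {..<length P}"]) auto
  have "\<forall>(k, l)\<in>I. \<exists>\<kappa>>0. \<forall>y\<in>side P k. \<forall>z\<in>side P l. \<kappa> * min (dist y (vertex P k)) (dist y (vertex P (Suc k))) \<le> dist y z"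
    using side_pair_separation[OF P] by (auto simp: I_def)
  then obtain \<kappa> where \<kappa>: "\<And>k l. (k, l) \<in> I \<Longrightarrow> 0 < \<kappa> (k, l)"
    "\<And>k l y z. (k, l) \<in> I \<Longrightarrow> y \<in> side P k \<Longrightarrow> z \<in> side P l \<Longrightarrow>
      \<kappa> (k, l) * min (dist y (vertex P k)) (dist y (vertex P (Suc k))) \<le> dist y z"
    unfolding split_beta by (metis fst_conv snd_conv)
  define m where "m = Min (insert 1 (\<kappa> ` I))"
  have m: "0 < m" using \<open>finite I\<close> \<kappa>(1) by (auto simp: m_def)
  have "m * min (dist y (vertex P k)) (dist y (vertex P (Suc k))) \<le> dist y z"
    if "(k, l) \<in> I" "y \<in> side P k" "z \<in> side P l" for k l y z
  proof -
    have "m \<le> \<kappa> (k, l)" using \<open>finite I\<close> that by (auto simp: m_def)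
    then have "m * min (dist y (vertex P k)) (dist y (vertex P (Suc k))) \<le> \<kappa> (k, l) * min (dist y (vertex P k)) (dist y (vertex P (Suc k)))"
      by (intro mult_right_mono) auto
    also have "\<dots> \<le> dist y z" using \<kappa>(2)[OF that] .
    finally show ?thesis .
  qed
  then show ?thesis using m by (intro exI[of _ m]) (auto simp: I_def)
qed

text \<open>The times that a ray spends in a convex set form an interval.\<close>

lemma ray_eventually_convex:
  fixes x u :: complex
  assumes "convex S"
  shows "(\<forall>\<^sub>F h in at_right (0::real). x + of_real h * u \<in> S) \<or> (\<forall>\<^sub>F h in at_right (0::real). x + of_real h * u \<notin> S)"
proof (cases "\<forall>\<^sub>F h in at_right (0::real). x + of_real h * u \<notin> S")
  case False
  then have fr: "\<exists>h. 0 < h \<and> h < \<epsilon> \<and> x + of_real h * u \<in> S" if "0 < \<epsilon>" for \<epsilon>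
    using that unfolding eventually_at_right_field by (metis)
  obtain h1 where h1: "0 < h1" "x + of_real h1 * u \<in> S" using fr[of 1] by auto
  have "x + of_real h * u \<in> S" if h: "0 < h" "h < h1" for h
  proof -
    obtain h2 where h2: "0 < h2" "h2 < h" "x + of_real h2 * u \<in> S" using fr[OF h(1)] by auto
    define t where "t = (h - h2) / (h1 - h2)"
    have "t * (h1 - h2) = h - h2" using h h2 by (simp add: t_def)
    then have "h = (1 - t) * h2 + t * h1" by (simp add: algebra_simps)
    moreover have "0 \<le> t" "t \<le> 1" using h h2 by (auto simp: t_def)
    ultimately have t: "0 \<le> t" "t \<le> 1" "h = (1 - t) * h2 + t * h1" by auto
    have "x + of_real h * u = (1 - t) *\<^sub>R (x + of_real h2 * u) + t *\<^sub>R (x + of_real h1 * u)"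
      by (subst t(3)) (simp add: scaleR_conv_of_real algebra_simps)
    then show ?thesis using convexD_alt[OF assms h2(3) h1(2) t(1,2)] by simp
  qed
  then show ?thesis using h1(1) by (auto simp: eventually_at_right_field)
qed simp

text \<open>A ray cannot enter and leave the polygon infinitely often near its origin: either it starts
  along a side, or a first piece of it misses all sides and is connected.\<close>

lemma ray_eventually_region:
  assumes P: "simple_polygon P"
  shows "(\<forall>\<^sub>F h in at_right (0::real). x + of_real h * u \<in> region P) \<or> (\<forall>\<^sub>F h in at_right (0::real). x + of_real h * u \<notin> region P)"
proof (cases "\<exists>k<length P. \<forall>\<^sub>F h in at_right (0::real). x + of_real h * u \<in> side P k")
  case True
  then obtain k where k: "k < length P" "\<forall>\<^sub>F h in at_right (0::real). x + of_real h * u \<in> side P k" by auto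
  from k(2) have "\<forall>\<^sub>F h in at_right (0::real). x + of_real h * u \<in> region P"
    by eventually_elim (use k in \<open>auto simp: region_def boundary_def\<close>)
  then show ?thesis ..
next
  case False
  have "\<forall>\<^sub>F h in at_right (0::real). x + of_real h * u \<notin> side P k" if "k < length P" for k
    using ray_eventually_convex[of "side P k" x u] False that by (auto simp: side_def)
  then have "\<forall>\<^sub>F h in at_right (0::real). \<forall>k\<in>{..<length P}. x + of_real h * u \<notin> side P k"
    by (intro eventually_ball_finite) auto
  then obtain \<epsilon> where \<epsilon>: "0 < \<epsilon>" "\<And>h. 0 < h \<Longrightarrow> h < \<epsilon> \<Longrightarrow> x + of_real h * u \<notin> boundary P"
    unfolding eventually_at_right_field boundary_def by auto
  define S where "S = (\<lambda>h. x + of_real h * u) ` {0<..<\<epsilon>}"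
  have S: "connected S" unfolding S_def
    by (intro connected_continuous_image continuous_intros) auto
  have "S \<inter> frontier (inside (boundary P)) = {}"
    using \<epsilon> polygon_Jordan(3)[OF P] by (auto simp: S_def)
  then have "S \<subseteq> inside (boundary P) \<or> S \<inter> inside (boundary P) = {}"
    using connected_Int_frontier[OF S, of "inside (boundary P)"] by blast
  then have "(\<forall>h. 0 < h \<longrightarrow> h < \<epsilon> \<longrightarrow> x + of_real h * u \<in> region P) \<or> (\<forall>h. 0 < h \<longrightarrow> h < \<epsilon> \<longrightarrow> x + of_real h * u \<notin> region P)"
    using \<epsilon>(2) unfolding S_def region_def by (fastforce simp: image_subset_iff)
  then show ?thesis using \<epsilon>(1) unfolding eventually_at_right_field by blast
qed

section \<open>The surface as a quotient of polygons\<close>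

locale transl_surface =
  fixes X :: surface
  assumes translation_surface: "translation_surface X"
begin

abbreviation poly :: "nat \<Rightarrow> complex list" where "poly i \<equiv> polys X ! i"
abbreviation n_polys :: nat where "n_polys \<equiv> length (polys X)"

lemma simple: "i < n_polys \<Longrightarrow> simple_polygon (poly i)"
  and oriented: "i < n_polys \<Longrightarrow> positively_oriented (poly i)"
  and pairing: "side_pairing X"
  and connected_surface: "connected_space (surface_topology X)"
  and sing_nonempty: "sing X \<noteq> {}"
  and sing_vertex: "sing X \<subseteq> vertex_points X"
  and cone_angle_regular: "p \<in> vertex_points X \<Longrightarrow> p \<notin> sing X \<Longrightarrow> cone_angle X p = 2 * pi"
  using translation_surface unfolding translation_surface_def by auto

definition V :: "(nat \<times> complex) set" where
  "V = (\<lambda>(i, k). (i, vertex (poly i) k)) ` sides X"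

lemma finite_sides: "finite (sides X)"
proof -
  have "sides X \<subseteq> (SIGMA i:{..<n_polys}. {..<length (poly i)})" by (auto simp: sides_def)
  then show ?thesis by (rule finite_subset) auto
qed

lemma finite_V: "finite V"
  using finite_sides by (simp add: V_def)

lemma length_poly: "i < n_polys \<Longrightarrow> 3 \<le> length (poly i)"
  using simple simple_polygon_length by blast

lemma side_nonempty: "(i, k) \<in> sides X \<Longrightarrow> i < n_polys" "(i, k) \<in> sides X \<Longrightarrow> k < length (poly i)"
  by (auto simp: sides_def)

lemma mod_in_sides: "i < n_polys \<Longrightarrow> (i, k mod length (poly i)) \<in> sides X"
  using length_poly[of i] by (auto simp: sides_def intro!: mod_less_divisor)

lemma vertex_in_V: "i < n_polys \<Longrightarrow> (i, vertex (poly i) k) \<in> V"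
  unfolding V_def using mod_in_sides[of i k] by (force simp: vertex_mod intro!: image_eqI[of _ _ "(i, k mod length (poly i))"])

lemma side_subset_region: "k < length P \<Longrightarrow> side P k \<subseteq> region P"
  by (auto simp: region_def boundary_def)

lemma glue_sides:
  assumes "(i, k) \<in> sides X" "glue X (i, k) = (j, l)"
  shows "(j, l) \<in> sides X" "glue X (j, l) = (i, k)" "edge (poly j) l = - edge (poly i) k"
    "vertex (poly j) l = vertex (poly i) (Suc k) + (vertex (poly j) (Suc l) - vertex (poly i) k)"
proof -
  have "case glue X (i, k) of (j, l) \<Rightarrow>
        (j, l) \<in> sides X \<and> glue X (j, l) = (i, k) \<and> edge (poly j) l = - edge (poly i) k"
    using pairing assms(1) unfolding side_pairing_def by (elim allE[of _ i] allE[of _ k]) (rule mp)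
  then show "(j, l) \<in> sides X" "glue X (j, l) = (i, k)" and e: "edge (poly j) l = - edge (poly i) k"
    using assms(2) by auto
  from e show "vertex (poly j) l = vertex (poly i) (Suc k) + (vertex (poly j) (Suc l) - vertex (poly i) k)"
    by (simp add: edge_def algebra_simps)
qed

lemma glue_relE:
  assumes "((i, x), b) \<in> glue_rel X"
  obtains k j l where "(i, k) \<in> sides X" "glue X (i, k) = (j, l)" "x \<in> side (poly i) k"
    "b = (j, x + (vertex (poly j) (Suc l) - vertex (poly i) k))"
  using assms by (auto simp: glue_rel_def)

lemma glue_relI:
  assumes "(i, k) \<in> sides X" "glue X (i, k) = (j, l)" "x \<in> side (poly i) k"
  shows "((i, x), (j, x + (vertex (poly j) (Suc l) - vertex (poly i) k))) \<in> glue_rel X"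
  using assms by (auto simp: glue_rel_def)

lemma vertex_on_side:
  assumes "i < n_polys" "k < length (poly i)" "x \<in> side (poly i) k" "(i, x) \<in> V"
  shows "x = vertex (poly i) k \<or> x = vertex (poly i) (Suc k)"
proof -
  obtain m where m: "m < length (poly i)" "x = vertex (poly i) m"
    using assms(4) by (auto simp: V_def sides_def)
  then show ?thesis
    using sides_meet[OF simple[OF assms(1)] m(1) assms(2)] assms(3) vertex_in_side(1)[of "poly i" m]
    by (cases "m = k") auto
qed

lemma unique_side:
  assumes "i < n_polys" "k < length (poly i)" "l < length (poly i)" "x \<in> side (poly i) k" "x \<in> side (poly i) l"
    "(i, x) \<notin> V"
  shows "k = l"
proof (rule ccontr)
  assume "k \<noteq> l"
  then have "x \<in> {vertex (poly i) k, vertex (poly i) (Suc k)}"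
    using sides_meet[OF simple[OF assms(1)] assms(2,3)] assms(4,5) by blast
  then show False using vertex_in_V[OF assms(1)] assms(6) by blast
qed

lemma glue_rel_vertex: "(a, b) \<in> glue_rel X \<Longrightarrow> a \<in> V \<Longrightarrow> b \<in> V"
proof -
  assume g: "(a, b) \<in> glue_rel X" and a: "a \<in> V"
  obtain i x where ax: "a = (i, x)" by (cases a)
  obtain k j l where kl: "(i, k) \<in> sides X" "glue X (i, k) = (j, l)" "x \<in> side (poly i) k"
    and b: "b = (j, x + (vertex (poly j) (Suc l) - vertex (poly i) k))"
    using glue_relE[OF g[unfolded ax]] .
  have "x = vertex (poly i) k \<or> x = vertex (poly i) (Suc k)"
    using vertex_on_side[of i k x] kl a ax side_nonempty[OF kl(1)] by auto
  moreover have "j < n_polys" using glue_sides(1)[OF kl(1,2)] side_nonempty by blast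
  ultimately show "b \<in> V"
    using vertex_in_V[of j] glue_sides(4)[OF kl(1,2)] b by (metis add_diff_cancel_left' add.commute diff_add_cancel)
qed

lemma glue_rel_vertex_iff: "(a, b) \<in> glue_rel X \<Longrightarrow> a \<in> V \<longleftrightarrow> b \<in> V"
  using glue_rel_vertex glue_rel_sym(1)[OF pairing] by blast

lemma glue_rel_unique:
  assumes "(a, b) \<in> glue_rel X" "(a, c) \<in> glue_rel X" "a \<notin> V"
  shows "b = c"
proof -
  obtain i x where ax: "a = (i, x)" by (cases a)
  from assms(1)[unfolded ax] obtain k j l where kl: "(i, k) \<in> sides X" "glue X (i, k) = (j, l)" "x \<in> side (poly i) k"
    and b: "b = (j, x + (vertex (poly j) (Suc l) - vertex (poly i) k))" by (rule glue_relE)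
  from assms(2)[unfolded ax] obtain k' j' l' where kl': "(i, k') \<in> sides X" "glue X (i, k') = (j', l')" "x \<in> side (poly i) k'"
    and c: "c = (j', x + (vertex (poly j') (Suc l') - vertex (poly i) k'))" by (rule glue_relE)
  have "k = k'"
    using unique_side[of i k k' x] kl kl' assms(3) ax side_nonempty by blast
  then show ?thesis using b c kl(2) kl'(2) by simp
qed

text \<open>A point which is not a vertex lies on at most one side, so that a chain of identifications
  merely goes back and forth between this point and one other. Vertices are only glued to
  vertices.\<close>

lemma same_point_cases:
  assumes "(a, b) \<in> same_point X"
  shows "a = b \<or> (a, b) \<in> glue_rel X \<or> a \<in> V \<and> b \<in> V"
proof -
  have "(a, b) \<in> (glue_rel X)\<^sup>*" using assms by (simp add: same_point_def)
  then show ?thesis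
  proof induction
    case (step b c)
    show ?case
    proof (cases "b \<in> V")
      case True
      then show ?thesis using step glue_rel_vertex_iff by blast
    next
      case False
      then show ?thesis using step glue_rel_unique[of b a c] glue_rel_sym(1)[OF pairing, of a b] by blast
    qed
  qed simp
qed

lemma equiv: "equiv (disjoint_polys X) (same_point X)"
  by (rule equiv_same_point[OF pairing])

lemma rep_in: "p \<in> points X \<Longrightarrow> (i, x) \<in> p \<Longrightarrow> i < n_polys \<and> x \<in> region (poly i)"
proof -
  assume p: "p \<in> points X" and x: "(i, x) \<in> p"
  obtain a where a: "a \<in> disjoint_polys X" "p = same_point X `` {a}" using p by (auto simp: points_def quotient_def)
  then have "(a, (i, x)) \<in> same_point X" using x by auto
  then have "(i, x) \<in> disjoint_polys X" using equiv by (auto simp: equiv_def)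
  then show ?thesis by (simp add: disjoint_polys_def)
qed

lemma pt_self: "i < n_polys \<Longrightarrow> x \<in> region (poly i) \<Longrightarrow> (i, x) \<in> pt X i x"
  unfolding pt_def using equiv by (auto simp: disjoint_polys_def equiv_def refl_on_def)

lemma rep_pt: "p \<in> points X \<Longrightarrow> (i, x) \<in> p \<Longrightarrow> pt X i x = p"
  unfolding pt_def points_def
  using equiv by (metis equiv_class_eq Image_singleton_iff quotientE)

lemma points_eqI: "p \<in> points X \<Longrightarrow> q \<in> points X \<Longrightarrow> a \<in> p \<Longrightarrow> a \<in> q \<Longrightarrow> p = q"
  using rep_pt by (metis surj_pair)

lemma same_point_iff: "p \<in> points X \<Longrightarrow> a \<in> p \<Longrightarrow> (a, b) \<in> same_point X \<longleftrightarrow> b \<in> p"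
  using rep_pt[of p "fst a" "snd a"] by (auto simp: pt_def)

lemma same_point_sym: "(a, b) \<in> same_point X \<Longrightarrow> (b, a) \<in> same_point X"
  using equiv by (auto simp: equiv_def dest: symD)

lemma ex_rep: "p \<in> points X \<Longrightarrow> \<exists>i x. (i, x) \<in> p"
  using equiv by (metis points_def quotientE equiv_class_self surj_pair)

lemma pointsE:
  assumes "p \<in> points X"
  obtains i x where "i < n_polys" "x \<in> region (poly i)" "p = pt X i x" "(i, x) \<in> p"
  using assms ex_rep rep_in rep_pt by metis

lemma finite_glue_image: "finite (glue_rel X `` {a})"
proof -
  obtain i x where a: "a = (i, x)" by (cases a)
  have "glue_rel X `` {a} \<subseteq> (\<lambda>(i', k). case glue X (i', k) of (j, l) \<Rightarrow>
      (j, x + (vertex (poly j) (Suc l) - vertex (poly i) k))) ` sides X"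
    unfolding a by (auto simp: glue_rel_def intro!: image_eqI)
  then show ?thesis using finite_sides finite_subset by blast
qed

lemma finite_point: "p \<in> points X \<Longrightarrow> finite p"
proof -
  assume p: "p \<in> points X"
  obtain i x where x: "(i, x) \<in> p" using ex_rep[OF p] by blast
  have "p \<subseteq> insert (i, x) (glue_rel X `` {(i, x)} \<union> V)"
    using same_point_cases[of "(i, x)"] same_point_iff[OF p x] by fastforce
  then show ?thesis using finite_V finite_glue_image by (meson finite_Un finite_insert finite_subset)
qed

lemma interior_point: "i < n_polys \<Longrightarrow> x \<in> inside (boundary (poly i)) \<Longrightarrow> pt X i x = {(i, x)}"
proof -
  assume i: "i < n_polys" and x: "x \<in> inside (boundary (poly i))"
  have xb: "x \<notin> side (poly i) k" if "k < length (poly i)" for k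
    using x that inside_region[of x "poly i"] by (auto simp: boundary_def)
  have r: "x \<in> region (poly i)" using x by (simp add: region_def)
  have "(i, x) \<notin> V" using xb vertex_in_side(1) by (auto simp: V_def sides_def)
  moreover have "((i, x), b) \<notin> glue_rel X" for b
    using xb by (auto simp: glue_rel_def sides_def)
  ultimately have "b = (i, x)" if "b \<in> pt X i x" for b
    using same_point_cases[of "(i, x)" b] that by (auto simp: pt_def)
  then have "pt X i x \<subseteq> {(i, x)}" by blast
  moreover have "{(i, x)} \<subseteq> pt X i x" using pt_self[OF i r] by blast
  ultimately show ?thesis by (rule subset_antisym)
qed

lemma sing_in_V: "p \<in> sing X \<Longrightarrow> p \<subseteq> V"
proof
  fix b assume p: "p \<in> sing X" and b: "b \<in> p"
  obtain i k where ik: "(i, k) \<in> sides X" "p = pt X i (vertex (poly i) k)"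
    using sing_vertex p by (auto simp: vertex_points_def)
  have a: "(i, vertex (poly i) k) \<in> V" using ik side_nonempty vertex_in_V by blast
  then have "((i, vertex (poly i) k), b) \<in> same_point X" using b ik by (simp add: pt_def)
  then show "b \<in> V" using same_point_cases a glue_rel_vertex_iff by blast
qed

lemma sing_points: "sing X \<subseteq> points X"
proof
  fix p assume "p \<in> sing X"
  then obtain i k where ik: "(i, k) \<in> sides X" "p = pt X i (vertex (poly i) k)"
    using sing_vertex by (auto simp: vertex_points_def)
  then show "p \<in> points X"
    using side_nonempty[OF ik(1)] vertex_in_side(1)[of "poly i" k] side_subset_region pt_in_points by blast
qed

text \<open>The identification is the union of the diagonal, of finitely many translations of segments and
  of finitely many pairs of vertices, each of which is compact. This is the Hausdorff property of the
  surface in the coordinates of the polygons.\<close>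

lemma closed_same_point: "closed {(x, y). ((i, x), (j, y)) \<in> same_point X}"
proof -
  let ?A = "(\<lambda>x. (x, x)) ` (if i = j \<and> i < n_polys then region (poly i) else {})"
  let ?K = "{k. (i, k) \<in> sides X \<and> fst (glue X (i, k)) = j}"
  let ?B = "\<Union>k\<in>?K.
      (\<lambda>x. (x, x + (vertex (poly j) (Suc (snd (glue X (i, k)))) - vertex (poly i) k))) ` side (poly i) k"
  let ?C = "{(x, y). ((i, x), (j, y)) \<in> same_point X \<and> (i, x) \<in> V \<and> (j, y) \<in> V}"
  have "compact ?A" by (auto intro!: compact_continuous_image continuous_intros compact_region)
  moreover have "finite ?K" by (rule finite_subset[of _ "snd ` sides X"]) (use finite_sides in force)+
  then have "compact ?B"
    by (intro compact_UN) (auto simp: side_def intro!: compact_continuous_image continuous_intros)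
  moreover have "finite ?C"
    by (rule finite_subset[of _ "snd ` V \<times> snd ` V"]) (use finite_V in force)+
  then have "compact ?C" by (rule finite_imp_compact)
  moreover have "{(x, y). ((i, x), (j, y)) \<in> same_point X} = ?A \<union> ?B \<union> ?C"
  proof (intro set_eqI iffI)
    fix q assume "q \<in> {(x, y). ((i, x), (j, y)) \<in> same_point X}"
    then obtain x y where q: "q = (x, y)" and s: "((i, x), (j, y)) \<in> same_point X" by auto
    have "i < n_polys" "x \<in> region (poly i)" using s by (auto simp: same_point_def disjoint_polys_def)
    consider "(i, x) = (j, y)" | "((i, x), (j, y)) \<in> glue_rel X" | "(i, x) \<in> V \<and> (j, y) \<in> V"
      using same_point_cases[OF s] by blast
    then show "q \<in> ?A \<union> ?B \<union> ?C"
    proof cases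
      case 2
      then show ?thesis
      proof (rule glue_relE)
        fix k j' l assume kl: "(i, k) \<in> sides X" "glue X (i, k) = (j', l)" "x \<in> side (poly i) k"
          "(j, y) = (j', x + (vertex (poly j') (Suc l) - vertex (poly i) k))"
        then have "q \<in> ?B" unfolding q by (intro UN_I[of k]) auto
        then show ?thesis by blast
      qed
    qed (use \<open>i < n_polys\<close> \<open>x \<in> region (poly i)\<close> s q in auto)
  next
    fix q assume "q \<in> ?A \<union> ?B \<union> ?C"
    then consider "q \<in> ?A" | "q \<in> ?B" | "q \<in> ?C" by blast
    then show "q \<in> {(x, y). ((i, x), (j, y)) \<in> same_point X}"
    proof cases
      case 1
      then show ?thesis by (auto simp: same_point_def disjoint_polys_def split: if_splits)
    next
      case 2
      then obtain k l x where k: "(i, k) \<in> sides X" "glue X (i, k) = (j, l)" "x \<in> side (poly i) k"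
        "q = (x, x + (vertex (poly j) (Suc l) - vertex (poly i) k))"
        by (auto simp: prod_eq_iff)
      then have "(i, x) \<in> disjoint_polys X"
        using side_nonempty[OF k(1)] side_subset_region by (auto simp: disjoint_polys_def)
      then show ?thesis using glue_relI[OF k(1-3)] k(4) by (auto simp: same_point_def)
    qed auto
  qed
  ultimately show ?thesis by (simp add: compact_imp_closed closed_Un)
qed

end

section \<open>Translation charts\<close>

text \<open>The inverse of a chart of the flat structure outside \<open>\<Sigma>\<close>, except that it need not be injective.
  It is a translation in the coordinates of each polygon, and the polygons that meet at \<open>\<psi> z\<close> have to
  fill a whole neighbourhood.\<close>

definition chart :: "surface \<Rightarrow> complex set \<Rightarrow> (complex \<Rightarrow> (nat \<times> complex) set) \<Rightarrow> bool" where
  "chart X U \<psi> \<longleftrightarrow> open U \<and> (\<forall>z\<in>U. \<psi> z \<in> points X - sing X \<and>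
     (\<forall>(i, x)\<in>\<psi> z. \<forall>\<^sub>F w in nhds 0. x + w \<in> region (polys X ! i) \<longrightarrow> (i, x + w) \<in> \<psi> (z + w)) \<and>
     (\<forall>\<^sub>F w in nhds 0. \<exists>(i, x)\<in>\<psi> z. x + w \<in> region (polys X ! i)))"

context transl_surface
begin

text \<open>A neighbourhood of \<open>p\<close> made up of the polygons that meet at \<open>p\<close>, each cut down to radius \<open>\<rho>\<close> and
  glued to the others by translations that match the representatives of \<open>p\<close>. It replaces the disc of a
  chart at points of \<open>\<Sigma>\<close>, where it is a cone.\<close>

definition tame :: "real \<Rightarrow> (nat \<times> complex) set \<Rightarrow> bool" where
  "tame \<rho> p \<longleftrightarrow> (\<forall>i x z i' x'. (i, x) \<in> p \<longrightarrow> norm z < \<rho> \<longrightarrow> x + z \<in> region (poly i) \<longrightarrow>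
     (i', x') \<in> pt X i (x + z) \<longrightarrow> (i', x' - z) \<in> p)"

text \<open>A chain of identifications at \<open>x + z\<close> may be moved back by \<open>z\<close>, because every side in it
  passes within \<open>\<rho>\<close> of a representative of \<open>p\<close> and therefore contains this representative.\<close>

lemma tameI:
  assumes p: "p \<in> points X"
    and away: "\<And>i x k. (i, x) \<in> p \<Longrightarrow> k < length (poly i) \<Longrightarrow> x \<notin> side (poly i) k \<Longrightarrow> ball x \<rho> \<inter> side (poly i) k = {}"
  shows "tame \<rho> p"
  unfolding tame_def
proof (intro allI impI)
  fix i x z i' x'
  assume x: "(i, x) \<in> p" and z: "norm z < \<rho>" and xz: "x + z \<in> region (poly i)" and x': "(i', x') \<in> pt X i (x + z)"
  have "((i, x + z), (i', x')) \<in> (glue_rel X)\<^sup>*" using x' by (simp add: pt_def same_point_def)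
  then have "(fst (i', x'), snd (i', x') - z) \<in> p"
  proof induction
    case base
    then show ?case using x by simp
  next
    case (step b c)
    obtain i1 x1 where b: "b = (i1, x1)" by (cases b)
    from step(2)[unfolded b] obtain k j l where kl: "(i1, k) \<in> sides X" "glue X (i1, k) = (j, l)" "x1 \<in> side (poly i1) k"
      and c: "c = (j, x1 + (vertex (poly j) (Suc l) - vertex (poly i1) k))" by (rule glue_relE)
    have IH: "(i1, x1 - z) \<in> p" using step(3) b by simp
    have "x1 \<in> ball (x1 - z) \<rho>" using z by (simp add: dist_norm)
    then have "x1 - z \<in> side (poly i1) k" using away[OF IH side_nonempty(2)[OF kl(1)]] kl(3) by blast
    from glue_relI[OF kl(1,2) this]
    have "((i1, x1 - z), (fst c, snd c - z)) \<in> glue_rel X" by (simp add: c algebra_simps)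
    moreover have "(i1, x1 - z) \<in> disjoint_polys X" using rep_in[OF p IH] by (simp add: disjoint_polys_def)
    ultimately have "((i1, x1 - z), (fst c, snd c - z)) \<in> same_point X" by (auto simp: same_point_def)
    then show ?case using same_point_iff[OF p IH] by blast
  qed
  then show "(i', x' - z) \<in> p" by simp
qed

lemma eventually_ball_away:
  assumes "x \<notin> side P k"
  shows "\<forall>\<^sub>F \<rho> in at_right (0::real). ball x \<rho> \<inter> side P k = {}"
proof -
  have "open (- side P k)" by (simp add: side_def open_Compl)
  then obtain e where e: "0 < e" "ball x e \<subseteq> - side P k" using assms by (meson ComplI openE)
  have "\<forall>\<^sub>F \<rho> in at_right (0::real). \<rho> < e" using e(1) by (simp add: eventually_at_right_field) blast
  then show ?thesis by eventually_elim (use e in force)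
qed

lemma eventually_tame:
  assumes p: "p \<in> points X"
  shows "\<forall>\<^sub>F \<rho> in at_right (0::real). tame \<rho> p"
proof -
  have "\<forall>\<^sub>F \<rho> in at_right (0::real). \<forall>a\<in>p. \<forall>k\<in>{..<length (poly (fst a))}.
     snd a \<notin> side (poly (fst a)) k \<longrightarrow> ball (snd a) \<rho> \<inter> side (poly (fst a)) k = {}"
    by (intro eventually_ball_finite finite_point[OF p] ballI) (auto simp: eventually_ball_away)
  then show ?thesis by eventually_elim (force intro!: tameI[OF p])
qed

lemma eventually_no_vertex:
  assumes p: "p \<in> points X"
  shows "\<forall>\<^sub>F \<rho> in at_right (0::real). \<forall>(i, x)\<in>p. \<forall>z. 0 < norm z \<and> norm z < \<rho> \<longrightarrow> (i, x + z) \<notin> V"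
proof -
  have "\<forall>\<^sub>F \<rho> in at_right (0::real). \<forall>a\<in>p. \<forall>b\<in>V. snd a = snd b \<or> \<rho> < dist (snd a) (snd b)"
  proof (intro eventually_ball_finite finite_point[OF p] finite_V ballI)
    fix a b :: "nat \<times> complex"
    show "\<forall>\<^sub>F \<rho> in at_right (0::real). snd a = snd b \<or> \<rho> < dist (snd a) (snd b)"
      by (cases "snd a = snd b") (auto simp: eventually_at_right_field intro!: exI[of _ "dist (snd a) (snd b)"])
  qed
  then show ?thesis by eventually_elim (force simp: dist_norm)
qed

text \<open>If the polygons at \<open>p\<close>, moved to the origin, cover the disc of radius \<open>\<rho>\<close> and are glued
  wherever they overlap, then any choice of a polygon for each \<open>z\<close> defines a chart. This covers
  sides and regular vertices alike.\<close>

lemma chart_at: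
  assumes p: "p \<in> points X" and \<rho>: "0 < \<rho>" and tame: "tame \<rho> p"
    and cover: "\<And>z. norm z < \<rho> \<Longrightarrow> \<exists>(i, x)\<in>p. x + z \<in> region (poly i)"
    and agree: "\<And>z i x j y. norm z < \<rho> \<Longrightarrow> (i, x) \<in> p \<Longrightarrow> (j, y) \<in> p \<Longrightarrow> x + z \<in> region (poly i) \<Longrightarrow>
      y + z \<in> region (poly j) \<Longrightarrow> ((i, x + z), (j, y + z)) \<in> same_point X"
    and nonsing: "\<And>z i x. norm z < \<rho> \<Longrightarrow> (i, x) \<in> p \<Longrightarrow> x + z \<in> region (poly i) \<Longrightarrow> pt X i (x + z) \<notin> sing X"
  shows "\<exists>\<psi>. chart X (ball 0 \<rho>) \<psi> \<and> \<psi> 0 = p \<and>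
    (\<forall>z i x. norm z < \<rho> \<longrightarrow> (i, x) \<in> p \<longrightarrow> x + z \<in> region (poly i) \<longrightarrow> (i, x + z) \<in> \<psi> z)"
proof -
  define f where "f z = (SOME a. a \<in> p \<and> snd a + z \<in> region (poly (fst a)))" for z
  define \<psi> where "\<psi> z = pt X (fst (f z)) (snd (f z) + z)" for z
  have f: "f z \<in> p \<and> snd (f z) + z \<in> region (poly (fst (f z)))" if "norm z < \<rho>" for z
    unfolding f_def by (rule someI_ex) (use cover[OF that] in force)
  have pts: "\<psi> z \<in> points X - sing X" if z: "norm z < \<rho>" for z
    using f[OF z] rep_in[OF p, of "fst (f z)" "snd (f z)"] nonsing[OF z, of "fst (f z)" "snd (f z)"]
    by (simp add: \<psi>_def pt_in_points)
  have mem: "(i, x + z) \<in> \<psi> z" if z: "norm z < \<rho>" and x: "(i, x) \<in> p" "x + z \<in> region (poly i)" for z i x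
    using agree[OF z, of "fst (f z)" "snd (f z)" i x] f[OF z] x by (simp add: \<psi>_def pt_def)
  have rep_back: "(i, x - z) \<in> p" if z: "norm z < \<rho>" and x: "(i, x) \<in> \<psi> z" for z i x
    using tame f[OF z] z x unfolding tame_def \<psi>_def by (metis prod.collapse)
  have small: "\<forall>\<^sub>F w in nhds 0. norm (z + w) < \<rho>" if "norm z < \<rho>" for z :: complex
  proof -
    have "((\<lambda>w. norm (z + w)) \<longlongrightarrow> norm (z + 0)) (nhds 0)" by (intro tendsto_intros) (simp add: filterlim_ident)
    then show ?thesis by (rule order_tendstoD) (use that in simp)
  qed
  have "chart X (ball 0 \<rho>) \<psi>"
    unfolding chart_def
  proof (intro conjI ballI)
    fix z :: complex assume "z \<in> ball 0 \<rho>"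
    then have z: "norm z < \<rho>" by simp
    show "\<psi> z \<in> points X - sing X" by (rule pts[OF z])
    show "case a of (i, x) \<Rightarrow> \<forall>\<^sub>F w in nhds 0. x + w \<in> region (poly i) \<longrightarrow> (i, x + w) \<in> \<psi> (z + w)"
      if a: "a \<in> \<psi> z" for a
    proof -
      obtain i x where ix: "a = (i, x)" by (cases a)
      have b: "(i, x - z) \<in> p" using rep_back[OF z] a ix by simp
      have "\<forall>\<^sub>F w in nhds 0. x + w \<in> region (poly i) \<longrightarrow> (i, x + w) \<in> \<psi> (z + w)"
        using small[OF z] 
      proof eventually_elim
        case (elim w)
        then show ?case using mem[OF elim b] by (auto simp: algebra_simps)
      qed
      then show ?thesis by (simp add: ix)
    qed
    have "\<forall>\<^sub>F w in nhds 0. \<forall>a\<in>p. snd a + z \<notin> region (poly (fst a)) \<longrightarrow> snd a + z + w \<notin> region (poly (fst a))"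
    proof (intro eventually_ball_finite finite_point[OF p] ballI)
      fix a assume "a \<in> p"
      show "\<forall>\<^sub>F w in nhds 0. snd a + z \<notin> region (poly (fst a)) \<longrightarrow> snd a + z + w \<notin> region (poly (fst a))"
      proof (cases "snd a + z \<in> region (poly (fst a))")
        case False
        have "((\<lambda>w. snd a + z + w) \<longlongrightarrow> snd a + z + 0) (nhds 0)" by (intro tendsto_intros) (simp add: filterlim_ident)
        moreover have "open (- region (poly (fst a)))" using compact_region compact_imp_closed by blast
        ultimately have "\<forall>\<^sub>F w in nhds 0. snd a + z + w \<in> - region (poly (fst a))"
          using False by (intro topological_tendstoD) auto
        then show ?thesis by eventually_elim simp
      qed simp
    qed
    with small[OF z] show "\<forall>\<^sub>F w in nhds 0. \<exists>(i, x)\<in>\<psi> z. x + w \<in> region (poly i)"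
    proof eventually_elim
      case (elim w)
      obtain i x where x: "(i, x) \<in> p" "x + (z + w) \<in> region (poly i)" using cover[OF elim(1)] by auto
      then have "x + z \<in> region (poly i)" using elim(2) by (force simp: algebra_simps)
      then have "(i, x + z) \<in> \<psi> z" using mem[OF z] x by simp
      then show ?case using x by (auto simp: algebra_simps intro!: bexI[of _ "(i, x + z)"])
    qed
  qed simp
  moreover have "\<psi> 0 = p"
    using f[of 0] \<rho> rep_pt[OF p, of "fst (f 0)" "snd (f 0)"] by (simp add: \<psi>_def)
  ultimately show ?thesis using mem by blast
qed

lemma chart_interior:
  assumes i: "i < n_polys"
  shows "chart X {z. x + z \<in> inside (boundary (poly i))} (\<lambda>z. pt X i (x + z))"
proof -
  let ?I = "inside (boundary (poly i))"
  have op: "open {z. x + z \<in> ?I}"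
  proof -
    have "open ((\<lambda>z. x + z) -` ?I)"
      by (intro open_vimage polygon_Jordan(1)[OF simple[OF i]] continuous_intros)
    then show ?thesis by (simp add: vimage_def)
  qed
  have ev: "\<forall>\<^sub>F w in nhds 0. x + (z + w) \<in> ?I" if "x + z \<in> ?I" for z
  proof -
    have "((\<lambda>w. x + (z + w)) \<longlongrightarrow> x + (z + 0)) (nhds 0)" by (intro tendsto_intros) (simp add: filterlim_ident)
    then show ?thesis using polygon_Jordan(1)[OF simple[OF i]] that by (intro topological_tendstoD) auto
  qed
  show ?thesis
    unfolding chart_def
  proof (intro conjI ballI op)
    fix z assume "z \<in> {z. x + z \<in> ?I}"
    then have z: "x + z \<in> ?I" by simp
    then have "x + z \<in> region (poly i)" by (simp add: region_def)
    moreover have "(i, x + z) \<notin> V"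
    proof
      assume "(i, x + z) \<in> V"
      then obtain m where "m < length (poly i)" "x + z = vertex (poly i) m" by (auto simp: V_def sides_def)
      then have "x + z \<in> boundary (poly i)" using vertex_in_side(1)[of "poly i" m] by (auto simp: boundary_def)
      then show False using z inside_region by blast
    qed
    ultimately show "pt X i (x + z) \<in> points X - sing X"
      using pt_in_points[OF i] sing_in_V pt_self[OF i] by blast
    show "case a of (i', y) \<Rightarrow> \<forall>\<^sub>F w in nhds 0. y + w \<in> region (poly i') \<longrightarrow> (i', y + w) \<in> pt X i (x + (z + w))"
      if a: "a \<in> pt X i (x + z)" for a
    proof -
      have "a = (i, x + z)" using a interior_point[OF i z] by simp
      moreover have "\<forall>\<^sub>F w in nhds 0. x + z + w \<in> region (poly i) \<longrightarrow> (i, x + z + w) \<in> pt X i (x + (z + w))"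
        using pt_self[OF i] by (auto simp: add.assoc)
      ultimately show ?thesis by simp
    qed
    show "\<forall>\<^sub>F w in nhds 0. \<exists>(i', y)\<in>pt X i (x + z). y + w \<in> region (poly i')"
      unfolding interior_point[OF i z] using ev[OF z] by eventually_elim (simp add: region_def add.assoc)
  qed
qed

lemma chart_subset: "chart X U \<psi> \<Longrightarrow> open U' \<Longrightarrow> U' \<subseteq> U \<Longrightarrow> chart X U' \<psi>"
  unfolding chart_def by blast

lemma chart_shift: "chart X U \<psi> \<Longrightarrow> chart X {z. a + z \<in> U} (\<lambda>z. \<psi> (a + z))"
proof -
  assume c: "chart X U \<psi>"
  then have op: "open ((\<lambda>z. a + z) -` U)"
    unfolding chart_def by (intro open_vimage continuous_intros) auto
  show ?thesis unfolding chart_def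
  proof (intro conjI ballI)
    show "open {z. a + z \<in> U}" using op by (simp add: vimage_def)
    fix z assume "z \<in> {z. a + z \<in> U}"
    then have z: "a + z \<in> U" by simp
    show "\<psi> (a + z) \<in> points X - sing X" "\<forall>\<^sub>F w in nhds 0. \<exists>(i, x)\<in>\<psi> (a + z). x + w \<in> region (poly i)"
      "\<And>b. b \<in> \<psi> (a + z) \<Longrightarrow> case b of (i, x) \<Rightarrow>
         \<forall>\<^sub>F w in nhds 0. x + w \<in> region (poly i) \<longrightarrow> (i, x + w) \<in> \<psi> (a + (z + w))"
      using c z unfolding chart_def add.assoc[symmetric] by blast+
  qed
qed

text \<open>The two half discs on either side of a pair of glued sides form a disc.\<close>

lemma chart_side:
  assumes ik: "(i, k) \<in> sides X" and g: "glue X (i, k) = (j, l)" and x: "x \<in> side (poly i) k" and \<rho>: "0 < \<rho>"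
    and y: "y = x + (vertex (poly j) (Suc l) - vertex (poly i) k)"
    and ax: "\<And>m. m < length (poly i) \<Longrightarrow> m \<noteq> k \<Longrightarrow> ball x \<rho> \<inter> side (poly i) m = {}"
    and ay: "\<And>m. m < length (poly j) \<Longrightarrow> m \<noteq> l \<Longrightarrow> ball y \<rho> \<inter> side (poly j) m = {}"
  shows "\<exists>\<psi>. chart X (ball 0 \<rho>) \<psi> \<and> \<psi> 0 = pt X i x \<and>
    (\<forall>z i' x'. norm z < \<rho> \<longrightarrow> (i', x') \<in> pt X i x \<longrightarrow> x' + z \<in> region (poly i') \<longrightarrow> (i', x' + z) \<in> \<psi> z)"
proof -
  have i: "i < n_polys" "k < length (poly i)" using side_nonempty[OF ik] by auto
  note G = glue_sides[OF ik g]
  have j: "j < n_polys" "l < length (poly j)" using side_nonempty[OF G(1)] by auto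
  have noV: "(i', x' + w) \<notin> V" if "i' < n_polys" "k' < length (poly i')"
    and aw: "\<And>m. m < length (poly i') \<Longrightarrow> m \<noteq> k' \<Longrightarrow> ball x' \<rho> \<inter> side (poly i') m = {}" and w: "norm w < \<rho>" for i' k' x' w
  proof
    assume "(i', x' + w) \<in> V"
    then obtain m where m: "m < length (poly i')" "x' + w = vertex (poly i') m" by (auto simp: V_def sides_def)
    have b: "x' + w \<in> ball x' \<rho>" using w by (simp add: dist_norm)
    note ps = previous_side[OF simple[OF that(1)] m(1)]
    let ?m' = "(m + length (poly i') - 1) mod length (poly i')"
    have "x' + w \<in> side (poly i') m" "x' + w \<in> side (poly i') ?m'"
      using vertex_in_side[of "poly i'" m] vertex_in_side(2)[of "poly i'" ?m'] m ps(2) by auto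
    moreover have "?m' \<noteq> m" using ps(4) m(1) length_poly[OF that(1)] by (auto simp: mod_Suc split: if_splits)
    ultimately show False using aw[of m] aw[of ?m'] b m(1) ps(1) by blast
  qed
  have xV: "(i, x) \<notin> V" using noV[OF i ax, of 0] \<rho> by simp
  have xr: "x \<in> region (poly i)" using x side_subset_region i(2) by blast
  have xy: "((i, x), (j, y)) \<in> glue_rel X" using glue_relI[OF ik g x] y by simp
  let ?p = "pt X i x"
  have p: "?p \<in> points X" by (rule pt_in_points[OF i(1) xr])
  have peq: "?p = {(i, x), (j, y)}"
  proof (intro set_eqI iffI)
    fix b assume "b \<in> ?p"
    then have "((i, x), b) \<in> same_point X" by (simp add: pt_def)
    then show "b \<in> {(i, x), (j, y)}" using same_point_cases xV glue_rel_unique[OF xy _ xV] by blast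
  next
    fix b assume "b \<in> {(i, x), (j, y)}"
    moreover have "((i, x), (j, y)) \<in> same_point X"
      using xy xr i by (auto simp: same_point_def disjoint_polys_def)
    ultimately show "b \<in> ?p" using pt_self[OF i(1) xr] by (auto simp: pt_def)
  qed
  have y': "y \<in> side (poly j) l" using glue_rel_sym(1)[OF pairing xy]
  proof (rule glue_relE)
    fix k' j' l' assume a: "(j, k') \<in> sides X" "glue X (j, k') = (j', l')" "y \<in> side (poly j) k'"
    have "y \<in> ball y \<rho>" using \<rho> by simp
    then have "k' = l" using ay[of k'] a side_nonempty by blast
    then show ?thesis using a by simp
  qed
  let ?e = "edge (poly i) k"
  note hx = half_disc[OF simple[OF i(1)] oriented[OF i(1)] i(2) x \<rho> ax]
  have hy: "y + w \<in> region (poly j) \<longleftrightarrow> Im (w / ?e) \<le> 0" if "norm w < \<rho>" for w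
    using half_disc(2)[OF simple[OF j(1)] oriented[OF j(1)] j(2) y' \<rho> ay that] unfolding G(3) by simp
  have glued: "((i, x + z), (j, y + z)) \<in> same_point X"
    if z: "norm z < \<rho>" "x + z \<in> region (poly i)" "y + z \<in> region (poly j)" for z
  proof -
    have "x + z \<in> side (poly i) k" using hx(1)[OF _ _ z(1)] hx(2)[OF _ _ z(1)] hy[OF z(1)] z by auto
    from glue_relI[OF ik g this] show ?thesis
      using z(2) i by (auto simp: same_point_def disjoint_polys_def y algebra_simps)
  qed
  show ?thesis
  proof (rule chart_at[OF p \<rho>])
    show "tame \<rho> ?p"
    proof (rule tameI[OF p])
      fix i' x' m assume "(i', x') \<in> ?p" "m < length (poly i')" "x' \<notin> side (poly i') m"
      then show "ball x' \<rho> \<inter> side (poly i') m = {}"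
        unfolding peq using ax[of m] ay[of m] x y' by auto
    qed
    show "\<exists>(i, x)\<in>?p. x + z \<in> region (poly i)" if "norm z < \<rho>" for z
      unfolding peq using hx(2)[OF _ _ that] hy[OF that] by auto
    show "((i', x' + z), (j', y' + z)) \<in> same_point X"
      if z: "norm z < \<rho>" and m: "(i', x') \<in> ?p" "(j', y') \<in> ?p" "x' + z \<in> region (poly i')" "y' + z \<in> region (poly j')"
      for z i' x' j' y'
    proof -
      have "((i', x' + z), (i', x' + z)) \<in> same_point X"
        using m rep_in[OF p m(1)] by (auto simp: same_point_def disjoint_polys_def)
      then show ?thesis using m glued[OF z] same_point_sym[OF glued[OF z]] unfolding peq by auto
    qed
    show "pt X i' (x' + z) \<notin> sing X" if z: "norm z < \<rho>" and m: "(i', x') \<in> ?p" "x' + z \<in> region (poly i')" for z i' x'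
    proof -
      have "(i', x' + z) \<notin> V" using m noV[OF i ax z] noV[OF j ay z] unfolding peq by auto
      then show ?thesis using sing_in_V pt_self m rep_in[OF p m(1)] by blast
    qed
  qed
qed

lemma uniform_side_separation:
  "\<exists>\<kappa>>0. \<forall>i<n_polys. \<forall>k<length (poly i). \<forall>l<length (poly i). k \<noteq> l \<longrightarrow>
     (\<forall>y\<in>side (poly i) k. \<forall>z\<in>side (poly i) l.
        \<kappa> * min (dist y (vertex (poly i) k)) (dist y (vertex (poly i) (Suc k))) \<le> dist y z)"
proof -
  let ?Q = "\<lambda>i \<kappa>. \<forall>k<length (poly i). \<forall>l<length (poly i). k \<noteq> l \<longrightarrow>
     (\<forall>y\<in>side (poly i) k. \<forall>z\<in>side (poly i) l.
        \<kappa> * min (dist y (vertex (poly i) k)) (dist y (vertex (poly i) (Suc k))) \<le> dist y z)"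
  have "\<forall>\<^sub>F \<kappa> in at_right (0::real). \<forall>i\<in>{..<n_polys}. ?Q i \<kappa>"
  proof (intro eventually_ball_finite ballI)
    fix i assume "i \<in> {..<n_polys}"
    then obtain \<kappa>0 where k0: "\<kappa>0 > 0" "?Q i \<kappa>0" using side_separation[OF simple] by (meson lessThan_iff)
    have "?Q i \<kappa>" if k: "\<kappa> < \<kappa>0" for \<kappa>
    proof (intro allI impI ballI)
      fix k l y z assume "k < length (poly i)" "l < length (poly i)" "k \<noteq> l" "y \<in> side (poly i) k" "z \<in> side (poly i) l"
      then have "\<kappa>0 * min (dist y (vertex (poly i) k)) (dist y (vertex (poly i) (Suc k))) \<le> dist y z"
        using k0(2) by blast
      moreover have "\<kappa> * min (dist y (vertex (poly i) k)) (dist y (vertex (poly i) (Suc k)))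
          \<le> \<kappa>0 * min (dist y (vertex (poly i) k)) (dist y (vertex (poly i) (Suc k)))"
        using k by (intro mult_right_mono) auto
      ultimately show "\<kappa> * min (dist y (vertex (poly i) k)) (dist y (vertex (poly i) (Suc k))) \<le> dist y z" by linarith
    qed
    then show "\<forall>\<^sub>F \<kappa> in at_right (0::real). ?Q i \<kappa>"
      unfolding eventually_at_right_field using k0(1) by blast
  qed simp
  then have "\<forall>\<^sub>F \<kappa> in at_right (0::real). (\<forall>i\<in>{..<n_polys}. ?Q i \<kappa>) \<and> 0 < \<kappa>"
    by (intro eventually_conj) (auto simp: eventually_at_right_less)
  from eventually_happens'[OF trivial_limit_at_right_real this] show ?thesis by auto
qed

text \<open>A disc that misses the boundary of the polygon is a chart. Otherwise it comes close to a
  point \<open>y\<close> of a side, which is still far from the vertices, so that the disc of twice the radius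
  around \<open>y\<close> meets no other side and is a chart. That \<open>K\<close> does not depend on \<open>c\<close> is what later
  turns bounds for the distance to the vertices into bounds for the radius of charts.\<close>

lemma chart_away_from_vertices:
  "\<exists>K>1. \<forall>c>0. \<forall>i<n_polys. \<forall>x\<in>region (poly i). (\<forall>k<length (poly i). K * c \<le> dist x (vertex (poly i) k)) \<longrightarrow>
     (\<exists>\<psi>. chart X (ball 0 c) \<psi> \<and> \<psi> 0 = pt X i x)"
proof -
  obtain \<kappa> where \<kappa>: "\<kappa> > 0" "\<And>i k l y z. i < n_polys \<Longrightarrow> k < length (poly i) \<Longrightarrow> l < length (poly i) \<Longrightarrow> k \<noteq> l \<Longrightarrow>
     y\<in>side (poly i) k \<Longrightarrow> z\<in>side (poly i) l \<Longrightarrow>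
        \<kappa> * min (dist y (vertex (poly i) k)) (dist y (vertex (poly i) (Suc k))) \<le> dist y z"
    using uniform_side_separation by metis
  \<comment> \<open>moving from \<open>x\<close> to \<open>y\<close> costs one \<open>c\<close>; the rest, multiplied by \<open>\<kappa>\<close>, gives the radius \<open>2 * c\<close>\<close>
  define K where "K = 1 + 2 / \<kappa>"
  have K: "K > 1" "\<kappa> * (K - 1) = 2" using \<kappa>(1) by (auto simp: K_def)
  have "\<exists>\<psi>. chart X (ball 0 c) \<psi> \<and> \<psi> 0 = pt X i x"
    if c: "0 < c" and i: "i < n_polys" and x: "x \<in> region (poly i)"
      and far: "\<forall>k<length (poly i). K * c \<le> dist x (vertex (poly i) k)" for c i x
  proof (cases "ball x c \<inter> boundary (poly i) = {}")
    case True
    have "x \<in> ball x c" using c by simp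
    then have "x \<in> inside (boundary (poly i))" using True x unfolding region_def by blast
    then have "ball x c \<subseteq> inside (boundary (poly i))"
      using connected_Int_frontier[of "ball x c" "inside (boundary (poly i))"] True \<open>x \<in> ball x c\<close>
        polygon_Jordan(3)[OF simple[OF i]] connected_ball by blast
    then have "ball 0 c \<subseteq> {z. x + z \<in> inside (boundary (poly i))}" by (force simp: subset_iff dist_norm)
    from chart_subset[OF chart_interior[OF i] _ this] show ?thesis by (intro exI[of _ "\<lambda>z. pt X i (x + z)"]) auto
  next
    case False
    then obtain y k where k: "k < length (poly i)" and y: "y \<in> side (poly i) k" "dist x y < c"
      by (auto simp: boundary_def)
    have far': "(K - 1) * c \<le> dist y (vertex (poly i) m)" for m
    proof -
      have "m mod length (poly i) < length (poly i)" using length_poly[OF i] by (intro mod_less_divisor) linarith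
      then have "K * c \<le> dist x (vertex (poly i) m)" using far vertex_mod[of "poly i" m] by metis
      then show ?thesis using y(2) dist_triangle[of x "vertex (poly i) m" y] by (simp add: algebra_simps)
    qed
    have ik: "(i, k) \<in> sides X" using i k by (simp add: sides_def)
    obtain j l where jl: "glue X (i, k) = (j, l)" by (cases "glue X (i, k)")
    note G = glue_sides[OF ik jl]
    define y' where "y' = y + (vertex (poly j) (Suc l) - vertex (poly i) k)"
    have y': "y' \<in> side (poly j) l"
    proof -
      obtain s where s: "0 \<le> s" "s \<le> 1" "y = vertex (poly i) k + of_real s * edge (poly i) k"
        using y by (auto simp: side_iff)
      have "y' = vertex (poly j) l + of_real (1 - s) * edge (poly j) l"
        unfolding y'_def s(3) G(3) G(4) by (simp add: edge_def algebra_simps)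
      then show ?thesis unfolding side_iff using s by (intro exI[of _ "1 - s"]) auto
    qed
    have d': "dist y' (vertex (poly j) (Suc l)) = dist y (vertex (poly i) k)"
      "dist y' (vertex (poly j) l) = dist y (vertex (poly i) (Suc k))"
      unfolding y'_def G(4) dist_norm by (auto simp: algebra_simps)
    have main: "ball z (2 * c) \<inter> side (poly i') m = {}"
      if "(i', k') \<in> sides X" "z \<in> side (poly i') k'" "m < length (poly i')" "m \<noteq> k'"
        "(K - 1) * c \<le> dist z (vertex (poly i') k')" "(K - 1) * c \<le> dist z (vertex (poly i') (Suc k'))" for z i' k' m
    proof -
      have "2 * c \<le> dist z u" if u: "u \<in> side (poly i') m" for u
      proof -
        have "2 * c = \<kappa> * ((K - 1) * c)" using K(2) by (simp add: mult.assoc[symmetric])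
        also have "\<dots> \<le> \<kappa> * min (dist z (vertex (poly i') k')) (dist z (vertex (poly i') (Suc k')))"
          using \<open>(K - 1) * c \<le> dist z (vertex (poly i') k')\<close> \<open>(K - 1) * c \<le> dist z (vertex (poly i') (Suc k'))\<close> \<kappa>(1)
          by (intro mult_left_mono) auto
        also have "\<dots> \<le> dist z u"
          using \<kappa>(2)[of i' k' m z u] side_nonempty[OF \<open>(i', k') \<in> sides X\<close>] \<open>z \<in> side (poly i') k'\<close>
            \<open>m < length (poly i')\<close> \<open>m \<noteq> k'\<close> u by auto
        finally show ?thesis .
      qed
      then show ?thesis by force
    qed
    have "\<exists>\<psi>. chart X (ball 0 (2 * c)) \<psi> \<and> \<psi> 0 = pt X i y \<and>
    (\<forall>z i' x'. norm z < 2 * c \<longrightarrow> (i', x') \<in> pt X i y \<longrightarrow> x' + z \<in> region (poly i') \<longrightarrow> (i', x' + z) \<in> \<psi> z)"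
      using main[OF ik y(1)] main[OF G(1) y'] far' d' c
      by (intro chart_side[OF ik jl y(1) _ y'_def]) auto
    then obtain \<psi> where \<psi>: "chart X (ball 0 (2 * c)) \<psi>"
      "\<And>z i' x'. norm z < 2 * c \<Longrightarrow> (i', x') \<in> pt X i y \<Longrightarrow> x' + z \<in> region (poly i') \<Longrightarrow> (i', x' + z) \<in> \<psi> z"
      by blast
    define \<psi>' where "\<psi>' z = \<psi> ((x - y) + z)" for z
    have "norm ((x - y) + z) < 2 * c" if "norm z < c" for z
      using y(2) that norm_triangle_ineq[of "x - y" z] by (simp add: dist_norm)
    then have "ball 0 c \<subseteq> {z. (x - y) + z \<in> ball 0 (2 * c)}" by auto
    then have ch: "chart X (ball 0 c) \<psi>'"
      unfolding \<psi>'_def using chart_subset[OF chart_shift[OF \<psi>(1), of "x - y"]] by blast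
    have yr: "y \<in> region (poly i)" using y(1) k side_subset_region by blast
    have "(i, x) \<in> \<psi>' 0"
      using \<psi>(2)[of "x - y" i y] y(2) c pt_self[OF i yr] x by (simp add: \<psi>'_def dist_norm)
    moreover have "\<psi>' 0 \<in> points X" using ch c by (auto simp: chart_def)
    ultimately have "\<psi>' 0 = pt X i x" using rep_pt by simp
    then show ?thesis using ch by blast
  qed
  then show ?thesis using K(1) by blast
qed


section \<open>Regular vertices\<close>

text \<open>The pair \<open>(i, k)\<close> stands for the corner of the polygon \<open>i\<close> at its vertex \<open>k\<close>. The next corner in
  clockwise direction around the same point of the surface lies across the side \<open>k\<close>, which leaves
  that vertex.\<close>

definition turn :: "nat \<times> nat \<Rightarrow> nat \<times> nat" where
  "turn c = (case glue X c of (j, l) \<Rightarrow> (j, Suc l mod length (poly j)))"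

abbreviation vtx :: "nat \<times> nat \<Rightarrow> complex" where "vtx c \<equiv> vertex (poly (fst c)) (snd c)"
abbreviation edg :: "nat \<times> nat \<Rightarrow> complex" where "edg c \<equiv> edge (poly (fst c)) (snd c)"
abbreviation ang :: "nat \<times> nat \<Rightarrow> real" where "ang c \<equiv> interior_angle (poly (fst c)) (snd c)"

lemma turn_sides: "c \<in> sides X \<Longrightarrow> turn c \<in> sides X"
  using glue_sides(1)[of "fst c" "snd c"] mod_in_sides side_nonempty
  by (cases "glue X c") (auto simp: turn_def)

lemma turn_inj:
  assumes "c \<in> sides X" "d \<in> sides X" "turn c = turn d"
  shows "c = d"
proof -
  obtain j l where jl: "glue X c = (j, l)" by (cases "glue X c")
  obtain j' l' where jl': "glue X d = (j', l')" by (cases "glue X d")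
  note g = glue_sides[of "fst c" "snd c" j l, simplified, OF assms(1) jl]
  note g' = glue_sides[of "fst d" "snd d" j' l', simplified, OF assms(2) jl']
  have "j = j'" "Suc l mod length (poly j) = Suc l' mod length (poly j)"
    using assms(3) jl jl' by (auto simp: turn_def)
  moreover have "l < length (poly j)" "l' < length (poly j)"
    using side_nonempty(2)[OF g(1)] side_nonempty(2)[OF g'(1)] \<open>j = j'\<close> by auto
  ultimately have "l = l'" by (auto simp: mod_Suc split: if_splits)
  then show ?thesis using g(2) g'(2) \<open>j = j'\<close> by simp
qed

lemma turn_glue:
  assumes "c \<in> sides X" "vtx c + w \<in> side (poly (fst c)) (snd c)"
  shows "((fst c, vtx c + w), (fst (turn c), vtx (turn c) + w)) \<in> glue_rel X"
proof -
  obtain j l where jl: "glue X c = (j, l)" by (cases "glue X c")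
  have "vtx (turn c) = vertex (poly j) (Suc l)" by (simp add: turn_def jl vertex_mod)
  then show ?thesis
    using glue_relI[of "fst c" "snd c" j l, simplified, OF assms(1) jl assms(2)]
    by (simp add: turn_def jl algebra_simps)
qed

text \<open>The side that two consecutive corners share is outgoing for the first and incoming for the
  second. This is how their interior angles add up.\<close>

lemma turn_previous:
  assumes "c \<in> sides X"
  shows "vertex (poly (fst (turn c))) (snd (turn c) + length (poly (fst (turn c))) - 1) - vtx (turn c) = edg c"
proof -
  obtain j l where jl: "glue X c = (j, l)" by (cases "glue X c")
  note g = glue_sides[of "fst c" "snd c" j l, simplified, OF assms jl]
  have t: "turn c = (j, Suc l mod length (poly j))" by (simp add: turn_def jl)
  have j: "j < n_polys" "l < length (poly j)" using side_nonempty[OF g(1)] by auto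
  note ps = previous_side[OF simple[OF j(1)], of "Suc l mod length (poly j)"]
  have m: "Suc l mod length (poly j) < length (poly j)" using j(2) by (intro mod_less_divisor) linarith
  have "Suc ((Suc l mod length (poly j) + length (poly j) - 1) mod length (poly j)) mod length (poly j) = Suc l mod length (poly j)"
    using ps(4)[OF m] .
  moreover have "(Suc l mod length (poly j) + length (poly j) - 1) mod length (poly j) < length (poly j)"
    using ps(1)[OF m] .
  ultimately have "(Suc l mod length (poly j) + length (poly j) - 1) mod length (poly j) = l"
    using j(2) by (auto simp: mod_Suc split: if_splits)
  then have "vertex (poly j) (Suc l mod length (poly j) + length (poly j) - 1) = vertex (poly j) l"
    using ps(3)[OF m] by metis
  then show ?thesis using g(3) by (simp add: t vertex_mod edge_def algebra_simps)
qed

lemma corner_unique: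
  assumes "c \<in> sides X" "d \<in> sides X" "fst c = fst d" "vtx c = vtx d"
  shows "c = d"
proof -
  have c: "fst c < n_polys" "snd c < length (poly (fst c))" "snd d < length (poly (fst c))"
    using assms(1-3) by (auto simp: sides_def)
  have "distinct (poly (fst c))" "poly (fst c) \<noteq> []" using simple[OF c(1)] c(2) by (auto simp: simple_polygon_def)
  then have "snd c = snd d" using vertex_eq_iff[of "poly (fst c)" "snd c" "snd d"] assms(3,4) c by simp
  then show ?thesis using assms(3) by (simp add: prod_eq_iff)
qed

text \<open>Each identification of a vertex across a side is a clockwise or an anticlockwise turn,
  according to which end of the side the vertex is.\<close>

lemma vertex_reach:
  assumes c: "c \<in> sides X" and b: "((fst c, vtx c), b) \<in> same_point X"
  shows "\<exists>d\<in>sides X. b = (fst d, vtx d) \<and> (c, d) \<in> ({(c, turn c) |c. c \<in> sides X} \<union> {(turn c, c) |c. c \<in> sides X})\<^sup>*"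
proof -
  let ?T = "{(c, turn c) |c. c \<in> sides X} \<union> {(turn c, c) |c. c \<in> sides X}"
  have "((fst c, vtx c), b) \<in> (glue_rel X)\<^sup>*" using b by (simp add: same_point_def)
  then show ?thesis
  proof induction
    case base
    then show ?case using c by blast
  next
    case (step a b)
    then obtain d where d: "d \<in> sides X" "a = (fst d, vtx d)" "(c, d) \<in> ?T\<^sup>*" by blast
    from step(2)[unfolded d(2)] obtain k j l where kl: "(fst d, k) \<in> sides X" "glue X (fst d, k) = (j, l)"
      "vtx d \<in> side (poly (fst d)) k" and b: "b = (j, vtx d + (vertex (poly j) (Suc l) - vertex (poly (fst d)) k))"
      by (rule glue_relE)
    have fd: "fst d < n_polys" "snd d < length (poly (fst d))" using d(1) by (auto simp: sides_def)
    note k = side_nonempty[OF kl(1)]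
    consider "vtx d = vertex (poly (fst d)) k" | "vtx d = vertex (poly (fst d)) (Suc k)"
      using vertex_on_side[OF k kl(3)] vertex_in_V[OF fd(1)] by blast
    then show ?case
    proof cases
      case 1
      then have "d = (fst d, k)" using corner_unique[OF d(1) kl(1)] by simp
      then have kd: "k = snd d" by (metis snd_conv)
      have "b = (fst (turn d), vtx (turn d))" using b kl(2) unfolding kd by (simp add: turn_def vertex_mod)
      moreover have "(c, turn d) \<in> ?T\<^sup>*" using d(3) by (rule rtrancl_into_rtrancl) (use d(1) in blast)
      ultimately show ?thesis using turn_sides[OF d(1)] by blast
    next
      case 2
      note g = glue_sides[OF kl(1,2)]
      have "turn (j, l) = (fst d, Suc k mod length (poly (fst d)))" using g(2) by (simp add: turn_def)
      then have td: "turn (j, l) = d"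
        using corner_unique[OF turn_sides[OF g(1)] d(1)] 2 by (simp add: vertex_mod)
      have "b = (j, vertex (poly j) l)" using b 2 g(4) by simp
      moreover have "(c, (j, l)) \<in> ?T\<^sup>*" using d(3) by (rule rtrancl_into_rtrancl) (use g(1) td in blast)
      ultimately show ?thesis using g(1) by (intro bexI[of _ "(j, l)"]) auto
    qed
  qed
qed

lemma turn_funpow_sides: "c \<in> sides X \<Longrightarrow> (turn ^^ m) c \<in> sides X"
  by (induction m) (auto simp: turn_sides)

lemma turn_funpow_cancel: "c \<in> sides X \<Longrightarrow> (turn ^^ (a + m)) c = (turn ^^ a) c \<Longrightarrow> (turn ^^ m) c = c"
proof (induction a)
  case (Suc a)
  then have "(turn ^^ (a + m)) c = (turn ^^ a) c"
    using turn_inj[of "(turn ^^ (a + m)) c" "(turn ^^ a) c"] turn_funpow_sides by simp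
  then show ?case using Suc by blast
qed simp

lemma turn_period:
  assumes c: "c \<in> sides X"
  obtains N where "0 < N" "(turn ^^ N) c = c" "\<And>a b. a < N \<Longrightarrow> b < N \<Longrightarrow> (turn ^^ a) c = (turn ^^ b) c \<Longrightarrow> a = b"
proof -
  have "\<not> inj (\<lambda>m. (turn ^^ m) c)"
    using finite_subset[OF _ finite_sides, of "range (\<lambda>m. (turn ^^ m) c)"] turn_funpow_sides[OF c]
      finite_imageD[of "\<lambda>m. (turn ^^ m) c" UNIV] by auto
  then obtain a b where ab: "a \<noteq> b" "(turn ^^ a) c = (turn ^^ b) c" by (auto simp: inj_def)
  have ex: "\<exists>m>0. (turn ^^ m) c = c"
  proof (cases "a < b")
    case True
    then show ?thesis using ab turn_funpow_cancel[OF c, of a "b - a"] by (intro exI[of _ "b - a"]) auto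
  next
    case False
    then show ?thesis using ab turn_funpow_cancel[OF c, of b "a - b"] by (intro exI[of _ "a - b"]) auto
  qed
  define N where "N = (LEAST m. 0 < m \<and> (turn ^^ m) c = c)"
  have N: "0 < N" "(turn ^^ N) c = c" using LeastI_ex[OF ex[unfolded Bex_def]] ex unfolding N_def
    by (metis (mono_tags, lifting) LeastI_ex)+
  have "a = b" if "a < N" "b < N" "(turn ^^ a) c = (turn ^^ b) c" "a \<le> b" for a b
  proof (rule ccontr)
    assume "a \<noteq> b"
    then have "0 < b - a" "(turn ^^ (b - a)) c = c" using that turn_funpow_cancel[OF c, of a "b - a"] by auto
    then have "N \<le> b - a" unfolding N_def by (intro Least_le) auto
    then show False using that by auto
  qed
  then have "a = b" if "a < N" "b < N" "(turn ^^ a) c = (turn ^^ b) c" for a b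
    using that by (metis linear)
  then show ?thesis using that N by blast
qed

text \<open>Turning permutes the finitely many corners. All corners at \<open>p\<close> belong to the same cycle of this
  permutation, so that the sum over the cycle is the cone angle.\<close>

lemma corners_tile:
  assumes p: "p \<in> vertex_points X" and c: "c \<in> sides X" "pt X (fst c) (vtx c) = p" and cone: "cone_angle X p = 2 * pi"
  obtains N where "0 < N" "(turn ^^ N) c = c"
    "\<And>i x. (i, x) \<in> p \<Longrightarrow> \<exists>m\<in>{1..N}. (i, x) = (fst ((turn ^^ m) c), vtx ((turn ^^ m) c))"
    "\<And>m. (fst ((turn ^^ m) c), vtx ((turn ^^ m) c)) \<in> p"
    "(\<Sum>m=1..N. ang ((turn ^^ m) c)) = 2 * pi"
proof -
  obtain N where N: "0 < N" "(turn ^^ N) c = c" and inj: "\<And>a b. a < N \<Longrightarrow> b < N \<Longrightarrow> (turn ^^ a) c = (turn ^^ b) c \<Longrightarrow> a = b"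
    using turn_period[OF c(1)] by blast
  have fc: "fst d < n_polys \<and> vtx d \<in> region (poly (fst d))" if "d \<in> sides X" for d
    using that vertex_in_side(1) side_subset_region by (fastforce simp: sides_def)
  have pp: "p \<in> points X" using c fc pt_in_points by metis
  have corner: "(fst d, vtx d) \<in> p \<longleftrightarrow> pt X (fst d) (vtx d) = p" if "d \<in> sides X" for d
    using fc[OF that] pt_self rep_pt[OF pp] by auto
  have turn_p: "(fst ((turn ^^ m) c), vtx ((turn ^^ m) c)) \<in> p" for m
  proof (induction m)
    case 0
    then show ?case using corner[OF c(1)] c(2) by simp
  next
    case (Suc m)
    let ?d = "(turn ^^ m) c"
    have d: "?d \<in> sides X" using turn_funpow_sides c(1) by blast
    have "((fst ?d, vtx ?d), (fst (turn ?d), vtx (turn ?d))) \<in> same_point X"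
      using turn_glue[OF d, of 0] vertex_in_side(1) fc[OF d] by (auto simp: same_point_def disjoint_polys_def)
    then show ?case using same_point_iff[OF pp Suc] by simp
  qed
  let ?O = "(\<lambda>m. (turn ^^ m) c) ` {1..N}"
  have c_O: "c \<in> ?O" using N by (auto intro!: image_eqI[of _ _ N])
  have turn_O: "turn d \<in> ?O" if dO: "d \<in> ?O" for d
  proof -
    obtain m where "d = (turn ^^ m) c" "m \<in> {1..N}" by (rule imageE[OF dO])
    then have m: "1 \<le> m" "m \<le> N" "d = (turn ^^ m) c" by auto
    show ?thesis
    proof (cases "m = N")
      case True
      then have "turn d = (turn ^^ 1) c" using m N by simp
      then show ?thesis using N(1) by (intro image_eqI[of _ _ 1]) auto
    next
      case False
      then show ?thesis using m by (intro image_eqI[of _ _ "Suc m"]) auto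
    qed
  qed
  have turn_O': "d \<in> ?O" if ds: "d \<in> sides X" "turn d \<in> ?O" for d
  proof -
    obtain m where "turn d = (turn ^^ m) c" "m \<in> {1..N}" by (rule imageE[OF ds(2)])
    then have m: "1 \<le> m" "m \<le> N" "turn d = (turn ^^ m) c" by auto
    then have "turn d = turn ((turn ^^ (m - 1)) c)" by (cases m) auto
    then have "d = (turn ^^ (m - 1)) c" using turn_inj ds(1) turn_funpow_sides c(1) by blast
    moreover have "(turn ^^ (m - 1)) c \<in> ?O" if "m \<noteq> 1"
      using that m by (intro imageI) auto
    ultimately show ?thesis using c_O by (cases "m = 1") (simp_all only: diff_self_eq_0 funpow_0, blast)
  qed
  have reach: "\<exists>d\<in>?O. (i, x) = (fst d, vtx d)" if "(i, x) \<in> p" for i x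
  proof -
    have "((fst c, vtx c), (i, x)) \<in> same_point X"
      using that c(2) corner[OF c(1)] same_point_iff[OF pp] by blast
    then obtain d where d: "d \<in> sides X" "(i, x) = (fst d, vtx d)"
      "(c, d) \<in> ({(c, turn c) |c. c \<in> sides X} \<union> {(turn c, c) |c. c \<in> sides X})\<^sup>*"
      using vertex_reach[OF c(1)] by blast
    from d(3) have "d \<in> ?O"
    proof induction
      case (step a b)
      then consider "a \<in> sides X" "b = turn a" | "b \<in> sides X" "a = turn b" by blast
      then show ?case
      proof cases
        case 1
        then show ?thesis using turn_O[OF step(3)] by (simp only:)
      next
        case 2
        then show ?thesis using turn_O'[of b] step(3) by (simp only:)
      qed
    qed (rule c_O)
    then show ?thesis using d(2) by blast
  qed
  have eq: "{(i, k) \<in> sides X. pt X i (vertex (poly i) k) = p} = ?O"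
  proof (intro set_eqI iffI)
    fix d assume "d \<in> {(i, k) \<in> sides X. pt X i (vertex (poly i) k) = p}"
    then have d: "d \<in> sides X" "pt X (fst d) (vtx d) = p" by auto
    then obtain d' where d': "d' \<in> ?O" "(fst d, vtx d) = (fst d', vtx d')" using reach corner by blast
    then have "d = d'" using corner_unique[OF d(1), of d'] turn_funpow_sides[OF c(1)] by auto
    then show "d \<in> ?O" using d' by simp
  next
    fix d assume "d \<in> ?O"
    then obtain m where m: "d = (turn ^^ m) c" by auto
    have "d \<in> sides X" using m turn_funpow_sides[OF c(1)] by simp
    then show "d \<in> {(i, k) \<in> sides X. pt X i (vertex (poly i) k) = p}"
      using corner turn_p[of m] m by (auto simp: split_beta)
  qed
  have "inj_on (\<lambda>m. (turn ^^ m) c) {1..N}"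
  proof (rule inj_onI)
    fix a b assume ab: "a \<in> {1..N}" "b \<in> {1..N}" "(turn ^^ a) c = (turn ^^ b) c"
    have "(turn ^^ (a - 1)) c = (turn ^^ (b - 1)) c"
      using turn_inj[of "(turn ^^ (a - 1)) c" "(turn ^^ (b - 1)) c"] turn_funpow_sides[OF c(1)] ab
      by (cases a; cases b) auto
    moreover have "a - 1 < N" "b - 1 < N" "0 < a" "0 < b" using ab N(1) by auto
    ultimately have "a - 1 = b - 1" using inj by blast
    then show "a = b" using \<open>0 < a\<close> \<open>0 < b\<close> by linarith
  qed
  then have "(\<Sum>m=1..N. ang ((turn ^^ m) c)) = sum ang ?O" by (simp add: sum.reindex)
  also have "\<dots> = 2 * pi" using cone unfolding cone_angle_def eq by (simp add: split_beta)
  finally show ?thesis using that[of N] N reach turn_p by blast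
qed

text \<open>Let \<open>A m\<close> be the sum of the first \<open>m\<close> angles. Measured from the outgoing side of the corner
  \<open>c 0\<close>, the corner \<open>c m\<close> occupies the directions between \<open>- A m\<close> and \<open>- A (m - 1)\<close>. Because of
  \<open>A N = 2 * pi\<close> these sectors cover a disc and overlap only along the rays between consecutive
  corners, the last and the first included; and there the corners are glued.\<close>

lemma chart_regular_vertex:
  assumes p: "p \<in> vertex_points X" "p \<notin> sing X"
  shows "\<exists>\<rho>>0. \<exists>\<psi>. chart X (ball 0 \<rho>) \<psi> \<and> \<psi> 0 = p"
proof -
  obtain c0 where c0: "c0 \<in> sides X" "pt X (fst c0) (vtx c0) = p"
    using p(1) by (auto simp: vertex_points_def)
  obtain N where N: "0 < N" "(turn ^^ N) c0 = c0"
    and reps: "\<And>i x. (i, x) \<in> p \<Longrightarrow> \<exists>m\<in>{1..N}. (i, x) = (fst ((turn ^^ m) c0), vtx ((turn ^^ m) c0))"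
    and reps': "\<And>m. (fst ((turn ^^ m) c0), vtx ((turn ^^ m) c0)) \<in> p"
    and total: "(\<Sum>m=1..N. ang ((turn ^^ m) c0)) = 2 * pi"
    using corners_tile[OF p(1) c0 cone_angle_regular[OF p]] by blast
  define c where "c m = (turn ^^ m) c0" for m
  have cs: "c m \<in> sides X" for m using turn_funpow_sides c0(1) by (simp add: c_def)
  have ci: "fst (c m) < n_polys" "snd (c m) < length (poly (fst (c m)))" for m using cs[of m] by (auto simp: sides_def)
  have cN: "c N = c 0" using N by (simp add: c_def)
  have pp: "p \<in> points X"
    using c0 ci[of 0] vertex_in_side(1) side_subset_region pt_in_points unfolding c_def by (metis funpow_0 subsetD)
  define E where "E m = edg (c m)" for m
  have E0: "E m \<noteq> 0" for m using edge_nonzero[OF simple[OF ci(1)]] by (simp add: E_def)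
  define A where "A m = (\<Sum>l=1..m. ang (c l))" for m
  have A0: "A 0 = 0" and AS: "A (Suc m) = A m + ang (c (Suc m))" for m by (simp_all add: A_def)
  have AN: "A N = 2 * pi" using total by (simp add: A_def c_def)
  have ang_eq: "ang (c (Suc m)) = Arg2pi (E m / E (Suc m))" for m
    using turn_previous[OF cs[of m]] unfolding interior_angle_def by (simp add: E_def edge_def c_def)
  define dir where "dir m = E m / of_real (norm (E m))" for m
  have ndir: "norm (dir m) = 1" for m using E0 by (simp add: dir_def norm_divide)
  have "dir m = dir (Suc m) * cis (ang (c (Suc m)))" for m
  proof -
    have "E m / E (Suc m) = of_real (norm (E m / E (Suc m))) * exp (\<i> * of_real (ang (c (Suc m))))"
      unfolding ang_eq by (rule Arg2pi_eq)
    then show ?thesis using E0[of m] E0[of "Suc m"] by (simp add: dir_def cis_conv_exp norm_divide field_simps)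
  qed
  then have dirS: "dir (Suc m) = dir m * cis (- ang (c (Suc m)))" for m
    by (metis (no_types, lifting) add.right_inverse cis_mult cis_zero mult.assoc mult.right_neutral)
  have dir: "dir m = dir 0 * cis (- A m)" for m
  proof (induction m)
    case (Suc m)
    show ?case unfolding dirS[of m] Suc AS by (simp add: mult.assoc cis_mult)
  qed (simp add: A0)
  define G where "G \<rho> \<longleftrightarrow> (\<forall>m\<in>{..N}. \<rho> \<le> norm (E m) \<and>
      \<rho> \<le> norm (vertex (poly (fst (c m))) (snd (c m) + length (poly (fst (c m))) - 1) - vtx (c m)) \<and>
      (\<forall>l\<in>{..<length (poly (fst (c m)))}. l \<noteq> snd (c m) \<and> Suc l mod length (poly (fst (c m))) \<noteq> snd (c m) \<longrightarrow>
         ball (vtx (c m)) \<rho> \<inter> side (poly (fst (c m))) l = {}))" for \<rho>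
  have "\<forall>\<^sub>F \<rho> in at_right (0::real). G \<rho>"
    unfolding G_def
  proof (intro eventually_ball_finite ballI eventually_conj)
    fix m
    have le: "\<forall>\<^sub>F \<rho> in at_right (0::real). \<rho> \<le> a" if "0 < a" for a
      using that by (auto simp: eventually_at_right_field)
    show "\<forall>\<^sub>F \<rho> in at_right (0::real). \<rho> \<le> norm (E m)" using E0 by (intro le) simp
    note ps = previous_side[OF simple[OF ci(1)] ci(2), of m]
    have "vertex (poly (fst (c m))) (snd (c m) + length (poly (fst (c m))) - 1) \<noteq> vtx (c m)"
      using edge_nonzero[OF simple[OF ci(1)], of m "(snd (c m) + length (poly (fst (c m))) - 1) mod length (poly (fst (c m)))"]
      unfolding edge_def ps(2,3) by auto
    then show "\<forall>\<^sub>F \<rho> in at_right (0::real). \<rho> \<le> norm (vertex (poly (fst (c m))) (snd (c m) + length (poly (fst (c m))) - 1) - vtx (c m))"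
      by (intro le) simp
  next
    fix m l assume l: "l \<in> {..<length (poly (fst (c m)))}"
    show "\<forall>\<^sub>F \<rho> in at_right (0::real). l \<noteq> snd (c m) \<and> Suc l mod length (poly (fst (c m))) \<noteq> snd (c m) \<longrightarrow>
         ball (vtx (c m)) \<rho> \<inter> side (poly (fst (c m))) l = {}"
    proof (cases "l \<noteq> snd (c m) \<and> Suc l mod length (poly (fst (c m))) \<noteq> snd (c m)")
      case True
      let ?P = "poly (fst (c m))"
      have d: "distinct ?P" "?P \<noteq> []" using simple[OF ci(1)[of m]] l by (auto simp: simple_polygon_def)
      have "vtx (c m) \<noteq> vertex ?P l" "vtx (c m) \<noteq> vertex ?P (Suc l)"
        using True l ci(2)[of m] by (auto simp: vertex_eq_iff[OF d])
      then have "vtx (c m) \<notin> side ?P l"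
        using vertex_on_side[OF ci(1)[of m], of l "vtx (c m)"] l vertex_in_V[OF ci(1)] by blast
      then show ?thesis using eventually_ball_away by simp
    qed auto
  qed auto
  moreover have "\<forall>\<^sub>F \<rho> in at_right (0::real). 0 < \<rho>" by (simp add: eventually_at_right_less)
  moreover note eventually_tame[OF pp] eventually_no_vertex[OF pp]
  ultimately have "\<forall>\<^sub>F \<rho> in at_right (0::real). G \<rho> \<and> 0 < \<rho> \<and> tame \<rho> p \<and>
      (\<forall>(i, x)\<in>p. \<forall>z. 0 < norm z \<and> norm z < \<rho> \<longrightarrow> (i, x + z) \<notin> V)"
    by eventually_elim auto
  then obtain \<rho> where "G \<rho>" and \<rho>: "0 < \<rho>" "tame \<rho> p"
      "\<forall>(i, x)\<in>p. \<forall>z. 0 < norm z \<and> norm z < \<rho> \<longrightarrow> (i, x + z) \<notin> V"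
    using eventually_happens'[OF trivial_limit_at_right_real] by blast
  then have \<rho>m: "\<forall>m\<in>{..N}. \<rho> \<le> norm (E m) \<and>
      \<rho> \<le> norm (vertex (poly (fst (c m))) (snd (c m) + length (poly (fst (c m))) - 1) - vtx (c m)) \<and>
      (\<forall>l\<in>{..<length (poly (fst (c m)))}. l \<noteq> snd (c m) \<and> Suc l mod length (poly (fst (c m))) \<noteq> snd (c m) \<longrightarrow>
         ball (vtx (c m)) \<rho> \<inter> side (poly (fst (c m))) l = {})" unfolding G_def by blast
  have sector: "0 < ang (c m)"
    "norm w < \<rho> \<Longrightarrow> vtx (c m) + w \<in> region (poly (fst (c m))) \<longleftrightarrow> Arg2pi (w / E m) \<le> ang (c m)"
    "norm w < \<rho> \<Longrightarrow> Arg2pi (w / E m) = 0 \<Longrightarrow> vtx (c m) + w \<in> side (poly (fst (c m))) (snd (c m))"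
    if "m \<le> N" for m w
    unfolding E_def
    using vertex_sector(1)[OF simple[OF ci(1)[of m]] oriented[OF ci(1)[of m]] ci(2)[of m] \<rho>(1)] vertex_sector(2,3)[OF simple[OF ci(1)[of m]] oriented[OF ci(1)[of m]] ci(2)[of m] \<rho>(1), where w = w] \<rho>m that
    by (auto simp: E_def)
  have Apos: "A m < A (Suc m)" if "m < N" for m using sector(1)[of "Suc m"] that by (simp add: AS)
  have Amono: "A a \<le> A b" if "a \<le> b" "b \<le> N" for a b
    using that
  proof (induction b)
    case (Suc b)
    then show ?case using Apos[of b] by (cases "a = Suc b") auto
  qed simp
  have Astrict: "A a < A b" if "a < b" "b \<le> N" for a b
    using Apos[of a] Amono[of "Suc a" b] that by linarith
  \<comment> \<open>angles measured clockwise from a common direction, and angles measured within the corner \<open>c m\<close>\<close>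
  have polar: "Arg2pi (w / E m) = \<phi> + A m" if "w = of_real (norm w) * dir 0 * cis \<phi>" "w \<noteq> 0" "0 \<le> \<phi> + A m" "\<phi> + A m < 2 * pi" for w m \<phi>
  proof (rule Arg2pi_unique)
    show "0 < norm w / norm (E m)" using that(2) E0 by simp
    have "dir 0 = dir m * cis (A m)" unfolding dir[of m] by (simp add: mult.assoc cis_mult)
    then have "w = of_real (norm w) * (E m / of_real (norm (E m))) * cis (\<phi> + A m)"
      by (subst that(1)) (simp add: dir_def cis_mult mult.assoc mult.left_commute add.commute)
    then have "w / E m = of_real (norm w) / of_real (norm (E m)) * cis (\<phi> + A m)"
      using E0[of m] by (metis (no_types, lifting) mult.commute nonzero_mult_div_cancel_left times_divide_eq_left times_divide_eq_right)
    then show "of_real (norm w / norm (E m)) * exp (\<i> * of_real (\<phi> + A m)) = w / E m"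
      by (simp add: cis_conv_exp)
  qed (use that in auto)
  have polar': "w = of_real (norm w) * dir 0 * cis (Arg2pi (w / E m) - A m)" for w m
  proof -
    have "w / E m = of_real (norm (w / E m)) * cis (Arg2pi (w / E m))"
      using Arg2pi_eq[of "w / E m"] by (simp add: cis_conv_exp)
    then have "w = of_real (norm w) * dir m * cis (Arg2pi (w / E m))"
      using E0[of m] by (simp add: dir_def norm_divide field_simps)
    then show ?thesis unfolding dir[of m] by (simp add: mult.assoc cis_mult)
  qed
  have next_glue: "((fst (c m), vtx (c m) + w), (fst (c (Suc m)), vtx (c (Suc m)) + w)) \<in> same_point X"
    if "m \<le> N" "norm w < \<rho>" "Arg2pi (w / E m) = 0" for m w
  proof -
    have s: "vtx (c m) + w \<in> side (poly (fst (c m))) (snd (c m))" using sector(3)[OF that(1) that(2,3)] .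
    then have "vtx (c m) + w \<in> region (poly (fst (c m)))" using side_subset_region ci(2) by blast
    then show ?thesis using turn_glue[OF cs s] ci(1)[of m] by (auto simp: same_point_def disjoint_polys_def c_def)
  qed
  have "\<exists>\<psi>. chart X (ball 0 \<rho>) \<psi> \<and> \<psi> 0 = p \<and>
    (\<forall>z i x. norm z < \<rho> \<longrightarrow> (i, x) \<in> p \<longrightarrow> x + z \<in> region (poly i) \<longrightarrow> (i, x + z) \<in> \<psi> z)"
  proof (rule chart_at[OF pp \<rho>(1,2)])
    fix z :: complex assume z: "norm z < \<rho>"
    show "\<exists>(i, x)\<in>p. x + z \<in> region (poly i)"
    proof (cases "z = 0")
      case True
      obtain i x where "(i, x) \<in> p" using ex_rep[OF pp] by blast
      then show ?thesis using rep_in[OF pp] True by force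
    next
      case False
      define t where "t = Arg2pi (z / dir 0)"
      have t: "0 \<le> t" "t < 2 * pi" using Arg2pi_ge_0 Arg2pi_lt_2pi by (auto simp: t_def)
      \<comment> \<open>the argument of \<open>z\<close> in \<open>(- 2 * pi, 0]\<close>, since the corners follow one another clockwise\<close>
      define \<phi> where "\<phi> = (if t = 0 then 0 else t - 2 * pi)"
      have cis_eq: "cis \<phi> = cis t" by (auto simp: \<phi>_def cis_divide[symmetric])
      have zd: "z / dir 0 = of_real (norm (z / dir 0)) * cis t"
        using Arg2pi_eq[of "z / dir 0"] by (simp add: t_def cis_conv_exp)
      then have zeq: "z = of_real (norm z) * dir 0 * cis \<phi>"
      proof -
        have "dir 0 \<noteq> 0" using ndir[of 0] by auto
        then show ?thesis using zd ndir[of 0] cis_eq by (simp add: norm_divide field_simps)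
      qed
      have \<phi>: "- 2 * pi < \<phi>" "\<phi> \<le> 0" using t by (auto simp: \<phi>_def)
      define m where "m = (LEAST m. - \<phi> \<le> A m)"
      have ex: "- \<phi> \<le> A N" using \<phi> AN by simp
      have m: "- \<phi> \<le> A m" "m \<le> N" unfolding m_def using LeastI[of "\<lambda>m. - \<phi> \<le> A m", OF ex] Least_le[of "\<lambda>m. - \<phi> \<le> A m", OF ex] by auto
      obtain m' where m': "m' \<ge> 1" "m' \<le> N" "- \<phi> \<le> A m'" "A (m' - 1) \<le> - \<phi>"
      proof (cases "m = 0")
        case True
        then have "\<phi> = 0" using m(1) \<phi> by (simp add: A0)
        then show ?thesis using that[of 1] N(1) A0 Amono[of 0 1] by simp
      next
        case False
        then have "\<not> - \<phi> \<le> A (m - 1)" unfolding m_def by (intro not_less_Least) simp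
        then show ?thesis using that[of m] False m by simp
      qed
      have "A m' = A (m' - 1) + ang (c m')" using AS[of "m' - 1"] m'(1) by simp
      moreover have "ang (c m') < 2 * pi" by (simp add: interior_angle_def Arg2pi_lt_2pi)
      ultimately have "Arg2pi (z / E m') = \<phi> + A m'" "\<phi> + A m' \<le> ang (c m')"
        using polar[OF zeq False, of m'] m' by auto
      then have "vtx (c m') + z \<in> region (poly (fst (c m')))" using sector(2)[OF m'(2) z] by simp
      moreover have "(fst (c m'), vtx (c m')) \<in> p" using reps' by (simp add: c_def)
      ultimately show ?thesis by blast
    qed
    show "pt X i (x + z) \<notin> sing X" if "(i, x) \<in> p" "x + z \<in> region (poly i)" for i x
    proof (cases "z = 0")
      case True
      then show ?thesis using rep_pt[OF pp that(1)] p(2) by simp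
    next
      case False
      then have "(i, x + z) \<notin> V" using \<rho>(3) that(1) z by auto
      then show ?thesis using sing_in_V pt_self that rep_in[OF pp that(1)] by blast
    qed
    fix i x j y assume x: "(i, x) \<in> p" "x + z \<in> region (poly i)" and y: "(j, y) \<in> p" "y + z \<in> region (poly j)"
    obtain a where a: "1 \<le> a" "a \<le> N" "i = fst (c a)" "x = vtx (c a)" using reps[OF x(1)] by (auto simp: c_def)
    obtain b where b: "1 \<le> b" "b \<le> N" "j = fst (c b)" "y = vtx (c b)" using reps[OF y(1)] by (auto simp: c_def)
    have main: "((fst (c a), vtx (c a) + z), (fst (c b), vtx (c b) + z)) \<in> same_point X"
      if a: "1 \<le> a" "a \<le> N" "vtx (c a) + z \<in> region (poly (fst (c a)))" and b: "1 \<le> b" "b \<le> N" "vtx (c b) + z \<in> region (poly (fst (c b)))"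
      and ab: "a < b" and z0: "z \<noteq> 0" for a b
    proof -
      define s where "s = Arg2pi (z / E a)"
      define t where "t = Arg2pi (z / E b)"
      have s: "0 \<le> s" "s \<le> ang (c a)" using sector(2)[OF a(2) z] a(3) Arg2pi_ge_0 by (auto simp: s_def)
      have t: "0 \<le> t" "t \<le> ang (c b)" using sector(2)[OF b(2) z] b(3) Arg2pi_ge_0 by (auto simp: t_def)
      have Aa: "A a = A (a - 1) + ang (c a)" using AS[of "a - 1"] a(1) by simp
      have Ab: "A b = A (b - 1) + ang (c b)" using AS[of "b - 1"] b(1) by simp
      have "of_real (norm z) * dir 0 * cis (s - A a) = of_real (norm z) * dir 0 * cis (t - A b)"
        using polar'[of z a] polar'[of z b] by (simp add: s_def t_def)
      then have "cis (s - A a) = cis (t - A b)" using z0 ndir[of 0] by auto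
      then have "cis (s - A a - (t - A b)) = 1" by (simp add: cis_divide[symmetric])
      then obtain k :: int where k: "s - A a - (t - A b) = of_int (2 * k) * pi"
        unfolding cis_conv_exp exp_eq_1 by auto
      have up: "s - A a - (t - A b) \<le> A b - A (a - 1)" using s t Aa by linarith
      have lo: "A (b - 1) - A a \<le> s - A a - (t - A b)" using s t Ab by linarith
      have m1: "A a \<le> A (b - 1)" using Amono[of a "b - 1"] ab b by simp
      have m2: "0 \<le> A (a - 1)" "A b \<le> 2 * pi" using Amono[of 0 "a - 1"] Amono[of b N] a b A0 AN by auto
      \<comment> \<open>the sectors touch at the end of corner \<open>a\<close>, or after a full turn at its beginning\<close>
      have "0 \<le> of_int (2 * k) * pi" "of_int (2 * k) * pi \<le> 2 * pi" using k up lo m1 m2 by linarith+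
      then have "0 \<le> real_of_int (2 * k)" "real_of_int (2 * k) \<le> 2"
        using zero_le_mult_iff[of "real_of_int (2 * k)" pi] mult_le_cancel_right_pos[OF pi_gt_zero] pi_gt_zero
        by (linarith, blast)
      then have "0 \<le> k" "k \<le> 1" by auto
      then consider "k = 0" | "k = 1" by linarith
      then show ?thesis
      proof cases
        case 1
        then have e: "s - A a - (t - A b) = 0" using k by simp
        then have "A (b - 1) = A a" "s = 0" using lo m1 s t Ab by linarith+
        moreover have "b - 1 = a"
        proof (rule ccontr)
          assume "b - 1 \<noteq> a"
          then have "A a < A (b - 1)" using Astrict[of a "b - 1"] ab b(2) by linarith
          then show False using \<open>A (b - 1) = A a\<close> by simp
        qed
        ultimately show ?thesis using next_glue[OF a(2) z] b(1) by (metis s_def Suc_diff_1 less_eq_Suc_le One_nat_def)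
      next
        case 2
        then have e: "s - A a - (t - A b) = 2 * pi" using k by simp
        then have "A (a - 1) = 0" "A b = 2 * pi" "t = 0" using up m2 s t Aa by linarith+
        moreover have "a - 1 \<le> N" using a(2) by linarith
        ultimately have "a - 1 = 0" "b = N" "t = 0"
          using Astrict[of 0 "a - 1"] Astrict[of b N] b(2) A0 AN by (metis gr0I less_irrefl, metis le_neq_implies_less less_irrefl order_refl, simp)
        moreover have "a = 1" using calculation a by simp
        moreover have "c (Suc N) = c 1" using cN by (simp add: c_def)
        ultimately show ?thesis
          using same_point_sym[OF next_glue[OF b(2) z]] by (simp add: t_def)
      qed
    qed
    have xr: "((i, x + z), (i, x + z)) \<in> same_point X"
      using x rep_in[OF pp x(1)] by (auto simp: same_point_def disjoint_polys_def)
    show "((i, x + z), (j, y + z)) \<in> same_point X"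
    proof (cases "z = 0")
      case True
      then show ?thesis using same_point_iff[OF pp x(1)] y by simp
    next
      case False
      consider "a = b" | "a < b" | "b < a" by linarith
      then show ?thesis
      proof cases
        case 1
        then show ?thesis using a b xr by simp
      next
        case 2
        show ?thesis using main[OF a(1,2) _ b(1,2) _ 2 False] x y unfolding a(3,4) b(3,4) by blast
      next
        case 3
        show ?thesis using same_point_sym[OF main[OF b(1,2) _ a(1,2) _ 3 False]] x y unfolding a(3,4) b(3,4) by blast
      qed
    qed
  qed
  then show ?thesis using \<rho>(1) by blast
qed

lemma chart_exists:
  assumes p: "p \<in> points X" "p \<notin> sing X"
  shows "\<exists>\<rho>>0. \<exists>\<psi>. chart X (ball 0 \<rho>) \<psi> \<and> \<psi> 0 = p"
proof (cases "p \<in> vertex_points X")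
  case True
  then show ?thesis using chart_regular_vertex p by blast
next
  case False
  obtain i x where x: "i < n_polys" "x \<in> region (poly i)" "p = pt X i x" using pointsE[OF p(1)] .
  obtain K where K: "K > 1" "\<And>c. c > 0 \<Longrightarrow> (\<forall>k<length (poly i). K * c \<le> dist x (vertex (poly i) k)) \<Longrightarrow>
     \<exists>\<psi>. chart X (ball 0 c) \<psi> \<and> \<psi> 0 = pt X i x"
    using chart_away_from_vertices x(1,2) by metis
  have "\<forall>\<^sub>F c in at_right (0::real). \<forall>k\<in>{..<length (poly i)}. K * c \<le> dist x (vertex (poly i) k)"
  proof (intro eventually_ball_finite ballI)
    fix k assume "k \<in> {..<length (poly i)}"
    then have "x \<noteq> vertex (poly i) k" using False x by (auto simp: vertex_points_def sides_def)
    then show "\<forall>\<^sub>F c in at_right (0::real). K * c \<le> dist x (vertex (poly i) k)"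
      using K(1) unfolding eventually_at_right_field
      by (intro exI[of _ "dist x (vertex (poly i) k) / K"]) (auto simp: field_simps)
  qed simp
  moreover have "\<forall>\<^sub>F c in at_right (0::real). 0 < c" by (simp add: eventually_at_right_less)
  ultimately have "\<forall>\<^sub>F c in at_right (0::real). 0 < c \<and> (\<forall>k\<in>{..<length (poly i)}. K * c \<le> dist x (vertex (poly i) k))"
    by eventually_elim auto
  then obtain c where "0 < c" "\<forall>k\<in>{..<length (poly i)}. K * c \<le> dist x (vertex (poly i) k)"
    using eventually_happens'[OF trivial_limit_at_right_real] by blast
  then show ?thesis using K(2)[of c] x by auto
qed

end

section \<open>Uniqueness of charts and of integral curves\<close>

text \<open>The times where \<open>Q\<close> holds and those where it fails are open in the interval, which is
  connected. Integral curves are only described immediately before and after each time, and this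
  is how such information spreads to the whole curve.\<close>

lemma interval_locally_constant:
  fixes Q :: "real \<Rightarrow> bool"
  assumes fw: "\<And>t. a \<le> t \<Longrightarrow> t < b \<Longrightarrow> \<forall>\<^sub>F h in at_right 0. Q t = Q (t + h)"
    and bw: "\<And>t. a < t \<Longrightarrow> t \<le> b \<Longrightarrow> \<forall>\<^sub>F h in at_right 0. Q t = Q (t - h)"
    and s: "a \<le> s" "s \<le> b" and t: "a \<le> t" "t \<le> b"
  shows "Q s = Q t"
proof -
  have loc: "\<exists>e>0. \<forall>x\<in>{a..b}. \<bar>x - t\<bar> < e \<longrightarrow> Q x = Q t" if t: "a \<le> t" "t \<le> b" for t
  proof -
    have "\<exists>e>0. \<forall>h. 0 < h \<longrightarrow> h < e \<longrightarrow> t + h \<le> b \<longrightarrow> Q t = Q (t + h)"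
    proof (cases "t < b")
      case True
      then show ?thesis using fw[OF t(1)] by (auto simp: eventually_at_right_field)
    qed (auto intro: exI[of _ 1])
    then obtain e1 where e1: "e1 > 0" "\<And>h. 0 < h \<Longrightarrow> h < e1 \<Longrightarrow> t + h \<le> b \<Longrightarrow> Q t = Q (t + h)" by blast
    have "\<exists>e>0. \<forall>h. 0 < h \<longrightarrow> h < e \<longrightarrow> a \<le> t - h \<longrightarrow> Q t = Q (t - h)"
    proof (cases "a < t")
      case True
      then show ?thesis using bw[OF _ t(2)] by (auto simp: eventually_at_right_field)
    qed (auto intro: exI[of _ 1])
    then obtain e2 where e2: "e2 > 0" "\<And>h. 0 < h \<Longrightarrow> h < e2 \<Longrightarrow> a \<le> t - h \<Longrightarrow> Q t = Q (t - h)" by blast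
    have "Q x = Q t" if x: "x \<in> {a..b}" "\<bar>x - t\<bar> < min e1 e2" for x
    proof (cases x t rule: linorder_cases)
      case less
      then show ?thesis using e2(2)[of "t - x"] x by auto
    next
      case greater
      then show ?thesis using e1(2)[of "x - t"] x by auto
    qed auto
    then show ?thesis using e1(1) e2(1) by (intro exI[of _ "min e1 e2"]) auto
  qed
  have op: "openin (top_of_set {a..b}) {x\<in>{a..b}. Q x = c}" for c
    unfolding openin_euclidean_subtopology_iff
    using loc by (auto simp: dist_real_def)
  let ?E1 = "{x\<in>{a..b}. Q x = Q s}" and ?E2 = "{x\<in>{a..b}. Q x = (\<not> Q s)}"
  have E: "{a..b} \<subseteq> ?E1 \<union> ?E2" "?E1 \<inter> ?E2 = {}" "s \<in> ?E1" using s by auto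
  have ne: "?E1 \<noteq> {}" using E(3) by (metis empty_iff)
  have "?E2 = {}"
  proof (rule ccontr)
    assume "?E2 \<noteq> {}"
    with op[of "Q s"] op[of "\<not> Q s"] E(1,2) ne
    have "\<exists>E1 E2. openin (top_of_set {a..b}) E1 \<and> openin (top_of_set {a..b}) E2 \<and>
        {a..b} \<subseteq> E1 \<union> E2 \<and> E1 \<inter> E2 = {} \<and> E1 \<noteq> {} \<and> E2 \<noteq> {}"
      by (intro exI[of _ ?E1] exI[of _ ?E2] conjI)
    moreover have "connected {a..b}" by simp
    ultimately show False unfolding connected_openin by (rule notE[rotated])
  qed
  then show ?thesis using t by auto
qed

lemma eventually_small:
  assumes "0 < (a::real)"
  shows "\<forall>\<^sub>F h in at_right 0. h < a \<and> 0 < h"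
  unfolding eventually_at_right_field using assms by (intro exI[of _ a]) auto

lemma tendsto_scaled_at_right: "((\<lambda>h::real. z + of_real h * u) \<longlongrightarrow> (z::complex)) (at_right 0)"
  by (auto intro!: tendsto_eq_intros)

lemma filterlim_scaled_at_right: "filterlim (\<lambda>h::real. of_real h * u) (nhds (0::complex)) (at_right 0)"
  using tendsto_scaled_at_right[of 0 u] by simp

context transl_surface
begin

lemma chart_open: "chart X U \<psi> \<Longrightarrow> open U"
  and chart_points: "chart X U \<psi> \<Longrightarrow> z \<in> U \<Longrightarrow> \<psi> z \<in> points X"
  and chart_nonsing: "chart X U \<psi> \<Longrightarrow> z \<in> U \<Longrightarrow> \<psi> z \<notin> sing X"
  by (auto simp: chart_def)

lemma chart_compat: "chart X U \<psi> \<Longrightarrow> z \<in> U \<Longrightarrow> (i, x) \<in> \<psi> z \<Longrightarrow>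
    \<forall>\<^sub>F w in nhds 0. x + w \<in> region (poly i) \<longrightarrow> (i, x + w) \<in> \<psi> (z + w)"
  unfolding chart_def by (metis (no_types, lifting) case_prodD)

lemma chart_cover: "chart X U \<psi> \<Longrightarrow> z \<in> U \<Longrightarrow> \<forall>\<^sub>F w in nhds 0. \<exists>(i, x)\<in>\<psi> z. x + w \<in> region (poly i)"
  by (auto simp: chart_def)

lemma chart_nbhd:
  assumes c: "chart X U \<psi>" and z: "z \<in> U"
  shows "\<forall>\<^sub>F w in nhds 0. \<exists>(i, x)\<in>\<psi> z. x + w \<in> region (poly i) \<and> (i, x + w) \<in> \<psi> (z + w)"
proof -
  have "\<forall>\<^sub>F w in nhds 0. \<forall>a\<in>\<psi> z. snd a + w \<in> region (poly (fst a)) \<longrightarrow> (fst a, snd a + w) \<in> \<psi> (z + w)"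
    by (intro eventually_ball_finite finite_point[OF chart_points[OF c z]] ballI chart_compat[OF c z]) simp
  with chart_cover[OF c z] show ?thesis by eventually_elim fastforce
qed

lemma eventually_in_open_shift:
  fixes z :: complex
  assumes "open U" "z \<in> U"
  shows "\<forall>\<^sub>F w in nhds 0. z + w \<in> U"
proof -
  have "((\<lambda>w. z + w) \<longlongrightarrow> z + 0) (nhds 0)" by (intro tendsto_intros) (simp add: filterlim_ident)
  then show ?thesis using assms by (intro topological_tendstoD) auto
qed

text \<open>Limits may be taken in the coordinates of one polygon, because the identification is closed
  and finitely many representatives are involved.\<close>

lemma chart_lim:
  assumes c: "chart X U \<psi>" and z: "z \<in> U" and fz: "(f \<longlongrightarrow> z) F" and gx: "(g \<longlongrightarrow> x) F"
    and fr: "\<exists>\<^sub>F m in F. (i, g m) \<in> \<psi> (f m)"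
  shows "(i, x) \<in> \<psi> z"
proof (rule ccontr)
  assume neg: "(i, x) \<notin> \<psi> z"
  note p = chart_points[OF c z]
  have fz0: "((\<lambda>m. f m - z) \<longlongrightarrow> 0) F" using fz by (simp add: LIM_zero)
  have ev: "\<forall>\<^sub>F m in F. P (f m - z)" if "eventually P (nhds 0)" for P
    using fz0 that unfolding filterlim_iff by blast
  have "\<forall>\<^sub>F m in F. \<forall>a\<in>\<psi> z. ((i, g m), (fst a, snd a + (f m - z))) \<notin> same_point X"
  proof (intro eventually_ball_finite finite_point[OF p] ballI)
    fix a assume a: "a \<in> \<psi> z"
    have "((i, x), a) \<notin> same_point X"
      using same_point_sym[of "(i, x)" a] same_point_iff[OF p a, of "(i, x)"] neg by blast
    then have "(x, snd a) \<in> - {(x, y). ((i, x), (fst a, y)) \<in> same_point X}" by simp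
    moreover have "((\<lambda>m. (g m, snd a + (f m - z))) \<longlongrightarrow> (x, snd a + 0)) F"
      by (intro tendsto_intros gx fz0)
    ultimately have "\<forall>\<^sub>F m in F. (g m, snd a + (f m - z)) \<in> - {(x, y). ((i, x), (fst a, y)) \<in> same_point X}"
      using closed_same_point by (intro topological_tendstoD) (auto simp: open_Compl)
    then show "\<forall>\<^sub>F m in F. ((i, g m), (fst a, snd a + (f m - z))) \<notin> same_point X"
      by eventually_elim simp
  qed
  moreover have "\<forall>\<^sub>F m in F. \<exists>(j, y)\<in>\<psi> z. (j, y + (f m - z)) \<in> \<psi> (z + (f m - z))"
    using ev[OF chart_nbhd[OF c z]] by eventually_elim auto
  moreover have "\<forall>\<^sub>F m in F. f m \<in> U"
    using fz chart_open[OF c] z by (rule topological_tendstoD)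
  ultimately have "\<forall>\<^sub>F m in F. (i, g m) \<notin> \<psi> (f m)"
  proof eventually_elim
    case (elim m)
    then obtain j y where "(j, y) \<in> \<psi> z" "(j, y + (f m - z)) \<in> \<psi> (f m)" by auto
    then show ?case using elim(1) same_point_iff[OF chart_points[OF c elim(3)], of "(i, g m)" "(j, y + (f m - z))"] by force
  qed
  then show False using fr by (simp add: frequently_def)
qed

text \<open>Near a point where two charts agree they are the same translation in the coordinates of a
  polygon. Near a point where they differ they stay different, by the Hausdorff property.\<close>

lemma chart_unique:
  assumes c: "chart X U \<psi>" and c': "chart X U \<psi>'" and U: "connected U" and z0: "z0 \<in> U" "\<psi> z0 = \<psi>' z0"
    and z: "z \<in> U"
  shows "\<psi> z = \<psi>' z"
proof -
  have op: "open {z\<in>U. (\<psi> z = \<psi>' z) = b}" for b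
    unfolding open_contains_ball
  proof
    fix z assume "z \<in> {z\<in>U. (\<psi> z = \<psi>' z) = b}"
    then have z: "z \<in> U" "(\<psi> z = \<psi>' z) = b" by auto
    have "\<forall>\<^sub>F w in nhds 0. (\<psi> (z + w) = \<psi>' (z + w)) = b"
    proof (cases b)
      case True
      have "\<forall>\<^sub>F w in nhds 0. \<forall>a\<in>\<psi> z. snd a + w \<in> region (poly (fst a)) \<longrightarrow> (fst a, snd a + w) \<in> \<psi>' (z + w)"
        using z True
        by (intro eventually_ball_finite finite_point[OF chart_points[OF c z(1)]] ballI chart_compat[OF c' z(1)]) auto
      with chart_nbhd[OF c z(1)] eventually_in_open_shift[OF chart_open[OF c] z(1)] show ?thesis
      proof eventually_elim
        case (elim w)
        then have "\<exists>a. a \<in> \<psi> (z + w) \<and> a \<in> \<psi>' (z + w)" by fastforce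
        then show ?case using points_eqI[OF chart_points[OF c elim(2)] chart_points[OF c' elim(2)]] True by blast
      qed
    next
      case False
      have "\<forall>\<^sub>F w in nhds 0. \<forall>a\<in>\<psi> z. (fst a, snd a + w) \<notin> \<psi>' (z + w)"
      proof (intro eventually_ball_finite finite_point[OF chart_points[OF c z(1)]] ballI)
        fix a assume a: "a \<in> \<psi> z"
        then have na: "a \<notin> \<psi>' z" using points_eqI[OF chart_points[OF c z(1)] chart_points[OF c' z(1)]] z(2) False by blast
        have t: "((\<lambda>w. z + w) \<longlongrightarrow> z) (nhds 0)" "((\<lambda>w. snd a + w) \<longlongrightarrow> snd a) (nhds 0)"
          by (auto intro!: tendsto_eq_intros filterlim_ident)
        show "\<forall>\<^sub>F w in nhds 0. (fst a, snd a + w) \<notin> \<psi>' (z + w)"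
          using chart_lim[OF c' z(1) t, of "fst a"] na by (auto simp: frequently_def)
      qed
      with chart_nbhd[OF c z(1)] show ?thesis
        by eventually_elim (use False in force)
    qed
    with eventually_in_open_shift[OF chart_open[OF c] z(1)]
    have "\<forall>\<^sub>F w in nhds 0. z + w \<in> {z\<in>U. (\<psi> z = \<psi>' z) = b}" by eventually_elim simp
    then obtain e where e: "e > 0" "\<And>w. dist w 0 < e \<Longrightarrow> z + w \<in> {z\<in>U. (\<psi> z = \<psi>' z) = b}"
      unfolding eventually_nhds_metric by blast
    have "y \<in> {z\<in>U. (\<psi> z = \<psi>' z) = b}" if "y \<in> ball z e" for y
      using e(2)[of "y - z"] that by (simp add: dist_norm norm_minus_commute)
    then show "\<exists>e>0. ball z e \<subseteq> {z\<in>U. (\<psi> z = \<psi>' z) = b}" using e(1) by blast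
  qed
  have "{z\<in>U. (\<psi> z = \<psi>' z) = False} \<inter> U = {}"
    using connectedD[OF U op[of True] op[of False]] z0 by auto
  then show ?thesis using z by blast
qed

text \<open>The polygons at \<open>\<psi> z\<close> fill a neighbourhood and are finitely many, and none of them is
  entered and left infinitely often by the ray. So one of them contains a first piece of it.\<close>

lemma chart_direction:
  assumes c: "chart X U \<psi>" and z: "z \<in> U"
  shows "\<exists>(i, x)\<in>\<psi> z. \<forall>\<^sub>F h in at_right 0. (i, x + of_real h * u) \<in> \<psi> (z + of_real h * u)"
proof -
  note p = chart_points[OF c z]
  have ev: "\<forall>\<^sub>F h in at_right 0. P (of_real h * u)" if "eventually P (nhds 0)" for P
    using filterlim_scaled_at_right[of u] that unfolding filterlim_iff by blast
  have "\<exists>a\<in>\<psi> z. \<forall>\<^sub>F h in at_right (0::real). snd a + of_real h * u \<in> region (poly (fst a))"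
  proof (rule ccontr)
    assume neg: "\<not> ?thesis"
    have "\<forall>\<^sub>F h in at_right (0::real). \<forall>a\<in>\<psi> z. snd a + of_real h * u \<notin> region (poly (fst a))"
    proof (intro eventually_ball_finite finite_point[OF p] ballI)
      fix a assume a: "a \<in> \<psi> z"
      then have "simple_polygon (poly (fst a))" using rep_in[OF p, of "fst a" "snd a"] simple by simp
      then show "\<forall>\<^sub>F h in at_right (0::real). snd a + of_real h * u \<notin> region (poly (fst a))"
        using ray_eventually_region[of "poly (fst a)" "snd a" u] a neg by blast
    qed
    with ev[OF chart_cover[OF c z]] have "\<forall>\<^sub>F h in at_right (0::real). False" by eventually_elim fastforce
    then show False by simp
  qed
  then obtain i x where x: "(i, x) \<in> \<psi> z" "\<forall>\<^sub>F h in at_right (0::real). x + of_real h * u \<in> region (poly i)" by auto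
  have "\<forall>\<^sub>F h in at_right (0::real). (i, x + of_real h * u) \<in> \<psi> (z + of_real h * u)"
    using x(2) ev[OF chart_compat[OF c z x(1)]] by eventually_elim simp
  then show ?thesis using x(1) by blast
qed

text \<open>A curve with velocity \<open>u\<close> and a straight line of a chart either stay equal or stay different
  for a short time. This is the local form, along a ray, of the uniqueness of charts.\<close>

lemma chart_agree_local:
  assumes c: "chart X U \<psi>" and z: "z \<in> U" and x: "(i, x) \<in> p" "p \<in> points X"
    and q: "\<forall>\<^sub>F h in at_right 0. (i, x + of_real h * u) \<in> q h" "\<forall>\<^sub>F h in at_right (0::real). q h \<in> points X"
  shows "\<forall>\<^sub>F h in at_right 0. (p = \<psi> z) = (q h = \<psi> (z + of_real h * u))"
proof -
  have U: "\<forall>\<^sub>F h in at_right (0::real). z + of_real h * u \<in> U"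
    using tendsto_scaled_at_right chart_open[OF c] z by (rule topological_tendstoD)
  have ev: "\<forall>\<^sub>F h in at_right 0. P (of_real h * u)" if "eventually P (nhds 0)" for P
    using filterlim_scaled_at_right[of u] that unfolding filterlim_iff by blast
  show ?thesis
  proof (cases "p = \<psi> z")
    case True
    then have "(i, x) \<in> \<psi> z" using x by simp
    from ev[OF chart_compat[OF c z this]] U q show ?thesis
    proof eventually_elim
      case (elim h)
      then have "x + of_real h * u \<in> region (poly i)" using rep_in by blast
      then show ?case using elim True points_eqI[OF elim(4) chart_points[OF c elim(2)]] by blast
    qed
  next
    case False
    then have "(i, x) \<notin> \<psi> z" using points_eqI[OF x(2) chart_points[OF c z] x(1)] by blast
    then have "\<forall>\<^sub>F h in at_right (0::real). (i, x + of_real h * u) \<notin> \<psi> (z + of_real h * u)"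
      using chart_lim[OF c z tendsto_scaled_at_right tendsto_scaled_at_right, of i x u u] by (auto simp: frequently_def)
    with q(1) show ?thesis by eventually_elim (use False in auto)
  qed
qed

lemma integral_curve_points: "integral_curve X v T \<gamma> \<Longrightarrow> 0 \<le> t \<Longrightarrow> t \<le> T \<Longrightarrow> \<gamma> t \<in> points X"
  by (auto simp: integral_curve_def)

lemma integral_curve_forward:
  assumes "integral_curve X v T \<gamma>" "0 \<le> t" "t < T"
  obtains i x where "(i, x) \<in> \<gamma> t" "\<forall>\<^sub>F h in at_right 0. (i, x + of_real h * v) \<in> \<gamma> (t + h)"
    "\<forall>\<^sub>F h in at_right (0::real). \<gamma> (t + h) \<in> points X"
proof -
  have "\<forall>\<^sub>F h in at_right (0::real). h < T - t \<and> 0 < h" using assms by (intro eventually_small) auto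
  then have "\<forall>\<^sub>F h in at_right (0::real). \<gamma> (t + h) \<in> points X"
    by eventually_elim (use assms in \<open>auto simp: integral_curve_def\<close>)
  moreover have "\<exists>(i, x)\<in>\<gamma> t. \<forall>\<^sub>F h in at_right 0. (i, x + of_real h * v) \<in> \<gamma> (t + h)"
    using assms by (auto simp: integral_curve_def)
  ultimately show ?thesis using that by blast
qed

lemma integral_curve_backward:
  assumes "integral_curve X v T \<gamma>" "0 < t" "t \<le> T"
  obtains i x where "(i, x) \<in> \<gamma> t" "\<forall>\<^sub>F h in at_right 0. (i, x + of_real h * (- v)) \<in> \<gamma> (t - h)"
    "\<forall>\<^sub>F h in at_right (0::real). \<gamma> (t - h) \<in> points X"
proof -
  have "\<forall>\<^sub>F h in at_right (0::real). h < t \<and> 0 < h" using assms by (intro eventually_small) auto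
  then have "\<forall>\<^sub>F h in at_right (0::real). \<gamma> (t - h) \<in> points X"
    by eventually_elim (use assms in \<open>auto simp: integral_curve_def\<close>)
  moreover have "\<exists>(i, x)\<in>\<gamma> t. \<forall>\<^sub>F h in at_right 0. (i, x - of_real h * v) \<in> \<gamma> (t - h)"
    using assms by (auto simp: integral_curve_def)
  ultimately show ?thesis using that by auto
qed

lemma integral_curve_in_chart:
  assumes \<gamma>: "integral_curve X v T \<gamma>" and c: "chart X U \<psi>"
    and ab: "0 \<le> a" "b \<le> T" and U: "\<And>t. a \<le> t \<Longrightarrow> t \<le> b \<Longrightarrow> z + of_real t * v \<in> U"
    and s: "a \<le> s" "s \<le> b" "\<gamma> s = \<psi> (z + of_real s * v)" and t: "a \<le> t" "t \<le> b"
  shows "\<gamma> t = \<psi> (z + of_real t * v)"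
proof -
  let ?Q = "\<lambda>t. \<gamma> t = \<psi> (z + of_real t * v)"
  have "?Q s = ?Q t"
  proof (rule interval_locally_constant[where Q = ?Q, OF _ _ s(1,2) t])
    fix t assume t: "a \<le> t" "t < b"
    then have t': "0 \<le> t" "t < T" using ab by auto
    obtain i x where ix: "(i, x) \<in> \<gamma> t" "\<forall>\<^sub>F h in at_right 0. (i, x + of_real h * v) \<in> \<gamma> (t + h)"
      "\<forall>\<^sub>F h in at_right (0::real). \<gamma> (t + h) \<in> points X" using integral_curve_forward[OF \<gamma> t'] .
    have "z + of_real t * v \<in> U" using U t by simp
    from chart_agree_local[OF c this ix(1) _ ix(2,3)]
    show "\<forall>\<^sub>F h in at_right 0. ?Q t = ?Q (t + h)"
      using integral_curve_points[OF \<gamma>, of t] t' by (simp add: algebra_simps)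
  next
    fix t assume t: "a < t" "t \<le> b"
    then have t': "0 < t" "t \<le> T" using ab by auto
    obtain i x where ix: "(i, x) \<in> \<gamma> t" "\<forall>\<^sub>F h in at_right 0. (i, x + of_real h * (- v)) \<in> \<gamma> (t - h)"
      "\<forall>\<^sub>F h in at_right (0::real). \<gamma> (t - h) \<in> points X" using integral_curve_backward[OF \<gamma> t'] .
    have "z + of_real t * v \<in> U" using U t by simp
    from chart_agree_local[OF c this ix(1) _ ix(2,3)]
    show "\<forall>\<^sub>F h in at_right 0. ?Q t = ?Q (t - h)"
      using integral_curve_points[OF \<gamma>, of t] t' by (simp add: algebra_simps)
  qed
  then show ?thesis using s(3) by simp
qed

lemma integral_curveI:
  assumes "\<And>t. 0 \<le> t \<Longrightarrow> t \<le> T \<Longrightarrow> \<gamma> t \<in> points X"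
    and "\<And>t. 0 \<le> t \<Longrightarrow> t < T \<Longrightarrow> \<exists>(i, x)\<in>\<gamma> t. \<forall>\<^sub>F h in at_right 0. (i, x + of_real h * v) \<in> \<gamma> (t + h)"
    and "\<And>t. 0 < t \<Longrightarrow> t \<le> T \<Longrightarrow> \<exists>(i, x)\<in>\<gamma> t. \<forall>\<^sub>F h in at_right 0. (i, x + of_real h * (- v)) \<in> \<gamma> (t - h)"
  shows "integral_curve X v T \<gamma>"
  using assms by (auto simp: integral_curve_def)

lemma integral_curve_charts:
  assumes "\<And>t. 0 \<le> t \<Longrightarrow> t \<le> T \<Longrightarrow> \<exists>U \<psi> z. chart X U \<psi> \<and> z \<in> U \<and> \<gamma> t = \<psi> z \<and>
      (t < T \<longrightarrow> (\<forall>\<^sub>F h in at_right 0. \<gamma> (t + h) = \<psi> (z + of_real h * v))) \<and>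
      (0 < t \<longrightarrow> (\<forall>\<^sub>F h in at_right 0. \<gamma> (t - h) = \<psi> (z + of_real h * (- v))))"
  shows "integral_curve X v T \<gamma>"
proof (rule integral_curveI)
  fix t assume "0 \<le> t" "t \<le> T"
  then show "\<gamma> t \<in> points X" using assms[of t] chart_points by metis
next
  fix t assume "0 \<le> t" "t < T"
  then obtain U \<psi> z where c: "chart X U \<psi>" "z \<in> U" "\<gamma> t = \<psi> z" "\<forall>\<^sub>F h in at_right 0. \<gamma> (t + h) = \<psi> (z + of_real h * v)"
    using assms[of t] by auto
  obtain i x where x: "(i, x) \<in> \<psi> z" "\<forall>\<^sub>F h in at_right 0. (i, x + of_real h * v) \<in> \<psi> (z + of_real h * v)"
    using chart_direction[OF c(1,2), of v] by blast
  from x(2) c(4) have "\<forall>\<^sub>F h in at_right 0. (i, x + of_real h * v) \<in> \<gamma> (t + h)" by eventually_elim simp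
  then show "\<exists>(i, x)\<in>\<gamma> t. \<forall>\<^sub>F h in at_right 0. (i, x + of_real h * v) \<in> \<gamma> (t + h)" using x(1) c(3) by blast
next
  fix t assume "0 < t" "t \<le> T"
  then obtain U \<psi> z where c: "chart X U \<psi>" "z \<in> U" "\<gamma> t = \<psi> z" "\<forall>\<^sub>F h in at_right 0. \<gamma> (t - h) = \<psi> (z + of_real h * (- v))"
    using assms[of t] by auto
  obtain i x where x: "(i, x) \<in> \<psi> z" "\<forall>\<^sub>F h in at_right 0. (i, x + of_real h * (- v)) \<in> \<psi> (z + of_real h * (- v))"
    using chart_direction[OF c(1,2), of "- v"] by blast
  from x(2) c(4) have "\<forall>\<^sub>F h in at_right 0. (i, x + of_real h * (- v)) \<in> \<gamma> (t - h)" by eventually_elim simp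
  then show "\<exists>(i, x)\<in>\<gamma> t. \<forall>\<^sub>F h in at_right 0. (i, x + of_real h * (- v)) \<in> \<gamma> (t - h)" using x(1) c(3) by blast
qed

text \<open>The disc need not be embedded: the chart may run several times around a thin cylinder.\<close>

definition reg :: "real \<Rightarrow> (nat \<times> complex) set \<Rightarrow> bool" where
  "reg \<rho> p \<longleftrightarrow> 0 < \<rho> \<and> (\<exists>\<psi>. chart X (ball 0 \<rho>) \<psi> \<and> \<psi> 0 = p)"

text \<open>The point \<open>p + w\<close>, reached from \<open>p\<close> by a straight displacement. Charts with the same centre
  agree on the smaller disc, so that this does not depend on the chart.\<close>

definition shift :: "(nat \<times> complex) set \<Rightarrow> complex \<Rightarrow> (nat \<times> complex) set" where
  "shift p w = (THE q. \<exists>\<rho> \<psi>. norm w < \<rho> \<and> chart X (ball 0 \<rho>) \<psi> \<and> \<psi> 0 = p \<and> q = \<psi> w)"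

lemma shift_eq:
  assumes "chart X (ball 0 \<rho>) \<psi>" "\<psi> 0 = p" "norm w < \<rho>"
  shows "shift p w = \<psi> w"
  unfolding shift_def
proof (rule the_equality)
  fix q assume "\<exists>\<rho> \<psi>. norm w < \<rho> \<and> chart X (ball 0 \<rho>) \<psi> \<and> \<psi> 0 = p \<and> q = \<psi> w"
  then obtain \<rho>' \<psi>' where *: "norm w < \<rho>'" "chart X (ball 0 \<rho>') \<psi>'" "\<psi>' 0 = p" "q = \<psi>' w" by blast
  let ?U = "ball (0::complex) (min \<rho> \<rho>')"
  have sub: "?U \<subseteq> ball 0 \<rho>" "?U \<subseteq> ball 0 \<rho>'" by (simp_all add: subset_ball)
  have w: "w \<in> ?U" using assms(3) *(1) by simp
  have "0 < \<rho>" "0 < \<rho>'" using assms(3) *(1) norm_ge_zero[of w] by linarith+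
  then have z: "0 \<in> ?U" by simp
  have "\<psi> 0 = \<psi>' 0" using assms(2) *(3) by simp
  from chart_unique[OF chart_subset[OF assms(1) open_ball sub(1)] chart_subset[OF *(2) open_ball sub(2)]
      connected_ball z this w]
  have "\<psi> w = \<psi>' w" .
  then show "q = \<psi> w" using * by simp
qed (use assms in blast)

lemma chart_cong:
  assumes c: "chart X U \<psi>" and eq: "\<And>z. z \<in> U \<Longrightarrow> \<psi>' z = \<psi> z"
  shows "chart X U \<psi>'"
  unfolding chart_def
proof (intro conjI ballI)
  show "open U" by (rule chart_open[OF c])
  fix z assume z: "z \<in> U"
  show "\<psi>' z \<in> points X - sing X" using c z eq by (auto simp: chart_def)
  show "\<forall>\<^sub>F w in nhds 0. \<exists>(i, x)\<in>\<psi>' z. x + w \<in> region (poly i)"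
    using chart_cover[OF c z] eq[OF z] by simp
  fix a assume a: "a \<in> \<psi>' z"
  obtain i x where ix: "a = (i, x)" by (cases a)
  have "\<forall>\<^sub>F w in nhds 0. x + w \<in> region (poly i) \<longrightarrow> (i, x + w) \<in> \<psi>' (z + w)"
    using chart_compat[OF c z a[unfolded ix eq[OF z]]] eventually_in_open_shift[OF chart_open[OF c] z]
    by eventually_elim (auto simp: eq)
  then show "case a of (i, x) \<Rightarrow> \<forall>\<^sub>F w in nhds 0. x + w \<in> region (poly i) \<longrightarrow> (i, x + w) \<in> \<psi>' (z + w)"
    by (simp add: ix)
qed

lemma shift_chart:
  assumes "reg \<rho> p"
  shows "chart X (ball 0 \<rho>) (shift p)" "shift p 0 = p"
proof -
  obtain \<psi> where \<psi>: "0 < \<rho>" "chart X (ball 0 \<rho>) \<psi>" "\<psi> 0 = p" using assms by (auto simp: reg_def)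
  show "chart X (ball 0 \<rho>) (shift p)"
    by (rule chart_cong[OF \<psi>(2)]) (use shift_eq[OF \<psi>(2,3)] in simp)
  show "shift p 0 = p" using shift_eq[OF \<psi>(2,3), of 0] \<psi> by simp
qed

lemma reg_chart:
  assumes c: "chart X U \<psi>" and b: "ball z \<rho> \<subseteq> U" "0 < \<rho>"
  shows "reg \<rho> (\<psi> z)" "norm w < \<rho> \<Longrightarrow> shift (\<psi> z) w = \<psi> (z + w)"
proof -
  have "ball 0 \<rho> \<subseteq> {w. z + w \<in> U}" using b by (auto simp: subset_iff dist_norm)
  then have c': "chart X (ball 0 \<rho>) (\<lambda>w. \<psi> (z + w))"
    using chart_subset[OF chart_shift[OF c, of z]] by blast
  then show "reg \<rho> (\<psi> z)" using b(2) unfolding reg_def by (intro conjI exI[of _ "\<lambda>w. \<psi> (z + w)"]) auto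
  show "norm w < \<rho> \<Longrightarrow> shift (\<psi> z) w = \<psi> (z + w)" using shift_eq[OF c'] by simp
qed

lemma reg_shift:
  assumes "reg \<rho> p" "norm a < \<rho>"
  shows "reg (\<rho> - norm a) (shift p a)"
    "norm a + norm w < \<rho> \<Longrightarrow> shift (shift p a) w = shift p (a + w)"
proof -
  have b: "ball a (\<rho> - norm a) \<subseteq> ball 0 \<rho>"
    by (auto simp: subset_iff dist_norm) (smt (verit) norm_minus_commute norm_triangle_sub)
  show "reg (\<rho> - norm a) (shift p a)" "norm a + norm w < \<rho> \<Longrightarrow> shift (shift p a) w = shift p (a + w)"
    using reg_chart[OF shift_chart(1)[OF assms(1)] b] assms(2) by auto
qed

lemma reg_mono: "reg \<rho> p \<Longrightarrow> 0 < \<rho>' \<Longrightarrow> \<rho>' \<le> \<rho> \<Longrightarrow> reg \<rho>' p"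
  unfolding reg_def using chart_subset[OF _ open_ball subset_ball] by metis

lemma reg_nonsing: "reg \<rho> p \<Longrightarrow> p \<in> points X" "reg \<rho> p \<Longrightarrow> p \<notin> sing X"
  unfolding reg_def using chart_points chart_nonsing by (metis centre_in_ball)+

lemma reg_exists: "p \<in> points X \<Longrightarrow> p \<notin> sing X \<Longrightarrow> \<exists>\<rho>>0. reg \<rho> p"
  using chart_exists unfolding reg_def by blast

lemma shift_points: "reg \<rho> p \<Longrightarrow> norm w < \<rho> \<Longrightarrow> shift p w \<in> points X \<and> shift p w \<notin> sing X"
  using shift_chart(1) chart_points chart_nonsing by (metis mem_ball_0)

lemma integral_curve_shift:
  assumes \<gamma>: "integral_curve X v T \<gamma>" and v: "norm v = 1" and s: "0 \<le> s" "s \<le> T" and t: "0 \<le> t" "t \<le> T"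
    and r: "reg b (\<gamma> s)" "\<bar>t - s\<bar> < b"
  shows "\<gamma> t = shift (\<gamma> s) (of_real (t - s) * v)"
proof -
  let ?a = "min s t" and ?b = "max s t"
  have "\<gamma> t = shift (\<gamma> s) (of_real (- s) * v + of_real t * v)"
  proof (rule integral_curve_in_chart[OF \<gamma> shift_chart(1)[OF r(1)], of ?a ?b _ s])
    fix u assume u: "?a \<le> u" "u \<le> ?b"
    have "of_real (- s) * v + of_real u * v = of_real (u - s) * v" by (simp add: algebra_simps)
    then have "norm (of_real (- s) * v + of_real u * v) = \<bar>u - s\<bar>" by (simp only: norm_mult norm_of_real v) simp
    also have "\<dots> < b" using u r(2) by auto
    finally show "of_real (- s) * v + of_real u * v \<in> ball 0 b" by simp
  qed (use s t shift_chart(2)[OF r(1)] in auto)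
  then show ?thesis by (simp add: algebra_simps)
qed

text \<open>A disc around one point of the curve contains discs of half its radius around the
  neighbouring points, and finitely many discs suffice.\<close>

lemma integral_curve_radius:
  assumes \<gamma>: "integral_curve X v T \<gamma>" and v: "norm v = 1" and ns: "\<And>t. 0 \<le> t \<Longrightarrow> t \<le> T \<Longrightarrow> \<gamma> t \<notin> sing X"
  shows "\<exists>b>0. \<forall>t. 0 \<le> t \<longrightarrow> t \<le> T \<longrightarrow> reg b (\<gamma> t)"
proof -
  have "\<forall>t\<in>{0..T}. \<exists>\<rho>>0. reg \<rho> (\<gamma> t)"
    using reg_exists integral_curve_points[OF \<gamma>] ns by simp
  then obtain \<rho> where \<rho>: "\<And>t. t \<in> {0..T} \<Longrightarrow> \<rho> t > 0 \<and> reg (\<rho> t) (\<gamma> t)" by metis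
  have "compact {0..T}" by simp
  moreover have "{0..T} \<subseteq> (\<Union>t\<in>{0..T}. ball t (\<rho> t / 2))" using \<rho> by force
  ultimately obtain C where C: "C \<subseteq> {0..T}" "finite C" "{0..T} \<subseteq> (\<Union>t\<in>C. ball t (\<rho> t / 2))"
    using compactE_image[of "{0..T}" "{0..T}" "\<lambda>t. ball t (\<rho> t / 2)"] by blast
  define b where "b = Min (insert 1 ((\<lambda>t. \<rho> t / 2) ` C))"
  have b: "b > 0" using C \<rho> by (auto simp: b_def)
  have "reg b (\<gamma> t)" if t: "0 \<le> t" "t \<le> T" for t
  proof -
    obtain s where s: "s \<in> C" "t \<in> ball s (\<rho> s / 2)" 
    proof -
      have "t \<in> (\<Union>t\<in>C. ball t (\<rho> t / 2))" using t by (intro subsetD[OF C(3)]) simp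
      then show ?thesis using that by blast
    qed
    then have s': "0 \<le> s" "s \<le> T" and r: "reg (\<rho> s) (\<gamma> s)" and d: "\<bar>t - s\<bar> < \<rho> s / 2"
      using C(1) \<rho>[of s] by (auto simp: dist_real_def abs_minus_commute)
    have "\<gamma> t = shift (\<gamma> s) (of_real (t - s) * v)"
      by (rule integral_curve_shift[OF \<gamma> v s' t r]) (use d abs_ge_zero[of "t - s"] in linarith)
    moreover have n: "norm (of_real (t - s) * v) = \<bar>t - s\<bar>" by (simp only: norm_mult norm_of_real v) simp
    moreover have "\<bar>t - s\<bar> < \<rho> s" using d abs_ge_zero[of "t - s"] by linarith
    ultimately have "reg (\<rho> s - \<bar>t - s\<bar>) (\<gamma> t)" using reg_shift(1)[OF r, of "of_real (t - s) * v"] by simp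
    moreover have "b \<le> \<rho> s / 2" unfolding b_def using C(2) s(1) by (intro Min_le) auto
    then have "b \<le> \<rho> s - \<bar>t - s\<bar>" using d by linarith
    ultimately show ?thesis using reg_mono b by blast
  qed
  then show ?thesis using b by blast
qed

text \<open>In a disc around \<open>\<gamma> t\<close> the curve \<open>\<gamma>\<close> is a straight line, with which \<open>\<delta>\<close> either stays equal
  or stays different.\<close>

lemma integral_curve_unique:
  assumes \<gamma>: "integral_curve X v T \<gamma>" and \<delta>: "integral_curve X v T \<delta>" and v: "norm v = 1"
    and ns: "\<And>t. 0 \<le> t \<Longrightarrow> t \<le> T \<Longrightarrow> \<gamma> t \<notin> sing X"
    and s: "0 \<le> s" "s \<le> T" "\<delta> s = \<gamma> s" and t: "0 \<le> t" "t \<le> T"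
  shows "\<delta> t = \<gamma> t"
proof -
  obtain b where b: "b > 0" "\<And>t. 0 \<le> t \<Longrightarrow> t \<le> T \<Longrightarrow> reg b (\<gamma> t)"
    using integral_curve_radius[OF \<gamma> v ns] by blast
  let ?Q = "\<lambda>t. \<delta> t = \<gamma> t"
  have "?Q s = ?Q t"
  proof (rule interval_locally_constant[where Q = ?Q, OF _ _ s(1,2) t])
    fix t assume t: "0 \<le> t" "t < T"
    obtain i x where ix: "(i, x) \<in> \<delta> t" "\<forall>\<^sub>F h in at_right 0. (i, x + of_real h * v) \<in> \<delta> (t + h)"
      "\<forall>\<^sub>F h in at_right (0::real). \<delta> (t + h) \<in> points X" using integral_curve_forward[OF \<delta> t] .
    have r: "reg b (\<gamma> t)" using b t by simp
    have sh: "\<gamma> (t + h) = shift (\<gamma> t) (of_real h * v)" if "h < min b (T - t)" "0 < h" for h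
      using integral_curve_shift[OF \<gamma> v _ _ _ _ r, of "t + h"] t that by simp
    have "\<forall>\<^sub>F h in at_right (0::real). h < min b (T - t) \<and> 0 < h" using t b by (intro eventually_small) auto
    with chart_agree_local[OF shift_chart(1)[OF r] _ ix(1) integral_curve_points[OF \<delta>] ix(2,3), of 0] b(1) t
    have "\<forall>\<^sub>F h in at_right (0::real). h < min b (T - t) \<and> 0 < h \<and>
      (\<delta> t = shift (\<gamma> t) 0) = (\<delta> (t + h) = shift (\<gamma> t) (0 + of_real h * v))" by (simp add: eventually_conj_iff)
    then show "\<forall>\<^sub>F h in at_right 0. ?Q t = ?Q (t + h)"
      by eventually_elim (use sh shift_chart(2)[OF r] in simp)
  next
    fix t assume t: "0 < t" "t \<le> T"
    obtain i x where ix: "(i, x) \<in> \<delta> t" "\<forall>\<^sub>F h in at_right 0. (i, x + of_real h * (- v)) \<in> \<delta> (t - h)"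
      "\<forall>\<^sub>F h in at_right (0::real). \<delta> (t - h) \<in> points X" using integral_curve_backward[OF \<delta> t] .
    have r: "reg b (\<gamma> t)" using b t by simp
    have sh: "\<gamma> (t - h) = shift (\<gamma> t) (of_real h * (- v))" if "h < min b t" "0 < h" for h
      using integral_curve_shift[OF \<gamma> v _ _ _ _ r, of "t - h"] t that by simp
    have "\<forall>\<^sub>F h in at_right (0::real). h < min b t \<and> 0 < h" using t b by (intro eventually_small) auto
    with chart_agree_local[OF shift_chart(1)[OF r] _ ix(1) integral_curve_points[OF \<delta>] ix(2,3), of 0] b(1) t
    have "\<forall>\<^sub>F h in at_right (0::real). h < min b t \<and> 0 < h \<and>
      (\<delta> t = shift (\<gamma> t) 0) = (\<delta> (t - h) = shift (\<gamma> t) (0 + of_real h * (- v)))" by (simp add: eventually_conj_iff)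
    then show "\<forall>\<^sub>F h in at_right 0. ?Q t = ?Q (t - h)"
      by eventually_elim (use sh shift_chart(2)[OF r] in simp)
  qed
  then show ?thesis using s(3) by simp
qed

text \<open>In a disc around \<open>\<gamma> t\<close> the translated curve is a line parallel to \<open>\<gamma>\<close>.\<close>

lemma integral_curve_translate:
  assumes \<gamma>: "integral_curve X v T \<gamma>" and v: "norm v = 1" and r: "\<And>t. 0 \<le> t \<Longrightarrow> t \<le> T \<Longrightarrow> reg b (\<gamma> t)"
    and w: "norm w < b"
  shows "integral_curve X v T (\<lambda>t. shift (\<gamma> t) w)"
proof (rule integral_curve_charts)
  fix t assume t: "0 \<le> t" "t \<le> T"
  note c = shift_chart[OF r[OF t]]
  have *: "shift (\<gamma> t') w = shift (\<gamma> t) (w + of_real (t' - t) * v)"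
    if t': "0 \<le> t'" "t' \<le> T" "\<bar>t' - t\<bar> + norm w < b" for t'
  proof -
    have n: "norm (of_real (t' - t) * v) = \<bar>t' - t\<bar>" by (simp only: norm_mult norm_of_real v) simp
    have "\<gamma> t' = shift (\<gamma> t) (of_real (t' - t) * v)"
      using t' norm_ge_zero[of w] by (intro integral_curve_shift[OF \<gamma> v t _ _ r[OF t]]) linarith+
    then show ?thesis using reg_shift(2)[OF r[OF t], of "of_real (t' - t) * v" w] n t'(3) norm_ge_zero[of w]
      by (simp add: add.commute)
  qed
  have "\<forall>\<^sub>F h in at_right (0::real). shift (\<gamma> (t + h)) w = shift (\<gamma> t) (w + of_real h * v)" if "t < T"
  proof -
    have "\<forall>\<^sub>F h in at_right (0::real). h < min (b - norm w) (T - t) \<and> 0 < h"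
      using that w by (intro eventually_small) auto
    then show ?thesis by eventually_elim (use *[of "t + h" for h] t in auto)
  qed
  moreover have "\<forall>\<^sub>F h in at_right (0::real). shift (\<gamma> (t - h)) w = shift (\<gamma> t) (w + of_real h * (- v))" if "0 < t"
  proof -
    have "\<forall>\<^sub>F h in at_right (0::real). h < min (b - norm w) t \<and> 0 < h"
      using that w by (intro eventually_small) auto
    then show ?thesis by eventually_elim (use *[of "t - h" for h] t in auto)
  qed
  ultimately show "\<exists>U \<psi> z. chart X U \<psi> \<and> z \<in> U \<and> shift (\<gamma> t) w = \<psi> z \<and>
      (t < T \<longrightarrow> (\<forall>\<^sub>F h in at_right 0. shift (\<gamma> (t + h)) w = \<psi> (z + of_real h * v))) \<and>
      (0 < t \<longrightarrow> (\<forall>\<^sub>F h in at_right 0. shift (\<gamma> (t - h)) w = \<psi> (z + of_real h * (- v))))"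
    using c(1) w by (intro exI[of _ "ball 0 b"] exI[of _ "shift (\<gamma> t)"] exI[of _ w]) auto
qed

lemma integral_curve_sub:
  assumes "integral_curve X v T \<gamma>" "0 \<le> a" "a + T' \<le> T"
  shows "integral_curve X v T' (\<lambda>t. \<gamma> (a + t))"
proof (rule integral_curveI)
  fix t assume "0 \<le> t" "t < T'"
  then show "\<exists>(i, x)\<in>\<gamma> (a + t). \<forall>\<^sub>F h in at_right 0. (i, x + of_real h * v) \<in> \<gamma> (a + (t + h))"
    using integral_curve_forward[OF assms(1), of "a + t"] assms by (auto simp: add.assoc)
next
  fix t assume "0 < t" "t \<le> T'"
  then show "\<exists>(i, x)\<in>\<gamma> (a + t). \<forall>\<^sub>F h in at_right 0. (i, x + of_real h * (- v)) \<in> \<gamma> (a + (t - h))"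
    using integral_curve_backward[OF assms(1), of "a + t"] assms by (auto simp: add_diff_eq)
qed (use assms integral_curve_points[OF assms(1)] in auto)

lemma integral_curve_concat:
  assumes \<gamma>: "integral_curve X v S \<gamma>" and \<delta>: "integral_curve X v T \<delta>" and eq: "\<gamma> S = \<delta> 0" and pos: "0 \<le> S" "0 \<le> T"
  shows "integral_curve X v (S + T) (\<lambda>t. if t \<le> S then \<gamma> t else \<delta> (t - S))"
proof (rule integral_curveI)
  fix t assume t: "0 \<le> t" "t \<le> S + T"
  then show "(if t \<le> S then \<gamma> t else \<delta> (t - S)) \<in> points X"
    using integral_curve_points[OF \<gamma>, of t] integral_curve_points[OF \<delta>, of "t - S"] by auto
next
  fix t assume t: "0 \<le> t" "t < S + T"
  let ?g = "\<lambda>t. if t \<le> S then \<gamma> t else \<delta> (t - S)"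
  show "\<exists>(i, x)\<in>?g t. \<forall>\<^sub>F h in at_right 0. (i, x + of_real h * v) \<in> ?g (t + h)"
  proof (cases "t < S")
    case True
    obtain i x where ix: "(i, x) \<in> \<gamma> t" "\<forall>\<^sub>F h in at_right 0. (i, x + of_real h * v) \<in> \<gamma> (t + h)"
      using integral_curve_forward[OF \<gamma> t(1) True] .
    have "\<forall>\<^sub>F h in at_right (0::real). h < S - t \<and> 0 < h" using True by (intro eventually_small) auto
    with ix(2) have "\<forall>\<^sub>F h in at_right 0. (i, x + of_real h * v) \<in> ?g (t + h)" by eventually_elim auto
    then show ?thesis using ix(1) True by (intro bexI[of _ "(i, x)"]) auto
  next
    case False
    then have t': "0 \<le> t - S" "t - S < T" using t by auto
    obtain i x where ix: "(i, x) \<in> \<delta> (t - S)" "\<forall>\<^sub>F h in at_right 0. (i, x + of_real h * v) \<in> \<delta> (t - S + h)"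
      using integral_curve_forward[OF \<delta> t'] .
    have "\<forall>\<^sub>F h in at_right (0::real). 0 < h" by (simp add: eventually_at_right_less)
    with ix(2) have "\<forall>\<^sub>F h in at_right 0. (i, x + of_real h * v) \<in> ?g (t + h)"
      by eventually_elim (use False in \<open>auto simp: algebra_simps\<close>)
    moreover have "?g t = \<delta> (t - S)" using False eq by (cases "t = S") auto
    ultimately show ?thesis using ix(1) by (intro bexI[of _ "(i, x)"]) auto
  qed
next
  fix t assume t: "0 < t" "t \<le> S + T"
  let ?g = "\<lambda>t. if t \<le> S then \<gamma> t else \<delta> (t - S)"
  show "\<exists>(i, x)\<in>?g t. \<forall>\<^sub>F h in at_right 0. (i, x + of_real h * (- v)) \<in> ?g (t - h)"
  proof (cases "t \<le> S")
    case True
    obtain i x where ix: "(i, x) \<in> \<gamma> t" "\<forall>\<^sub>F h in at_right 0. (i, x + of_real h * (- v)) \<in> \<gamma> (t - h)"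
      using integral_curve_backward[OF \<gamma> t(1) True] .
    have "\<forall>\<^sub>F h in at_right (0::real). 0 < h" by (simp add: eventually_at_right_less)
    with ix(2) have "\<forall>\<^sub>F h in at_right 0. (i, x + of_real h * (- v)) \<in> ?g (t - h)" by eventually_elim (use True in auto)
    then show ?thesis using ix(1) True by (intro bexI[of _ "(i, x)"]) auto
  next
    case False
    then have t': "0 < t - S" "t - S \<le> T" using t by auto
    obtain i x where ix: "(i, x) \<in> \<delta> (t - S)" "\<forall>\<^sub>F h in at_right 0. (i, x + of_real h * (- v)) \<in> \<delta> (t - S - h)"
      using integral_curve_backward[OF \<delta> t'] .
    have "\<forall>\<^sub>F h in at_right (0::real). h < t - S \<and> 0 < h" using t' by (intro eventually_small) auto
    with ix(2) have "\<forall>\<^sub>F h in at_right 0. (i, x + of_real h * (- v)) \<in> ?g (t - h)"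
      by eventually_elim (auto simp: algebra_simps)
    then show ?thesis using ix(1) False by (intro bexI[of _ "(i, x)"]) auto
  qed
qed

end

section \<open>The flow\<close>

definition flowv :: "surface \<Rightarrow> complex \<Rightarrow> real \<Rightarrow> (nat \<times> complex) set \<Rightarrow> (nat \<times> complex) set \<Rightarrow> bool" where
  "flowv X v t p q \<longleftrightarrow> 0 \<le> t \<and> (\<exists>\<gamma>. integral_curve X v t \<gamma> \<and>
     \<gamma> 0 = p \<and> \<gamma> t = q \<and> (\<forall>s\<in>{0..t}. \<gamma> s \<notin> sing X))"

lemma flow_flowv: "flow X \<theta> = flowv X (direction \<theta>)"
  by (simp add: flow_def flowv_def fun_eq_iff)

lemma norm_direction: "norm (direction \<theta>) = 1"
  by (simp add: direction_def cmod_def)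

context transl_surface
begin

lemma flowE:
  assumes "flowv X v t p q" "norm v = 1"
  obtains \<gamma> b where "integral_curve X v t \<gamma>" "\<gamma> 0 = p" "\<gamma> t = q" "0 < b" "\<And>s. 0 \<le> s \<Longrightarrow> s \<le> t \<Longrightarrow> reg b (\<gamma> s)" "0 \<le> t"
proof -
  obtain \<gamma> where \<gamma>: "0 \<le> t" "integral_curve X v t \<gamma>" "\<gamma> 0 = p" "\<gamma> t = q" "\<forall>s\<in>{0..t}. \<gamma> s \<notin> sing X"
    using assms(1) by (auto simp: flowv_def)
  then have "\<exists>b>0. \<forall>s. 0 \<le> s \<longrightarrow> s \<le> t \<longrightarrow> reg b (\<gamma> s)"
    by (intro integral_curve_radius[OF \<gamma>(2) assms(2)]) auto
  then show ?thesis using that \<gamma> by blast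
qed

lemma flowI:
  assumes "integral_curve X v t \<gamma>" "0 \<le> t" "\<And>s. 0 \<le> s \<Longrightarrow> s \<le> t \<Longrightarrow> \<gamma> s \<notin> sing X" "p = \<gamma> 0" "q = \<gamma> t"
  shows "flowv X v t p q"
  using assms unfolding flowv_def by (auto intro!: exI[of _ \<gamma>])

lemma flow_nonsing:
  assumes "flowv X v t p q"
  shows "p \<in> points X" "p \<notin> sing X" "q \<in> points X" "q \<notin> sing X" "0 \<le> t"
  using assms integral_curve_points unfolding flowv_def by fastforce+

lemma flow_unique:
  assumes "flowv X v t p q" "flowv X v t p q'" "norm v = 1"
  shows "q = q'"
proof -
  obtain \<gamma> b where \<gamma>: "integral_curve X v t \<gamma>" "\<gamma> 0 = p" "\<gamma> t = q" "0 < b" "\<And>s. 0 \<le> s \<Longrightarrow> s \<le> t \<Longrightarrow> reg b (\<gamma> s)" "0 \<le> t"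
    using flowE[OF assms(1,3)] by blast
  obtain \<delta> c where \<delta>: "integral_curve X v t \<delta>" "\<delta> 0 = p" "\<delta> t = q'" "0 < c" "\<And>s. 0 \<le> s \<Longrightarrow> s \<le> t \<Longrightarrow> reg c (\<delta> s)"
    using flowE[OF assms(2,3)] by blast
  have "\<delta> t = \<gamma> t"
    by (rule integral_curve_unique[OF \<gamma>(1) \<delta>(1) assms(3), of 0]) (use \<gamma> \<delta> reg_nonsing(2)[OF \<gamma>(5)] in auto)
  then show ?thesis using \<gamma> \<delta> by simp
qed

lemma flow_inj:
  assumes "flowv X v t p q" "flowv X v t p' q" "norm v = 1"
  shows "p = p'"
proof -
  obtain \<gamma> b where \<gamma>: "integral_curve X v t \<gamma>" "\<gamma> 0 = p" "\<gamma> t = q" "0 < b" "\<And>s. 0 \<le> s \<Longrightarrow> s \<le> t \<Longrightarrow> reg b (\<gamma> s)" "0 \<le> t"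
    using flowE[OF assms(1,3)] by blast
  obtain \<delta> c where \<delta>: "integral_curve X v t \<delta>" "\<delta> 0 = p'" "\<delta> t = q" "0 < c" "\<And>s. 0 \<le> s \<Longrightarrow> s \<le> t \<Longrightarrow> reg c (\<delta> s)"
    using flowE[OF assms(2,3)] by blast
  have "\<delta> 0 = \<gamma> 0"
    by (rule integral_curve_unique[OF \<gamma>(1) \<delta>(1) assms(3), of t]) (use \<gamma> \<delta> reg_nonsing(2)[OF \<gamma>(5)] in auto)
  then show ?thesis using \<gamma> \<delta> by simp
qed

lemma flow_along:
  assumes "integral_curve X v T \<gamma>" "\<And>t. 0 \<le> t \<Longrightarrow> t \<le> T \<Longrightarrow> reg b (\<gamma> t)" "0 \<le> a" "a \<le> c" "c \<le> T"
  shows "flowv X v (c - a) (\<gamma> a) (\<gamma> c)"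
  using integral_curve_sub[OF assms(1,3), of "c - a"] assms reg_nonsing(2)[OF assms(2)]
  by (intro flowI[of v "c - a" "\<lambda>t. \<gamma> (a + t)"]) auto

lemma flow_zero: "p \<in> points X \<Longrightarrow> p \<notin> sing X \<Longrightarrow> flowv X v 0 p p"
  by (rule flowI[of v 0 "\<lambda>_. p"]) (auto simp: integral_curve_def)

lemma flow_add:
  assumes "flowv X v s p q" "flowv X v t q r"
  shows "flowv X v (s + t) p r"
proof -
  obtain \<gamma> where \<gamma>: "0 \<le> s" "integral_curve X v s \<gamma>" "\<gamma> 0 = p" "\<gamma> s = q" "\<forall>u\<in>{0..s}. \<gamma> u \<notin> sing X"
    using assms(1) by (auto simp: flowv_def)
  obtain \<delta> where \<delta>: "0 \<le> t" "integral_curve X v t \<delta>" "\<delta> 0 = q" "\<delta> t = r" "\<forall>u\<in>{0..t}. \<delta> u \<notin> sing X"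
    using assms(2) by (auto simp: flowv_def)
  show ?thesis
    by (rule flowI[OF integral_curve_concat[OF \<gamma>(2) \<delta>(2)]]) (use \<gamma> \<delta> in auto)
qed

lemma flow_split:
  assumes "flowv X v t p r" "0 \<le> s" "s \<le> t"
  obtains q where "flowv X v s p q" "flowv X v (t - s) q r"
proof -
  obtain \<gamma> where \<gamma>: "integral_curve X v t \<gamma>" "\<gamma> 0 = p" "\<gamma> t = r" "\<forall>u\<in>{0..t}. \<gamma> u \<notin> sing X"
    using assms(1) by (auto simp: flowv_def)
  have "flowv X v s p (\<gamma> s)"
    using integral_curve_sub[OF \<gamma>(1), of 0 s] assms \<gamma> by (intro flowI[of v s \<gamma>]) auto
  moreover have "flowv X v (t - s) (\<gamma> s) r"
    using integral_curve_sub[OF \<gamma>(1), of s "t - s"] assms \<gamma> by (intro flowI[of v "t - s" "\<lambda>u. \<gamma> (s + u)"]) auto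
  ultimately show ?thesis using that by blast
qed

lemma flow_diff:
  assumes "flowv X v s p q" "flowv X v t p r" "s \<le> t" "norm v = 1"
  shows "flowv X v (t - s) q r"
proof -
  obtain q' where "flowv X v s p q'" "flowv X v (t - s) q' r"
    using flow_split[OF assms(2) flow_nonsing(5)[OF assms(1)] assms(3)] .
  then show ?thesis using flow_unique[OF assms(1) _ assms(4)] by blast
qed

lemma flow_translate:
  assumes \<gamma>: "integral_curve X v t \<gamma>" and v: "norm v = 1" and r: "\<And>s. 0 \<le> s \<Longrightarrow> s \<le> t \<Longrightarrow> reg b (\<gamma> s)"
    and t: "0 \<le> t" and w: "norm w < b"
  shows "flowv X v t (shift (\<gamma> 0) w) (shift (\<gamma> t) w)"
  by (rule flowI[OF integral_curve_translate[OF \<gamma> v r w] t]) (use shift_points[OF r w] in auto)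

lemma flow_shift_local:
  assumes "flowv X v t p q" "norm v = 1"
  obtains b where "0 < b" "reg b p" "reg b q" "\<And>w. norm w < b \<Longrightarrow> flowv X v t (shift p w) (shift q w)"
proof -
  obtain \<gamma> b where \<gamma>: "integral_curve X v t \<gamma>" "\<gamma> 0 = p" "\<gamma> t = q" "0 < b" "\<And>s. 0 \<le> s \<Longrightarrow> s \<le> t \<Longrightarrow> reg b (\<gamma> s)" "0 \<le> t"
    using flowE[OF assms] by blast
  have "flowv X v t (shift p w) (shift q w)" if "norm w < b" for w
    using flow_translate[OF \<gamma>(1) assms(2) \<gamma>(5,6) that] \<gamma>(2,3) by simp
  then show ?thesis using that[of b] \<gamma> by (metis order_refl)
qed

lemma flow_straight:
  assumes r: "reg b p" and v: "norm v = 1" and z: "norm z + t < b" and t: "0 \<le> t"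
  shows "flowv X v t (shift p z) (shift p (z + of_real t * v))"
proof (rule flowI[where \<gamma> = "\<lambda>s. shift p (z + of_real s * v)"])
  have nb: "norm (z + of_real s * v) < b" if "0 \<le> s" "s \<le> t" for s
  proof -
    have "norm (z + of_real s * v) \<le> norm z + norm (of_real s * v)" by (rule norm_triangle_ineq)
    also have "norm (of_real s * v) = s" using v that by (simp add: norm_mult)
    finally show ?thesis using z that by simp
  qed
  show "integral_curve X v t (\<lambda>s. shift p (z + of_real s * v))"
  proof (rule integral_curve_charts)
    fix s assume s: "0 \<le> s" "s \<le> t"
    show "\<exists>U \<psi> z'. chart X U \<psi> \<and> z' \<in> U \<and> shift p (z + of_real s * v) = \<psi> z' \<and>
      (s < t \<longrightarrow> (\<forall>\<^sub>F h in at_right 0. shift p (z + of_real (s + h) * v) = \<psi> (z' + of_real h * v))) \<and>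
      (0 < s \<longrightarrow> (\<forall>\<^sub>F h in at_right 0. shift p (z + of_real (s - h) * v) = \<psi> (z' + of_real h * (- v))))"
      using shift_chart(1)[OF r] nb[OF s]
      by (intro exI[of _ "ball 0 b"] exI[of _ "shift p"] exI[of _ "z + of_real s * v"]) (auto simp: algebra_simps)
  qed
  show "shift p (z + of_real s * v) \<notin> sing X" if "0 \<le> s" "s \<le> t" for s
    using shift_points[OF r nb[OF that]] by simp
qed (use t in auto)

lemma flow_closed_orbit:
  assumes \<gamma>: "integral_curve X v T \<gamma>" "\<And>t. 0 \<le> t \<Longrightarrow> t \<le> T \<Longrightarrow> reg b (\<gamma> t)" "\<gamma> T = \<gamma> 0"
    and s: "0 \<le> s" "s \<le> T"
  shows "flowv X v T (\<gamma> s) (\<gamma> s)"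
  using flow_add[OF flow_along[OF \<gamma>(1,2) s order_refl] flow_along[OF \<gamma>(1,2) order_refl s, folded \<gamma>(3)]] by simp

section \<open>Open and closed sets of points\<close>

text \<open>The surface is compact: infinitely many points lie in the same polygon, and polygons are
  compact.\<close>

lemma points_limit:
  assumes "\<And>m::nat. q m \<in> points X"
  obtains r i x y where "strict_mono r" "i < n_polys" "x \<in> region (poly i)" "y \<longlonglongrightarrow> x"
    "\<And>m. y m \<in> region (poly i)" "\<And>m. q (r m) = pt X i (y m)"
proof -
  have "\<forall>m. \<exists>i x. i < n_polys \<and> x \<in> region (poly i) \<and> q m = pt X i x"
    using assms pointsE by metis
  then obtain f g where fg: "\<And>m. f m < n_polys" "\<And>m. g m \<in> region (poly (f m))" "\<And>m. q m = pt X (f m) (g m)" by metis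
  have "\<exists>i\<in>{..<n_polys}. infinite {m\<in>UNIV. f m = i}"
    by (rule pigeonhole_infinite_rel) (use fg in auto)
  then obtain i where i: "i < n_polys" "infinite {m. f m = i}" by auto
  obtain r :: "nat \<Rightarrow> nat" where r: "strict_mono r" "\<And>m. f (r m) = i"
    using infinite_enumerate[OF i(2)] by (metis (mono_tags, lifting) mem_Collect_eq)
  have "\<forall>m. g (r m) \<in> region (poly i)" using fg(2) r(2) by metis
  then obtain x s where xs: "x \<in> region (poly i)" "strict_mono s" "(\<lambda>m. g (r (s m))) \<longlonglongrightarrow> x"
    using compact_region[of "poly i"] unfolding compact_def
    by (elim allE[of _ "\<lambda>m. g (r m)"]) (auto simp: comp_def)
  show ?thesis
    by (rule that[of "r \<circ> s" i x "\<lambda>m. g (r (s m))"])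
      (use i r xs fg in \<open>auto simp: strict_mono_o\<close>, metis+)
qed

lemma near_point:
  assumes r: "reg \<rho> (pt X i x)" and i: "i < n_polys" "x \<in> region (poly i)"
  shows "\<exists>e>0. \<forall>y\<in>region (poly i). dist y x < e \<longrightarrow> dist y x < \<rho> \<and> pt X i y = shift (pt X i x) (y - x)"
proof -
  note c = shift_chart[OF r]
  have \<rho>: "0 < \<rho>" using r by (simp add: reg_def)
  have "(i, x) \<in> shift (pt X i x) 0" using pt_self[OF i] c(2) by simp
  from chart_compat[OF c(1) _ this] \<rho>
  have "\<forall>\<^sub>F w in nhds 0. x + w \<in> region (poly i) \<longrightarrow> (i, x + w) \<in> shift (pt X i x) w" by simp
  then obtain e where e: "e > 0" "\<And>w. dist w 0 < e \<Longrightarrow> x + w \<in> region (poly i) \<Longrightarrow> (i, x + w) \<in> shift (pt X i x) w"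
    unfolding eventually_nhds_metric by blast
  have "dist y x < \<rho> \<and> pt X i y = shift (pt X i x) (y - x)" if y: "y \<in> region (poly i)" "dist y x < min e \<rho>" for y
  proof -
    have "(i, y) \<in> shift (pt X i x) (y - x)" using e(2)[of "y - x"] y by (simp add: dist_norm)
    moreover have "shift (pt X i x) (y - x) \<in> points X" using chart_points[OF c(1)] y by (simp add: dist_norm)
    ultimately show ?thesis using rep_pt y by auto
  qed
  then show ?thesis using e(1) \<rho> by (intro exI[of _ "min e \<rho>"]) auto
qed

text \<open>Such a set is open and closed. By connectedness it is empty or the whole surface, and it is
  not the whole surface because it does not contain the points of \<open>\<Sigma>\<close>. Both contradictions below,
  to a periodic orbit and to two close returns, arise in this way.\<close>

lemma clopen_empty:
  assumes nb: "\<And>p. p \<in> A \<Longrightarrow> \<exists>\<rho>>0. reg \<rho> p \<and> (\<forall>w. norm w < \<rho> \<longrightarrow> shift p w \<in> A)"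
    and closed: "\<And>i x y. i < n_polys \<Longrightarrow> x \<in> region (poly i) \<Longrightarrow> (\<And>m. y m \<in> region (poly i)) \<Longrightarrow>
       (\<And>m. pt X i (y m) \<in> A) \<Longrightarrow> y \<longlonglongrightarrow> x \<Longrightarrow> pt X i x \<in> A"
  shows "A = {}"
proof -
  have sub: "A \<subseteq> points X" "A \<inter> sing X = {}" using nb reg_nonsing by blast+
  have opA: "openin (surface_topology X) A"
    unfolding openin_surface_topology
  proof (intro conjI sub allI impI)
    fix i assume i: "i < n_polys"
    show "openin (top_of_set (region (poly i))) (polygon_part X i A)"
      unfolding openin_euclidean_subtopology_iff
    proof (intro conjI ballI)
      fix x assume "x \<in> polygon_part X i A"
      then have x: "x \<in> region (poly i)" "pt X i x \<in> A" by (auto simp: polygon_part_def)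
      obtain \<rho> where \<rho>: "reg \<rho> (pt X i x)" "\<And>w. norm w < \<rho> \<Longrightarrow> shift (pt X i x) w \<in> A" using nb[OF x(2)] by blast
      obtain e where e: "e > 0" "\<And>y. y \<in> region (poly i) \<Longrightarrow> dist y x < e \<Longrightarrow> dist y x < \<rho> \<and> pt X i y = shift (pt X i x) (y - x)"
        using near_point[OF \<rho>(1) i x(1)] by blast
      show "\<exists>e>0. \<forall>x'\<in>region (poly i). dist x' x < e \<longrightarrow> x' \<in> polygon_part X i A"
        using e \<rho>(2) by (intro exI[of _ e]) (auto simp: polygon_part_def dist_norm)
    qed (auto simp: polygon_part_def)
  qed
  have opB: "openin (surface_topology X) (points X - A)"
    unfolding openin_surface_topology
  proof (intro conjI allI impI)
    fix i assume i: "i < n_polys"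
    have "closed (polygon_part X i A)"
      unfolding closed_sequential_limits
    proof (intro allI impI, elim conjE)
      fix y x assume y: "\<forall>m. y m \<in> polygon_part X i A" "y \<longlonglongrightarrow> x"
      then have "x \<in> region (poly i)"
        using compact_imp_closed[OF compact_region] closed_sequentially[of "region (poly i)" y x] by (auto simp: polygon_part_def)
      then show "x \<in> polygon_part X i A" using closed[OF i _ _ _ y(2)] y(1) by (auto simp: polygon_part_def)
    qed
    moreover have "polygon_part X i (points X - A) = region (poly i) - polygon_part X i A"
      using pt_in_points[OF i] by (auto simp: polygon_part_def)
    ultimately show "openin (top_of_set (region (poly i))) (polygon_part X i (points X - A))"
      by (metis Diff_eq open_Compl openin_open_Int)
  qed auto
  have "topspace (surface_topology X) \<subseteq> points X"
    unfolding topspace_def by (auto simp: openin_surface_topology)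
  then have "A = {} \<or> points X - A = {}"
    using connected_surface opA opB unfolding connected_space_def by blast
  then show ?thesis using sub sing_nonempty sing_points by blast
qed

section \<open>Orbits near a singular point\<close>

text \<open>Around a singular point there is no chart, but a curve in the cone around \<open>p\<close> still moves on
  straight lines in the coordinates that have a representative of \<open>p\<close> as their origin.\<close>

lemma in_cone:
  assumes \<gamma>: "integral_curve X v T \<gamma>" and tame: "tame \<rho> p" and p: "p \<in> points X"
    and ab: "0 \<le> a" "b \<le> T" and z: "\<And>t. a \<le> t \<Longrightarrow> t \<le> b \<Longrightarrow> norm (z + of_real t * v) < \<rho>"
    and s: "a \<le> s" "s \<le> b" "\<exists>(j, y)\<in>p. (j, y + (z + of_real s * v)) \<in> \<gamma> s" and t: "a \<le> t" "t \<le> b"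
  shows "\<exists>(j, y)\<in>p. (j, y + (z + of_real t * v)) \<in> \<gamma> t"
proof -
  let ?Q = "\<lambda>t. \<exists>(j, y)\<in>p. (j, y + (z + of_real t * v)) \<in> \<gamma> t"
  have loc: "(i, x - (z + of_real t * v)) \<in> p" if t: "a \<le> t" "t \<le> b" and Q: "?Q t" and x: "(i, x) \<in> \<gamma> t" for i x t
  proof -
    obtain j y where y: "(j, y) \<in> p" "(j, y + (z + of_real t * v)) \<in> \<gamma> t" using Q by auto
    have "\<gamma> t \<in> points X" using integral_curve_points[OF \<gamma>] t ab by simp
    then have "pt X j (y + (z + of_real t * v)) = \<gamma> t" "y + (z + of_real t * v) \<in> region (poly j)"
      using rep_pt rep_in y(2) by blast+
    then show ?thesis using tame y(1) z[OF t] x unfolding tame_def by blast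
  qed
  have "?Q s = ?Q t"
  proof (rule interval_locally_constant[where Q = ?Q, OF _ _ s(1,2) t])
    fix t assume t: "a \<le> t" "t < b"
    then have t': "0 \<le> t" "t < T" using ab by auto
    obtain i x where ix: "(i, x) \<in> \<gamma> t" "\<forall>\<^sub>F h in at_right 0. (i, x + of_real h * v) \<in> \<gamma> (t + h)"
      using integral_curve_forward[OF \<gamma> t'] .
    have "\<forall>\<^sub>F h in at_right (0::real). h < b - t \<and> 0 < h" using t by (intro eventually_small) simp
    with ix(2) show "\<forall>\<^sub>F h in at_right 0. ?Q t = ?Q (t + h)"
    proof eventually_elim
      case (elim h)
      show ?case
      proof
        assume Q: "?Q t"
        have "(i, x - (z + of_real t * v)) \<in> p" by (rule loc[OF _ _ Q ix(1)]) (use t in auto)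
        then show "?Q (t + h)" using elim(1)
          by (intro bexI[of _ "(i, x - (z + of_real t * v))"]) (auto simp: algebra_simps)
      next
        assume Q: "?Q (t + h)"
        have "(i, x + of_real h * v - (z + of_real (t + h) * v)) \<in> p" by (rule loc[OF _ _ Q elim(1)]) (use t elim in auto)
        then show "?Q t" using ix(1)
          by (intro bexI[of _ "(i, x + of_real h * v - (z + of_real (t + h) * v))"]) (auto simp: algebra_simps)
      qed
    qed
  next
    fix t assume t: "a < t" "t \<le> b"
    then have t': "0 < t" "t \<le> T" using ab by auto
    obtain i x where ix: "(i, x) \<in> \<gamma> t" "\<forall>\<^sub>F h in at_right 0. (i, x + of_real h * (- v)) \<in> \<gamma> (t - h)"
      using integral_curve_backward[OF \<gamma> t'] .
    have "\<forall>\<^sub>F h in at_right (0::real). h < t - a \<and> 0 < h" using t by (intro eventually_small) simp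
    with ix(2) show "\<forall>\<^sub>F h in at_right 0. ?Q t = ?Q (t - h)"
    proof eventually_elim
      case (elim h)
      show ?case
      proof
        assume Q: "?Q t"
        have "(i, x - (z + of_real t * v)) \<in> p" by (rule loc[OF _ _ Q ix(1)]) (use t in auto)
        then show "?Q (t - h)" using elim(1)
          by (intro bexI[of _ "(i, x - (z + of_real t * v))"]) (auto simp: algebra_simps)
      next
        assume Q: "?Q (t - h)"
        have "(i, x + of_real h * (- v) - (z + of_real (t - h) * v)) \<in> p" by (rule loc[OF _ _ Q elim(1)]) (use t elim in auto)
        then show "?Q t" using ix(1)
          by (intro bexI[of _ "(i, x + of_real h * (- v) - (z + of_real (t - h) * v))"]) (auto simp: algebra_simps)
      qed
    qed
  qed
  then show ?thesis using s(3) by blast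
qed

lemma cone_radius:
  assumes p: "p \<in> points X"
  obtains \<rho> where "0 < \<rho>" "tame \<rho> p" "\<And>i x z. (i, x) \<in> p \<Longrightarrow> 0 < norm z \<Longrightarrow> norm z < \<rho> \<Longrightarrow> (i, x + z) \<notin> V"
proof -
  have "\<forall>\<^sub>F \<rho> in at_right (0::real). 0 < \<rho>" by (simp add: eventually_at_right_less)
  with eventually_tame[OF p] eventually_no_vertex[OF p]
  have "\<forall>\<^sub>F \<rho> in at_right (0::real). 0 < \<rho> \<and> tame \<rho> p \<and> (\<forall>(i, x)\<in>p. \<forall>z. 0 < norm z \<and> norm z < \<rho> \<longrightarrow> (i, x + z) \<notin> V)"
    by eventually_elim auto
  from eventually_happens'[OF trivial_limit_at_right_real this] show ?thesis using that by blast
qed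

text \<open>Of the finitely many polygons at \<open>p\<close> one is involved for arbitrarily small \<open>h\<close>, and it
  contains a first piece of the ray because no ray enters and leaves it infinitely often.\<close>

lemma ray_corner:
  assumes p: "p \<in> points X" and fr: "\<exists>\<^sub>F h in at_right (0::real). \<exists>(j, y)\<in>p. y + of_real h * u \<in> region (poly j) \<and> P h j y"
    and e: "0 < e"
  obtains j y h where "(j, y) \<in> p" "0 < h" "h < e" "P h j y" "\<And>t. 0 \<le> t \<Longrightarrow> t \<le> h \<Longrightarrow> y + of_real t * u \<in> region (poly j)"
proof -
  have "\<exists>a\<in>p. \<exists>\<^sub>F h in at_right (0::real). snd a + of_real h * u \<in> region (poly (fst a)) \<and> P h (fst a) (snd a)"
  proof (rule ccontr)
    assume "\<not> ?thesis"
    then have "\<forall>\<^sub>F h in at_right (0::real). \<forall>a\<in>p. \<not> (snd a + of_real h * u \<in> region (poly (fst a)) \<and> P h (fst a) (snd a))"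
      by (intro eventually_ball_finite finite_point[OF p]) (auto simp: frequently_def)
    then have "\<forall>\<^sub>F h in at_right (0::real). \<not> (\<exists>(j, y)\<in>p. y + of_real h * u \<in> region (poly j) \<and> P h j y)"
      by eventually_elim auto
    with fr show False by (simp add: frequently_def)
  qed
  then obtain j y where jy: "(j, y) \<in> p"
    and f: "\<exists>\<^sub>F h in at_right (0::real). y + of_real h * u \<in> region (poly j) \<and> P h j y" by auto
  have j: "j < n_polys" "y \<in> region (poly j)" using rep_in[OF p jy] by auto
  have "\<forall>\<^sub>F h in at_right (0::real). y + of_real h * u \<in> region (poly j)"
  proof (rule ccontr)
    assume "\<not> ?thesis"
    then have "\<forall>\<^sub>F h in at_right (0::real). y + of_real h * u \<notin> region (poly j)"
      using ray_eventually_region[OF simple[OF j(1)], of y u] by blast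
    then have "\<forall>\<^sub>F h in at_right (0::real). \<not> (y + of_real h * u \<in> region (poly j) \<and> P h j y)"
      by eventually_elim simp
    then show False using f by (simp add: frequently_def)
  qed
  then obtain e' where e': "e' > 0" "\<And>h. 0 < h \<Longrightarrow> h < e' \<Longrightarrow> y + of_real h * u \<in> region (poly j)"
    by (auto simp: eventually_at_right_field)
  have "\<exists>\<^sub>F h in at_right (0::real). P h j y \<and> h < min e e' \<and> 0 < h"
    using frequently_eventually_frequently[OF f eventually_small[of "min e e'"]] e e'(1)
    by (auto elim!: frequently_elim1)
  then obtain h where "P h j y" "h < min e e'" "0 < h" using frequently_ex by blast
  then show ?thesis using that[of j y h] jy e'(2) j(2) by (metis less_eq_real_def min_less_iff_conj mult_zero_left of_real_0 add_0_right order_le_less_trans)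
qed

lemma integral_curve_in_polygon:
  assumes j: "j < n_polys" and r: "\<And>t. 0 \<le> t \<Longrightarrow> t \<le> T \<Longrightarrow> y + of_real t * v \<in> region (poly j)"
  shows "integral_curve X v T (\<lambda>t. pt X j (y + of_real t * v))"
proof (rule integral_curveI)
  fix t assume t: "0 \<le> t" "t < T"
  have "\<forall>\<^sub>F h in at_right (0::real). h < T - t \<and> 0 < h" using t by (intro eventually_small) simp
  then have "\<forall>\<^sub>F h in at_right 0. (j, y + of_real t * v + of_real h * v) \<in> pt X j (y + of_real (t + h) * v)"
  proof eventually_elim
    case (elim h)
    then show ?case using pt_self[OF j r[of "t + h"]] t by (simp add: algebra_simps)
  qed
  then show "\<exists>(i, x)\<in>pt X j (y + of_real t * v). \<forall>\<^sub>F h in at_right 0. (i, x + of_real h * v) \<in> pt X j (y + of_real (t + h) * v)"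
    using pt_self[OF j r, of t] t by (intro bexI[of _ "(j, y + of_real t * v)"]) auto
next
  fix t assume t: "0 < t" "t \<le> T"
  have "\<forall>\<^sub>F h in at_right (0::real). h < t \<and> 0 < h" using t by (intro eventually_small) simp
  then have "\<forall>\<^sub>F h in at_right 0. (j, y + of_real t * v + of_real h * (- v)) \<in> pt X j (y + of_real (t - h) * v)"
  proof eventually_elim
    case (elim h)
    then show ?case using pt_self[OF j r[of "t - h"]] t by (simp add: algebra_simps)
  qed
  then show "\<exists>(i, x)\<in>pt X j (y + of_real t * v). \<forall>\<^sub>F h in at_right 0. (i, x + of_real h * (- v)) \<in> pt X j (y + of_real (t - h) * v)"
    using pt_self[OF j r, of t] t by (intro bexI[of _ "(j, y + of_real t * v)"]) auto
qed (use pt_in_points[OF j r] in auto)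

text \<open>Let \<open>s\<close> be the supremum of the times up to which the orbit of \<open>q\<close> exists, and let \<open>l\<close> be a limit of
  the points of the orbit as the time tends to \<open>s\<close>. It is singular, because a disc around it would let
  the orbit continue beyond \<open>s\<close>. In the cone around \<open>l\<close> the orbit is straight and tends to the apex, so
  its last piece lies on a ray from \<open>l\<close> inside one polygon. Along this ray the orbit extends to \<open>l\<close>.\<close>

lemma orbit_ends:
  assumes q: "q \<in> points X" "q \<notin> sing X" and v: "norm v = 1" and nT: "\<And>q'. \<not> flowv X v T q q'"
    and T: "0 \<le> T"
  obtains s \<delta> where "0 < s" "integral_curve X v s \<delta>" "\<delta> 0 = q" "\<delta> s \<in> sing X" "\<And>t. 0 \<le> t \<Longrightarrow> t < s \<Longrightarrow> \<delta> t \<notin> sing X"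
proof -
  define D where "D = {t. \<exists>q'. flowv X v t q q'}"
  have D0: "0 \<in> D" using flow_zero[OF q] by (auto simp: D_def)
  have down: "s \<in> D" if "t \<in> D" "0 \<le> s" "s \<le> t" for s t
  proof -
    obtain r where "flowv X v t q r" using \<open>t \<in> D\<close> by (auto simp: D_def)
    from flow_split[OF this that(2,3)] show ?thesis by (auto simp: D_def)
  qed
  have up: "\<exists>\<rho>>0. t + \<rho> \<in> D" if "t \<in> D" for t
  proof -
    obtain r where r: "flowv X v t q r" using \<open>t \<in> D\<close> by (auto simp: D_def)
    obtain \<rho> where \<rho>: "\<rho> > 0" "reg \<rho> r" using reg_exists flow_nonsing[OF r] by blast
    have "flowv X v (\<rho> / 2) (shift r 0) (shift r (0 + of_real (\<rho> / 2) * v))" by (rule flow_straight[OF \<rho>(2) v]) (use \<rho> in auto)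
    then have "flowv X v (t + \<rho> / 2) q (shift r (0 + of_real (\<rho> / 2) * v))"
      using flow_add[OF r] shift_chart(2)[OF \<rho>(2)] by simp
    then show ?thesis using \<rho>(1) by (intro exI[of _ "\<rho> / 2"]) (auto simp: D_def)
  qed
  have bdd: "t < T" if "t \<in> D" for t using down[OF that T] nT by (force simp: D_def)
  define s where "s = Sup D"
  have bddD: "bdd_above D" using bdd by (meson bdd_above.I less_imp_le)
  have le_s: "t \<le> s" if "t \<in> D" for t unfolding s_def using cSup_upper[OF that bddD] .
  have lt_s: "t < s" if "t \<in> D" for t using up[OF that] le_s by fastforce
  have s0: "0 < s" using lt_s D0 .
  have in_D: "t \<in> D" if ts: "0 \<le> t" "t < s" for t
  proof -
    obtain u where "u \<in> D" "t < u" using less_cSupD[of D t] D0 ts(2) unfolding s_def by blast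
    then show ?thesis using down ts(1) by simp
  qed
  define t where "t m = s - s / real (Suc (Suc m))" for m
  have t: "0 \<le> t m" "t m < s" for m using s0 by (auto simp: t_def field_simps)
  have "(\<lambda>m. s - s * inverse (real (Suc (Suc m)))) \<longlonglongrightarrow> s - s * 0"
    by (intro tendsto_intros LIMSEQ_Suc[OF LIMSEQ_inverse_real_of_nat])
  then have tlim: "t \<longlonglongrightarrow> s" by (simp add: t_def[abs_def] divide_inverse)
  have "\<forall>m. \<exists>r. flowv X v (t m) q r" using in_D[OF t] by (auto simp: D_def)
  then obtain f where f: "\<And>m. flowv X v (t m) q (f m)" by metis
  obtain r i x y where r: "strict_mono r" and i: "i < n_polys" "x \<in> region (poly i)" and y: "y \<longlonglongrightarrow> x"
    "\<And>m. y m \<in> region (poly i)" "\<And>m. f (r m) = pt X i (y m)"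
    using points_limit[of f] flow_nonsing(3)[OF f] by blast
  have trlim: "(\<lambda>m. t (r m)) \<longlonglongrightarrow> s" using LIMSEQ_subseq_LIMSEQ[OF tlim r] by (simp add: comp_def)
  let ?l = "pt X i x"
  have lp: "?l \<in> points X" by (rule pt_in_points[OF i])
  have lsing: "?l \<in> sing X"
  proof (rule ccontr)
    assume "?l \<notin> sing X"
    then obtain \<rho> where \<rho>: "\<rho> > 0" "reg \<rho> ?l" using reg_exists lp by blast
    obtain e where e: "e > 0" "\<And>y. y \<in> region (poly i) \<Longrightarrow> dist y x < e \<Longrightarrow> dist y x < \<rho> \<and> pt X i y = shift ?l (y - x)"
      using near_point[OF \<rho>(2) i] by blast
    have "\<forall>\<^sub>F m in sequentially. dist (y m) x < min e (\<rho> / 2)" using y(1) e \<rho> by (intro tendstoD) auto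
    moreover have "\<forall>\<^sub>F m in sequentially. dist (t (r m)) s < \<rho> / 4" using trlim \<rho> by (intro tendstoD) auto
    ultimately have "\<forall>\<^sub>F m in sequentially. dist (y m) x < min e (\<rho> / 2) \<and> dist (t (r m)) s < \<rho> / 4"
      by eventually_elim auto
    then obtain m where m: "dist (y m) x < min e (\<rho> / 2)" "dist (t (r m)) s < \<rho> / 4"
      using eventually_happens'[OF sequentially_bot] by blast
    have fm: "f (r m) = shift ?l (y m - x)" using e(2)[OF y(2)[of m]] m(1) y(3)[of m] by simp
    have "flowv X v (\<rho> / 4) (shift ?l (y m - x)) (shift ?l (y m - x + of_real (\<rho> / 4) * v))"
      by (rule flow_straight[OF \<rho>(2) v]) (use m(1) \<rho>(1) in \<open>auto simp: dist_norm\<close>)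
    then have "t (r m) + \<rho> / 4 \<in> D" using flow_add[OF f[of "r m"]] fm by (auto simp: D_def)
    from lt_s[OF this] m(2) show False unfolding dist_real_def by linarith
  qed
  obtain \<rho> where \<rho>: "0 < \<rho>" "tame \<rho> ?l" "\<And>i' x' z. (i', x') \<in> ?l \<Longrightarrow> 0 < norm z \<Longrightarrow> norm z < \<rho> \<Longrightarrow> (i', x' + z) \<notin> V"
    using cone_radius[OF lp] by blast
  have xl: "(i, x) \<in> ?l" by (rule pt_self[OF i])
  have lV: "?l \<subseteq> V" by (rule sing_in_V[OF lsing])
  have "\<forall>\<^sub>F m in sequentially. dist (y m) x < \<rho> / 4" using y(1) \<rho> by (intro tendstoD) auto
  moreover have "\<forall>\<^sub>F m in sequentially. dist (t (r m)) s < \<rho> / 4" using trlim \<rho> by (intro tendstoD) auto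
  ultimately have "\<forall>\<^sub>F m in sequentially. dist (y m) x < \<rho> / 4 \<and> dist (t (r m)) s < \<rho> / 4" by eventually_elim auto
  then obtain m0 where m0: "\<And>m. m \<ge> m0 \<Longrightarrow> dist (y m) x < \<rho> / 4" "\<And>m. m \<ge> m0 \<Longrightarrow> dist (t (r m)) s < \<rho> / 4"
    by (auto simp: eventually_sequentially)
  define t0 where "t0 = t (r m0)"
  define z0 where "z0 = y m0 - x"
  have t0: "0 \<le> t0" "t0 < s" "s - t0 < \<rho> / 4" using t[of "r m0"] m0(2)[of m0] by (auto simp: t0_def dist_real_def)
  have z0: "norm z0 < \<rho> / 4" using m0(1)[of m0] by (simp add: z0_def dist_norm)
  have q0: "f (r m0) = pt X i (x + z0)" using y(3) by (simp add: z0_def)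
  have cone: "\<exists>(j, y)\<in>?l. (j, y + (z0 + of_real (t1 - t0) * v)) \<in> p1"
    if t1: "t0 \<le> t1" "t1 < s" "flowv X v t1 q p1" for t1 p1
  proof -
    have fl: "flowv X v (t1 - t0) (f (r m0)) p1" using flow_diff[OF f[of "r m0"] that(3)] t1 v by (simp add: t0_def)
    obtain \<gamma> where \<gamma>: "integral_curve X v (t1 - t0) \<gamma>" "\<gamma> 0 = f (r m0)" "\<gamma> (t1 - t0) = p1"
      using fl by (auto simp: flowv_def)
    have "\<exists>(j, y)\<in>?l. (j, y + (z0 + of_real (t1 - t0) * v)) \<in> \<gamma> (t1 - t0)"
    proof (rule in_cone[OF \<gamma>(1) \<rho>(2) lp, of 0 "t1 - t0" _ 0])
      fix u assume u: "0 \<le> u" "u \<le> t1 - t0"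
      have "norm (z0 + of_real u * v) \<le> norm z0 + norm (of_real u * v)" by (rule norm_triangle_ineq)
      also have "norm (of_real u * v) = u" using u v by (simp add: norm_mult)
      finally show "norm (z0 + of_real u * v) < \<rho>" using z0 u t0 t1 by linarith
    next
      show "\<exists>(j, y)\<in>?l. (j, y + (z0 + of_real 0 * v)) \<in> \<gamma> 0"
        using xl q0 pt_self[OF i(1) y(2)[of m0]] \<gamma>(2) by (intro bexI[of _ "(i, x)"]) (auto simp: z0_def)
    qed (use t1 in auto)
    then show ?thesis using \<gamma>(3) by simp
  qed
  \<comment> \<open>the cone coordinate of the orbit at time \<open>t (r m)\<close> is \<open>y m - x\<close>, as \<open>x\<close> is the only vertex nearby\<close>
  have "y m - x = z0 + of_real (t (r m) - t0) * v" if m: "m \<ge> m0" for m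
  proof -
    have tm: "t0 \<le> t (r m)"
    proof -
      have "r m0 \<le> r m" using r m by (simp add: strict_mono_less_eq)
      then show ?thesis unfolding t0_def t_def using s0 by (auto simp: field_simps)
    qed
    let ?z = "z0 + of_real (t (r m) - t0) * v"
    have nz: "norm ?z < \<rho> / 2"
    proof -
      have "norm ?z \<le> norm z0 + norm (of_real (t (r m) - t0) * v)" by (rule norm_triangle_ineq)
      also have "norm (of_real (t (r m) - t0) * v) = t (r m) - t0" using tm v by (simp only: norm_mult norm_of_real) simp
      finally show ?thesis using z0 t0 t[of "r m"] by linarith
    qed
    obtain j u where ju: "(j, u) \<in> ?l" "(j, u + ?z) \<in> f (r m)"
      using cone[OF tm t(2) f[of "r m"]] by blast
    have fp: "f (r m) \<in> points X" using flow_nonsing(3)[OF f] .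
    have "pt X j (u + ?z) = f (r m)" "u + ?z \<in> region (poly j)" using rep_pt[OF fp ju(2)] rep_in[OF fp ju(2)] by auto
    moreover have "(i, y m) \<in> f (r m)" using y pt_self[OF i(1)] by simp
    ultimately have "(i, y m - ?z) \<in> ?l" using \<rho>(2) ju(1) nz \<rho>(1) unfolding tame_def by (smt (verit, best) field_sum_of_halves)
    then have "(i, y m - ?z) \<in> V" using lV by blast
    moreover have "x + (y m - ?z - x) = y m - ?z" by simp
    ultimately have inV: "(i, x + (y m - ?z - x)) \<in> V" by (simp only:)
    have "norm (y m - ?z - x) \<le> norm (y m - x) + norm ?z"
      using norm_triangle_ineq4[of "y m - x" ?z] by (simp add: algebra_simps)
    then have "norm (y m - ?z - x) < \<rho>" using nz m0(1)[OF m] \<rho>(1) by (simp add: dist_norm)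
    then have "y m - ?z - x = 0" using \<rho>(3)[OF xl, of "y m - ?z - x"] inV by auto
    then show ?thesis by (simp add: algebra_simps)
  qed
  then have "\<forall>\<^sub>F m in sequentially. y m - x = z0 + of_real (t (r m) - t0) * v"
    by (auto simp: eventually_sequentially)
  moreover have "(\<lambda>m. y m - x) \<longlonglongrightarrow> 0" using y(1) by (simp add: LIM_zero)
  ultimately have "(\<lambda>m. z0 + of_real (t (r m) - t0) * v) \<longlonglongrightarrow> 0" by (rule Lim_transform_eventually[rotated])
  moreover have "(\<lambda>m. z0 + of_real (t (r m) - t0) * v) \<longlonglongrightarrow> z0 + of_real (s - t0) * v"
    by (intro tendsto_intros trlim)
  ultimately have zs: "z0 + of_real (s - t0) * v = 0" using LIMSEQ_unique by blast
  have cone': "\<exists>(j, y)\<in>?l. (j, y + of_real h * (- v)) \<in> p1"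
    if h: "0 < h" "h \<le> s - t0" "flowv X v (s - h) q p1" for h p1
  proof -
    have "z0 + of_real (s - h - t0) * v = of_real h * (- v)" using zs by (simp add: algebra_simps)
    then show ?thesis using cone[of "s - h" p1] h by simp
  qed
  have "\<exists>\<^sub>F h in at_right (0::real). \<exists>(j, y)\<in>?l. y + of_real h * (- v) \<in> region (poly j) \<and>
      (\<exists>p1. flowv X v (s - h) q p1 \<and> (j, y + of_real h * (- v)) \<in> p1)"
  proof (rule eventually_frequently)
    show "\<forall>\<^sub>F h in at_right (0::real). \<exists>(j, y)\<in>?l. y + of_real h * (- v) \<in> region (poly j) \<and>
      (\<exists>p1. flowv X v (s - h) q p1 \<and> (j, y + of_real h * (- v)) \<in> p1)"
      using eventually_small[of "s - t0"] t0(2)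
    proof (auto elim!: eventually_mono)
      fix h assume h: "h < s - t0" "0 < h"
      obtain p1 where p1: "flowv X v (s - h) q p1" using in_D[of "s - h"] h t0 by (auto simp: D_def)
      obtain j y where jy: "(j, y) \<in> ?l" "(j, y + of_real h * (- v)) \<in> p1" using cone'[OF h(2) _ p1] h by auto
      then have "y + of_real h * (- v) \<in> region (poly j)" using rep_in flow_nonsing(3)[OF p1] by blast
      then show "\<exists>(j, y)\<in>?l. y - of_real h * v \<in> region (poly j) \<and> (\<exists>p1. flowv X v (s - h) q p1 \<and> (j, y - of_real h * v) \<in> p1)"
        using jy p1 by (intro bexI[of _ "(j, y)"]) auto
    qed
  qed simp
  from ray_corner[OF lp this, of "min s \<rho>"] s0 \<rho>(1) obtain j u h where ju: "(j, u) \<in> ?l" and h: "0 < h" "h < s" "h < \<rho>"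
    and ex: "\<exists>p1. flowv X v (s - h) q p1 \<and> (j, u + of_real h * (- v)) \<in> p1"
    and ray: "\<And>t. 0 \<le> t \<Longrightarrow> t \<le> h \<Longrightarrow> u + of_real t * (- v) \<in> region (poly j)"
    by (metis (no_types, lifting) min_less_iff_conj)
  obtain p1 where p1: "flowv X v (s - h) q p1" "(j, u + of_real h * (- v)) \<in> p1" using ex by blast
  obtain \<gamma> where \<gamma>: "integral_curve X v (s - h) \<gamma>" "\<gamma> 0 = q" "\<gamma> (s - h) = p1" "\<forall>t\<in>{0..s - h}. \<gamma> t \<notin> sing X"
    using p1(1) by (auto simp: flowv_def)
  define u' where "u' = u + of_real h * (- v)"
  have j: "j < n_polys" using rep_in[OF lp ju] by simp
  have back_ray: "u' + of_real t * v = u + of_real (h - t) * (- v)" for t by (simp add: u'_def algebra_simps)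
  have ray': "u' + of_real t * v \<in> region (poly j)" if "0 \<le> t" "t \<le> h" for t
    unfolding back_ray by (rule ray) (use that in auto)
  define \<eta> where "\<eta> t = pt X j (u' + of_real t * v)" for t
  have \<eta>: "integral_curve X v h \<eta>" unfolding \<eta>_def[abs_def] by (rule integral_curve_in_polygon[OF j ray'])
  have \<eta>0: "\<eta> 0 = p1" using rep_pt[OF flow_nonsing(3)[OF p1(1)] p1(2)] by (simp add: \<eta>_def u'_def)
  have \<eta>h: "\<eta> h = ?l" using rep_pt[OF lp ju] by (simp add: \<eta>_def u'_def)
  have \<eta>ns: "\<eta> t \<notin> sing X" if t: "0 \<le> t" "t < h" for t
  proof -
    have "norm (of_real (h - t) * (- v)) = h - t" using t v by (simp only: norm_mult norm_of_real norm_minus_cancel) simp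
    then have "(j, u' + of_real t * v) \<notin> V" 
      unfolding back_ray using \<rho>(3)[OF ju, of "of_real (h - t) * (- v)"] t h by (simp only:) simp
    moreover have "(j, u' + of_real t * v) \<in> \<eta> t" unfolding \<eta>_def by (rule pt_self[OF j ray']) (use t in auto)
    ultimately show ?thesis using sing_in_V by blast
  qed
  let ?\<delta> = "\<lambda>t. if t \<le> s - h then \<gamma> t else \<eta> (t - (s - h))"
  have "integral_curve X v (s - h + h) ?\<delta>"
    by (rule integral_curve_concat[OF \<gamma>(1) \<eta>]) (use \<gamma> \<eta>0 h in auto)
  then have "integral_curve X v s ?\<delta>" by simp
  then show ?thesis
    by (rule that[OF s0]) (use \<gamma> \<eta>h \<eta>ns h lsing in auto)
qed


section \<open>A Keane direction has no periodic orbit\<close>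

definition limit_of :: "(nat \<times> complex) set set \<Rightarrow> nat \<Rightarrow> complex \<Rightarrow> bool" where
  "limit_of C i x \<longleftrightarrow> i < n_polys \<and> x \<in> region (poly i) \<and>
     (\<exists>y. (\<forall>m::nat. y m \<in> region (poly i) \<and> pt X i (y m) \<in> C) \<and> y \<longlonglongrightarrow> x)"

lemma limit_near:
  assumes l: "limit_of C i x" and ns: "pt X i x \<notin> sing X"
  shows "\<exists>\<rho> y. reg \<rho> (pt X i x) \<and> 0 < \<rho> \<and> y \<longlonglongrightarrow> x \<and>
    (\<forall>m::nat. y m \<in> region (poly i) \<and> pt X i (y m) \<in> C) \<and>
    (\<forall>\<^sub>F m in sequentially. pt X i (y m) = shift (pt X i x) (y m - x))"
proof -
  obtain y where y: "i < n_polys" "x \<in> region (poly i)" "\<And>m::nat. y m \<in> region (poly i)" "\<And>m. pt X i (y m) \<in> C" "y \<longlonglongrightarrow> x"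
    using l by (auto simp: limit_of_def)
  obtain \<rho> where \<rho>: "0 < \<rho>" "reg \<rho> (pt X i x)" using reg_exists[OF pt_in_points[OF y(1,2)] ns] by blast
  obtain e where e: "e > 0" "\<And>y. y \<in> region (poly i) \<Longrightarrow> dist y x < e \<Longrightarrow> pt X i y = shift (pt X i x) (y - x)"
    using near_point[OF \<rho>(2) y(1,2)] by blast
  have "\<forall>\<^sub>F m in sequentially. dist (y m) x < e" using y(5) e(1) by (rule tendstoD)
  then have "\<forall>\<^sub>F m in sequentially. pt X i (y m) = shift (pt X i x) (y m - x)"
    by eventually_elim (use e(2) y(3) in blast)
  then show ?thesis using \<rho> y by blast
qed

text \<open>Assume that no singular point is a limit of the set \<open>C\<close> of points of period \<open>T\<close>. By
  compactness the points of \<open>C\<close> have discs of a common radius. A point close enough to \<open>C\<close> then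
  lies in the tube of a periodic orbit of period \<open>T\<close>, and is a point of \<open>C\<close> as a translate. So \<open>C\<close>
  is open and closed and consists of nonsingular points, but it is not empty.\<close>

lemma sing_limit_of_periodic:
  assumes v: "norm v = 1" and T: "0 < T" and ne: "flowv X v T p0 p0"
  defines "C \<equiv> {q. flowv X v T q q}"
  shows "\<exists>i x. limit_of C i x \<and> pt X i x \<in> sing X"
proof (rule ccontr)
  assume "\<not> ?thesis"
  then have ns: "\<And>i x. limit_of C i x \<Longrightarrow> pt X i x \<notin> sing X" by blast
  have "\<exists>b>0. \<forall>q\<in>C. reg b q"
  proof (rule ccontr)
    assume "\<not> ?thesis"
    then have "\<forall>m::nat. \<exists>q\<in>C. \<not> reg (inverse (real (Suc m))) q" by (metis inverse_positive_iff_positive of_nat_0_less_iff zero_less_Suc)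
    then obtain q where q: "\<And>m. q m \<in> C" "\<And>m. \<not> reg (inverse (real (Suc m))) (q m)" by metis
    have qp: "q m \<in> points X" for m using q(1)[of m] flow_nonsing(1) by (auto simp: C_def)
    obtain r i x y where r: "strict_mono r" and i: "i < n_polys" "x \<in> region (poly i)"
      and y: "y \<longlonglongrightarrow> x" "\<And>m. y m \<in> region (poly i)" "\<And>m. q (r m) = pt X i (y m)"
      using points_limit[of q] qp by blast
    have "\<forall>m. pt X i (y m) \<in> C" using q(1) y(3) by metis
    then have l: "limit_of C i x" using i y by (auto simp: limit_of_def)
    have nsl: "pt X i x \<notin> sing X" by (rule ns[OF l])
    obtain \<rho> where \<rho>: "0 < \<rho>" "reg \<rho> (pt X i x)" using reg_exists[OF pt_in_points[OF i] nsl] by blast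
    obtain e where e: "e > 0" "\<And>y. y \<in> region (poly i) \<Longrightarrow> dist y x < e \<Longrightarrow> pt X i y = shift (pt X i x) (y - x)"
      using near_point[OF \<rho>(2) i] by blast
    have "\<forall>\<^sub>F m in sequentially. dist (y m) x < min e (\<rho> / 2)" using y(1) e \<rho> by (intro tendstoD) auto
    moreover have "(\<lambda>m. inverse (real (Suc (r m)))) \<longlonglongrightarrow> 0"
      using LIMSEQ_subseq_LIMSEQ[OF LIMSEQ_inverse_real_of_nat r] by (simp add: comp_def)
    then have "\<forall>\<^sub>F m in sequentially. inverse (real (Suc (r m))) < \<rho> / 2" using \<rho>(1) by (intro order_tendstoD(2)) auto
    ultimately have "\<forall>\<^sub>F m in sequentially. dist (y m) x < min e (\<rho> / 2) \<and> inverse (real (Suc (r m))) < \<rho> / 2"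
      by eventually_elim auto
    then obtain m where m: "dist (y m) x < min e (\<rho> / 2)" "inverse (real (Suc (r m))) < \<rho> / 2"
      using eventually_happens'[OF sequentially_bot] by blast
    have "q (r m) = shift (pt X i x) (y m - x)" using e(2)[OF y(2)[of m]] m(1) y(3)[of m] by simp
    then have "reg (\<rho> - norm (y m - x)) (q (r m))" using reg_shift(1)[OF \<rho>(2), of "y m - x"] m(1) \<rho>(1) by (simp add: dist_norm)
    then have "reg (inverse (real (Suc (r m)))) (q (r m))"
      by (rule reg_mono) (use m in \<open>auto simp: dist_norm\<close>)
    then show False using q(2) by blast
  qed
  then obtain b where b: "0 < b" "\<And>q. q \<in> C \<Longrightarrow> reg b q" by blast
  have "C = {}"
  proof (rule clopen_empty)
    fix p assume "p \<in> C"
    then have "flowv X v T p p" by (simp add: C_def)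
    then obtain c where c: "0 < c" "reg c p" "\<And>w. norm w < c \<Longrightarrow> flowv X v T (shift p w) (shift p w)"
      using flow_shift_local[OF _ v] by metis
    then show "\<exists>\<rho>>0. reg \<rho> p \<and> (\<forall>w. norm w < \<rho> \<longrightarrow> shift p w \<in> C)" by (auto simp: C_def)
  next
    fix i x and y :: "nat \<Rightarrow> complex"
    assume "i < n_polys" "x \<in> region (poly i)" "\<And>m. y m \<in> region (poly i)" "\<And>m. pt X i (y m) \<in> C" "y \<longlonglongrightarrow> x"
    then have l: "limit_of C i x" by (auto simp: limit_of_def)
    obtain \<rho> y where \<rho>: "reg \<rho> (pt X i x)" "0 < \<rho>" and y: "y \<longlonglongrightarrow> x" "\<And>m::nat. y m \<in> region (poly i)" "\<And>m. pt X i (y m) \<in> C"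
      "\<forall>\<^sub>F m in sequentially. pt X i (y m) = shift (pt X i x) (y m - x)"
      using limit_near[OF l ns[OF l]] by blast
    have "\<forall>\<^sub>F m in sequentially. dist (y m) x < min b (\<rho> / 2)" using y(1) b(1) \<rho>(2) by (intro tendstoD) auto
    with y(4) have "\<forall>\<^sub>F m in sequentially. pt X i (y m) = shift (pt X i x) (y m - x) \<and> dist (y m) x < min b (\<rho> / 2)"
      by eventually_elim auto
    then obtain m where m: "pt X i (y m) = shift (pt X i x) (y m - x)" "dist (y m) x < min b (\<rho> / 2)"
      using eventually_happens'[OF sequentially_bot] by blast
    let ?q = "pt X i (y m)" and ?w = "x - y m"
    have nw: "norm ?w < b" "norm ?w < \<rho> / 2" using m(2) by (auto simp: dist_norm norm_minus_commute)
    have "shift ?q ?w = shift (pt X i x) ((y m - x) + ?w)"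
      unfolding m(1)
    proof (rule reg_shift(2)[OF \<rho>(1)])
      show "norm (y m - x) < \<rho>" "norm (y m - x) + norm (x - y m) < \<rho>"
        using nw(2) norm_ge_zero[of "x - y m"] unfolding norm_minus_commute[of "y m" x] by linarith+
    qed
    then have p: "shift ?q ?w = pt X i x" using shift_chart(2)[OF \<rho>(1)] by simp
    have fq: "flowv X v T ?q ?q" using y(3) by (simp add: C_def)
    obtain \<gamma> c where \<gamma>: "integral_curve X v T \<gamma>" "\<gamma> 0 = ?q" "\<gamma> T = ?q" "\<And>s. 0 \<le> s \<Longrightarrow> s \<le> T \<Longrightarrow> reg c (\<gamma> s)"
      using flowE[OF fq v] by metis
    have "reg b (\<gamma> s)" if s: "0 \<le> s" "s \<le> T" for s
      using b(2) flow_closed_orbit[OF \<gamma>(1,4) _ s] \<gamma>(2,3) by (simp add: C_def)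
    from flow_translate[OF \<gamma>(1) v this _ nw(1)] T
    show "pt X i x \<in> C" using \<gamma>(2,3) p by (simp add: C_def)
  qed
  then show False using ne by (auto simp: C_def)
qed

text \<open>Let the singular point \<open>l\<close> be a limit of points of period \<open>T\<close>. Their orbits accumulate on a
  ray that leaves \<open>l\<close> in direction \<open>\<theta>\<close>, which contains a nonsingular point \<open>q\<close>. If the orbit of \<open>q\<close> exists
  up to time \<open>T\<close>, then \<open>q\<close> has period \<open>T\<close> as a limit of such points; but followed backwards its
  orbit hits the singular point \<open>l\<close>. If not, the orbit ends in \<open>\<Sigma>\<close>, and together with the ray it
  is a saddle connection.\<close>

theorem no_periodic_orbit:
  assumes keane: "keane X \<theta>" and T: "0 < T"
  shows "\<not> flowv X (direction \<theta>) T p p"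
proof
  assume per: "flowv X (direction \<theta>) T p p"
  define v where "v = direction \<theta>"
  have v: "norm v = 1" by (simp add: v_def norm_direction)
  define C where "C = {q. flowv X v T q q}"
  obtain i x where l: "limit_of C i x" and sing: "pt X i x \<in> sing X"
    using sing_limit_of_periodic[OF v T] per unfolding v_def C_def by blast
  let ?l = "pt X i x"
  have i: "i < n_polys" "x \<in> region (poly i)" using l by (auto simp: limit_of_def)
  have lp: "?l \<in> points X" by (rule pt_in_points[OF i])
  have xl: "(i, x) \<in> ?l" by (rule pt_self[OF i])
  obtain y where y: "\<And>m::nat. y m \<in> region (poly i)" "\<And>m. pt X i (y m) \<in> C" "y \<longlonglongrightarrow> x"
    using l by (auto simp: limit_of_def)
  obtain \<rho> where \<rho>: "0 < \<rho>" "tame \<rho> ?l" "\<And>i' x' z. (i', x') \<in> ?l \<Longrightarrow> 0 < norm z \<Longrightarrow> norm z < \<rho> \<Longrightarrow> (i', x' + z) \<notin> V"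
    using cone_radius[OF lp] by blast
  \<comment> \<open>the orbits of the points \<open>y m\<close> run through the cone around \<open>l\<close> for a time \<open>h\<close>\<close>
  have lim: "\<exists>(j, u)\<in>?l. u + of_real h * v \<in> region (poly j) \<and> limit_of C j (u + of_real h * v)"
    if h: "0 < h" "h < min (\<rho> / 2) T" for h
  proof -
    have "\<forall>\<^sub>F m in sequentially. dist (y m) x < \<rho> / 2" using y(3) \<rho>(1) by (intro tendstoD) auto
    then obtain m0 where m0: "\<And>m. m \<ge> m0 \<Longrightarrow> dist (y m) x < \<rho> / 2" by (auto simp: eventually_sequentially)
    have "\<exists>a\<in>?l. snd a + (y m - x + of_real h * v) \<in> region (poly (fst a)) \<and> pt X (fst a) (snd a + (y m - x + of_real h * v)) \<in> C"
      if m: "m \<in> {m0..}" for m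
    proof -
      have fq: "flowv X v T (pt X i (y m)) (pt X i (y m))" using y(2) by (simp add: C_def)
      obtain \<gamma> c where \<gamma>: "integral_curve X v T \<gamma>" "\<gamma> 0 = pt X i (y m)" "\<gamma> T = pt X i (y m)" "\<And>s. 0 \<le> s \<Longrightarrow> s \<le> T \<Longrightarrow> reg c (\<gamma> s)"
        using flowE[OF fq v] by metis
      have "\<exists>(j, u)\<in>?l. (j, u + (y m - x + of_real h * v)) \<in> \<gamma> h"
      proof (rule in_cone[OF \<gamma>(1) \<rho>(2) lp, of 0 h _ 0])
        fix t assume t: "0 \<le> t" "t \<le> h"
        have "norm (y m - x + of_real t * v) \<le> norm (y m - x) + norm (of_real t * v)" by (rule norm_triangle_ineq)
        also have "norm (of_real t * v) = t" using t v by (simp add: norm_mult)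
        finally show "norm (y m - x + of_real t * v) < \<rho>" using m0[of m] m t h by (simp add: dist_norm)
      next
        show "\<exists>(j, u)\<in>?l. (j, u + (y m - x + of_real 0 * v)) \<in> \<gamma> 0"
          using xl \<gamma>(2) pt_self[OF i(1) y(1)[of m]] by (intro bexI[of _ "(i, x)"]) auto
      qed (use h in auto)
      then obtain j u where ju: "(j, u) \<in> ?l" "(j, u + (y m - x + of_real h * v)) \<in> \<gamma> h" by blast
      have "\<gamma> h \<in> points X" using integral_curve_points[OF \<gamma>(1)] h by simp
      note rp = rep_pt[OF this ju(2)] rep_in[OF this ju(2)]
      have "\<gamma> h \<in> C" using flow_closed_orbit[OF \<gamma>(1,4), of h] \<gamma>(2,3) h by (simp add: C_def)
      then show ?thesis using ju(1) rp by (intro bexI[of _ "(j, u)"]) auto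
    qed
    then have "\<exists>a\<in>?l. infinite {m\<in>{m0..}. snd a + (y m - x + of_real h * v) \<in> region (poly (fst a)) \<and> pt X (fst a) (snd a + (y m - x + of_real h * v)) \<in> C}"
      by (intro pigeonhole_infinite_rel finite_point[OF lp]) (auto simp: infinite_Ici)
    then obtain j u where ju: "(j, u) \<in> ?l"
      and inf: "infinite {m\<in>{m0..}. u + (y m - x + of_real h * v) \<in> region (poly j) \<and> pt X j (u + (y m - x + of_real h * v)) \<in> C}"
      by force
    obtain r :: "nat \<Rightarrow> nat" where r: "strict_mono r" "\<And>m. r m \<in> {m\<in>{m0..}. u + (y m - x + of_real h * v) \<in> region (poly j) \<and> pt X j (u + (y m - x + of_real h * v)) \<in> C}"
      using infinite_enumerate[OF inf] by blast
    define f where "f m = u + (y (r m) - x + of_real h * v)" for m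
    have f: "f m \<in> region (poly j)" "pt X j (f m) \<in> C" for m using r(2)[of m] by (auto simp: f_def)
    have "(\<lambda>m. y (r m)) \<longlonglongrightarrow> x" using LIMSEQ_subseq_LIMSEQ[OF y(3) r(1)] by (simp add: comp_def)
    then have "f \<longlonglongrightarrow> u + (x - x + of_real h * v)" unfolding f_def by (intro tendsto_intros)
    then have fl: "f \<longlonglongrightarrow> u + of_real h * v" by simp
    have "u + of_real h * v \<in> region (poly j)"
      using closed_sequentially[OF compact_imp_closed[OF compact_region] _ fl] f(1) by blast
    then show ?thesis using ju f fl rep_in[OF lp ju] by (intro bexI[of _ "(j, u)"]) (auto simp: limit_of_def)
  qed
  have "\<exists>\<^sub>F h in at_right (0::real). \<exists>(j, u)\<in>?l. u + of_real h * v \<in> region (poly j) \<and> limit_of C j (u + of_real h * v)"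
    by (rule eventually_frequently) (use eventually_small[of "min (\<rho> / 2) T"] \<rho>(1) T lim in \<open>auto elim!: eventually_mono\<close>)
  from ray_corner[OF lp this, of "min (\<rho> / 2) T"] \<rho>(1) T obtain j u h where ju: "(j, u) \<in> ?l"
    and h: "0 < h" "h < min (\<rho> / 2) T" and lim_h: "limit_of C j (u + of_real h * v)"
    and ray: "\<And>t. 0 \<le> t \<Longrightarrow> t \<le> h \<Longrightarrow> u + of_real t * v \<in> region (poly j)" by (metis half_gt_zero min_less_iff_conj)
  have j: "j < n_polys" using rep_in[OF lp ju] by simp
  define \<eta> where "\<eta> t = pt X j (u + of_real t * v)" for t
  have \<eta>: "integral_curve X v h \<eta>" unfolding \<eta>_def[abs_def] by (rule integral_curve_in_polygon[OF j ray])
  have \<eta>0: "\<eta> 0 = ?l" using rep_pt[OF lp ju] by (simp add: \<eta>_def)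
  have \<eta>ns: "\<eta> t \<notin> sing X" if t: "0 < t" "t \<le> h" for t
  proof -
    have "norm (of_real t * v) = t" using t v by (simp add: norm_mult)
    then have "(j, u + of_real t * v) \<notin> V" using \<rho>(3)[OF ju, of "of_real t * v"] t h by simp
    moreover have "(j, u + of_real t * v) \<in> \<eta> t" unfolding \<eta>_def by (rule pt_self[OF j ray]) (use t in auto)
    ultimately show ?thesis using sing_in_V by blast
  qed
  define q where "q = \<eta> h"
  have q: "q \<in> points X" "q \<notin> sing X" using \<eta>ns[of h] h integral_curve_points[OF \<eta>] by (auto simp: q_def)
  have qeq: "q = pt X j (u + of_real h * v)" by (simp add: q_def \<eta>_def)
  show False
  proof (cases "\<exists>q'. flowv X v T q q'")
    case True
    then obtain q' where q': "flowv X v T q q'" by blast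
    obtain b where b: "0 < b" "reg b q" "reg b q'" "\<And>w. norm w < b \<Longrightarrow> flowv X v T (shift q w) (shift q' w)"
      using flow_shift_local[OF q' v] by blast
    let ?x = "u + of_real h * v"
    obtain y where y: "y \<longlonglongrightarrow> ?x" "\<And>m::nat. y m \<in> region (poly j)" "\<And>m. pt X j (y m) \<in> C"
      "\<forall>\<^sub>F m in sequentially. pt X j (y m) = shift q (y m - ?x)"
      using limit_near[OF lim_h q(2)[unfolded qeq]] unfolding qeq by blast
    have "\<forall>\<^sub>F m in sequentially. dist (y m) ?x < b" using y(1) b(1) by (rule tendstoD)
    with y(4) have ev: "\<forall>\<^sub>F m in sequentially. (j, y m) \<in> shift q' (y m - ?x)"
    proof eventually_elim
      case (elim m)
      have "flowv X v T (pt X j (y m)) (shift q' (y m - ?x))" using b(4)[of "y m - ?x"] elim by (simp add: dist_norm)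
      moreover have "flowv X v T (pt X j (y m)) (pt X j (y m))" using y(3) by (simp add: C_def)
      ultimately have "shift q' (y m - ?x) = pt X j (y m)" using flow_unique[OF _ _ v] by blast
      then show ?case using pt_self[OF j y(2)] by simp
    qed
    have "(j, ?x) \<in> shift q' 0"
    proof (rule chart_lim[OF shift_chart(1)[OF b(3)]])
      show "(\<lambda>m. y m - ?x) \<longlonglongrightarrow> 0" using y(1) by (simp add: LIM_zero)
      show "\<exists>\<^sub>F m in sequentially. (j, y m) \<in> shift q' (y m - ?x)" using ev by (intro eventually_frequently) auto
    qed (use b y in auto)
    then have "q' = q" using shift_chart(2)[OF b(3)] rep_pt flow_nonsing(3)[OF q'] qeq by metis
    then obtain \<gamma> c where \<gamma>: "integral_curve X v T \<gamma>" "\<gamma> 0 = q" "\<gamma> T = q" "\<And>s. 0 \<le> s \<Longrightarrow> s \<le> T \<Longrightarrow> reg c (\<gamma> s)"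
      using flowE[OF q' v] by metis
    have "integral_curve X v h (\<lambda>t. \<gamma> (T - h + t))"
      using integral_curve_sub[OF \<gamma>(1), of "T - h" h] h by simp
    from integral_curve_unique[OF this \<eta> v, of h 0]
    have "\<eta> 0 = \<gamma> (T - h + 0)" using \<gamma> reg_nonsing(2)[OF \<gamma>(4)] h by (simp add: q_def)
    then show False using \<eta>0 sing \<gamma>(4)[of "T - h"] reg_nonsing(2) h by auto
  next
    case False
    then obtain s \<delta> where \<delta>: "0 < s" "integral_curve X v s \<delta>" "\<delta> 0 = q" "\<delta> s \<in> sing X" "\<And>t. 0 \<le> t \<Longrightarrow> t < s \<Longrightarrow> \<delta> t \<notin> sing X"
      using orbit_ends[OF q v _ less_imp_le[OF T]] by blast
    let ?g = "\<lambda>t. if t \<le> h then \<eta> t else \<delta> (t - h)"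
    have "integral_curve X v (h + s) ?g"
      by (rule integral_curve_concat[OF \<eta> \<delta>(2)]) (use \<delta> h in \<open>auto simp: q_def\<close>)
    then have "saddle_connection X \<theta> (h + s) ?g"
      unfolding saddle_connection_def v_def[symmetric] using \<delta> h \<eta>0 sing \<eta>ns by auto
    then show False using keane by (auto simp: keane_def)
  qed
qed

end

section \<open>Two close returns\<close>

context transl_surface
begin

text \<open>After a return with displacement \<open>\<zeta>\<close> the orbit runs parallel to its own beginning.\<close>

lemma returns_transport:
  assumes \<gamma>: "integral_curve X v T \<gamma>" and v: "norm v = 1" and r: "\<And>t. 0 \<le> t \<Longrightarrow> t \<le> T \<Longrightarrow> reg b (\<gamma> t)"
    and \<zeta>: "norm \<zeta> < b" and u: "0 \<le> u" "u \<le> T" "\<gamma> u = shift (\<gamma> 0) \<zeta>"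
    and d: "0 \<le> d" "u + d \<le> T" and w: "norm \<zeta> + norm w < b"
  shows "shift (\<gamma> (u + d)) w = shift (\<gamma> d) (\<zeta> + w)"
proof -
  have "integral_curve X v (T - u) (\<lambda>s. \<gamma> (u + s))" by (rule integral_curve_sub[OF \<gamma>]) (use u in auto)
  moreover have "integral_curve X v (T - u) \<gamma>" using integral_curve_sub[OF \<gamma>, of 0 "T - u"] u by simp
  then have "integral_curve X v (T - u) (\<lambda>s. shift (\<gamma> s) \<zeta>)"
    by (rule integral_curve_translate[OF _ v _ \<zeta>]) (use r u in auto)
  moreover have "\<gamma> (u + s) \<notin> sing X" if "0 \<le> s" "s \<le> T - u" for s
    using reg_nonsing(2)[OF r[of "u + s"]] that u by auto
  ultimately have "shift (\<gamma> d) \<zeta> = \<gamma> (u + d)"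
    using integral_curve_unique[of v "T - u" "\<lambda>s. \<gamma> (u + s)" "\<lambda>s. shift (\<gamma> s) \<zeta>" 0 d] v u d by simp
  moreover have "reg b (\<gamma> d)" using r d u by auto
  ultimately show ?thesis using reg_shift(2)[of b "\<gamma> d" \<zeta> w] \<zeta> w by simp
qed

text \<open>In the tube, the coordinates \<open>(\<tau>, \<omega>)\<close> stand for the point at time \<open>\<tau>\<close> of the orbit moved by \<open>\<omega>\<close>
  across the flow. The returns at the times \<open>u\<close> and \<open>T\<close> identify \<open>(\<tau> + u, \<omega>)\<close> with \<open>(\<tau>, \<omega> + z)\<close> and
  \<open>(T, \<omega>)\<close> with \<open>(0, \<omega> + s)\<close>, hence also \<open>(\<tau> + T - u, \<omega>)\<close> with \<open>(\<tau>, \<omega> + s - z)\<close>. Wherever \<open>\<tau>\<close> lies in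
  \<open>[0, T]\<close>, one of these identifications moves a point inwards if \<open>\<bar>\<omega>\<bar>\<close> is large, because \<open>z\<close> is positive
  and \<open>s - z\<close> is negative. So the strip \<open>\<bar>\<omega>\<bar> \<le> 5 * z\<close> contains no other points than the narrower strip
  \<open>\<bar>\<omega>\<bar> \<le> 3 * z\<close>. It is compact, and it is open since it has neither an edge nor an end: it is a flat
  torus without singular points. The bound \<open>10 * z < b\<close> keeps everything inside the tube.\<close>

theorem no_two_close_returns:
  assumes \<gamma>: "integral_curve X v T \<gamma>" and v: "norm v = 1" and n: "n = \<i> * v \<or> n = - (\<i> * v)"
    and r: "\<And>t. 0 \<le> t \<Longrightarrow> t \<le> T \<Longrightarrow> reg b (\<gamma> t)" and T: "0 < T"
    and s: "\<gamma> T = shift (\<gamma> 0) (of_real s * n)" and u: "0 \<le> u" "u \<le> T" "\<gamma> u = shift (\<gamma> 0) (of_real z * n)"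
    and sz: "\<bar>s\<bar> < z" "10 * z < b"
  shows False
proof -
  have nn: "norm n = 1" using n v by (auto simp: norm_mult)
  have nrm: "norm (of_real a * n) = \<bar>a\<bar>" "norm (of_real a * v) = \<bar>a\<bar>" for a by (simp_all add: norm_mult nn v)
  have nrm2: "norm (of_real a * v + of_real c * n) \<le> \<bar>a\<bar> + \<bar>c\<bar>" for a c
    using norm_triangle_ineq[of "of_real a * v" "of_real c * n"] by (simp only: nrm)
  have z0: "0 < z" using sz by linarith
  define E where "E \<tau> a c = shift (\<gamma> \<tau>) (of_real a * v + of_real c * n)" for \<tau> a c
  have sm: "shift p (of_real c * n + (of_real a * v + of_real d * n)) = shift p (of_real a * v + of_real (c + d) * n)" for p a c d
    by (simp add: algebra_simps)
  \<comment> \<open>the same point seen from two times of the orbit\<close>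
  have along: "E \<tau>' a c = E \<tau> (\<tau>' - \<tau> + a) c"
    if "0 \<le> \<tau>" "\<tau> \<le> T" "0 \<le> \<tau>'" "\<tau>' \<le> T" "\<bar>\<tau>' - \<tau>\<bar> + (\<bar>a\<bar> + \<bar>c\<bar>) < b" for \<tau> \<tau>' a c
  proof -
    have "\<gamma> \<tau>' = shift (\<gamma> \<tau>) (of_real (\<tau>' - \<tau>) * v)"
      by (rule integral_curve_shift[OF \<gamma> v that(1-4) r]) (use that in auto)
    moreover have "shift (shift (\<gamma> \<tau>) (of_real (\<tau>' - \<tau>) * v)) (of_real a * v + of_real c * n)
        = shift (\<gamma> \<tau>) (of_real (\<tau>' - \<tau>) * v + (of_real a * v + of_real c * n))"
      by (rule reg_shift(2)[OF r[OF that(1,2)]]) (use nrm nrm2[of a c] that(5) in \<open>auto simp del: of_real_diff\<close>)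
    ultimately show ?thesis by (simp add: E_def algebra_simps)
  qed
  \<comment> \<open>the three identifications, for the times \<open>u\<close>, \<open>T\<close> and \<open>T - u\<close>\<close>
  have ret_u: "E (\<tau> + u) a c = E \<tau> a (c + z)" if "0 \<le> \<tau>" "\<tau> + u \<le> T" "\<bar>a\<bar> + \<bar>c\<bar> + z < b" for \<tau> a c
  proof -
    have "shift (\<gamma> (u + \<tau>)) (of_real a * v + of_real c * n) = shift (\<gamma> \<tau>) (of_real z * n + (of_real a * v + of_real c * n))"
      by (rule returns_transport[OF \<gamma> v r _ u])
        (use that nrm nrm2[of a c] z0 in auto)
    then show ?thesis unfolding E_def sm by (simp add: add.commute)
  qed
  have ret_T: "E T a c = E 0 a (c + s)" if "\<bar>a\<bar> + \<bar>c\<bar> + \<bar>s\<bar> < b" for a c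
  proof -
    have "shift (\<gamma> (T + 0)) (of_real a * v + of_real c * n) = shift (\<gamma> 0) (of_real s * n + (of_real a * v + of_real c * n))"
      by (rule returns_transport[OF \<gamma> v r _ _ _ s]) (use that nrm nrm2[of a c] T in auto)
    then show ?thesis unfolding E_def sm by (simp add: add.commute)
  qed
  have "E (T - u) 0 0 = E (T - u) 0 (- z + z)" by simp
  also have "\<dots> = E T 0 (- z)" using ret_u[of "T - u" 0 "- z"] u sz z0 by simp
  also have "\<dots> = E 0 0 (s - z)" using ret_T[of 0 "- z"] sz by simp
  finally have Tu: "\<gamma> (T - u) = shift (\<gamma> 0) (of_real (s - z) * n)"
    using shift_chart(2)[OF r[of "T - u"]] u by (simp add: E_def)
  have ret_Tu: "E (\<tau> + (T - u)) a c = E \<tau> a (c + (s - z))" if "0 \<le> \<tau>" "\<tau> \<le> u" "\<bar>a\<bar> + \<bar>c\<bar> + \<bar>s - z\<bar> < b" for \<tau> a c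
  proof -
    have "shift (\<gamma> (T - u + \<tau>)) (of_real a * v + of_real c * n) = shift (\<gamma> \<tau>) (of_real (s - z) * n + (of_real a * v + of_real c * n))"
      by (rule returns_transport[OF \<gamma> v r _ _ _ Tu]) (use that nrm[of "s - z"] nrm2[of a c] u in \<open>auto simp del: of_real_diff\<close>)
    then show ?thesis unfolding E_def sm by (simp add: add.commute)
  qed
  define K where "K c = {E \<tau> 0 \<omega> |\<tau> \<omega>. 0 \<le> \<tau> \<and> \<tau> \<le> T \<and> \<bar>\<omega>\<bar> \<le> c}" for c
  \<comment> \<open>the width gained in one step; it may be tiny, which is why the step has to be iterated\<close>
  define \<eta> where "\<eta> = z - \<bar>s\<bar>"
  have \<eta>: "0 < \<eta>" "\<eta> \<le> z" using sz by (auto simp: \<eta>_def)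
  have K_mono: "K c \<subseteq> K c'" if "c \<le> c'" for c c' using that unfolding K_def by fastforce
  have KI: "E \<tau> 0 \<omega> \<in> K c" if "0 \<le> \<tau>" "\<tau> \<le> T" "\<bar>\<omega>\<bar> \<le> c" for \<tau> \<omega> c using that unfolding K_def by blast
  have reduce: "K c \<subseteq> K (c - \<eta>)" if c: "2 * z \<le> c" "c \<le> 5 * z" for c
  proof
    fix q assume "q \<in> K c"
    then obtain \<tau> \<omega> where q: "q = E \<tau> 0 \<omega>" "0 \<le> \<tau>" "\<tau> \<le> T" "\<bar>\<omega>\<bar> \<le> c" by (auto simp: K_def)
    consider "\<bar>\<omega>\<bar> \<le> c - \<eta>" | "\<omega> > c - \<eta>" "\<tau> + u \<le> T" | "\<omega> > c - \<eta>" "\<tau> + u > T"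
      | "\<omega> < - (c - \<eta>)" "u \<le> \<tau>" | "\<omega> < - (c - \<eta>)" "\<tau> < u" by linarith
    then show "q \<in> K (c - \<eta>)"
    proof cases
      case 1
      then show ?thesis using q KI by simp
    next
      case 2
      have "E (\<tau> + u) 0 (\<omega> - z) = E \<tau> 0 (\<omega> - z + z)" using 2 q c sz z0 \<eta> by (intro ret_u) (auto simp: \<eta>_def)
      then show ?thesis using 2 q c \<eta> u(1) KI[of "\<tau> + u" "\<omega> - z" "c - \<eta>"] by (simp add: \<eta>_def)
    next
      case 3
      have "E (\<tau> - (T - u) + (T - u)) 0 \<omega> = E (\<tau> - (T - u)) 0 (\<omega> + (s - z))"
        using 3 q c sz z0 \<eta> by (intro ret_Tu) (auto simp: \<eta>_def)
      then show ?thesis using 3 q c \<eta> u KI[of "\<tau> - (T - u)" "\<omega> + (s - z)" "c - \<eta>"] by (simp add: \<eta>_def)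
    next
      case 4
      have "E (\<tau> - u + u) 0 \<omega> = E (\<tau> - u) 0 (\<omega> + z)" using 4 q c sz z0 \<eta> u by (intro ret_u) (auto simp: \<eta>_def)
      then show ?thesis using 4 q c \<eta> u(1) KI[of "\<tau> - u" "\<omega> + z" "c - \<eta>"] by (simp add: \<eta>_def)
    next
      case 5
      have "E (\<tau> + (T - u)) 0 (\<omega> + z - s) = E \<tau> 0 (\<omega> + z - s + (s - z))"
        using 5 q c sz z0 \<eta> by (intro ret_Tu) (auto simp: \<eta>_def)
      then show ?thesis using 5 q c \<eta> u KI[of "\<tau> + (T - u)" "\<omega> + z - s" "c - \<eta>"] by (simp add: \<eta>_def)
    qed
  qed
  have iter: "K (5 * z) \<subseteq> K (max (3 * z) (5 * z - real k * \<eta>))" for k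
  proof (induction k)
    case 0
    then show ?case using z0 by simp
  next
    case (Suc k)
    show ?case
    proof (cases "5 * z - real k * \<eta> \<le> 3 * z")
      case True
      then have "K (5 * z) \<subseteq> K (3 * z)" using Suc by (simp add: max_absorb1)
      also have "\<dots> \<subseteq> K (max (3 * z) (5 * z - real (Suc k) * \<eta>))" by (rule K_mono) simp
      finally show ?thesis .
    next
      case False
      then have "K (5 * z - real k * \<eta>) \<subseteq> K (5 * z - real k * \<eta> - \<eta>)" using \<eta> z0 by (intro reduce) auto
      also have "\<dots> \<subseteq> K (max (3 * z) (5 * z - real (Suc k) * \<eta>))" by (rule K_mono) (simp add: algebra_simps)
      finally show ?thesis using Suc False by (simp add: max_def split: if_splits)
    qed
  qed
  obtain k where "2 * z < real k * \<eta>" using reals_Archimedean3[OF \<eta>(1)] by blast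
  then have K53: "K (5 * z) \<subseteq> K (3 * z)" using iter[of k] by (simp add: max_def split: if_splits)
  define Y where "Y = K (5 * z)"
  have "Y = {}"
  proof (rule clopen_empty)
    fix q assume "q \<in> Y"
    then obtain \<tau> \<omega> where q: "q = E \<tau> 0 \<omega>" "0 \<le> \<tau>" "\<tau> \<le> T" "\<bar>\<omega>\<bar> \<le> 3 * z"
    proof -
      have "q \<in> K (3 * z)" using K53 \<open>q \<in> Y\<close> unfolding Y_def by blast
      then show ?thesis using that unfolding K_def by blast
    qed
    define \<rho> where "\<rho> = min (z / 2) T"
    have \<rho>: "0 < \<rho>" "\<rho> \<le> z / 2" "\<rho> \<le> T" using z0 T by (auto simp: \<rho>_def)
    have rq: "reg (b - \<bar>\<omega>\<bar>) q" using reg_shift(1)[OF r[OF q(2,3)], of "of_real \<omega> * n"] nrm[of \<omega>] q sz z0 by (simp add: E_def)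
    then have "reg \<rho> q" by (rule reg_mono) (use q sz \<rho> in auto)
    moreover have "shift q w \<in> Y" if w: "norm w < \<rho>" for w
    proof -
      obtain \<alpha> \<beta> where ab: "w = of_real \<alpha> * v + of_real \<beta> * n" "\<bar>\<alpha>\<bar> < \<rho>" "\<bar>\<beta>\<bar> < \<rho>"
      proof -
        define \<epsilon> where "\<epsilon> = (if n = \<i> * v then 1 else - 1 :: real)"
        have v0: "v \<noteq> 0" using v by auto
        have ne: "n = of_real \<epsilon> * (\<i> * v)" using n by (auto simp: \<epsilon>_def)
        have nwv: "norm (w / v) < \<rho>" using w v by (simp add: norm_divide)
        have "w / v = of_real (Re (w / v)) + of_real (Im (w / v)) * \<i>" by (simp add: complex_eq_iff)
        then have "w = (of_real (Re (w / v)) + of_real (Im (w / v)) * \<i>) * v" using v0 by (metis nonzero_eq_divide_eq)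
        then have "w = of_real (Re (w / v)) * v + of_real (\<epsilon> * Im (w / v)) * n"
          unfolding ne by (simp add: \<epsilon>_def algebra_simps)
        moreover have "\<bar>Re (w / v)\<bar> < \<rho>" using abs_Re_le_cmod[of "w / v"] nwv by linarith
        moreover have "\<bar>\<epsilon> * Im (w / v)\<bar> < \<rho>" using abs_Im_le_cmod[of "w / v"] nwv by (auto simp: \<epsilon>_def)
        ultimately show ?thesis using that by blast
      qed
      have "shift q w = shift (\<gamma> \<tau>) (of_real \<omega> * n + w)"
        unfolding q(1) E_def using reg_shift(2)[OF r[OF q(2,3)], of "of_real \<omega> * n" w] nrm[of \<omega>] q w \<rho> sz z0 by simp
      also have "\<dots> = E \<tau> \<alpha> (\<omega> + \<beta>)" unfolding E_def ab(1) by (simp add: algebra_simps)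
      finally have sq: "shift q w = E \<tau> \<alpha> (\<omega> + \<beta>)" .
      \<comment> \<open>a point that leaves through an end of the strip comes back through the other end, moved by \<open>s\<close>\<close>
      consider "0 \<le> \<tau> + \<alpha>" "\<tau> + \<alpha> \<le> T" | "\<tau> + \<alpha> < 0" | "\<tau> + \<alpha> > T" by linarith
      then show "shift q w \<in> Y"
      proof cases
        case 1
        have "E (\<tau> + \<alpha>) 0 (\<omega> + \<beta>) = E \<tau> (\<tau> + \<alpha> - \<tau> + 0) (\<omega> + \<beta>)"
          by (rule along) (use 1 q ab \<rho> sz in auto)
        then show ?thesis using sq 1 KI[of "\<tau> + \<alpha>" "\<omega> + \<beta>" "5 * z"] q ab \<rho> by (simp add: Y_def)
      next
        case 2
        have "E 0 (\<tau> + \<alpha>) (\<omega> + \<beta>) = E \<tau> (0 - \<tau> + (\<tau> + \<alpha>)) (\<omega> + \<beta>)"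
          by (rule along) (use 2 q ab \<rho> sz T in auto)
        moreover have "E T (\<tau> + \<alpha>) (\<omega> + \<beta> - s) = E 0 (\<tau> + \<alpha>) (\<omega> + \<beta> - s + s)"
          by (rule ret_T) (use 2 q ab \<rho> sz T in auto)
        moreover have "E (T + (\<tau> + \<alpha>)) 0 (\<omega> + \<beta> - s) = E T (T + (\<tau> + \<alpha>) - T + 0) (\<omega> + \<beta> - s)"
          by (rule along) (use 2 q ab \<rho> sz T in auto)
        ultimately have "shift q w = E (T + (\<tau> + \<alpha>)) 0 (\<omega> + \<beta> - s)" using sq by simp
        then show ?thesis using 2 KI[of "T + (\<tau> + \<alpha>)" "\<omega> + \<beta> - s" "5 * z"] q ab \<rho> sz by (simp add: Y_def)
      next
        case 3
        have "E T (\<tau> + \<alpha> - T) (\<omega> + \<beta>) = E \<tau> (T - \<tau> + (\<tau> + \<alpha> - T)) (\<omega> + \<beta>)"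
          by (rule along) (use 3 q ab \<rho> sz T in auto)
        moreover have "E T (\<tau> + \<alpha> - T) (\<omega> + \<beta>) = E 0 (\<tau> + \<alpha> - T) (\<omega> + \<beta> + s)"
          by (rule ret_T) (use 3 q ab \<rho> sz T in auto)
        moreover have "E (\<tau> + \<alpha> - T) 0 (\<omega> + \<beta> + s) = E 0 (\<tau> + \<alpha> - T - 0 + 0) (\<omega> + \<beta> + s)"
          by (rule along) (use 3 q ab \<rho> sz T in auto)
        ultimately have "shift q w = E (\<tau> + \<alpha> - T) 0 (\<omega> + \<beta> + s)" using sq by simp
        then show ?thesis using 3 KI[of "\<tau> + \<alpha> - T" "\<omega> + \<beta> + s" "5 * z"] q ab \<rho> sz by (simp add: Y_def)
      qed
    qed
    ultimately show "\<exists>\<rho>>0. reg \<rho> q \<and> (\<forall>w. norm w < \<rho> \<longrightarrow> shift q w \<in> Y)" using \<rho>(1) by blast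
  next
    fix i x and y :: "nat \<Rightarrow> complex"
    assume i: "i < n_polys" "x \<in> region (poly i)" and y: "\<And>m. y m \<in> region (poly i)" "\<And>m. pt X i (y m) \<in> Y" "y \<longlonglongrightarrow> x"
    have "\<forall>m. \<exists>\<tau> \<omega>. pt X i (y m) = E \<tau> 0 \<omega> \<and> 0 \<le> \<tau> \<and> \<tau> \<le> T \<and> \<bar>\<omega>\<bar> \<le> 5 * z" using y(2) by (auto simp: Y_def K_def)
    then obtain f g where fg: "\<And>m. pt X i (y m) = E (f m) 0 (g m)" "\<And>m. 0 \<le> f m" "\<And>m. f m \<le> T" "\<And>m. \<bar>g m\<bar> \<le> 5 * z"
      by metis
    have "compact ({0..T} \<times> {- (5 * z)..5 * z})" by (intro compact_Times compact_Icc)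
    moreover have "\<forall>m. (f m, g m) \<in> {0..T} \<times> {- (5 * z)..5 * z}" using fg by (auto simp: abs_le_iff minus_le_iff)
    ultimately obtain l r' where l: "l \<in> {0..T} \<times> {- (5 * z)..5 * z}" and r': "strict_mono r'" "(\<lambda>m. (f (r' m), g (r' m))) \<longlonglongrightarrow> l"
      unfolding compact_def by (elim allE[of _ "\<lambda>m. (f m, g m)"]) (auto simp: comp_def)
    define \<tau> where "\<tau> = fst l"
    define \<omega> where "\<omega> = snd l"
    have lim: "(\<lambda>m. f (r' m)) \<longlonglongrightarrow> \<tau>" "(\<lambda>m. g (r' m)) \<longlonglongrightarrow> \<omega>"
      using tendsto_fst[OF r'(2)] tendsto_snd[OF r'(2)] by (simp_all add: \<tau>_def \<omega>_def)
    have \<tau>: "0 \<le> \<tau>" "\<tau> \<le> T" "\<bar>\<omega>\<bar> \<le> 5 * z" using l by (auto simp: \<tau>_def \<omega>_def)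
    have "\<forall>\<^sub>F m in sequentially. dist (f (r' m)) \<tau> < z" using lim(1) z0 by (rule tendstoD)
    then have ev: "\<forall>\<^sub>F m in sequentially. (i, y (r' m)) \<in> shift (\<gamma> \<tau>) (of_real (f (r' m) - \<tau>) * v + of_real (g (r' m)) * n)"
    proof eventually_elim
      case (elim m)
      have "E (f (r' m)) 0 (g (r' m)) = E \<tau> (f (r' m) - \<tau> + 0) (g (r' m))"
        by (rule along) (use fg[of "r' m"] \<tau> elim sz z0 in \<open>auto simp: dist_real_def\<close>)
      then have "pt X i (y (r' m)) = shift (\<gamma> \<tau>) (of_real (f (r' m) - \<tau>) * v + of_real (g (r' m)) * n)"
        using fg(1) by (simp add: E_def)
      then show ?case using pt_self[OF i(1) y(1)] by metis
    qed
    have "(i, x) \<in> shift (\<gamma> \<tau>) (of_real (\<tau> - \<tau>) * v + of_real \<omega> * n)"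
    proof (rule chart_lim[OF shift_chart(1)[OF r[OF \<tau>(1,2)]]])
      show "(\<lambda>m. of_real (f (r' m) - \<tau>) * v + of_real (g (r' m)) * n) \<longlonglongrightarrow> of_real (\<tau> - \<tau>) * v + of_real \<omega> * n"
        by (intro tendsto_intros lim)
      show "(\<lambda>m. y (r' m)) \<longlonglongrightarrow> x" using LIMSEQ_subseq_LIMSEQ[OF y(3) r'(1)] by (simp add: comp_def)
      show "\<exists>\<^sub>F m in sequentially. (i, y (r' m)) \<in> shift (\<gamma> \<tau>) (of_real (f (r' m) - \<tau>) * v + of_real (g (r' m)) * n)"
        using ev by (intro eventually_frequently) auto
    qed (use nrm[of \<omega>] \<tau> sz z0 in auto)
    then have "(i, x) \<in> E \<tau> 0 \<omega>" by (simp add: E_def)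
    moreover have "E \<tau> 0 \<omega> \<in> points X"
      unfolding E_def using shift_points[OF r[OF \<tau>(1,2)], of "of_real \<omega> * n"] nrm[of \<omega>] \<tau> sz z0 by simp
    ultimately have "pt X i x = E \<tau> 0 \<omega>" using rep_pt by blast
    then show "pt X i x \<in> Y" using KI[OF \<tau>] by (simp add: Y_def)
  qed
  moreover have "E 0 0 0 \<in> Y" unfolding Y_def by (rule KI) (use T z0 in auto)
  ultimately show False by blast
qed

end

section \<open>Area\<close>

context transl_surface
begin

abbreviation intr :: "nat \<Rightarrow> complex set" where "intr i \<equiv> inside (boundary (poly i))"

text \<open>Inside the polygons, representatives are unique; the boundaries have area zero.\<close>

definition core :: "nat \<Rightarrow> (nat \<times> complex) set set \<Rightarrow> complex set" where
  "core i A = {x \<in> intr i. pt X i x \<in> A}"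

lemma inner_region: "intr i \<subseteq> region (poly i)"
  by (auto simp: region_def)

lemma open_inner: "i < n_polys \<Longrightarrow> open (intr i)"
  using polygon_Jordan(1)[OF simple] .

lemma negligible_boundary: "negligible (boundary P)"
proof -
  have "negligible (side P k)" for k
    by (simp add: side_def negligible_convex_interior interior_closed_segment_ge2)
  then show ?thesis unfolding boundary_def by (intro negligible_Union) auto
qed

lemma core_part: "i < n_polys \<Longrightarrow> core i A \<subseteq> polygon_part X i A"
  "polygon_part X i A - core i A \<subseteq> boundary (poly i)"
  by (auto simp: core_def polygon_part_def region_def)

lemma part_measurable_iff:
  assumes i: "i < n_polys"
  shows "polygon_part X i A \<in> sets lebesgue \<longleftrightarrow> core i A \<in> sets lebesgue"
    "core i A \<in> sets lebesgue \<Longrightarrow> emeasure lebesgue (polygon_part X i A) = emeasure lebesgue (core i A)"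
proof -
  have n: "polygon_part X i A - core i A \<in> null_sets lebesgue"
    using negligible_subset[OF negligible_boundary core_part(2)] negligible_iff_null_sets by blast
  have eq: "polygon_part X i A = core i A \<union> (polygon_part X i A - core i A)" using core_part(1)[OF i] by blast
  have eq': "core i A = polygon_part X i A - (polygon_part X i A - core i A)" using core_part(1)[OF i] by blast
  show "polygon_part X i A \<in> sets lebesgue \<longleftrightarrow> core i A \<in> sets lebesgue"
    using eq eq' n by (metis null_setsD2 sets.Diff sets.Un)
  show "emeasure lebesgue (polygon_part X i A) = emeasure lebesgue (core i A)" if "core i A \<in> sets lebesgue"
    using emeasure_Un_null_set[OF that n] eq by simp
qed

lemma core_measurable:
  assumes "A \<subseteq> points X"
  shows "A \<in> sets (area_measure X) \<longleftrightarrow> (\<forall>i<n_polys. core i A \<in> sets lebesgue)"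
  using part_measurable_iff(1) assms unfolding sets_area_measure by auto

lemma emeasure_core:
  assumes "A \<in> sets (area_measure X)"
  shows "emeasure (area_measure X) A = (\<Sum>i<n_polys. emeasure lebesgue (core i A))"
proof -
  have "A \<subseteq> points X" using sets.sets_into_space[OF assms] by (simp add: space_area_measure)
  then have "\<forall>i<n_polys. core i A \<in> sets lebesgue" using core_measurable assms by blast
  then show ?thesis unfolding emeasure_area_measure[OF assms] by (intro sum.cong) (auto simp: part_measurable_iff(2))
qed

lemma null_core:
  assumes "A \<subseteq> points X" "\<And>i. i < n_polys \<Longrightarrow> negligible (core i A)"
  shows "A \<in> null_sets (area_measure X)"
proof -
  have n: "core i A \<in> null_sets lebesgue" if "i < n_polys" for i using assms(2)[OF that] negligible_iff_null_sets by blast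
  then have s: "A \<in> sets (area_measure X)" using core_measurable[OF assms(1)] by blast
  have "emeasure (area_measure X) A = 0" unfolding emeasure_core[OF s] using n by (intro sum.neutral) auto
  then show ?thesis using s by blast
qed

lemma inner_pt_eq: "i < n_polys \<Longrightarrow> x \<in> intr i \<Longrightarrow> j < n_polys \<Longrightarrow> y \<in> intr j \<Longrightarrow> pt X i x = pt X j y \<longleftrightarrow> i = j \<and> x = y"
  using interior_point[of i x] interior_point[of j y] by auto

lemma inner_shift:
  assumes i: "i < n_polys" and b: "ball x \<rho> \<subseteq> intr i" and \<rho>: "0 < \<rho>"
  shows "reg \<rho> (pt X i x)" "norm w < \<rho> \<Longrightarrow> shift (pt X i x) w = pt X i (x + w)"
proof -
  have "ball 0 \<rho> \<subseteq> {z. x + z \<in> intr i}" using b by (auto simp: subset_iff dist_norm)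
  from reg_chart[OF chart_interior[OF i] this \<rho>] show "reg \<rho> (pt X i x)" "norm w < \<rho> \<Longrightarrow> shift (pt X i x) w = pt X i (x + w)"
    by simp_all
qed

lemma core_image:
  assumes "i < n_polys" "B \<subseteq> intr i" "j < n_polys"
  shows "core j (pt X i ` B) = (if j = i then B else {})"
  using assms inner_pt_eq unfolding core_def by (auto simp: subset_iff)

lemma area_image:
  assumes i: "i < n_polys" and B: "B \<subseteq> intr i" "B \<in> sets lebesgue"
  shows "pt X i ` B \<in> sets (area_measure X)" "emeasure (area_measure X) (pt X i ` B) = emeasure lebesgue B"
proof -
  have "pt X i ` B \<subseteq> points X" using B(1) inner_region pt_in_points[OF i] by blast
  then show s: "pt X i ` B \<in> sets (area_measure X)"
    using core_measurable core_image[OF i B(1)] B(2) by simp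
  have "emeasure (area_measure X) (pt X i ` B) = (\<Sum>j<n_polys. if j = i then emeasure lebesgue B else 0)"
    unfolding emeasure_core[OF s] by (intro sum.cong) (auto simp: core_image[OF i B(1)])
  then show "emeasure (area_measure X) (pt X i ` B) = emeasure lebesgue B" using i by simp
qed

definition inner_points :: "(nat \<times> complex) set set" where
  "inner_points = (\<Union>i<n_polys. pt X i ` intr i)"

lemma AE_inner: "AE p in area_measure X. p \<in> inner_points"
proof -
  have "points X - inner_points \<in> null_sets (area_measure X)"
  proof (rule null_core)
    fix i assume "i < n_polys"
    then have "core i (points X - inner_points) = {}" by (auto simp: core_def inner_points_def)
    then show "negligible (core i (points X - inner_points))" by simp
  qed auto
  from AE_not_in[OF this] have "AE p in area_measure X. p \<notin> points X - inner_points" .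
  then show ?thesis by (rule AE_mp) (rule AE_I2, simp add: space_area_measure)
qed

lemma finite_area: "emeasure (area_measure X) (points X) < \<infinity>"
proof -
  have s: "points X \<in> sets (area_measure X)" using sets.top[of "area_measure X"] by (simp add: space_area_measure)
  have "emeasure lebesgue (core i (points X)) < \<infinity>" if "i < n_polys" for i
  proof -
    have "core i (points X) = intr i" using inner_region pt_in_points[OF that] by (auto simp: core_def)
    moreover have "bounded (intr i)" using bounded_subset[OF compact_imp_bounded[OF compact_region] inner_region] .
    then have "intr i \<in> lmeasurable" using open_inner[OF that] lmeasurable_open by blast
    then have "emeasure lebesgue (intr i) < \<infinity>" by (auto simp: fmeasurable_def)
    ultimately show ?thesis by (simp only:)
  qed
  then show ?thesis unfolding emeasure_core[OF s] by simp
qed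

section \<open>Local translations preserve area\<close>

text \<open>A partial bijection which is locally a translation. The flow at a fixed time is of this
  kind; it is not defined at the points whose orbits have reached \<open>\<Sigma>\<close>.\<close>

definition transl_corr :: "((nat \<times> complex) set \<times> (nat \<times> complex) set) set \<Rightarrow> bool" where
  "transl_corr F \<longleftrightarrow> single_valued F \<and> single_valued (F\<inverse>) \<and>
     (\<forall>(p, q)\<in>F. \<exists>\<rho>>0. reg \<rho> p \<and> reg \<rho> q \<and> (\<forall>w. norm w < \<rho> \<longrightarrow> (shift p w, shift q w) \<in> F))"

lemma transl_corr_converse: "transl_corr F \<Longrightarrow> transl_corr (F\<inverse>)"
  unfolding transl_corr_def by fastforce

lemma transl_corr_flow:
  assumes v: "norm v = 1"
  shows "transl_corr {(p, q). flowv X v t p q}"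
  unfolding transl_corr_def
proof (intro conjI)
  show "single_valued {(p, q). flowv X v t p q}"
    using flow_unique[OF _ _ v] by (intro single_valuedI) blast
  show "single_valued ({(p, q). flowv X v t p q}\<inverse>)"
    using flow_inj[OF _ _ v] by (intro single_valuedI) blast
  show "\<forall>(p, q)\<in>{(p, q). flowv X v t p q}. \<exists>\<rho>>0. reg \<rho> p \<and> reg \<rho> q \<and>
      (\<forall>w. norm w < \<rho> \<longrightarrow> (shift p w, shift q w) \<in> {(p, q). flowv X v t p q})"
    using flow_shift_local[OF _ v] by (smt (verit, best) case_prodI2 mem_Collect_eq split_conv)
qed

text \<open>Near \<open>p\<close> the points that are not inner points lie on the boundaries of the finitely many
  polygons at \<open>p\<close>.\<close>

lemma boundary_offsets_negligible:
  assumes r: "reg \<rho> p"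
  shows "\<exists>e>0. e \<le> \<rho> \<and> negligible {w. norm w < e \<and> shift p w \<notin> inner_points}"
proof -
  have \<rho>: "0 < \<rho>" using r by (simp add: reg_def)
  have p: "p \<in> points X" using reg_nonsing(1)[OF r] .
  have "\<forall>\<^sub>F w in nhds 0. \<exists>(i, x)\<in>p. x + w \<in> region (poly i) \<and> (i, x + w) \<in> shift p w"
    using chart_nbhd[OF shift_chart(1)[OF r], of 0] \<rho> shift_chart(2)[OF r] by simp
  then obtain e where e: "e > 0" "\<And>w. norm w < e \<Longrightarrow> \<exists>(i, x)\<in>p. x + w \<in> region (poly i) \<and> (i, x + w) \<in> shift p w"
    unfolding eventually_nhds_metric by (auto simp: dist_norm)
  have "{w. norm w < min e \<rho> \<and> shift p w \<notin> inner_points} \<subseteq> (\<Union>a\<in>p. (+) (- snd a) ` boundary (poly (fst a)))"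
  proof
    fix w assume "w \<in> {w. norm w < min e \<rho> \<and> shift p w \<notin> inner_points}"
    then have w: "norm w < e" "norm w < \<rho>" "shift p w \<notin> inner_points" by auto
    obtain i x where x: "(i, x) \<in> p" "x + w \<in> region (poly i)" "(i, x + w) \<in> shift p w" using e(2)[OF w(1)] by blast
    have "pt X i (x + w) = shift p w" using rep_pt[OF _ x(3)] shift_points[OF r w(2)] by blast
    then have "x + w \<notin> intr i" using w(3) rep_in[OF p x(1)] by (auto simp: inner_points_def)
    then have "x + w \<in> boundary (poly i)" using x(2) by (auto simp: region_def)
    then show "w \<in> (\<Union>a\<in>p. (+) (- snd a) ` boundary (poly (fst a)))"
      by (intro UN_I[OF x(1)] image_eqI[of _ _ "x + w"]) auto
  qed
  moreover have "negligible (\<Union>a\<in>p. (+) (- snd a) ` boundary (poly (fst a)))"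
  proof (rule negligible_Union)
    fix S assume "S \<in> (\<lambda>a. (+) (- snd a) ` boundary (poly (fst a))) ` p"
    then show "negligible S" using negligible_translation[OF negligible_boundary] by blast
  qed (use finite_point[OF p] in blast)
  ultimately show ?thesis using e(1) \<rho> negligible_subset by (intro exI[of _ "min e \<rho>"]) auto
qed

text \<open>Sort the points of \<open>A\<close> by their polygon \<open>i\<close>, the polygon \<open>j\<close> of their image, and the
  displacement \<open>w\<close> in the plane. The points of \<open>i\<close> with given \<open>j\<close> and \<open>w\<close> form an open set
  \<open>H (i, j, w)\<close>, and for different \<open>(j, w)\<close> these sets are disjoint; so only countably many of
  them are not empty. On each of them the image is a translate. Points on the boundaries do not
  count, as they form a set which is locally negligible. Applied to the converse as well, the
  inequality becomes an equality.\<close>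

lemma transl_corr_image:
  assumes F: "transl_corr F" and A: "A \<in> sets (area_measure X)"
  shows "F `` A \<in> sets (area_measure X)" "emeasure (area_measure X) (F `` A) \<le> emeasure (area_measure X) A"
proof -
  let ?M = "area_measure X"
  have sv: "q = q'" if "(p, q) \<in> F" "(p, q') \<in> F" for p q q' using F that by (auto simp: transl_corr_def dest: single_valuedD)
  have loc: "\<exists>\<rho>>0. reg \<rho> p \<and> reg \<rho> q \<and> (\<forall>w. norm w < \<rho> \<longrightarrow> (shift p w, shift q w) \<in> F)" if "(p, q) \<in> F" for p q
    using F that by (auto simp: transl_corr_def)
  have Apts: "A \<subseteq> points X" using sets.sets_into_space[OF A] by (simp add: space_area_measure)
  have FA: "F `` A \<subseteq> points X" using loc reg_nonsing by blast
  define H where "H = (\<lambda>(i, j, w). {x \<in> intr i. x + w \<in> intr j \<and> (pt X i x, pt X j (x + w)) \<in> F})"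
  define I where "I = {(i, j, w). i < n_polys \<and> j < n_polys \<and> H (i, j, w) \<noteq> {}}"
  have openH: "open (H (i, j, w))" if ij: "i < n_polys" "j < n_polys" for i j w
    unfolding open_contains_ball
  proof
    fix x assume "x \<in> H (i, j, w)"
    then have x: "x \<in> intr i" "x + w \<in> intr j" "(pt X i x, pt X j (x + w)) \<in> F" by (auto simp: H_def)
    obtain \<rho> where \<rho>: "\<rho> > 0" "\<And>d. norm d < \<rho> \<Longrightarrow> (shift (pt X i x) d, shift (pt X j (x + w)) d) \<in> F" using loc[OF x(3)] by blast
    obtain e1 where e1: "e1 > 0" "ball x e1 \<subseteq> intr i" using open_inner[OF ij(1)] x(1) openE by blast
    obtain e2 where e2: "e2 > 0" "ball (x + w) e2 \<subseteq> intr j" using open_inner[OF ij(2)] x(2) openE by blast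
    have "y \<in> H (i, j, w)" if y: "dist x y < min \<rho> (min e1 e2)" for y
    proof -
      define d where "d = y - x"
      have d: "norm d < \<rho>" "norm d < e1" "norm d < e2" using y by (auto simp: d_def dist_norm norm_minus_commute)
      have "y \<in> ball x e1" "y + w \<in> ball (x + w) e2" using y by (auto simp: dist_norm)
      moreover have "(pt X i (x + d), pt X j (x + w + d)) \<in> F"
        using \<rho>(2)[OF d(1)] inner_shift(2)[OF ij(1) e1(2,1) d(2)] inner_shift(2)[OF ij(2) e2(2,1) d(3)] by simp
      ultimately show ?thesis using e1 e2 by (auto simp: H_def d_def algebra_simps)
    qed
    then show "\<exists>e>0. ball x e \<subseteq> H (i, j, w)" using \<rho>(1) e1(1) e2(1) by (intro exI[of _ "min \<rho> (min e1 e2)"]) auto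
  qed
  have disj: "(j, w) = (j', w')" if "j < n_polys" "j' < n_polys" "x \<in> H (i, j, w)" "x \<in> H (i, j', w')" for i j j' w w' x
  proof -
    have "(pt X i x, pt X j (x + w)) \<in> F" "(pt X i x, pt X j' (x + w')) \<in> F" "x + w \<in> intr j" "x + w' \<in> intr j'"
      using that(3,4) by (auto simp: H_def)
    moreover from sv[OF this(1,2)] have "j = j' \<and> x + w = x + w'"
      using inner_pt_eq[OF that(1) \<open>x + w \<in> intr j\<close> that(2) \<open>x + w' \<in> intr j'\<close>] by simp
    ultimately show ?thesis by simp
  qed
  have "countable I"
  proof -
    have "countable {(j, w). (i, j, w) \<in> I}" for i
    proof -
      let ?W = "{(j, w). (i, j, w) \<in> I}" and ?h = "\<lambda>(j, w). H (i, j, w)"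
      have "pairwise disjnt (?h ` ?W)"
      proof (rule pairwiseI)
        fix R S assume RS: "R \<in> ?h ` ?W" "S \<in> ?h ` ?W" "R \<noteq> S"
        then obtain j w j' w' where R: "R = H (i, j, w)" "j < n_polys" and S: "S = H (i, j', w')" "j' < n_polys"
          by (auto simp: I_def)
        then show "disjnt R S" using disj[OF R(2) S(2)] RS(3) unfolding disjnt_def by blast
      qed
      then have "countable (?h ` ?W)"
        by (intro countable_disjoint_open_subsets) (use openH in \<open>auto simp: I_def\<close>)
      moreover have "inj_on ?h ?W"
      proof (rule inj_onI)
        fix a b assume ab: "a \<in> ?W" "b \<in> ?W" "?h a = ?h b"
        obtain j w where aeq: "a = (j, w)" by (cases a)
        obtain j' w' where beq: "b = (j', w')" by (cases b)
        have a: "a = (j, w)" "j < n_polys" "H (i, j, w) \<noteq> {}" and b: "b = (j', w')" "j' < n_polys"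
          using ab(1,2) aeq beq by (simp_all add: I_def)
        obtain x where "x \<in> H (i, j, w)" using a(3) by blast
        moreover from this have "x \<in> H (i, j', w')" using ab(3) a(1) b(1) by simp
        ultimately show "a = b" using disj[OF a(2) b(2)] a(1) b(1) by blast
      qed
      ultimately show ?thesis by (rule countable_image_inj_on)
    qed
    then have "countable (SIGMA i:{..<n_polys}. {(j, w). (i, j, w) \<in> I})" by (intro countable_SIGMA) auto
    moreover have "I \<subseteq> (SIGMA i:{..<n_polys}. {(j, w). (i, j, w) \<in> I})" by (auto simp: I_def)
    ultimately show ?thesis using countable_subset by blast
  qed
  define B where "B = (\<lambda>(i, j, w). H (i, j, w) \<inter> core i A)"
  have Bm: "B (i, j, w) \<in> sets lebesgue" "B (i, j, w) \<subseteq> intr i" "(\<lambda>x. x + w) ` B (i, j, w) \<subseteq> intr j"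
    "(\<lambda>x. x + w) ` B (i, j, w) \<in> sets lebesgue"
    "emeasure lebesgue ((\<lambda>x. x + w) ` B (i, j, w)) = emeasure lebesgue (B (i, j, w))"
    if ij: "i < n_polys" "j < n_polys" for i j w
  proof -
    show 1: "B (i, j, w) \<in> sets lebesgue"
      using openH[OF ij, of w] core_measurable[OF Apts] A ij(1) by (auto simp: B_def intro!: sets.Int)
    show "B (i, j, w) \<subseteq> intr i" "(\<lambda>x. x + w) ` B (i, j, w) \<subseteq> intr j" by (auto simp: B_def H_def)
    have eq: "(\<lambda>x. x + w) ` B (i, j, w) = (+) w ` B (i, j, w)" by (simp add: add.commute)
    show "(\<lambda>x. x + w) ` B (i, j, w) \<in> sets lebesgue"
      unfolding eq using lebesgue_sets_translation[OF 1, of w] .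
    show "emeasure lebesgue ((\<lambda>x. x + w) ` B (i, j, w)) = emeasure lebesgue (B (i, j, w))"
      using emeasure_lebesgue_affine[of 1 w "B (i, j, w)"] by simp
  qed
  define S where "S = (\<lambda>(i, j, w). pt X i ` B (i, j, w))"
  define T where "T = (\<lambda>(i, j, w). pt X j ` ((\<lambda>x. x + w) ` B (i, j, w)))"
  have ST: "S a \<in> sets ?M" "T a \<in> sets ?M" "emeasure ?M (T a) = emeasure ?M (S a)" "S a \<subseteq> A" if "a \<in> I" for a
  proof -
    obtain i j w where a: "a = (i, j, w)" "i < n_polys" "j < n_polys" using \<open>a \<in> I\<close> by (auto simp: I_def)
    note Bm' = Bm[OF a(2,3), of w]
    show "S a \<in> sets ?M" "T a \<in> sets ?M" "emeasure ?M (T a) = emeasure ?M (S a)"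
      using area_image[OF a(2) Bm'(2,1)] area_image[OF a(3) Bm'(3,4)] Bm'(5) by (simp_all add: a(1) S_def T_def)
    show "S a \<subseteq> A" by (auto simp: a(1) S_def B_def core_def)
  qed
  have Sdisj: "disjoint_family_on S I"
    unfolding disjoint_family_on_def
  proof (intro ballI impI)
    fix a b assume ab: "a \<in> I" "b \<in> I" "a \<noteq> b"
    obtain i j w where a: "a = (i, j, w)" "i < n_polys" "j < n_polys" using ab(1) by (auto simp: I_def)
    obtain i' j' w' where b: "b = (i', j', w')" "i' < n_polys" "j' < n_polys" using ab(2) by (auto simp: I_def)
    show "S a \<inter> S b = {}"
    proof (rule ccontr)
      assume "S a \<inter> S b \<noteq> {}"
      then obtain x x' where x: "x \<in> B a" "x' \<in> B b" "pt X i x = pt X i' x'" by (auto simp: S_def a b)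
      then have "i = i'" "x = x'" using inner_pt_eq[of i x i' x'] a b Bm(2)[OF a(2,3), of w] Bm(2)[OF b(2,3), of w'] by auto
      then have "(j, w) = (j', w')" using x disj[OF a(3) b(3), of x i w w'] by (auto simp: a b B_def)
      then show False using ab(3) a b \<open>i = i'\<close> by simp
    qed
  qed
  \<comment> \<open>the images of points on the boundaries of the polygons\<close>
  let ?Z = "F `` A - (\<Union>a\<in>I. T a)"
  have "?Z \<in> null_sets ?M"
  proof (rule null_core)
    fix j assume j: "j < n_polys"
    show "negligible (core j ?Z)"
      unfolding locally_negligible_alt[of "core j ?Z"]
    proof
      fix y assume y: "y \<in> core j ?Z"
      then have yj: "y \<in> intr j" and "pt X j y \<in> F `` A" by (auto simp: core_def)
      then obtain p where p: "p \<in> A" "(p, pt X j y) \<in> F" by blast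
      obtain \<rho> where \<rho>: "\<rho> > 0" "reg \<rho> p" "\<And>d. norm d < \<rho> \<Longrightarrow> (shift p d, shift (pt X j y) d) \<in> F" using loc[OF p(2)] by blast
      obtain e1 where e1: "e1 > 0" "ball y e1 \<subseteq> intr j" using open_inner[OF j] yj openE by blast
      obtain e where e: "e > 0" "e \<le> \<rho>" "negligible {w. norm w < e \<and> shift p w \<notin> inner_points}"
        using boundary_offsets_negligible[OF \<rho>(2)] by blast
      let ?U = "core j ?Z \<inter> ball y (min e e1)"
      have "?U \<subseteq> (+) y ` {w. norm w < e \<and> shift p w \<notin> inner_points}"
      proof
        fix y' assume y': "y' \<in> ?U"
        define d where "d = y' - y"
        have d: "norm d < e" "norm d < e1" "y' = y + d" using y' by (auto simp: d_def dist_norm norm_minus_commute)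
        have pd: "(shift p d, pt X j y') \<in> F" using \<rho>(3)[of d] d e(2) inner_shift(2)[OF j e1(2,1) d(2)] by simp
        have y'Z: "y' \<in> intr j" "pt X j y' \<in> F `` A" "pt X j y' \<notin> (\<Union>a\<in>I. T a)" using y' by (auto simp: core_def)
        obtain p' where p': "p' \<in> A" "(p', pt X j y') \<in> F" using y'Z(2) by blast
        have pp: "p' = shift p d" using F pd p'(2) by (auto simp: transl_corr_def single_valued_def)
        have "shift p d \<notin> inner_points"
        proof
          assume "shift p d \<in> inner_points"
          then obtain i x where x: "i < n_polys" "x \<in> intr i" "shift p d = pt X i x" by (auto simp: inner_points_def)
          then have "x \<in> B (i, j, y' - x)" using y'Z(1) pd p'(1) pp by (auto simp: B_def H_def core_def)
          then have "pt X j y' \<in> T (i, j, y' - x)" "(i, j, y' - x) \<in> I"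
            using x j by (auto simp: T_def I_def B_def intro!: image_eqI[of _ _ y'] image_eqI[of _ _ x])
          then show False using y'Z(3) by blast
        qed
        then show "y' \<in> (+) y ` {w. norm w < e \<and> shift p w \<notin> inner_points}" using d by blast
      qed
      then have "negligible ?U" using negligible_translation[OF e(3), of y] negligible_subset by blast
      moreover have "openin (top_of_set (core j ?Z)) ?U" by (intro openin_open_Int open_ball)
      moreover have "y \<in> ?U" using y e e1 by simp
      ultimately show "\<exists>U. openin (top_of_set (core j ?Z)) U \<and> y \<in> U \<and> negligible U" by blast
    qed
  qed (use FA in auto)
  have TF: "T a \<subseteq> F `` A" if "a \<in> I" for a
    using that by (auto simp: T_def I_def B_def H_def core_def)
  have UT: "(\<Union>a\<in>I. T a) \<in> sets ?M" using \<open>countable I\<close> ST(2) by (intro sets.countable_UN') auto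
  have FAeq: "F `` A = (\<Union>a\<in>I. T a) \<union> ?Z" using TF by blast
  show "F `` A \<in> sets ?M" using UT \<open>?Z \<in> null_sets ?M\<close> FAeq by (metis null_setsD2 sets.Un)
  have "emeasure ?M (F `` A) = emeasure ?M (\<Union>a\<in>I. T a)"
    using emeasure_Un_null_set[OF UT \<open>?Z \<in> null_sets ?M\<close>] FAeq by simp
  also have "\<dots> \<le> emeasure ?M (\<Union>a\<in>I. S a)"
  proof (cases "I = {}")
    case False
    \<comment> \<open>\<open>I\<close> may be finite or infinite; \<open>g\<close> lists its elements as sets with at most one element\<close>
    define g where "g n = (if n \<in> to_nat_on I ` I then {from_nat_into I n} else {})" for n
    have gI: "a \<in> I" if "a \<in> g n" for a n using that False by (auto simp: g_def from_nat_into split: if_splits)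
    have gU: "(\<Union>n. \<Union>a\<in>g n. R a) = (\<Union>a\<in>I. R a)" for R :: "nat \<times> nat \<times> complex \<Rightarrow> (nat \<times> complex) set set"
    proof
      show "(\<Union>a\<in>I. R a) \<subseteq> (\<Union>n. \<Union>a\<in>g n. R a)"
      proof
        fix x assume "x \<in> (\<Union>a\<in>I. R a)"
        then obtain a where a: "a \<in> I" "x \<in> R a" by blast
        have "a \<in> g (to_nat_on I a)" using a \<open>countable I\<close> by (simp add: g_def)
        then show "x \<in> (\<Union>n. \<Union>a\<in>g n. R a)" using a by blast
      qed
    qed (use gI in blast)
    have gM: "(\<Union>a\<in>g n. S a) \<in> sets ?M" "(\<Union>a\<in>g n. T a) \<in> sets ?M"
      "emeasure ?M (\<Union>a\<in>g n. T a) = emeasure ?M (\<Union>a\<in>g n. S a)" for n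
    proof -
      have "(\<Union>a\<in>g n. S a) \<in> sets ?M \<and> (\<Union>a\<in>g n. T a) \<in> sets ?M \<and>
        emeasure ?M (\<Union>a\<in>g n. T a) = emeasure ?M (\<Union>a\<in>g n. S a)"
      proof (cases "n \<in> to_nat_on I ` I")
        case True
        then have "g n = {from_nat_into I n}" by (simp add: g_def)
        moreover have "from_nat_into I n \<in> I" using False by (rule from_nat_into)
        ultimately show ?thesis using ST(1-3) by simp
      qed (simp add: g_def)
      then show "(\<Union>a\<in>g n. S a) \<in> sets ?M" "(\<Union>a\<in>g n. T a) \<in> sets ?M"
        "emeasure ?M (\<Union>a\<in>g n. T a) = emeasure ?M (\<Union>a\<in>g n. S a)" by blast+
    qed
    have "disjoint_family (\<lambda>n. \<Union>a\<in>g n. S a)"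
      unfolding disjoint_family_on_def
    proof (intro ballI impI)
      fix m n :: nat assume "m \<noteq> n"
      then have "a \<noteq> b" if "a \<in> g m" "b \<in> g n" for a b
        using that \<open>countable I\<close> by (auto simp: g_def split: if_splits)
      then show "(\<Union>a\<in>g m. S a) \<inter> (\<Union>a\<in>g n. S a) = {}"
        using Sdisj gI unfolding disjoint_family_on_def by blast
    qed
    then have "(\<Sum>n. emeasure ?M (\<Union>a\<in>g n. S a)) = emeasure ?M (\<Union>n. \<Union>a\<in>g n. S a)"
      using gM by (intro suminf_emeasure) auto
    moreover have "emeasure ?M (\<Union>n. \<Union>a\<in>g n. T a) \<le> (\<Sum>n. emeasure ?M (\<Union>a\<in>g n. T a))"
      using gM by (intro emeasure_subadditive_countably) auto
    ultimately show ?thesis unfolding gU gM(3) by simp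
  qed simp
  also have "\<dots> \<le> emeasure ?M A" using ST(4) A by (intro emeasure_mono) auto
  finally show "emeasure ?M (F `` A) \<le> emeasure ?M A" .
qed

end

section \<open>The flat distance near a regular point\<close>

context transl_surface
begin

text \<open>Suppose that the segment from \<open>x\<close> to a nearby point \<open>y\<close> meets a side after leaving \<open>x\<close>. Then
  this side contains \<open>x\<close>, and since \<open>y\<close> is closer to \<open>x\<close> than the ends of the side are, it
  contains \<open>y\<close> and the whole segment. Otherwise the segment misses the boundary and stays inside
  up to \<open>x\<close>.\<close>

lemma region_locally_starlike:
  assumes i: "i < n_polys" and x: "x \<in> region (poly i)"
  shows "\<exists>e>0. \<forall>y\<in>region (poly i). dist x y < e \<longrightarrow> closed_segment x y \<subseteq> region (poly i)"
proof -
  let ?P = "poly i"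
  have "\<forall>\<^sub>F e in at_right (0::real). \<forall>k\<in>{..<length ?P}. (x \<notin> side ?P k \<longrightarrow> ball x e \<inter> side ?P k = {}) \<and>
      (x \<noteq> vertex ?P k \<longrightarrow> e < dist x (vertex ?P k)) \<and> (x \<noteq> vertex ?P (Suc k) \<longrightarrow> e < dist x (vertex ?P (Suc k)))"
  proof (intro eventually_ball_finite ballI eventually_conj)
    fix k
    have le: "\<forall>\<^sub>F e in at_right (0::real). x \<noteq> a \<longrightarrow> e < dist x a" for a
    proof (cases "x = a")
      case False
      then have "\<forall>\<^sub>F e in at_right (0::real). e < dist x a \<and> 0 < e" by (intro eventually_small) simp
      then show ?thesis by eventually_elim simp
    qed simp
    show "\<forall>\<^sub>F e in at_right (0::real). x \<noteq> vertex ?P k \<longrightarrow> e < dist x (vertex ?P k)"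
      "\<forall>\<^sub>F e in at_right (0::real). x \<noteq> vertex ?P (Suc k) \<longrightarrow> e < dist x (vertex ?P (Suc k))" by (rule le)+
    show "\<forall>\<^sub>F e in at_right (0::real). x \<notin> side ?P k \<longrightarrow> ball x e \<inter> side ?P k = {}"
      using eventually_ball_away by (cases "x \<in> side ?P k") auto
  qed simp
  moreover have "\<forall>\<^sub>F e in at_right (0::real). 0 < e" by (simp add: eventually_at_right_less)
  ultimately have "\<forall>\<^sub>F e in at_right (0::real). 0 < e \<and> (\<forall>k\<in>{..<length ?P}. (x \<notin> side ?P k \<longrightarrow> ball x e \<inter> side ?P k = {}) \<and>
      (x \<noteq> vertex ?P k \<longrightarrow> e < dist x (vertex ?P k)) \<and> (x \<noteq> vertex ?P (Suc k) \<longrightarrow> e < dist x (vertex ?P (Suc k))))"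
    by eventually_elim blast
  from eventually_happens'[OF trivial_limit_at_right_real this] obtain e where e: "0 < e"
    and away: "\<And>k. k < length ?P \<Longrightarrow> x \<notin> side ?P k \<Longrightarrow> ball x e \<inter> side ?P k = {}"
    and ends: "\<And>k. k < length ?P \<Longrightarrow> x \<noteq> vertex ?P k \<Longrightarrow> e < dist x (vertex ?P k)"
      "\<And>k. k < length ?P \<Longrightarrow> x \<noteq> vertex ?P (Suc k) \<Longrightarrow> e < dist x (vertex ?P (Suc k))" by auto
  have "closed_segment x y \<subseteq> region ?P" if y: "y \<in> region ?P" "dist x y < e" for y
  proof (cases "\<exists>k<length ?P. x \<in> side ?P k \<and> y \<in> side ?P k")
    case True
    then obtain k where k: "k < length ?P" "x \<in> side ?P k" "y \<in> side ?P k" by blast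
    then have "closed_segment x y \<subseteq> side ?P k" unfolding side_def by (intro closed_segment_subset) auto
    then show ?thesis using side_subset_region[OF k(1)] by blast
  next
    case False
    have yb: "y \<notin> boundary ?P" using False away y(2) unfolding boundary_def by fastforce
    define S where "S = (\<lambda>t. x + of_real t * (y - x)) ` {0<..1::real}"
    have "z \<notin> boundary ?P" if z: "z \<in> S" for z
    proof
      assume "z \<in> boundary ?P"
      then obtain k where k: "k < length ?P" "z \<in> side ?P k" by (auto simp: boundary_def)
      obtain t where t: "0 < t" "t \<le> 1" "z = x + of_real t * (y - x)" using z by (auto simp: S_def)
      have "norm (of_real t * (y - x)) \<le> norm (y - x)" using t by (simp add: norm_mult mult_left_le_one_le)
      then have "dist x z < e" using y(2) t(3) by (simp add: dist_norm norm_minus_commute)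
      then have xk: "x \<in> side ?P k" using away[OF k(1)] k(2) by (metis disjoint_iff mem_ball)
      let ?a = "vertex ?P k" and ?e = "edge ?P k"
      have e0: "?e \<noteq> 0" by (rule edge_nonzero[OF simple[OF i]])
      then have np: "0 < norm ?e" by simp
      obtain s where s: "0 \<le> s" "s \<le> 1" "x = ?a + of_real s * ?e" using xk by (auto simp: side_iff)
      obtain s' where s': "0 \<le> s'" "s' \<le> 1" "z = ?a + of_real s' * ?e" using k(2) by (auto simp: side_iff)
      have "of_real t * (y - x) = of_real (s' - s) * ?e" using t(3) s(3) s'(3) by (simp add: algebra_simps)
      then have yx: "y - x = of_real ((s' - s) / t) * ?e" using t(1) by (simp add: field_simps)
      then have yeq: "y = ?a + of_real (s + (s' - s) / t) * ?e" using s(3) by (simp add: algebra_simps)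
      let ?r = "s + (s' - s) / t"
      have dxy: "dist x y = \<bar>(s' - s) / t\<bar> * norm ?e" 
      proof -
        have "dist x y = norm (y - x)" by (simp add: dist_norm norm_minus_commute)
        then show ?thesis unfolding yx norm_mult norm_of_real .
      qed
      have da: "dist x ?a = s * norm ?e" unfolding s(3) using s(1) by (simp add: dist_norm norm_mult)
      have "x - vertex ?P (Suc k) = of_real (s - 1) * ?e" unfolding s(3) by (simp add: edge_def algebra_simps)
      then have db: "dist x (vertex ?P (Suc k)) = (1 - s) * norm ?e"
        using s(2) by (simp add: dist_norm norm_mult del: of_real_diff)
      have "0 \<le> ?r \<and> ?r \<le> 1"
      proof (cases "s' \<ge> s")
        case True
        have "?r \<le> 1"
        proof (cases "s = 1")
          case True
          then have "s' = 1" using \<open>s' \<ge> s\<close> s' by simp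
          then show ?thesis using True by simp
        next
          case False
          then have "x \<noteq> vertex ?P (Suc k)" using db e0 by auto
          then have "\<bar>(s' - s) / t\<bar> * norm ?e < (1 - s) * norm ?e" using ends(2)[OF k(1)] db dxy y(2) by simp
          then have "\<bar>(s' - s) / t\<bar> < 1 - s" using mult_less_cancel_right_pos[OF np] by blast
          then show ?thesis by linarith
        qed
        then show ?thesis using True s t by (auto intro!: add_nonneg_nonneg)
      next
        case s's: False
        have "0 \<le> ?r"
        proof -
          have "s \<noteq> 0" using s's s'(1) by auto
          then have "x \<noteq> ?a" using da e0 by auto
          then have "\<bar>(s' - s) / t\<bar> * norm ?e < s * norm ?e" using ends(1)[OF k(1)] da dxy y(2) by simp
          then have "\<bar>(s' - s) / t\<bar> < s" using mult_less_cancel_right_pos[OF np] by blast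
          then show ?thesis by linarith
        qed
        moreover have "(s' - s) / t \<le> 0" using s's t by (simp add: divide_le_0_iff)
        ultimately show ?thesis using s by linarith
      qed
      then have "y \<in> side ?P k" unfolding side_iff using yeq by blast
      then show False using False k(1) xk by blast
    qed
    then have dis: "S \<inter> frontier (inside (boundary ?P)) = {}" using polygon_Jordan(3)[OF simple[OF i]] by blast
    have "connected S" unfolding S_def by (intro connected_continuous_image continuous_intros) auto
    moreover have "y \<in> S" by (auto simp: S_def intro!: image_eqI[of _ _ 1])
    moreover have "y \<in> inside (boundary ?P)" using y(1) yb by (auto simp: region_def)
    ultimately have "S \<subseteq> inside (boundary ?P)" using connected_Int_frontier[of S "inside (boundary ?P)"] dis by blast
    moreover have "z = x \<or> z \<in> S" if z: "z \<in> closed_segment x y" for z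
    proof -
      obtain t where t: "0 \<le> t" "t \<le> 1" "z = (1 - t) *\<^sub>R x + t *\<^sub>R y" using z by (auto simp: in_segment)
      then have "z = x + of_real t * (y - x)" by (simp add: scaleR_conv_of_real algebra_simps)
      then show ?thesis using t by (cases "t = 0") (auto simp: S_def)
    qed
    ultimately show ?thesis using x by (auto simp: region_def)
  qed
  then show ?thesis using e by blast
qed

lemma broken_line_nonneg: "broken_line X p l q \<Longrightarrow> 0 \<le> l"
  by (induction rule: broken_line.induct) auto

text \<open>The points that can be reached form an open and closed set. This is needed for the flat
  distance to be an infimum of a nonempty set of lengths.\<close>

lemma broken_line_exists:
  assumes p: "p \<in> points X" and q: "q \<in> points X"
  shows "\<exists>l. broken_line X p l q"
proof -
  define A where "A = {q \<in> points X. \<exists>l. broken_line X p l q}"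
  have near: "\<exists>e>0. \<forall>y\<in>region (poly i). dist y x < e \<longrightarrow> (pt X i y \<in> A \<longleftrightarrow> pt X i x \<in> A)"
    if i: "i < n_polys" and x: "x \<in> region (poly i)" for i x
  proof -
    obtain e where e: "e > 0" "\<And>y. y \<in> region (poly i) \<Longrightarrow> dist x y < e \<Longrightarrow> closed_segment x y \<subseteq> region (poly i)"
      using region_locally_starlike[OF i x] by blast
    have step: "pt X i b \<in> A" if "pt X i a \<in> A" "a \<in> region (poly i)" "b \<in> region (poly i)" "closed_segment a b \<subseteq> region (poly i)" for a b
      using that broken_line.step[of X p _ "pt X i a" "pt X i b" i a b] pt_self[OF i] pt_in_points[OF i]
      unfolding A_def by blast
    have "pt X i y \<in> A \<longleftrightarrow> pt X i x \<in> A" if y: "y \<in> region (poly i)" "dist y x < e" for y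
    proof -
      have "closed_segment x y \<subseteq> region (poly i)" "closed_segment y x \<subseteq> region (poly i)"
        using e(2)[OF y(1)] y(2) by (simp_all add: dist_commute closed_segment_commute)
      then show ?thesis using step[of y x] step[of x y] x y(1) by blast
    qed
    then show ?thesis using e(1) by blast
  qed
  have opn: "openin (surface_topology X) B" if B: "B = A \<or> B = points X - A" for B
    unfolding openin_surface_topology
  proof (intro conjI allI impI)
    fix i assume i: "i < n_polys"
    show "openin (top_of_set (region (poly i))) (polygon_part X i B)"
      unfolding openin_euclidean_subtopology_iff
    proof (intro conjI ballI)
      fix x assume "x \<in> polygon_part X i B"
      then have x: "x \<in> region (poly i)" "pt X i x \<in> B" by (auto simp: polygon_part_def)
      obtain e where e: "e > 0" "\<And>y. y \<in> region (poly i) \<Longrightarrow> dist y x < e \<Longrightarrow> pt X i y \<in> A \<longleftrightarrow> pt X i x \<in> A"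
        using near[OF i x(1)] by blast
      have "y \<in> polygon_part X i B" if "y \<in> region (poly i)" "dist y x < e" for y
        using e(2)[OF that] x(2) B that(1) pt_in_points[OF i that(1)] by (auto simp: polygon_part_def)
      then show "\<exists>e>0. \<forall>x'\<in>region (poly i). dist x' x < e \<longrightarrow> x' \<in> polygon_part X i B" using e(1) by blast
    qed (auto simp: polygon_part_def)
  qed (use B in \<open>auto simp: A_def\<close>)
  have "topspace (surface_topology X) \<subseteq> points X"
    unfolding topspace_def by (auto simp: openin_surface_topology)
  then have "A = {} \<or> points X - A = {}"
    using connected_surface opn[of A] opn[of "points X - A"] unfolding connected_space_def by blast
  moreover have "p \<in> A" using p broken_line.start[OF p] by (auto simp: A_def)
  ultimately show ?thesis using q by (auto simp: A_def)
qed

text \<open>A segment in a polygon is an integral curve of the constant field \<open>x - y\<close>, hence straight in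
  the chart.\<close>

lemma polygon_segment_in_chart:
  assumes r: "reg \<rho> p" and i: "i < n_polys" and z: "norm z < \<rho>" "norm (z + (x - y)) < \<rho>"
    and y: "(i, y) \<in> shift p z" and seg: "closed_segment x y \<subseteq> region (poly i)"
  shows "(i, x) \<in> shift p (z + (x - y))"
proof -
  let ?v = "x - y"
  have ray: "y + of_real t * ?v \<in> region (poly i)" if "0 \<le> t" "t \<le> 1" for t
  proof -
    have "y + of_real t * ?v = (1 - (1 - t)) *\<^sub>R x + (1 - t) *\<^sub>R y" by (simp add: scaleR_conv_of_real algebra_simps)
    then have "y + of_real t * ?v \<in> closed_segment x y" unfolding in_segment using that by (intro exI[of _ "1 - t"]) auto
    then show ?thesis using seg by blast
  qed
  have c: "chart X (ball 0 \<rho>) (shift p)" by (rule shift_chart(1)[OF r])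
  have "pt X i (y + of_real 1 * ?v) = shift p (z + of_real 1 * ?v)"
  proof (rule integral_curve_in_chart[OF integral_curve_in_polygon[OF i ray] c, where a = 0 and b = 1 and s = 0 and t = 1 and z = z])
    fix t :: real assume t: "0 \<le> t" "t \<le> 1"
    have "z + of_real t * ?v = (1 - t) *\<^sub>R z + t *\<^sub>R (z + ?v)" by (simp add: scaleR_conv_of_real algebra_simps)
    moreover have "(1 - t) *\<^sub>R z + t *\<^sub>R (z + ?v) \<in> ball 0 \<rho>"
      by (rule convexD_alt[OF convex_ball]) (use z t in auto)
    ultimately show "z + of_real t * ?v \<in> ball 0 \<rho>" by simp
  next
    show "pt X i (y + of_real 0 * ?v) = shift p (z + of_real 0 * ?v)"
      using rep_pt[OF chart_points[OF c] y] z by simp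
  qed auto
  then show ?thesis using pt_self[OF i, of x] ray[of 1] by simp
qed

lemma broken_line_in_chart:
  assumes "broken_line X q l p'" and r: "reg \<rho> p"
  shows "p' = shift p z \<Longrightarrow> norm z + l < \<rho> \<Longrightarrow> \<exists>w. q = shift p w \<and> norm w \<le> norm z + l"
  using assms(1)
proof (induction arbitrary: z rule: broken_line.induct)
  case (start q)
  then show ?case by auto
next
  case (step q l q' q'' i x y)
  have l: "0 \<le> l" using broken_line_nonneg[OF step(1)] .
  have i: "i < n_polys" using rep_in[OF step(2,4)] by simp
  have q'p: "q' \<in> points X" using step(1) by cases auto
  have n: "norm (z + (x - y)) \<le> norm z + dist x y" unfolding dist_norm by (rule norm_triangle_ineq)
  have nz: "norm z < \<rho>" "norm (z + (x - y)) < \<rho>" using n step.prems(2) l zero_le_dist[of x y] by linarith+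
  have "(i, x) \<in> shift p (z + (x - y))"
    using step.hyps(4,5) step.prems(1) by (intro polygon_segment_in_chart[OF r i nz]) auto
  moreover have "shift p (z + (x - y)) \<in> points X" using shift_points[OF r nz(2)] by simp
  ultimately have "q' = shift p (z + (x - y))" using points_eqI[OF q'p] step.hyps(3) by blast
  from step.IH[OF this] obtain w where "q = shift p w" "norm w \<le> norm (z + (x - y)) + l"
    using n step.prems(2) by auto
  then show ?case using n by (intro exI[of _ w]) auto
qed

text \<open>A broken line that ends at \<open>p\<close> and is shorter than \<open>\<rho>\<close> unrolls, segment by segment, into the
  disc around \<open>p\<close>.\<close>

lemma flat_dist_chart:
  assumes r: "reg \<rho> p" and q: "q \<in> points X" and d: "flat_dist X q p < a" "a \<le> \<rho>"
  shows "\<exists>w. q = shift p w \<and> norm w < a"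
proof -
  have "{l. broken_line X q l p} \<noteq> {}" using broken_line_exists[OF q reg_nonsing(1)[OF r]] by blast
  then obtain l where l: "broken_line X q l p" "l < a"
    using cInf_lessD[of "{l. broken_line X q l p}" a] d(1) unfolding flat_dist_def by blast
  have "\<exists>w. q = shift p w \<and> norm w \<le> norm (0::complex) + l"
    by (rule broken_line_in_chart[OF l(1) r]) (use shift_chart(2)[OF r] l(2) d(2) in auto)
  then show ?thesis using l(2) by force
qed

lemma flat_dist_polygon:
  assumes i: "i < n_polys" and seg: "closed_segment x y \<subseteq> region (poly i)"
  shows "flat_dist X (pt X i x) (pt X i y) \<le> dist x y"
proof -
  have xy: "x \<in> region (poly i)" "y \<in> region (poly i)" using seg by auto
  have "broken_line X (pt X i x) (0 + dist x y) (pt X i y)"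
    by (rule broken_line.step[OF broken_line.start _ _ _ seg]) (use pt_in_points[OF i] pt_self[OF i] xy in auto)
  then show ?thesis unfolding flat_dist_def
    by (intro cInf_lower) (auto intro!: bdd_belowI[of _ 0] broken_line_nonneg)
qed

end

section \<open>Almost every orbit stays away from the vertices\<close>

context transl_surface
begin

abbreviation area :: "(nat \<times> complex) set set \<Rightarrow> real" where "area \<equiv> measure (area_measure X)"

lemma finite_measure_area: "finite_measure (area_measure X)"
  using finite_area by (intro finite_measureI) (simp add: space_area_measure)

lemma preimage_area:
  assumes F: "transl_corr F" and A: "A \<in> sets (area_measure X)"
  shows "F\<inverse> `` A \<in> sets (area_measure X)" "area (F\<inverse> `` A) \<le> area A"
proof -
  interpret finite_measure "area_measure X" by (rule finite_measure_area)
  show "F\<inverse> `` A \<in> sets (area_measure X)" using transl_corr_image(1)[OF transl_corr_converse[OF F] A] .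
  show "area (F\<inverse> `` A) \<le> area A"
    using transl_corr_image(2)[OF transl_corr_converse[OF F] A] by (simp add: emeasure_eq_measure)
qed

lemma image_area_eq:
  assumes F: "transl_corr F" and A: "A \<in> sets (area_measure X)" and dom: "A \<subseteq> Domain F"
  shows "F `` A \<in> sets (area_measure X)" "area (F `` A) = area A"
proof -
  interpret finite_measure "area_measure X" by (rule finite_measure_area)
  show s: "F `` A \<in> sets (area_measure X)" by (rule transl_corr_image(1)[OF F A])
  have "F\<inverse> `` (F `` A) = A"
  proof
    have "single_valued (F\<inverse>)" using F by (simp add: transl_corr_def)
    then have "x = a" if "(x, y) \<in> F" "(a, y) \<in> F" for x y a
      using that by (auto dest: single_valuedD)
    then show "F\<inverse> `` (F `` A) \<subseteq> A" by blast
    show "A \<subseteq> F\<inverse> `` (F `` A)" using dom by blast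
  qed
  then have "area A \<le> area (F `` A)" using preimage_area(2)[OF F s] by simp
  moreover have "area (F `` A) \<le> area A"
    using transl_corr_image(2)[OF F A] by (simp add: emeasure_eq_measure)
  ultimately show "area (F `` A) = area A" by simp
qed

definition near_vertices :: "real \<Rightarrow> (nat \<times> complex) set set" where
  "near_vertices \<rho> = {p \<in> points X. \<exists>i x k. (i, x) \<in> p \<and> k < length (poly i) \<and> dist x (vertex (poly i) k) < \<rho>}"

lemma near_vertices_area:
  obtains C where "0 \<le> C" "\<And>\<rho>. 0 \<le> \<rho> \<Longrightarrow> near_vertices \<rho> \<in> sets (area_measure X)"
    "\<And>\<rho>. 0 \<le> \<rho> \<Longrightarrow> area (near_vertices \<rho>) \<le> C * \<rho>\<^sup>2"
proof -
  define U where "U = measure lborel (ball (0::complex) 1)"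
  define C where "C = (\<Sum>i<n_polys. real (length (poly i))) * U"
  have U: "0 \<le> U" by (simp add: U_def)
  interpret finite_measure "area_measure X" by (rule finite_measure_area)
  have sub: "near_vertices \<rho> \<subseteq> points X" for \<rho> by (auto simp: near_vertices_def)
  have core_eq: "core i (near_vertices \<rho>) = intr i \<inter> (\<Union>k<length (poly i). ball (vertex (poly i) k) \<rho>)"
    if i: "i < n_polys" for i \<rho>
  proof -
    have "{(i, x)} \<in> points X" if "x \<in> intr i" for x
      using interior_point[OF i that] inner_region pt_in_points[OF i, of x] that by auto
    then show ?thesis using interior_point[OF i] by (auto simp: core_def near_vertices_def dist_commute)
  qed
  have core_m: "core i (near_vertices \<rho>) \<in> sets lebesgue" if "i < n_polys" for i \<rho>
    unfolding core_eq[OF that] using open_inner[OF that] by (intro sets.Int sets.finite_UN) auto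
  have s: "near_vertices \<rho> \<in> sets (area_measure X)" for \<rho> using core_measurable[OF sub] core_m by blast
  have ball_m: "emeasure lebesgue (ball (a::complex) \<rho>) = ennreal (\<rho>\<^sup>2 * U)" if "0 \<le> \<rho>" for a \<rho>
  proof -
    have "measure lebesgue (ball a \<rho>) = \<rho>\<^sup>2 * U"
      using content_ball_conv_unit_ball[OF that, of a] by (simp add: U_def)
    moreover have "ball a \<rho> \<in> lmeasurable" by simp
    ultimately show ?thesis by (simp add: emeasure_eq_measure2)
  qed
  have "area (near_vertices \<rho>) \<le> C * \<rho>\<^sup>2" if \<rho>: "0 \<le> \<rho>" for \<rho>
  proof -
    have "emeasure lebesgue (core i (near_vertices \<rho>)) \<le> ennreal (real (length (poly i)) * (\<rho>\<^sup>2 * U))" if i: "i < n_polys" for i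
    proof -
      have "emeasure lebesgue (core i (near_vertices \<rho>)) \<le> emeasure lebesgue (\<Union>k<length (poly i). ball (vertex (poly i) k) \<rho>)"
        unfolding core_eq[OF i] by (intro emeasure_mono sets.finite_UN) auto
      also have "\<dots> \<le> (\<Sum>k<length (poly i). emeasure lebesgue (ball (vertex (poly i) k) \<rho>))"
        by (intro emeasure_subadditive_finite) auto
      also have "\<dots> = of_nat (length (poly i)) * ennreal (\<rho>\<^sup>2 * U)" using ball_m[OF \<rho>] by simp
      also have "\<dots> = ennreal (real (length (poly i)) * (\<rho>\<^sup>2 * U))" using U by (simp add: ennreal_mult ennreal_of_nat_eq_real_of_nat)
      finally show ?thesis .
    qed
    then have "emeasure (area_measure X) (near_vertices \<rho>) \<le> (\<Sum>i<n_polys. ennreal (real (length (poly i)) * (\<rho>\<^sup>2 * U)))"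
      unfolding emeasure_core[OF s] by (intro sum_mono) auto
    also have "\<dots> = ennreal (\<Sum>i<n_polys. real (length (poly i)) * (\<rho>\<^sup>2 * U))" using U by (intro sum_ennreal) auto
    also have "(\<Sum>i<n_polys. real (length (poly i)) * (\<rho>\<^sup>2 * U)) = C * \<rho>\<^sup>2"
      by (simp add: C_def sum_distrib_left sum_distrib_right algebra_simps)
    finally show ?thesis using U by (simp add: emeasure_eq_measure C_def sum_nonneg)
  qed
  moreover have "0 \<le> C" using U by (simp add: C_def sum_nonneg)
  ultimately show ?thesis using that s by blast
qed

definition tubed :: "complex \<Rightarrow> real \<Rightarrow> real \<Rightarrow> (nat \<times> complex) set \<Rightarrow> bool" where
  "tubed v T b p \<longleftrightarrow> (\<exists>\<gamma>. integral_curve X v T \<gamma> \<and> \<gamma> 0 = p \<and> (\<forall>t. 0 \<le> t \<longrightarrow> t \<le> T \<longrightarrow> reg b (\<gamma> t)))"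

lemma tubed_mono: "tubed v T b p \<Longrightarrow> T' \<le> T \<Longrightarrow> tubed v T' b p"
  unfolding tubed_def using integral_curve_sub[of v T _ 0 T'] by (metis (no_types, lifting) add_0 order_refl order_trans)

lemma tubed_flow: "tubed v T b p \<Longrightarrow> 0 \<le> T \<Longrightarrow> \<exists>q. flowv X v T p q"
  unfolding tubed_def using flowI reg_nonsing(2) by metis

text \<open>It is enough to look at the orbit at the multiples of \<open>c / 2\<close>. From a point with a disc of
  radius \<open>c\<close> the orbit continues for a time \<open>c / 2\<close>, and meanwhile it has discs of radius \<open>c / 2\<close>.\<close>

lemma tubed_if_away:
  assumes v: "norm v = 1" and c: "0 < c" and p: "p \<in> points X" "p \<notin> sing X"
    and regular: "\<And>q. q \<in> points X \<Longrightarrow> q \<notin> B \<Longrightarrow> reg c q"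
    and away: "\<And>j q. j \<le> m \<Longrightarrow> flowv X v (real j * (c / 2)) p q \<Longrightarrow> q \<notin> B"
  shows "tubed v (real m * (c / 2)) (c / 2) p"
proof -
  have step: "\<exists>q. flowv X v (real j * (c / 2)) p q \<and> reg c q" if "j \<le> m" for j
    using that
  proof (induction j)
    case 0
    have "flowv X v (real 0 * (c / 2)) p p" using flow_zero[OF p] by simp
    then show ?case using away[OF 0] regular p(1) by blast
  next
    case (Suc j)
    then obtain q where q: "flowv X v (real j * (c / 2)) p q" "reg c q" by auto
    have "flowv X v (c / 2) (shift q 0) (shift q (0 + of_real (c / 2) * v))"
      by (rule flow_straight[OF q(2) v]) (use c in auto)
    then have "flowv X v (real j * (c / 2) + c / 2) p (shift q (0 + of_real (c / 2) * v))"
      using flow_add[OF q(1)] shift_chart(2)[OF q(2)] by simp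
    moreover have "real j * (c / 2) + c / 2 = real (Suc j) * (c / 2)" by (simp add: algebra_simps)
    ultimately have "flowv X v (real (Suc j) * (c / 2)) p (shift q (0 + of_real (c / 2) * v))" by (simp only:)
    then show ?case using away[OF Suc.prems] regular flow_nonsing(3) by blast
  qed
  obtain q where "flowv X v (real m * (c / 2)) p q" using step by blast
  then obtain \<gamma> b where \<gamma>: "integral_curve X v (real m * (c / 2)) \<gamma>" "\<gamma> 0 = p"
    "\<And>s. 0 \<le> s \<Longrightarrow> s \<le> real m * (c / 2) \<Longrightarrow> reg b (\<gamma> s)" using flowE[OF _ v] by metis
  have "reg (c / 2) (\<gamma> t)" if t: "0 \<le> t" "t \<le> real m * (c / 2)" for t
  proof -
    define j where "j = nat \<lfloor>t / (c / 2)\<rfloor>"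
    have "real j = of_int \<lfloor>t / (c / 2)\<rfloor>" using t c by (simp add: j_def)
    then have "real j \<le> t / (c / 2)" "t / (c / 2) < real j + 1" by linarith+
    then have j: "real j * (c / 2) \<le> t" "t < real j * (c / 2) + c / 2" using c by (simp_all add: field_simps)
    have "real j * (c / 2) \<le> real m * (c / 2)" using j t by linarith
    then have jm: "j \<le> m" using c by (simp add: mult_le_cancel_right)
    obtain q where q: "flowv X v (real j * (c / 2)) p q" "reg c q" using step[OF jm] by blast
    let ?s = "real j * (c / 2)"
    have s: "0 \<le> ?s" "?s \<le> real m * (c / 2)" using c \<open>?s \<le> real m * (c / 2)\<close> by auto
    have "flowv X v ?s p (\<gamma> ?s)"
      using flow_along[OF \<gamma>(1,3) order_refl s] \<gamma>(2) by simp
    then have rs: "reg c (\<gamma> ?s)" using flow_unique[OF q(1) _ v] q(2) by blast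
    have "\<gamma> t = shift (\<gamma> ?s) (of_real (t - ?s) * v)"
      by (rule integral_curve_shift[OF \<gamma>(1) v s t rs]) (use j c in linarith)
    moreover have "norm (of_real (t - ?s) * v) = t - ?s" using j v by (simp only: norm_mult norm_of_real) simp
    ultimately have "reg (c - (t - ?s)) (\<gamma> t)" using reg_shift(1)[OF rs, of "of_real (t - ?s) * v"] j c by simp
    then show ?thesis by (rule reg_mono) (use j c in auto)
  qed
  then show ?thesis unfolding tubed_def using \<gamma> by blast
qed

lemma inner_points_nonsing: "p \<in> inner_points \<Longrightarrow> p \<in> points X \<and> p \<notin> sing X"
  using openE[OF open_inner] inner_shift(1) reg_nonsing by (auto simp: inner_points_def) metis+

lemma geometric_powr: "0 < \<epsilon> \<Longrightarrow> summable (\<lambda>n. (2 ^ n :: real) powr (- \<epsilon>))"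
proof -
  assume "0 < \<epsilon>"
  then have "(2::real) powr (- \<epsilon>) < 1" using powr_less_cancel_iff[of 2 "- \<epsilon>" 0] by simp
  then have "summable (\<lambda>n. (2 powr (- \<epsilon>) :: real) ^ n)" by (intro summable_geometric) simp
  moreover have "(2 powr (- \<epsilon>) :: real) ^ n = (2 ^ n) powr (- \<epsilon>)" for n
    by (simp add: powr_powr powr_realpow[symmetric] mult.commute)
  ultimately show ?thesis by simp
qed

text \<open>With \<open>c\<close> of order \<open>2\<^sup>n\<close> to the power \<open>- 1 - \<epsilon>\<close>, the orbit up to time \<open>2\<^sup>n\<close> is looked at
  about \<open>2\<^sup>n / c\<close> times. As the flow preserves area, each time the points that are within \<open>K * c\<close>
  of a vertex have area of order \<open>c\<^sup>2\<close>. In total this is of order \<open>2\<^sup>n * c\<close>, which is summable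
  over \<open>n\<close>.\<close>

lemma AE_tubed:
  assumes v: "norm v = 1" and \<epsilon>: "0 < \<epsilon>"
  shows "AE p in area_measure X. \<forall>\<^sub>F n in sequentially. tubed v (2 ^ n) ((2 ^ n) powr (- 1 - \<epsilon>) / 2) p"
proof -
  interpret finite_measure "area_measure X" by (rule finite_measure_area)
  obtain K where K: "K > 1" "\<And>c i x. c > 0 \<Longrightarrow> i < n_polys \<Longrightarrow> x \<in> region (poly i) \<Longrightarrow>
     (\<forall>k<length (poly i). K * c \<le> dist x (vertex (poly i) k)) \<Longrightarrow> \<exists>\<psi>. chart X (ball 0 c) \<psi> \<and> \<psi> 0 = pt X i x"
    using chart_away_from_vertices by metis
  obtain C where C: "0 \<le> C" "\<And>\<rho>. 0 \<le> \<rho> \<Longrightarrow> near_vertices \<rho> \<in> sets (area_measure X)"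
    "\<And>\<rho>. 0 \<le> \<rho> \<Longrightarrow> area (near_vertices \<rho>) \<le> C * \<rho>\<^sup>2" using near_vertices_area by blast
  have regular: "reg c q" if q: "q \<in> points X" "q \<notin> near_vertices (K * c)" "0 < c" for q c
  proof -
    obtain i x where x: "i < n_polys" "x \<in> region (poly i)" "q = pt X i x" "(i, x) \<in> q" using pointsE[OF q(1)] .
    have "\<forall>k<length (poly i). K * c \<le> dist x (vertex (poly i) k)"
      using q(1,2) x(4) unfolding near_vertices_def by force
    then show ?thesis using K(2)[OF q(3) x(1,2)] q(3) x(3) by (simp add: reg_def)
  qed
  define c where "c n = (2 ^ n :: real) powr (- 1 - \<epsilon>)" for n
  define m where "m n = nat \<lceil>2 ^ n * 2 / c n\<rceil>" for n
  define F where "F t = {(p, q). flowv X v t p q}" for t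
  have F: "transl_corr (F t)" for t unfolding F_def by (rule transl_corr_flow[OF v])
  define E where "E n = (\<Union>j\<in>{..m n}. (F (real j * (c n / 2)))\<inverse> `` near_vertices (K * c n))" for n
  have c0: "0 < c n" "c n \<le> 1" for n
  proof -
    show "0 < c n" by (simp add: c_def)
    have "(2 ^ n :: real) powr (- 1 - \<epsilon>) \<le> (2 ^ n) powr 0" using \<epsilon> by (intro powr_mono) auto
    then show "c n \<le> 1" by (simp add: c_def)
  qed
  have Kc: "0 \<le> K * c n" for n using K(1) c0(1)[of n] by simp
  have EM: "E n \<in> sets (area_measure X)" for n
    unfolding E_def using preimage_area(1)[OF F C(2)[OF Kc]] by (intro sets.finite_UN) auto
  have bound: "area (E n) \<le> 4 * C * K\<^sup>2 * (2 ^ n) powr (- \<epsilon>)" for n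
  proof -
    have "area (E n) \<le> (\<Sum>j\<in>{..m n}. area ((F (real j * (c n / 2)))\<inverse> `` near_vertices (K * c n)))"
      unfolding E_def using preimage_area(1)[OF F C(2)[OF Kc]] by (intro finite_measure_subadditive_finite) auto
    also have "\<dots> \<le> (\<Sum>j\<in>{..m n}. C * (K * c n)\<^sup>2)"
      using preimage_area(2)[OF F C(2)[OF Kc]] C(3)[OF Kc] by (intro sum_mono) (meson order_trans)
    also have "\<dots> = (real (m n) + 1) * (C * (K * c n)\<^sup>2)" by simp
    also have "\<dots> \<le> (2 ^ n * 2 / c n + 2) * (C * (K * c n)\<^sup>2)"
    proof (rule mult_right_mono)
      have "0 \<le> 2 ^ n * 2 / c n" using c0(1)[of n] by simp
      then show "real (m n) + 1 \<le> 2 ^ n * 2 / c n + 2" unfolding m_def by linarith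
    qed (use C(1) in simp)
    also have "\<dots> = C * K\<^sup>2 * (2 * (2 ^ n * c n) + 2 * (c n * c n))"
      using c0(1)[of n] by (simp add: field_simps power2_eq_square)
    also have "\<dots> \<le> C * K\<^sup>2 * (2 * (2 ^ n * c n) + 2 * (2 ^ n * c n))"
    proof (intro mult_left_mono add_left_mono)
      have "c n \<le> 2 ^ n" using c0(2)[of n] one_le_power[of "2::real" n] by linarith
      then show "c n * c n \<le> 2 ^ n * c n" using c0(1)[of n] by (intro mult_right_mono) auto
    qed (use C(1) in auto)
    also have "2 ^ n * c n = (2 ^ n) powr (- \<epsilon>)"
      using powr_add[of "2 ^ n :: real" 1 "- 1 - \<epsilon>"] by (simp add: c_def)
    finally show ?thesis by (simp add: algebra_simps)
  qed
  have "summable (\<lambda>n. area (E n))"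
  proof (rule summable_comparison_test')
    show "summable (\<lambda>n. 4 * C * K\<^sup>2 * (2 ^ n) powr (- \<epsilon>))" by (intro summable_mult geometric_powr \<epsilon>)
    show "norm (area (E n)) \<le> 4 * C * K\<^sup>2 * (2 ^ n) powr (- \<epsilon>)" if "n \<ge> 0" for n using bound[of n] by simp
  qed
  then have "AE p in area_measure X. \<forall>\<^sub>F n in sequentially. p \<in> space (area_measure X) - E n"
    using EM by (intro borel_cantelli_AE1) (auto simp: emeasure_eq_measure)
  with AE_inner show ?thesis
  proof eventually_elim
    case (elim p)
    have p: "p \<in> points X" "p \<notin> sing X" using inner_points_nonsing[OF elim(1)] by auto
    from elim(2) show ?case
    proof eventually_elim
      case (elim n)
      have "tubed v (real (m n) * (c n / 2)) (c n / 2) p"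
      proof (rule tubed_if_away[OF v c0(1) p regular[OF _ _ c0(1)]])
        show "q \<notin> near_vertices (K * c n)" if "j \<le> m n" "flowv X v (real j * (c n / 2)) p q" for j q
          using elim that by (auto simp: E_def F_def)
      qed
      moreover have "2 ^ n \<le> real (m n) * (c n / 2)"
      proof -
        have "2 ^ n * 2 / c n \<le> real (m n)" unfolding m_def by linarith
        then show ?thesis using c0(1)[of n] by (simp add: field_simps)
      qed
      ultimately show ?case using tubed_mono by (simp add: c_def)
    qed
  qed
qed

lemma AE_flow_defined:
  assumes v: "norm v = 1"
  shows "AE p in area_measure X. \<forall>t\<ge>0. \<exists>q. flowv X v t p q"
proof -
  have "AE p in area_measure X. \<forall>\<^sub>F n in sequentially. tubed v (2 ^ n) ((2 ^ n) powr (- 2) / 2) p"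
    using AE_tubed[OF v, of 1] by simp
  then show ?thesis
  proof eventually_elim
    case (elim p)
    show ?case
    proof (intro allI impI)
      fix t :: real assume t: "0 \<le> t"
      obtain n0 where n0: "\<And>n. n \<ge> n0 \<Longrightarrow> tubed v (2 ^ n) ((2 ^ n) powr (- 2) / 2) p" using elim by (auto simp: eventually_sequentially)
      obtain n1 where "t < 2 ^ n1" using real_arch_pow[of 2 t] by auto
      moreover have "(2::real) ^ n1 \<le> 2 ^ max n0 n1" by (rule power_increasing) auto
      ultimately have "t \<le> 2 ^ max n0 n1" by linarith
      from tubed_flow[OF tubed_mono[OF n0 this] t] show "\<exists>q. flowv X v t p q" by simp
    qed
  qed
qed

section \<open>Almost every point returns quickly\<close>

text \<open>The images of \<open>A\<close> at the times \<open>0\<close>, \<open>\<tau>\<close>, ..., \<open>m * \<tau>\<close> have the same area and are disjoint: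
  if two of them had a common point, a point of \<open>A\<close> would come back to \<open>A\<close> at the difference of
  the two times.\<close>

lemma no_return_area:
  fixes m :: nat
  assumes v: "norm v = 1" and \<tau>: "0 < \<tau>" and Q: "Q \<in> sets (area_measure X)"
  defines "A \<equiv> {p \<in> Q. (\<exists>q. flowv X v (real m * \<tau>) p q) \<and> (\<forall>j\<in>{1..m}. \<forall>q. flowv X v (real j * \<tau>) p q \<longrightarrow> q \<notin> Q)}"
  shows "A \<in> sets (area_measure X)" "real (Suc m) * area A \<le> area (points X)"
proof -
  interpret finite_measure "area_measure X" by (rule finite_measure_area)
  define F where "F t = {(p, q). flowv X v t p q}" for t
  have F: "transl_corr (F t)" for t unfolding F_def by (rule transl_corr_flow[OF v])
  have pts: "points X \<in> sets (area_measure X)" using sets.top[of "area_measure X"] by (simp add: space_area_measure)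
  have "A = Q \<inter> (F (real m * \<tau>))\<inverse> `` points X - (\<Union>j\<in>{1..m}. (F (real j * \<tau>))\<inverse> `` Q)"
    using flow_nonsing(3) by (auto simp: A_def F_def)
  then show As: "A \<in> sets (area_measure X)"
    using preimage_area(1)[OF F] Q pts by (auto intro!: sets.Diff sets.Int sets.finite_UN)
  have dom: "A \<subseteq> Domain (F (real j * \<tau>))" if "j \<le> m" for j
  proof
    fix p assume "p \<in> A"
    then obtain q where q: "flowv X v (real m * \<tau>) p q" by (auto simp: A_def)
    have "real j * \<tau> \<le> real m * \<tau>" using that \<tau> by (intro mult_right_mono) auto
    then obtain q' where "flowv X v (real j * \<tau>) p q'" using flow_split[OF q, of "real j * \<tau>"] \<tau> by auto
    then show "p \<in> Domain (F (real j * \<tau>))" by (auto simp: F_def)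
  qed
  have disj: "disjoint_family_on (\<lambda>j. F (real j * \<tau>) `` A) {..m}"
  proof -
    have False if ij: "i < j" "j \<le> m" and q: "q \<in> F (real i * \<tau>) `` A" "q \<in> F (real j * \<tau>) `` A" for i j q
    proof -
      obtain a where a: "a \<in> A" "flowv X v (real i * \<tau>) a q" using q(1) by (auto simp: F_def)
      obtain b where b: "b \<in> A" "flowv X v (real j * \<tau>) b q" using q(2) by (auto simp: F_def)
      have d: "real j * \<tau> - real i * \<tau> = real (j - i) * \<tau>" using ij by (simp add: of_nat_diff algebra_simps)
      have "0 \<le> real j * \<tau> - real i * \<tau>" unfolding d using \<tau> by simp
      moreover have "real j * \<tau> - real i * \<tau> \<le> real j * \<tau>" using \<tau> by simp
      ultimately obtain a' where a': "flowv X v (real j * \<tau> - real i * \<tau>) b a'"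
        "flowv X v (real j * \<tau> - (real j * \<tau> - real i * \<tau>)) a' q" using flow_split[OF b(2)] by blast
      then have "a' = a" using flow_inj[OF _ a(2) v] by simp
      then have "flowv X v (real (j - i) * \<tau>) b a" using a'(1) unfolding d by simp
      moreover have "j - i \<in> {1..m}" using ij by auto
      ultimately show False using a(1) b(1) unfolding A_def by blast
    qed
    then show ?thesis unfolding disjoint_family_on_def by (metis atMost_iff disjoint_iff nat_neq_iff)
  qed
  have im: "F (real j * \<tau>) `` A \<in> sets (area_measure X)" "area (F (real j * \<tau>) `` A) = area A" if "j \<le> m" for j
    using image_area_eq[OF F As dom[OF that]] by auto
  have "real (Suc m) * area A = (\<Sum>j\<in>{..m}. area (F (real j * \<tau>) `` A))" using im(2) by simp
  also have "\<dots> = area (\<Union>j\<in>{..m}. F (real j * \<tau>) `` A)"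
    using im(1) disj by (intro finite_measure_finite_Union[symmetric]) auto
  also have "\<dots> \<le> area (points X)"
    by (rule finite_measure_mono[OF _ pts]) (use flow_nonsing(3) in \<open>auto simp: F_def\<close>)
  finally show "real (Suc m) * area A \<le> area (points X)" .
qed

definition cell :: "real \<Rightarrow> int \<Rightarrow> int \<Rightarrow> complex set" where
  "cell h a b = {x. of_int a * h \<le> Re x \<and> Re x < (of_int a + 1) * h \<and> of_int b * h \<le> Im x \<and> Im x < (of_int b + 1) * h}"

lemma cell_lebesgue: "cell h a b \<in> sets lebesgue"
proof -
  have "cell h a b = {x. of_int a * h \<le> Re x} \<inter> {x. Re x < (of_int a + 1) * h} \<inter> {x. of_int b * h \<le> Im x} \<inter> {x. Im x < (of_int b + 1) * h}"
    by (auto simp: cell_def)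
  moreover have "closed {x. of_int a * h \<le> Re x}" "open {x. Re x < (of_int a + 1) * h}"
    "closed {x. of_int b * h \<le> Im x}" "open {x. Im x < (of_int b + 1) * h}"
    by (intro closed_Collect_le open_Collect_less continuous_intros)+
  ultimately show ?thesis by (auto intro!: sets.Int)
qed

lemma cell_convex: "convex (cell h a b)"
proof -
  have "cell h a b = {x. Re x \<ge> of_int a * h} \<inter> {x. Re x < (of_int a + 1) * h} \<inter> {x. Im x \<ge> of_int b * h} \<inter> {x. Im x < (of_int b + 1) * h}"
    by (auto simp: cell_def)
  then show ?thesis
    by (auto intro!: convex_Int convex_halfspace_Re_ge convex_halfspace_Re_lt convex_halfspace_Im_ge convex_halfspace_Im_lt)
qed

lemma cell_diameter: "x \<in> cell h a b \<Longrightarrow> y \<in> cell h a b \<Longrightarrow> dist x y < 2 * h"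
proof -
  assume "x \<in> cell h a b" "y \<in> cell h a b"
  then have "\<bar>Re (x - y)\<bar> < h" "\<bar>Im (x - y)\<bar> < h" by (auto simp: cell_def abs_less_iff algebra_simps)
  then show ?thesis using cmod_le[of "x - y"] by (simp add: dist_norm)
qed

text \<open>There are of the order of \<open>4\<^sup>n\<close> squares of diameter less than \<open>1 / 2\<^sup>n\<close>, while \<open>m\<close> is larger
  by the factor \<open>2\<^sup>n\<close> to the power \<open>\<epsilon>\<close>. So the areas of the points that are slow to return to
  their own square are summable over \<open>n\<close>. The time \<open>m * \<tau>\<close> is only of order \<open>2\<^sup>n\<close> to the power
  \<open>1 + \<epsilon>\<close>, because the time step \<open>\<tau>\<close> is comparable to the size of the squares.\<close>

lemma AE_returns:
  assumes v: "norm v = 1" and \<epsilon>: "0 < \<epsilon>"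
  shows "AE p in area_measure X. \<forall>\<^sub>F n in sequentially. \<exists>t q. 2 / 2 ^ n \<le> t \<and>
    t \<le> 2 / 2 ^ n * ((2 ^ n) powr (2 + \<epsilon>) + 1) \<and> flowv X v t p q \<and> flat_dist X q p < 1 / 2 ^ n"
proof -
  interpret finite_measure "area_measure X" by (rule finite_measure_area)
  have "bounded (\<Union>i<n_polys. intr i)"
    using bounded_subset[OF compact_imp_bounded[OF compact_region] inner_region] by (intro bounded_UN) auto
  then obtain N0 where N0: "\<And>i x. i < n_polys \<Longrightarrow> x \<in> intr i \<Longrightarrow> norm x \<le> N0" unfolding bounded_iff by blast
  obtain N :: nat where N: "N0 \<le> real N" "1 \<le> N" using real_arch_simple[of "max N0 1"] by auto
  define h where "h n = 1 / (2 * 2 ^ n :: real)" for n :: nat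
  have h: "0 < h n" "2 * h n = 1 / 2 ^ n" for n by (simp_all add: h_def)
  \<comment> \<open>already the first step is longer than every radius below \<open>2 / 2 ^ n\<close>, as required of a return time\<close>
  define \<tau> where "\<tau> n = 2 / (2 ^ n :: real)" for n :: nat
  define m where "m n = nat \<lceil>(2 ^ n :: real) powr (2 + \<epsilon>)\<rceil>" for n :: nat
  define L where "L n = int (2 * N * 2 ^ n)" for n :: nat
  define J where "J n = {(i, a, b). i < n_polys \<and> a \<in> {- L n..L n} \<and> b \<in> {- L n..L n} \<and> cell (h n) a b \<subseteq> intr i}" for n
  define A where "A n Q = {p \<in> Q. (\<exists>q. flowv X v (real (m n) * \<tau> n) p q) \<and>
    (\<forall>j\<in>{1..m n}. \<forall>q. flowv X v (real j * \<tau> n) p q \<longrightarrow> q \<notin> Q)}" for n Q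
  define Q where "Q n = (\<lambda>(i, a, b). pt X i ` cell (h n) a b)" for n
  define E where "E n = (\<Union>x\<in>J n. A n (Q n x))" for n
  have Jsub: "J n \<subseteq> {..<n_polys} \<times> {- L n..L n} \<times> {- L n..L n}" for n by (auto simp: J_def)
  have Jfin: "finite (J n)" for n using finite_subset[OF Jsub] by blast
  have Jcard: "real (card (J n)) \<le> real n_polys * (25 * real N ^ 2) * (2 ^ n) powr 2" for n
  proof -
    have "card (J n) \<le> card ({..<n_polys} \<times> {- L n..L n} \<times> {- L n..L n})"
      using Jsub by (intro card_mono) auto
    then have "real (card (J n)) \<le> real n_polys * (real (nat (2 * L n + 1)) * real (nat (2 * L n + 1)))"
      unfolding card_cartesian_product of_nat_mult[symmetric] of_nat_le_iff by (simp add: algebra_simps)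
    also have "real (nat (2 * L n + 1)) = 4 * real N * 2 ^ n + 1" by (simp add: L_def)
    also have "\<dots> \<le> 5 * real N * 2 ^ n"
    proof -
      have "1 * 1 \<le> real N * 2 ^ n" using N(2) by (intro mult_mono) auto
      then show ?thesis by linarith
    qed
    then have "real n_polys * ((4 * real N * 2 ^ n + 1) * (4 * real N * 2 ^ n + 1)) \<le> real n_polys * ((5 * real N * 2 ^ n) * (5 * real N * 2 ^ n))"
      by (intro mult_left_mono mult_mono) auto
    also have "\<dots> = real n_polys * (25 * real N ^ 2) * (2 ^ n) powr 2" by (simp add: power2_eq_square)
    finally show ?thesis .
  qed
  have QM: "Q n x \<in> sets (area_measure X)" if x: "x \<in> J n" for n x
  proof -
    obtain i a b where i: "x = (i, a, b)" "i < n_polys" "cell (h n) a b \<subseteq> intr i" using x by (auto simp: J_def)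
    then show ?thesis using area_image(1)[OF i(2,3) cell_lebesgue] by (simp add: Q_def)
  qed
  have \<tau>0: "0 < \<tau> n" for n by (simp add: \<tau>_def)
  have nr: "A n (Q n x) \<in> sets (area_measure X)" "real (Suc (m n)) * area (A n (Q n x)) \<le> area (points X)"
    if "x \<in> J n" for n x
    using no_return_area[OF v \<tau>0[of n] QM[OF that], of "m n"] unfolding A_def by auto
  have EM: "E n \<in> sets (area_measure X)" for n unfolding E_def using Jfin nr(1) by (intro sets.finite_UN) auto
  define C where "C = real n_polys * (25 * real N ^ 2) * area (points X)"
  have bound: "area (E n) \<le> C * (2 ^ n) powr (- \<epsilon>)" for n
  proof -
    have pos: "0 < (2 ^ n :: real) powr (2 + \<epsilon>)" by simp
    have mm: "(2 ^ n :: real) powr (2 + \<epsilon>) \<le> real (Suc (m n))" unfolding m_def by linarith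
    have "area (A n (Q n x)) \<le> area (points X) / (2 ^ n) powr (2 + \<epsilon>)" if "x \<in> J n" for x
    proof -
      have "(2 ^ n) powr (2 + \<epsilon>) * area (A n (Q n x)) \<le> real (Suc (m n)) * area (A n (Q n x))"
        using mm by (intro mult_right_mono) auto
      also have "\<dots> \<le> area (points X)" by (rule nr(2)[OF that])
      finally show ?thesis using pos by (simp add: field_simps)
    qed
    then have "(\<Sum>x\<in>J n. area (A n (Q n x))) \<le> real (card (J n)) * (area (points X) / (2 ^ n) powr (2 + \<epsilon>))"
      by (rule sum_bounded_above)
    moreover have "area (E n) \<le> (\<Sum>x\<in>J n. area (A n (Q n x)))"
      unfolding E_def using Jfin nr(1) by (intro finite_measure_subadditive_finite) auto
    ultimately have "area (E n) \<le> real (card (J n)) * (area (points X) / (2 ^ n) powr (2 + \<epsilon>))" by linarith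
    also have "\<dots> \<le> (real n_polys * (25 * real N ^ 2) * (2 ^ n) powr 2) * (area (points X) / (2 ^ n) powr (2 + \<epsilon>))"
      by (intro mult_right_mono Jcard) auto
    also have "\<dots> = C * ((2 ^ n) powr 2 / (2 ^ n) powr (2 + \<epsilon>))" by (simp add: C_def)
    also have "(2 ^ n :: real) powr 2 / (2 ^ n) powr (2 + \<epsilon>) = (2 ^ n) powr (- \<epsilon>)" by (simp only: powr_diff[symmetric]) simp
    finally show ?thesis .
  qed
  have "summable (\<lambda>n. area (E n))"
  proof (rule summable_comparison_test')
    show "summable (\<lambda>n. C * (2 ^ n) powr (- \<epsilon>))" by (intro summable_mult geometric_powr \<epsilon>)
    show "norm (area (E n)) \<le> C * (2 ^ n) powr (- \<epsilon>)" if "n \<ge> 0" for n using bound[of n] by simp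
  qed
  then have "AE p in area_measure X. \<forall>\<^sub>F n in sequentially. p \<in> space (area_measure X) - E n"
    using EM by (intro borel_cantelli_AE1) (auto simp: emeasure_eq_measure)
  with AE_inner AE_flow_defined[OF v] show ?thesis
  proof eventually_elim
    case (elim p)
    obtain i x where x: "i < n_polys" "x \<in> intr i" "p = pt X i x" using elim(1) by (auto simp: inner_points_def)
    obtain e where e: "0 < e" "ball x e \<subseteq> intr i" using openE[OF open_inner[OF x(1)] x(2)] .
    have "(\<lambda>n. inverse (2::real) ^ n) \<longlonglongrightarrow> 0" by (intro LIMSEQ_realpow_zero) auto
    then have "\<forall>\<^sub>F n in sequentially. inverse (2::real) ^ n < e" using e(1) by (rule order_tendstoD)
    with elim(3) show ?case
    proof eventually_elim
      case (elim n)
      define a where "a = \<lfloor>Re x / h n\<rfloor>"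
      define b where "b = \<lfloor>Im x / h n\<rfloor>"
      have fl: "of_int \<lfloor>r / h n\<rfloor> * h n \<le> r" "r < (of_int \<lfloor>r / h n\<rfloor> + 1) * h n" for r
      proof -
        have "of_int \<lfloor>r / h n\<rfloor> \<le> r / h n" "r / h n < of_int \<lfloor>r / h n\<rfloor> + 1" by linarith+
        then show "of_int \<lfloor>r / h n\<rfloor> * h n \<le> r" "r < (of_int \<lfloor>r / h n\<rfloor> + 1) * h n"
          using iffD1[OF pos_le_divide_eq[OF h(1)]] iffD1[OF pos_divide_less_eq[OF h(1)]] by blast+
      qed
      have xc: "x \<in> cell (h n) a b" using fl by (simp add: cell_def a_def b_def)
      have "cell (h n) a b \<subseteq> ball x e"
      proof
        fix y assume "y \<in> cell (h n) a b"
        then have "dist x y < 2 * h n" using cell_diameter xc by blast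
        moreover have "2 * h n < e" unfolding h(2) using elim(2) by (simp add: inverse_eq_divide power_one_over)
        ultimately show "y \<in> ball x e" by simp
      qed
      then have ci: "cell (h n) a b \<subseteq> intr i" using e(2) by blast
      have Lb: "\<lfloor>r / h n\<rfloor> \<in> {- L n..L n}" if "\<bar>r\<bar> \<le> real N" for r
      proof -
        have rr: "r / h n = r * (2 * 2 ^ n)" by (simp add: h_def)
        have "\<bar>r * (2 * 2 ^ n)\<bar> \<le> real N * (2 * 2 ^ n)" using that by (simp add: abs_mult)
        then have "- (real N * (2 * 2 ^ n)) \<le> r / h n" "r / h n \<le> real N * (2 * 2 ^ n)" unfolding rr by linarith+
        moreover have "real_of_int (L n) = real N * (2 * 2 ^ n)" by (simp add: L_def)
        ultimately have "of_int (- L n) \<le> r / h n" "r / h n \<le> of_int (L n)" by simp_all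
        then show ?thesis by (simp add: le_floor_iff floor_le_iff)
      qed
      have "\<bar>Re x\<bar> \<le> real N" "\<bar>Im x\<bar> \<le> real N"
        using N0[OF x(1,2)] N(1) abs_Re_le_cmod[of x] abs_Im_le_cmod[of x] by linarith+
      then have J: "(i, a, b) \<in> J n" using x(1) ci Lb by (auto simp: J_def a_def b_def)
      have pQ: "p \<in> Q n (i, a, b)" using xc x(3) by (auto simp: Q_def)
      have "p \<notin> A n (Q n (i, a, b))" using elim(1) J by (auto simp: E_def)
      moreover have "\<exists>q. flowv X v (real (m n) * \<tau> n) p q" using \<open>\<forall>t\<ge>0. \<exists>q. flowv X v t p q\<close> \<tau>0[of n] by simp
      ultimately obtain j q where j: "1 \<le> j" "j \<le> m n" "flowv X v (real j * \<tau> n) p q" "q \<in> Q n (i, a, b)"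
        using pQ by (auto simp: A_def)
      obtain y where y: "y \<in> cell (h n) a b" "q = pt X i y" using j(4) by (auto simp: Q_def)
      have "closed_segment y x \<subseteq> cell (h n) a b" using closed_segment_subset[OF y(1) xc cell_convex] .
      then have "flat_dist X q p \<le> dist y x" unfolding y(2) x(3)
        using ci inner_region by (intro flat_dist_polygon[OF x(1)]) blast
      also have "\<dots> < 1 / 2 ^ n" using cell_diameter[OF y(1) xc] h(2) by simp
      finally have d: "flat_dist X q p < 1 / 2 ^ n" .
      have "1 * \<tau> n \<le> real j * \<tau> n" using j(1) \<tau>0[of n] by (intro mult_right_mono) auto
      then have t1: "2 / 2 ^ n \<le> real j * \<tau> n" by (simp add: \<tau>_def)
      have "real (m n) \<le> (2 ^ n) powr (2 + \<epsilon>) + 1"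
        using powr_ge_zero[of "2 ^ n" "2 + \<epsilon>"] unfolding m_def by linarith
      then have "real j * \<tau> n \<le> ((2 ^ n) powr (2 + \<epsilon>) + 1) * \<tau> n" using j(2) \<tau>0[of n] by (intro mult_right_mono) auto
      then have t2: "real j * \<tau> n \<le> 2 / 2 ^ n * ((2 ^ n) powr (2 + \<epsilon>) + 1)" by (simp add: \<tau>_def mult.commute)
      show ?case using t1 t2 j(3) d by blast
    qed
  qed
qed

end

section \<open>Slow returns at infinitely many scales\<close>

lemma return_time_le:
  "t > r \<Longrightarrow> flow X \<theta> t p q \<Longrightarrow> flat_dist X q p < r \<Longrightarrow> return_time X \<theta> p r \<le> ereal t"
  unfolding return_time_def by (intro Inf_lower) auto

lemma return_time_ge:
  "(\<And>t q. t > r \<Longrightarrow> flow X \<theta> t p q \<Longrightarrow> flat_dist X q p < r \<Longrightarrow> a \<le> t) \<Longrightarrow> ereal a \<le> return_time X \<theta> p r"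
  unfolding return_time_def by (intro Inf_greatest) auto

context transl_surface
begin

text \<open>A return close to \<open>p\<close> becomes, a little earlier or later, a return to the segment through
  \<open>p\<close> orthogonal to the flow.\<close>

lemma transversal_return:
  assumes v: "norm v = 1" and \<rho>: "reg \<rho> p" and r: "0 < r" "2 * r \<le> \<rho>" and t: "r < t"
    and fl: "flowv X v t p q" "flat_dist X q p < r" and all: "\<And>t. 0 \<le> t \<Longrightarrow> \<exists>q. flowv X v t p q"
  obtains u s where "0 < u" "\<bar>u - t\<bar> < r" "\<bar>s\<bar> < r" "flowv X v u p (shift p (of_real s * (\<i> * v)))"
proof -
  obtain w where w: "q = shift p w" "norm w < r"
    using flat_dist_chart[OF \<rho> flow_nonsing(3)[OF fl(1)] fl(2)] r by auto
  have v0: "v \<noteq> 0" using v by auto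
  define a where "a = Re (w / v)"
  define s where "s = Im (w / v)"
  have "norm (w / v) < r" using w v by (simp add: norm_divide)
  then have as: "\<bar>a\<bar> < r" "\<bar>s\<bar> < r" using abs_Re_le_cmod[of "w / v"] abs_Im_le_cmod[of "w / v"] by (auto simp: a_def s_def)
  have "w / v = of_real a + of_real s * \<i>" by (simp add: complex_eq_iff a_def s_def)
  then have weq: "w = of_real s * (\<i> * v) + of_real a * v" using v0 by (simp add: field_simps)
  have ns: "norm (of_real s * (\<i> * v)) = \<bar>s\<bar>" by (simp add: norm_mult v)
  have "flowv X v (t - a) p (shift p (of_real s * (\<i> * v)))"
  proof (cases "0 \<le> a")
    case True
    have "flowv X v a (shift p (of_real s * (\<i> * v))) (shift p (of_real s * (\<i> * v) + of_real a * v))"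
      by (rule flow_straight[OF \<rho> v _ True]) (use ns as r in auto)
    then have 1: "flowv X v a (shift p (of_real s * (\<i> * v))) q" using w(1) weq by simp
    obtain q' where q': "flowv X v (t - a) p q'" "flowv X v (t - (t - a)) q' q"
      using flow_split[OF fl(1), of "t - a"] True as t by auto
    then have "q' = shift p (of_real s * (\<i> * v))" using flow_inj[OF _ 1 v] by simp
    then show ?thesis using q'(1) by simp
  next
    case False
    have "flowv X v (- a) (shift p w) (shift p (w + of_real (- a) * v))"
      by (rule flow_straight[OF \<rho> v]) (use w(2) as r False in auto)
    moreover have "w + of_real (- a) * v = of_real s * (\<i> * v)" using weq by simp
    ultimately have "flowv X v (- a) q (shift p (of_real s * (\<i> * v)))" unfolding w(1) by (simp only:)
    from flow_add[OF fl(1) this] show ?thesis by simp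
  qed
  then show ?thesis using that[of "t - a" s] as t by auto
qed

text \<open>The returns of \<open>p\<close> to the orthogonal segment of half length \<open>\<delta>\<close> are separated in time, so
  there is a first one, with a displacement \<open>s\<^sub>0\<close>. It is not zero because \<open>p\<close> is not periodic. For
  the radius \<open>r = \<bar>s\<^sub>0\<bar>\<close>, every return corresponds to a return to the segment which is later and
  closer; two such returns do not fit into one tube of radius larger than \<open>10 * r\<close>, so the second
  one takes place after the time up to which the orbit has such a tube.\<close>

lemma slow_return:
  assumes v: "v = direction \<theta>" and i: "i < n_polys" and x: "ball x \<rho> \<subseteq> intr i" and \<rho>: "0 < \<rho>" and p: "p = pt X i x"
    and all: "\<And>t. 0 \<le> t \<Longrightarrow> \<exists>q. flowv X v t p q"
    and nonper: "\<And>t. 0 < t \<Longrightarrow> \<not> flowv X v t p p"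
    and rec: "\<And>r. 0 < r \<Longrightarrow> r < \<rho> \<Longrightarrow> \<exists>t q. r < t \<and> flowv X v t p q \<and> flat_dist X q p < r"
    and tub: "\<And>n. n \<ge> n0 \<Longrightarrow> tubed v (2 ^ n) (b n) p"
    and \<delta>: "0 < \<delta>" "4 * \<delta> \<le> \<rho>"
  shows "\<exists>r. 0 < r \<and> r < \<delta> \<and> (\<forall>n\<ge>n0. 10 * r < b n \<longrightarrow> ereal (2 ^ n - r) \<le> return_time X \<theta> p r)"
proof -
  have nv: "norm v = 1" by (simp add: v norm_direction)
  have v0: "v \<noteq> 0" using nv by auto
  have reg: "reg \<rho> p" and sh: "norm w < \<rho> \<Longrightarrow> shift p w = pt X i (x + w)" for w
    using inner_shift[OF i x \<rho>] p by auto
  have inj: "w = w'" if "norm w < \<rho>" "norm w' < \<rho>" "shift p w = shift p w'" for w w'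
  proof -
    have "x + w \<in> intr i" "x + w' \<in> intr i" using x that by (auto simp: subset_iff dist_norm)
    then show ?thesis using inner_pt_eq[OF i _ i, of "x + w" "x + w'"] that(3) sh[OF that(1)] sh[OF that(2)] by simp
  qed
  let ?n = "\<i> * v"
  have nn: "norm (of_real s * ?n) = \<bar>s\<bar>" for s by (simp add: norm_mult nv)
  define S where "S = {t. 0 < t \<and> (\<exists>s. \<bar>s\<bar> < \<delta> \<and> flowv X v t p (shift p (of_real s * ?n)))}"
  have "\<delta> < \<rho>" using \<delta> by linarith
  then obtain t1 q1 where t1: "\<delta> < t1" "flowv X v t1 p q1" "flat_dist X q1 p < \<delta>" using rec[OF \<delta>(1)] by blast
  obtain u1 s1 where "0 < u1" "\<bar>s1\<bar> < \<delta>" "flowv X v u1 p (shift p (of_real s1 * ?n))"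
  proof -
    have "2 * \<delta> \<le> \<rho>" using \<delta> by linarith
    from transversal_return[OF nv reg \<delta>(1) this t1 all] show ?thesis using that by blast
  qed
  then have S1: "u1 \<in> S" by (auto simp: S_def)
  have Spos: "0 < t" if "t \<in> S" for t using that by (simp add: S_def)
  \<comment> \<open>inside the disc around \<open>p\<close> the flow leaves the segment and does not come back to it\<close>
  have gap: "t' = t" if tt: "t \<in> S" "t' \<in> S" "t' \<le> t" "t - t' < \<rho> / 2" for t t'
  proof -
    obtain s where s: "\<bar>s\<bar> < \<delta>" "flowv X v t p (shift p (of_real s * ?n))" using tt(1) by (auto simp: S_def)
    obtain s' where s': "\<bar>s'\<bar> < \<delta>" "flowv X v t' p (shift p (of_real s' * ?n))" using tt(2) by (auto simp: S_def)
    have 1: "flowv X v (t - t') (shift p (of_real s' * ?n)) (shift p (of_real s * ?n))"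
      by (rule flow_diff[OF s'(2) s(2) tt(3) nv])
    have 2: "flowv X v (t - t') (shift p (of_real s' * ?n)) (shift p (of_real s' * ?n + of_real (t - t') * v))"
      by (rule flow_straight[OF reg nv]) (use nn[of s'] s' tt \<delta> in auto)
    have "norm (of_real s' * ?n + of_real (t - t') * v) \<le> \<bar>s'\<bar> + \<bar>t - t'\<bar>"
      using norm_triangle_ineq[of "of_real s' * ?n" "of_real (t - t') * v"] unfolding nn by (simp only: norm_mult norm_of_real nv) simp
    then have nb: "norm (of_real s' * ?n + of_real (t - t') * v) < \<rho>" using s'(1) tt \<delta> by linarith
    have "of_real s' * ?n + of_real (t - t') * v = of_real s * ?n"
      using inj[OF nb _ flow_unique[OF 2 1 nv]] nn[of s] s(1) \<delta> by simp
    then have "(of_real s' * \<i> + of_real (t - t')) * v = (of_real s * \<i>) * v" by (simp add: algebra_simps)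
    then have "of_real s' * \<i> + of_real (t - t') = of_real s * \<i>" using v0 by (metis mult_right_cancel)
    then have "Re (of_real s' * \<i> + of_real (t - t')) = Re (of_real s * \<i>)" by (rule arg_cong)
    then show ?thesis by simp
  qed
  have bddS: "bdd_below S" using Spos by (meson bdd_below.I less_imp_le)
  have "Inf S < Inf S + \<rho> / 2" using \<rho> by simp
  then obtain t0 where t0: "t0 \<in> S" "t0 < Inf S + \<rho> / 2" using cInf_lessD[of S "Inf S + \<rho> / 2"] S1 by blast
  have min: "t0 \<le> t" if "t \<in> S" for t
  proof (rule ccontr)
    assume "\<not> t0 \<le> t"
    moreover have "Inf S \<le> t" by (rule cInf_lower[OF that bddS])
    ultimately show False using gap[OF t0(1) that] t0(2) by auto
  qed
  obtain s0 where s0: "\<bar>s0\<bar> < \<delta>" "flowv X v t0 p (shift p (of_real s0 * ?n))" using t0(1) by (auto simp: S_def)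
  have s0ne: "s0 \<noteq> 0"
  proof
    assume "s0 = 0"
    then show False using s0(2) nonper[OF Spos[OF t0(1)]] shift_chart(2)[OF reg] by simp
  qed
  let ?r = "\<bar>s0\<bar>"
  have "ereal (2 ^ n - ?r) \<le> return_time X \<theta> p ?r" if n: "n \<ge> n0" "10 * ?r < b n" for n
  proof (rule return_time_ge)
    fix t q assume t: "?r < t" "flow X \<theta> t p q" "flat_dist X q p < ?r"
    have fl: "flowv X v t p q" using t(2) by (simp add: flow_flowv v)
    have r2: "0 < ?r" "2 * ?r \<le> \<rho>" using s0ne s0(1) \<delta> by auto
    obtain u s where u: "0 < u" "\<bar>u - t\<bar> < ?r" "\<bar>s\<bar> < ?r" "flowv X v u p (shift p (of_real s * ?n))"
      using transversal_return[OF nv reg r2 t(1) fl t(3) all] by blast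
    have "\<bar>s\<bar> < \<delta>" using u(3) s0(1) by linarith
    then have "u \<in> S" using u by (auto simp: S_def)
    then have t0u: "t0 \<le> u" by (rule min)
    have "2 ^ n < u"
    proof (rule ccontr)
      assume "\<not> 2 ^ n < u"
      then have "tubed v u (b n) p" using tubed_mono[OF tub[OF n(1)]] by simp
      then obtain \<gamma> where \<gamma>: "integral_curve X v u \<gamma>" "\<gamma> 0 = p" "\<And>t. 0 \<le> t \<Longrightarrow> t \<le> u \<Longrightarrow> reg (b n) (\<gamma> t)"
        by (auto simp: tubed_def)
      have fg: "flowv X v t' p (\<gamma> t')" if "0 \<le> t'" "t' \<le> u" for t'
        using flow_along[OF \<gamma>(1,3) order_refl that] \<gamma>(2) by simp
      have gu: "\<gamma> u = shift (\<gamma> 0) (of_real s * ?n)"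
        using flow_unique[OF fg[of u] u(4) nv] u(1) \<gamma>(2) by simp
      have gt0: "\<gamma> t0 = shift (\<gamma> 0) (of_real s0 * ?n)"
        using flow_unique[OF fg[of t0] s0(2) nv] Spos[OF t0(1)] t0u \<gamma>(2) by simp
      \<comment> \<open>the normal vector is chosen such that the first return has a positive displacement\<close>
      define \<sigma> where "\<sigma> = sgn s0"
      have \<sigma>: "\<sigma> * s0 = ?r" "\<sigma> = 1 \<or> \<sigma> = - 1" using s0ne by (auto simp: \<sigma>_def sgn_real_def)
      have n': "of_real \<sigma> * ?n = ?n \<or> of_real \<sigma> * ?n = - ?n" using \<sigma>(2) by auto
      have e1: "of_real (\<sigma> * s) * (of_real \<sigma> * ?n) = of_real s * ?n" for s using \<sigma>(2) by auto
      have gu': "\<gamma> u = shift (\<gamma> 0) (of_real (\<sigma> * s) * (of_real \<sigma> * ?n))" using gu by (simp only: e1)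
      have gt': "\<gamma> t0 = shift (\<gamma> 0) (of_real ?r * (of_real \<sigma> * ?n))" using gt0 e1[of s0] unfolding \<sigma>(1) by (simp only:)
      have b: "\<bar>\<sigma> * s\<bar> < ?r" using u(3) \<sigma>(2) by auto
      show False
        by (rule no_two_close_returns[OF \<gamma>(1) nv n' \<gamma>(3) u(1) gu' less_imp_le[OF Spos[OF t0(1)]] t0u gt' b n(2)])
    qed
    then show "2 ^ n - ?r \<le> t" using u(2) by linarith
  qed
  then show ?thesis using s0ne s0(1) by (intro exI[of _ ?r]) auto
qed

section \<open>The exponent\<close>

lemma dyadic_scale:
  fixes r :: real
  assumes r: "0 < r" "r < 1 / 2 ^ n0"
  obtains n where "n0 < n" "1 / 2 ^ n \<le> r" "r < 2 / 2 ^ n"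
proof -
  have ex: "\<exists>n. 1 / 2 ^ n \<le> r"
  proof -
    obtain n where "1 / r < 2 ^ n" using real_arch_pow[of 2 "1 / r"] by auto
    then show ?thesis using r(1) by (intro exI[of _ n]) (simp add: field_simps)
  qed
  define n where "n = (LEAST n. 1 / 2 ^ n \<le> r)"
  have n: "1 / 2 ^ n \<le> r" unfolding n_def by (rule LeastI_ex[OF ex])
  have nn0: "n0 < n"
  proof (rule ccontr)
    assume "\<not> n0 < n"
    then have "(2::real) ^ n \<le> 2 ^ n0" by (intro power_increasing) auto
    then have "1 / 2 ^ n0 \<le> (1 / 2 ^ n :: real)" by (simp add: field_simps)
    then show False using n r(2) by linarith
  qed
  then have "\<not> 1 / 2 ^ (n - 1) \<le> r" unfolding n_def by (intro not_less_Least) auto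
  moreover have "(2::real) ^ n = 2 * 2 ^ (n - 1)" using nn0 by (cases n) auto
  ultimately have "r < 2 / 2 ^ n" by simp
  then show ?thesis using that nn0 n by blast
qed

text \<open>For \<open>1 / 2\<^sup>n \<le> r < 2 / 2\<^sup>n\<close> a return within \<open>1 / 2\<^sup>n\<close> after a time \<open>t \<ge> 2 / 2\<^sup>n\<close> is a return
  in the sense of the radius \<open>r\<close>, and \<open>t\<close> is bounded by a multiple of \<open>1 / r\<close> to the power
  \<open>1 + \<epsilon>\<close>.\<close>

lemma exponent_upper:
  assumes v: "v = direction \<theta>" and \<epsilon>: "0 < \<epsilon>"
    and ev: "\<forall>\<^sub>F n in sequentially. \<exists>t q. 2 / 2 ^ n \<le> t \<and>
    t \<le> 2 / 2 ^ n * ((2 ^ n) powr (2 + \<epsilon>) + 1) \<and> flowv X v t p q \<and> flat_dist X q p < 1 / 2 ^ n"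
  shows "upper_return_exponent X \<theta> p \<le> ereal (1 + 2 * \<epsilon>)"
  unfolding upper_return_exponent_def
proof (rule Limsup_bounded)
  obtain n0 where n0: "\<And>n. n \<ge> n0 \<Longrightarrow> \<exists>t q. 2 / 2 ^ n \<le> t \<and>
    t \<le> 2 / 2 ^ n * ((2 ^ n) powr (2 + \<epsilon>) + 1) \<and> flowv X v t p q \<and> flat_dist X q p < 1 / 2 ^ n"
    using ev by (auto simp: eventually_sequentially)
  \<comment> \<open>for \<open>- ln r > D\<close> the constants in the bound for the return time cost at most another \<open>\<epsilon>\<close>\<close>
  define D where "D = (ln 4 + (1 + \<epsilon>) * ln 2) / \<epsilon>"
  have D0: "0 < D" using \<epsilon> by (auto simp: D_def intro!: divide_pos_pos add_pos_pos)
  define r0 where "r0 = min (1 / 2 ^ n0) (exp (- D))"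
  have "\<forall>\<^sub>F r in at_right (0::real). r < r0 \<and> 0 < r" by (rule eventually_small) (simp add: r0_def)
  then show "\<forall>\<^sub>F r in at_right 0. log_ereal (return_time X \<theta> p r) / ereal (- ln r) \<le> ereal (1 + 2 * \<epsilon>)"
  proof eventually_elim
    case (elim r)
    then have r: "0 < r" "r < 1 / 2 ^ n0" "r < exp (- D)" by (auto simp: r0_def)
    have L: "D < - ln r" using r(1,3) ln_less_cancel_iff[of r "exp (- D)"] by simp
    obtain n where nn0: "n0 < n" and n: "1 / 2 ^ n \<le> r" and n2: "r < 2 / 2 ^ n" using dyadic_scale[OF r(1,2)] .
    obtain t q where t: "2 / 2 ^ n \<le> t" "t \<le> 2 / 2 ^ n * ((2 ^ n) powr (2 + \<epsilon>) + 1)" "flowv X v t p q" "flat_dist X q p < 1 / 2 ^ n"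
      using n0[of n] nn0 by auto
    have "return_time X \<theta> p r \<le> ereal t"
      by (rule return_time_le[of r t]) (use t n n2 in \<open>auto simp: flow_flowv v\<close>)
    moreover have "ereal r \<le> return_time X \<theta> p r" by (rule return_time_ge) simp
    ultimately obtain R where R: "return_time X \<theta> p r = ereal R" "r \<le> R" "R \<le> t"
      by (cases "return_time X \<theta> p r") auto
    let ?A = "2 ^ n :: real"
    have A: "1 \<le> ?A" "?A < 2 / r" using n2 r(1) by (simp_all add: field_simps)
    have "t \<le> 4 * ?A powr (1 + \<epsilon>)"
    proof -
      have "1 \<le> ?A powr (2 + \<epsilon>)" using A(1) \<epsilon> by (intro ge_one_powr_ge_zero) auto
      then have "2 / ?A * (?A powr (2 + \<epsilon>) + 1) \<le> 2 / ?A * (2 * ?A powr (2 + \<epsilon>))" by (intro mult_left_mono) auto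
      also have "\<dots> = 4 * (?A powr (2 + \<epsilon>) / ?A powr 1)" by simp
      also have "?A powr (2 + \<epsilon>) / ?A powr 1 = ?A powr (1 + \<epsilon>)" unfolding powr_diff[symmetric] by (simp add: add.commute)
      finally show ?thesis using t(2) by linarith
    qed
    also have "\<dots> \<le> 4 * (2 / r) powr (1 + \<epsilon>)" using A \<epsilon> by (intro mult_left_mono powr_mono2) auto
    finally have "R \<le> 4 * (2 / r) powr (1 + \<epsilon>)" using R(3) by simp
    moreover have "0 < R" using R(2) r(1) by linarith
    ultimately have "ln R \<le> ln (4 * (2 / r) powr (1 + \<epsilon>))" by (subst ln_le_cancel_iff) auto
    also have "\<dots> = ln 4 + (1 + \<epsilon>) * (ln 2 - ln r)"
      using r(1) by (simp add: ln_mult ln_powr ln_div)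
    also have "\<dots> = \<epsilon> * D + (1 + \<epsilon>) * (- ln r)"
    proof -
      have "\<epsilon> * D = ln 4 + (1 + \<epsilon>) * ln 2" using \<epsilon> by (simp add: D_def)
      then show ?thesis by (simp add: algebra_simps)
    qed
    also have "\<dots> \<le> \<epsilon> * (- ln r) + (1 + \<epsilon>) * (- ln r)" using L \<epsilon> by (intro add_right_mono mult_left_mono) auto
    also have "\<dots> = (1 + 2 * \<epsilon>) * (- ln r)" by (simp add: algebra_simps)
    finally have "ln R / (- ln r) \<le> 1 + 2 * \<epsilon>" using L D0 by (subst pos_divide_le_eq) auto
    moreover have "log_ereal (return_time X \<theta> p r) / ereal (- ln r) = ereal (ln R / (- ln r))"
      using R(1) L D0 by (simp add: log_ereal_def)
    ultimately show ?case by simp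
  qed
qed

text \<open>For a radius \<open>r\<close> as in \<open>slow\<close>, the largest admissible \<open>2\<^sup>n\<close> is comparable to \<open>20 * r\<close> to the
  power \<open>- 1 / (1 + \<epsilon>)\<close>, and the return time is at least about as large. Such radii are found
  arbitrarily close to \<open>0\<close>, which is enough for a limit superior.\<close>

lemma exponent_lower:
  assumes \<epsilon>: "0 < \<epsilon>" and y: "y < 1 / (1 + \<epsilon>)"
    and slow: "\<And>\<delta>. 0 < \<delta> \<Longrightarrow> \<delta> \<le> \<delta>0 \<Longrightarrow> \<exists>r. 0 < r \<and> r < \<delta> \<and>
      (\<forall>n\<ge>n0. 10 * r < (2 ^ n) powr (- 1 - \<epsilon>) / 2 \<longrightarrow> ereal (2 ^ n - r) \<le> return_time X \<theta> p r)"
    and \<delta>0: "0 < \<delta>0"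
  shows "ereal y \<le> upper_return_exponent X \<theta> p"
proof (rule ccontr)
  assume "\<not> ereal y \<le> upper_return_exponent X \<theta> p"
  then have "upper_return_exponent X \<theta> p < ereal y" by simp
  then have "\<forall>\<^sub>F r in at_right 0. log_ereal (return_time X \<theta> p r) / ereal (- ln r) < ereal y"
    unfolding upper_return_exponent_def by (rule Limsup_lessD)
  then obtain r1 where r1: "0 < r1" "\<And>r. 0 < r \<Longrightarrow> r < r1 \<Longrightarrow> log_ereal (return_time X \<theta> p r) / ereal (- ln r) < ereal y"
    by (auto simp: eventually_at_right_field)
  define k where "k = 1 / (1 + \<epsilon>)"
  have k: "0 < k" "y < k" "k * (1 + \<epsilon>) = 1" using \<epsilon> y by (auto simp: k_def)
  \<comment> \<open>\<open>D\<close> absorbs the constants into the difference of \<open>k\<close> and \<open>y\<close>; \<open>B0\<close> makes the time scale large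
    enough for \<open>n > n0\<close>\<close>
  define D where "D = max 1 ((k * ln 20 + ln 4) / (k - y))"
  define B0 where "B0 = max 4 (2 ^ (n0 + 1) :: real)"
  define \<delta> where "\<delta> = min \<delta>0 (min r1 (min (exp (- D)) (B0 powr (- 1 - \<epsilon>) / 20)))"
  have \<delta>: "0 < \<delta>" "\<delta> \<le> \<delta>0" using \<delta>0 r1(1) by (auto simp: \<delta>_def B0_def max_def)
  obtain r where r: "0 < r" "r < \<delta>"
    and sl: "\<And>n. n \<ge> n0 \<Longrightarrow> 10 * r < (2 ^ n) powr (- 1 - \<epsilon>) / 2 \<Longrightarrow> ereal (2 ^ n - r) \<le> return_time X \<theta> p r"
    using slow[OF \<delta>] by blast
  have r': "r < r1" "r < exp (- D)" "20 * r < B0 powr (- 1 - \<epsilon>)" using r(2) by (auto simp: \<delta>_def)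
  have D1: "1 \<le> D" by (simp add: D_def)
  have L: "D < - ln r" using r(1) r'(2) ln_less_cancel_iff[of r "exp (- D)"] by simp
  have rl1: "r < 1" using r'(2) D1 by (smt (verit) exp_less_one_iff)
  \<comment> \<open>the time scale at which the tubes have radius exactly \<open>10 * r\<close>\<close>
  define B where "B = (20 * r) powr (- k)"
  have Bpow: "(20 * r) = B powr (- 1 - \<epsilon>)"
  proof -
    have "B powr (- 1 - \<epsilon>) = (20 * r) powr (- k * (- 1 - \<epsilon>))" unfolding B_def by (rule powr_powr)
    also have "- k * (- 1 - \<epsilon>) = 1" using k(3) by (simp add: algebra_simps)
    finally show ?thesis using r(1) by simp
  qed
  have Bpos: "0 < B" using r(1) by (simp add: B_def)
  have B0pos: "0 < B0" by (simp add: B0_def max_def)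
  have lt: "b powr (- 1 - \<epsilon>) > a powr (- 1 - \<epsilon>)" if "0 < b" "b < a" for a b :: real
    by (rule powr_less_mono2_neg) (use that \<epsilon> in auto)
  have BB0: "B0 < B"
  proof (rule ccontr)
    assume "\<not> B0 < B"
    then have "B0 powr (- 1 - \<epsilon>) \<le> B powr (- 1 - \<epsilon>)"
      using lt[OF Bpos, of B0] by (cases "B = B0") auto
    then show False using r'(3) Bpow by linarith
  qed
  have ex: "\<exists>n. B \<le> 2 ^ (n + 1)"
  proof -
    obtain n where "B < 2 ^ n" using real_arch_pow[of 2 B] by auto
    moreover have "(2::real) ^ n \<le> 2 ^ (n + 1)" by (rule power_increasing) auto
    ultimately have "B \<le> 2 ^ (n + 1)" by linarith
    then show ?thesis by blast
  qed
  define n where "n = (LEAST n. B \<le> 2 ^ (n + 1))"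
  have n: "B \<le> 2 ^ (n + 1)" unfolding n_def by (rule LeastI_ex[OF ex])
  have n0: "n0 < n"
  proof (rule ccontr)
    assume "\<not> n0 < n"
    then have "(2::real) ^ (n + 1) \<le> 2 ^ (n0 + 1)" by (intro power_increasing) auto
    moreover have "2 ^ (n0 + 1) \<le> B0" by (simp add: B0_def)
    ultimately show False using n BB0 by linarith
  qed
  then have "\<not> B \<le> 2 ^ ((n - 1) + 1)" unfolding n_def by (intro not_less_Least) auto
  then have n2: "2 ^ n < B" using n0 by simp
  have "B powr (- 1 - \<epsilon>) < (2 ^ n) powr (- 1 - \<epsilon>)" using lt[of "2 ^ n" B] n2 by simp
  then have "10 * r < (2 ^ n) powr (- 1 - \<epsilon>) / 2" using Bpow by linarith
  then have ret: "ereal (2 ^ n - r) \<le> return_time X \<theta> p r" using sl n0 by simp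
  have B4: "4 < B" using BB0 by (simp add: B0_def)
  have "B / 2 \<le> 2 ^ n" using n by simp
  then have bb: "B / 4 \<le> 2 ^ n - r" using B4 rl1 by linarith
  have "ereal y \<le> log_ereal (return_time X \<theta> p r) / ereal (- ln r)"
  proof (cases "return_time X \<theta> p r")
    case PInf
    then show ?thesis using L D1 by (simp add: log_ereal_def)
  next
    case MInf
    then show ?thesis using ret by simp
  next
    case (real R)
    then have "B / 4 \<le> R" using ret bb by simp
    then have "ln (B / 4) \<le> ln R" using Bpos by (subst ln_le_cancel_iff) auto
    moreover have "ln (B / 4) = k * (- ln r) - (k * ln 20 + ln 4)"
      using Bpos r(1) by (simp add: ln_div B_def ln_powr ln_mult algebra_simps)
    moreover have "(k * ln 20 + ln 4) \<le> (k - y) * (- ln r)"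
    proof -
      have "(k * ln 20 + ln 4) / (k - y) \<le> - ln r" using L by (simp add: D_def)
      then show ?thesis using k(2) by (simp add: pos_divide_le_eq mult.commute)
    qed
    ultimately have "y * (- ln r) \<le> ln R" by (simp add: algebra_simps)
    then have "y \<le> ln R / (- ln r)" using L D1 by (subst pos_le_divide_eq) auto
    moreover have "log_ereal (return_time X \<theta> p r) / ereal (- ln r) = ereal (ln R / (- ln r))"
      using real L D1 by (simp add: log_ereal_def)
    ultimately show ?thesis by simp
  qed
  then show False using r1(2)[OF r(1) r'(1)] by simp
qed

end

theorem proposition4p5:
  fixes X :: surface and \<theta> :: real
  assumes "translation_surface X"
    and "keane X \<theta>"
  shows "AE p in area_measure X. upper_return_exponent X \<theta> p = 1"
proof -
  interpret transl_surface X by unfold_locales (rule assms(1))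
  define v where "v = direction \<theta>"
  have v: "norm v = 1" by (simp add: v_def norm_direction)
  define \<epsilon> where "\<epsilon> k = 1 / real (Suc k)" for k
  have \<epsilon>: "0 < \<epsilon> k" for k by (simp add: \<epsilon>_def)
  have \<epsilon>lim: "\<epsilon> \<longlonglongrightarrow> 0" unfolding \<epsilon>_def[abs_def] using LIMSEQ_inverse_real_of_nat by (simp add: inverse_eq_divide)
  have AE1: "AE p in area_measure X. \<forall>k. \<forall>\<^sub>F n in sequentially. tubed v (2 ^ n) ((2 ^ n) powr (- 1 - \<epsilon> k) / 2) p"
    using AE_tubed[OF v \<epsilon>] by (simp add: AE_all_countable)
  have AE2: "AE p in area_measure X. \<forall>k. \<forall>\<^sub>F n in sequentially. \<exists>t q. 2 / 2 ^ n \<le> t \<and>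
    t \<le> 2 / 2 ^ n * ((2 ^ n) powr (2 + \<epsilon> k) + 1) \<and> flowv X v t p q \<and> flat_dist X q p < 1 / 2 ^ n"
    using AE_returns[OF v \<epsilon>] by (simp add: AE_all_countable)
  from AE1 AE2 AE_inner AE_flow_defined[OF v] show ?thesis
  proof eventually_elim
    case (elim p)
    obtain i x where x: "i < n_polys" "x \<in> intr i" "p = pt X i x" using elim(3) by (auto simp: inner_points_def)
    obtain \<rho>' where \<rho>': "0 < \<rho>'" "ball x \<rho>' \<subseteq> intr i" using openE[OF open_inner[OF x(1)] x(2)] .
    obtain m where m: "\<And>n. n \<ge> m \<Longrightarrow> \<exists>t q. 2 / 2 ^ n \<le> t \<and> flowv X v t p q \<and> flat_dist X q p < 1 / 2 ^ n"
      using elim(2)[rule_format, of 0] unfolding eventually_sequentially by blast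
    define \<rho> where "\<rho> = min \<rho>' (1 / 2 ^ m)"
    have \<rho>: "0 < \<rho>" "ball x \<rho> \<subseteq> intr i" using \<rho>' by (auto simp: \<rho>_def)
    have all: "\<exists>q. flowv X v t p q" if "0 \<le> t" for t using elim(4) that by blast
    have nonper: "\<not> flowv X v t p p" if "0 < t" for t
      using no_periodic_orbit[OF assms(2) that] unfolding v_def .
    have rec: "\<exists>t q. r < t \<and> flowv X v t p q \<and> flat_dist X q p < r" if r: "0 < r" "r < \<rho>" for r
    proof -
      obtain n where n: "m < n" "1 / 2 ^ n \<le> r" "r < 2 / 2 ^ n" using dyadic_scale[of r m] r by (auto simp: \<rho>_def)
      then show ?thesis using m[of n] by (meson less_imp_le less_le_trans)
    qed
    have upper: "upper_return_exponent X \<theta> p \<le> ereal (1 + 2 * \<epsilon> k)" for k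
      by (rule exponent_upper[OF v_def \<epsilon>]) (use elim(2) in blast)
    have lower: "ereal (1 / (1 + \<epsilon> k) - \<epsilon> k) \<le> upper_return_exponent X \<theta> p" for k
    proof -
      obtain n0 where n0: "\<And>n. n \<ge> n0 \<Longrightarrow> tubed v (2 ^ n) ((2 ^ n) powr (- 1 - \<epsilon> k) / 2) p"
        using elim(1) unfolding eventually_sequentially by blast
      show ?thesis
      proof (rule exponent_lower[OF \<epsilon>])
        show "1 / (1 + \<epsilon> k) - \<epsilon> k < 1 / (1 + \<epsilon> k)" using \<epsilon>[of k] by simp
        show "\<exists>r. 0 < r \<and> r < \<delta> \<and> (\<forall>n\<ge>n0. 10 * r < (2 ^ n) powr (- 1 - \<epsilon> k) / 2 \<longrightarrow> ereal (2 ^ n - r) \<le> return_time X \<theta> p r)"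
          if "0 < \<delta>" "\<delta> \<le> \<rho> / 4" for \<delta>
          by (rule slow_return[OF v_def x(1) \<rho>(2,1) x(3) all nonper rec n0 that(1)]) (use that in auto)
        show "0 < \<rho> / 4" using \<rho> by simp
      qed
    qed
    have "(\<lambda>k. ereal (1 + 2 * \<epsilon> k)) \<longlonglongrightarrow> ereal (1 + 2 * 0)"
      by (intro tendsto_ereal tendsto_intros \<epsilon>lim)
    then have "upper_return_exponent X \<theta> p \<le> ereal 1"
      using LIMSEQ_le_const[of "\<lambda>k. ereal (1 + 2 * \<epsilon> k)" "ereal (1 + 2 * 0)" "upper_return_exponent X \<theta> p"] upper by simp
    moreover have "(\<lambda>k. ereal (1 / (1 + \<epsilon> k) - \<epsilon> k)) \<longlonglongrightarrow> ereal (1 / (1 + 0) - 0)"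
      by (intro tendsto_ereal tendsto_intros \<epsilon>lim) auto
    then have "ereal 1 \<le> upper_return_exponent X \<theta> p"
      using LIMSEQ_le_const2[of "\<lambda>k. ereal (1 / (1 + \<epsilon> k) - \<epsilon> k)" "ereal (1 / (1 + 0) - 0)" "upper_return_exponent X \<theta> p"] lower by simp
    ultimately show ?case by (simp add: one_ereal_def)
  qed
qed

end
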